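(* Let $\mathfrak{M}=(\mathcal{Q},\mathcal{W},\mathcal{R})$ be an hereditary abelian model structure on an abelian category $\mathcal{A}$. For all objects $A,B\in\mathcal{A}$ and each $n\geq1$ there are natural isomorphisms $$\mathrm{Ext}^n_{\mathrm{Ho}(\mathfrak{M})}(A,B)\cong\underline{\mathrm{Ext}}^n_{\mathrm{Ho}(\mathfrak{M})}(A,B)\cong\mathrm{Ext}^n_{\mathcal{A}}(QA,RB).$$
   Context: $\mathrm{Ext}^n_{\mathcal{A}}$ denotes Yoneda Ext: the group of equivalence classes of $n$-fold exact sequences (no enough projectives or injectives assumed). A cotorsion pair is a pair of classes $(\mathcal{X},\mathcal{Y})$ with $\mathcal{Y}=\{Y:\mathrm{Ext}^1_{\mathcal{A}}(X,Y)=0\ \forall X\in\mathcal{X}\}$ and $\mathcal{X}=\{X:\mathrm{Ext}^1_{\mathcal{A}}(X,Y)=0\ \forall Y\in\mathcal{Y}\}$. It is complete if every object $A$ admits short exact sequences $0\to Y\to X\to A\to0$ and $0\to A\to Y'\to X'\to 0$ with $X,X'\in\mathcal{X}$, $Y,Y'\in\mathcal{Y}$; hereditary if $\mathrm{Ext}^i_{\mathcal{A}}(X,Y)=0$ for all $X\in\mathcal{X}$, $Y\in\mathcal{Y}$, $i\ge1$. An hereditary abelian model structure is a triple $\mathfrak{M}=(\mathcal{Q},\mathcal{W},\mathcal{R})$ of classes of objects such that $\mathcal{W}$ is thick (2 out of 3 property on short exact sequences) and, with $\mathcal{Q}_{\mathcal{W}}=\mathcal{Q}\cap\mathcal{W}$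 and $\mathcal{R}_{\mathcal{W}}=\mathcal{W}\cap\mathcal{R}$, both $(\mathcal{Q},\mathcal{R}_{\mathcal{W}})$ and $(\mathcal{Q}_{\mathcal{W}},\mathcal{R})$ are complete hereditary cotorsion pairs. Objects of $\mathcal{Q}$ are cofibrant, objects of $\mathcal{R}$ fibrant. A cofibrant replacement $QA$ is given by a short exact sequence $0\to F\to QA\to A\to0$ with $QA\in\mathcal{Q}$, $F\in\mathcal{R}_{\mathcal{W}}$; a fibrant replacement $RA$ by $0\to A\to RA\to C\to0$ with $RA\in\mathcal{R}$, $C\in\mathcal{Q}_{\mathcal{W}}$. $RQA$ is a bifibrant replacement. An $\mathfrak{M}$-resolution of $A$ is an exact chain complex $W_A\equiv\cdots\to Q_1\xrightarrow{d_1}Q_0\xrightarrow{d_0}R_{-1}\xrightarrow{d_{-1}}R_{-2}\to\cdots$ with $d_0=\eta\epsilon$, where $\cdots\to Q_1\to Q_0\xrightarrow{\epsilon}A\to0$ is exact with each $Q_i\in\mathcal{Q}_{\mathcal{W}}$ and all kernels $\ker\epsilon$, $\ker d_i$ ($i\ge1$) in $\mathcal{R}$, and $0\to A\xrightarrow{\eta}R_{-1}\to R_{-2}\to\cdots$ is exact with each $R_i\in\mathcal{R}_{\mathcal{W}}$ and all cokernels $\mathrm{cok}\,\eta$, $\mathrm{cok}\,d_i$ ($i\le-1$) in $\mathcal{Q}$. An $\mathfrak{M}$-coresolution $W^B$ of $B$ is the same kind of complex written as a cochain complex $\cdots\to Q^{-2}\to Q^{-1}\to R^0\to R^1\to\cdots$,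 with $d^{-1}$ factoring as $Q^{-1}\twoheadrightarrow B\hookrightarrow R^0$. For $A$ cofibrant and $B$ fibrant, $\mathrm{Ext}^n_{\mathfrak{M}}(A,B)$ denotes the group $H^n[\mathrm{Hom}_{\mathcal{A}}(W_A,B)]$, canonically isomorphic to $H^n[\mathrm{Hom}_{\mathcal{A}}(A,W^B)]$ and independent of choices. For arbitrary $A,B$: $\mathrm{Ext}^n_{\mathrm{Ho}(\mathfrak{M})}(A,B):=\mathrm{Ext}^n_{\mathfrak{M}}(RQA,RQB)$ for $n\in\mathbb{Z}$, and $\underline{\mathrm{Ext}}^n_{\mathrm{Ho}(\mathfrak{M})}(A,B):=\mathrm{Ext}^n_{\mathcal{A}}(RQA,RQB)$ for $n\ge1$. *)

theory Defs
  imports "HOL-Algebra.Coset"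
begin

section \<open>Abelian categories\<close>

text \<open>
  Composition is written in the order of application, so \<open>g \<cdot> f\<close> is "g after f". The operations
  are total functions; their values are meaningful only on composable or parallel arrows.
\<close>

record ('o, 'm) addcat =
  Obj :: "'o set"
  Arr :: "'m set"
  Dom :: "'m \<Rightarrow> 'o"
  Cod :: "'m \<Rightarrow> 'o"
  Ident :: "'o \<Rightarrow> 'm"
  Comp :: "'m \<Rightarrow> 'm \<Rightarrow> 'm"  (infixr "\<cdot>\<index>" 70)
  Add :: "'m \<Rightarrow> 'm \<Rightarrow> 'm"  (infixl "\<^bold>+\<index>" 65)
  Zero :: "'o \<Rightarrow> 'o \<Rightarrow> 'm"

definition Hom :: "('o, 'm) addcat \<Rightarrow> 'o \<Rightarrow> 'o \<Rightarrow> 'm set" where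
  "Hom C A B = {f \<in> Arr C. Dom C f = A \<and> Cod C f = B}"

definition hom_group :: "('o, 'm) addcat \<Rightarrow> 'o \<Rightarrow> 'o \<Rightarrow> 'm monoid" where
  "hom_group C A B = \<lparr>carrier = Hom C A B, mult = Add C, one = Zero C A B\<rparr>"

locale preadditive_category =
  fixes C :: "('o, 'm) addcat" (structure)
  assumes Dom_Obj: "f \<in> Arr C \<Longrightarrow> Dom C f \<in> Obj C"
    and Cod_Obj: "f \<in> Arr C \<Longrightarrow> Cod C f \<in> Obj C"
    and Ident_Hom: "A \<in> Obj C \<Longrightarrow> Ident C A \<in> Hom C A A"
    and Comp_Hom: "f \<in> Hom C X Y \<Longrightarrow> g \<in> Hom C Y Z \<Longrightarrow> g \<cdot> f \<in> Hom C X Z"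
    and Comp_Ident: "f \<in> Hom C X Y \<Longrightarrow> f \<cdot> Ident C X = f"
    and Ident_Comp: "f \<in> Hom C X Y \<Longrightarrow> Ident C Y \<cdot> f = f"
    and Comp_assoc: "f \<in> Hom C X Y \<Longrightarrow> g \<in> Hom C Y Z \<Longrightarrow> h \<in> Hom C Z V \<Longrightarrow>
      (h \<cdot> g) \<cdot> f = h \<cdot> (g \<cdot> f)"
    and hom_comm_group: "A \<in> Obj C \<Longrightarrow> B \<in> Obj C \<Longrightarrow> comm_group (hom_group C A B)"
    and Comp_Add: "f \<in> Hom C X Y \<Longrightarrow> f' \<in> Hom C X Y \<Longrightarrow> g \<in> Hom C Y Z \<Longrightarrow>
      g \<cdot> (f \<^bold>+ f') = (g \<cdot> f) \<^bold>+ (g \<cdot> f')"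
    and Add_Comp: "f \<in> Hom C X Y \<Longrightarrow> g \<in> Hom C Y Z \<Longrightarrow> g' \<in> Hom C Y Z \<Longrightarrow>
      (g \<^bold>+ g') \<cdot> f = (g \<cdot> f) \<^bold>+ (g' \<cdot> f)"

definition is_mono :: "('o, 'm) addcat \<Rightarrow> 'm \<Rightarrow> bool" where
  "is_mono C f \<longleftrightarrow> f \<in> Arr C \<and>
     (\<forall>X. \<forall>g\<in>Hom C X (Dom C f). \<forall>h\<in>Hom C X (Dom C f). f \<cdot>\<^bsub>C\<^esub> g = f \<cdot>\<^bsub>C\<^esub> h \<longrightarrow> g = h)"

definition is_epi :: "('o, 'm) addcat \<Rightarrow> 'm \<Rightarrow> bool" where
  "is_epi C f \<longleftrightarrow> f \<in> Arr C \<and>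
     (\<forall>X. \<forall>g\<in>Hom C (Cod C f) X. \<forall>h\<in>Hom C (Cod C f) X. g \<cdot>\<^bsub>C\<^esub> f = h \<cdot>\<^bsub>C\<^esub> f \<longrightarrow> g = h)"

definition is_kernel :: "('o, 'm) addcat \<Rightarrow> 'm \<Rightarrow> 'm \<Rightarrow> bool" where
  "is_kernel C k f \<longleftrightarrow> k \<in> Arr C \<and> f \<in> Arr C \<and> Cod C k = Dom C f \<and>
     f \<cdot>\<^bsub>C\<^esub> k = Zero C (Dom C k) (Cod C f) \<and>
     (\<forall>X. \<forall>h\<in>Hom C X (Dom C f). f \<cdot>\<^bsub>C\<^esub> h = Zero C X (Cod C f) \<longrightarrow>
        (\<exists>!u. u \<in> Hom C X (Dom C k) \<and> k \<cdot>\<^bsub>C\<^esub> u = h))"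

definition is_cokernel :: "('o, 'm) addcat \<Rightarrow> 'm \<Rightarrow> 'm \<Rightarrow> bool" where
  "is_cokernel C c f \<longleftrightarrow> c \<in> Arr C \<and> f \<in> Arr C \<and> Dom C c = Cod C f \<and>
     c \<cdot>\<^bsub>C\<^esub> f = Zero C (Dom C f) (Cod C c) \<and>
     (\<forall>X. \<forall>h\<in>Hom C (Cod C f) X. h \<cdot>\<^bsub>C\<^esub> f = Zero C (Dom C f) X \<longrightarrow>
        (\<exists>!u. u \<in> Hom C (Cod C c) X \<and> u \<cdot>\<^bsub>C\<^esub> c = h))"

definition is_zero_object :: "('o, 'm) addcat \<Rightarrow> 'o \<Rightarrow> bool" where
  "is_zero_object C Z \<longleftrightarrow> Z \<in> Obj C \<and>
     (\<forall>A\<in>Obj C. (\<exists>!f. f \<in> Hom C A Z) \<and> (\<exists>!f. f \<in> Hom C Z A))"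

definition is_biproduct ::
  "('o, 'm) addcat \<Rightarrow> 'o \<Rightarrow> 'o \<Rightarrow> 'o \<Rightarrow> 'm \<Rightarrow> 'm \<Rightarrow> 'm \<Rightarrow> 'm \<Rightarrow> bool" where
  "is_biproduct C A B P i\<^sub>1 i\<^sub>2 p\<^sub>1 p\<^sub>2 \<longleftrightarrow>
     i\<^sub>1 \<in> Hom C A P \<and> i\<^sub>2 \<in> Hom C B P \<and> p\<^sub>1 \<in> Hom C P A \<and> p\<^sub>2 \<in> Hom C P B \<and>
     p\<^sub>1 \<cdot>\<^bsub>C\<^esub> i\<^sub>1 = Ident C A \<and> p\<^sub>2 \<cdot>\<^bsub>C\<^esub> i\<^sub>2 = Ident C B \<and>
     p\<^sub>1 \<cdot>\<^bsub>C\<^esub> i\<^sub>2 = Zero C B A \<and> p\<^sub>2 \<cdot>\<^bsub>C\<^esub> i\<^sub>1 = Zero C A B \<and>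
     (i\<^sub>1 \<cdot>\<^bsub>C\<^esub> p\<^sub>1) \<^bold>+\<^bsub>C\<^esub> (i\<^sub>2 \<cdot>\<^bsub>C\<^esub> p\<^sub>2) = Ident C P"

locale abelian_category = preadditive_category C for C :: "('o, 'm) addcat" (structure) +
  assumes zero_object: "\<exists>Z. is_zero_object C Z"
    and biproducts: "A \<in> Obj C \<Longrightarrow> B \<in> Obj C \<Longrightarrow> \<exists>P i\<^sub>1 i\<^sub>2 p\<^sub>1 p\<^sub>2. is_biproduct C A B P i\<^sub>1 i\<^sub>2 p\<^sub>1 p\<^sub>2"
    and kernels: "f \<in> Arr C \<Longrightarrow> \<exists>k. is_kernel C k f"
    and cokernels: "f \<in> Arr C \<Longrightarrow> \<exists>c. is_cokernel C c f"
    and mono_normal: "is_mono C f \<Longrightarrow> \<exists>g. is_kernel C f g"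
    and epi_normal: "is_epi C f \<Longrightarrow> \<exists>g. is_cokernel C f g"

text \<open>
  Exactness of \<open>X \<rightarrow> Y \<rightarrow> Z\<close> at \<open>Y\<close>: the image of \<open>f\<close> (the kernel of its cokernel) is the kernel
  of \<open>g\<close>.
\<close>

definition exact :: "('o, 'm) addcat \<Rightarrow> 'm \<Rightarrow> 'm \<Rightarrow> bool" where
  "exact C f g \<longleftrightarrow> f \<in> Arr C \<and> g \<in> Arr C \<and> Cod C f = Dom C g \<and>
     (\<exists>c k. is_cokernel C c f \<and> is_kernel C k c \<and> is_kernel C k g)"

definition short_exact :: "('o, 'm) addcat \<Rightarrow> 'm \<Rightarrow> 'm \<Rightarrow> bool" where
  "short_exact C f g \<longleftrightarrow> is_mono C f \<and> exact C f g \<and> is_epi C g"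

definition is_pullback :: "('o, 'm) addcat \<Rightarrow> 'm \<Rightarrow> 'm \<Rightarrow> 'm \<Rightarrow> 'm \<Rightarrow> bool" where
  "is_pullback C u p' p a \<longleftrightarrow> u \<in> Arr C \<and> p' \<in> Arr C \<and> p \<in> Arr C \<and> a \<in> Arr C \<and>
     Dom C u = Dom C p' \<and> Cod C u = Dom C p \<and> Cod C p' = Dom C a \<and> Cod C p = Cod C a \<and>
     p \<cdot>\<^bsub>C\<^esub> u = a \<cdot>\<^bsub>C\<^esub> p' \<and>
     (\<forall>X. \<forall>x\<in>Hom C X (Dom C p). \<forall>y\<in>Hom C X (Dom C a). p \<cdot>\<^bsub>C\<^esub> x = a \<cdot>\<^bsub>C\<^esub> y \<longrightarrow>
        (\<exists>!z. z \<in> Hom C X (Dom C u) \<and> u \<cdot>\<^bsub>C\<^esub> z = x \<and> p' \<cdot>\<^bsub>C\<^esub> z = y))"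

definition is_pushout :: "('o, 'm) addcat \<Rightarrow> 'm \<Rightarrow> 'm \<Rightarrow> 'm \<Rightarrow> 'm \<Rightarrow> bool" where
  "is_pushout C v i' i b \<longleftrightarrow> v \<in> Arr C \<and> i' \<in> Arr C \<and> i \<in> Arr C \<and> b \<in> Arr C \<and>
     Cod C v = Cod C i' \<and> Dom C v = Cod C i \<and> Dom C i' = Cod C b \<and> Dom C i = Dom C b \<and>
     v \<cdot>\<^bsub>C\<^esub> i = i' \<cdot>\<^bsub>C\<^esub> b \<and>
     (\<forall>X. \<forall>x\<in>Hom C (Cod C i) X. \<forall>y\<in>Hom C (Cod C b) X. x \<cdot>\<^bsub>C\<^esub> i = y \<cdot>\<^bsub>C\<^esub> b \<longrightarrow>
        (\<exists>!z. z \<in> Hom C (Cod C v) X \<and> z \<cdot>\<^bsub>C\<^esub> v = x \<and> z \<cdot>\<^bsub>C\<^esub> i' = y))"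


section \<open>Yoneda Ext\<close>

text \<open>
  For \<open>n \<ge> 1\<close>, an \<open>n\<close>-fold exact sequence
  \<open>0 \<rightarrow> B \<rightarrow> X\<^sub>1 \<rightarrow> \<dots> \<rightarrow> X\<^sub>n \<rightarrow> A \<rightarrow> 0\<close> is the list of its \<open>n + 1\<close> nontrivial arrows, from left
  to right. Its objects are indexed by \<open>0, \<dots>, n + 1\<close>, with \<open>B\<close> at \<open>0\<close> and \<open>A\<close> at \<open>n + 1\<close>.
\<close>

definition ext_seqs :: "('o, 'm) addcat \<Rightarrow> nat \<Rightarrow> 'o \<Rightarrow> 'o \<Rightarrow> 'm list set" where
  "ext_seqs C n A B = {E. length E = Suc n \<and> set E \<subseteq> Arr C \<and>
     Dom C (E ! 0) = B \<and> Cod C (E ! n) = A \<and>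
     is_mono C (E ! 0) \<and> (\<forall>i<n. exact C (E ! i) (E ! Suc i)) \<and> is_epi C (E ! n)}"

definition seq_obj :: "('o, 'm) addcat \<Rightarrow> nat \<Rightarrow> 'm list \<Rightarrow> nat \<Rightarrow> 'o" where
  "seq_obj C n E j = (if j \<le> n then Dom C (E ! j) else Cod C (E ! n))"

definition seq_morphism ::
  "('o, 'm) addcat \<Rightarrow> nat \<Rightarrow> 'm list \<Rightarrow> 'm list \<Rightarrow> (nat \<Rightarrow> 'm) \<Rightarrow> bool" where
  "seq_morphism C n E E' h \<longleftrightarrow>
     (\<forall>j\<le>Suc n. h j \<in> Hom C (seq_obj C n E j) (seq_obj C n E' j)) \<and>
     (\<forall>j\<le>n. h (Suc j) \<cdot>\<^bsub>C\<^esub> (E ! j) = (E' ! j) \<cdot>\<^bsub>C\<^esub> h j)"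

definition ext_step :: "('o, 'm) addcat \<Rightarrow> nat \<Rightarrow> 'o \<Rightarrow> 'o \<Rightarrow> ('m list \<times> 'm list) set" where
  "ext_step C n A B = {(E, E'). E \<in> ext_seqs C n A B \<and> E' \<in> ext_seqs C n A B \<and>
     (\<exists>h. seq_morphism C n E E' h \<and> h 0 = Ident C B \<and> h (Suc n) = Ident C A)}"

definition ext_equiv :: "('o, 'm) addcat \<Rightarrow> nat \<Rightarrow> 'o \<Rightarrow> 'o \<Rightarrow> ('m list \<times> 'm list) set" where
  "ext_equiv C n A B =
     (ext_step C n A B \<union> (ext_step C n A B)\<inverse>)\<^sup>* \<inter> (ext_seqs C n A B \<times> ext_seqs C n A B)"

text \<open>
  \<open>seq_pullback\<close> replaces the last arrow by its base change along \<open>a : A' \<rightarrow> A\<close>, and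
  \<open>seq_pushout\<close> the first one by its cobase change along \<open>b : B \<rightarrow> B'\<close>.
\<close>

definition seq_pullback ::
  "('o, 'm) addcat \<Rightarrow> nat \<Rightarrow> 'm \<Rightarrow> 'm list \<Rightarrow> 'm list \<Rightarrow> bool" where
  "seq_pullback C n a E E' \<longleftrightarrow>
     E \<in> ext_seqs C n (Cod C a) (Dom C (E ! 0)) \<and>
     E' \<in> ext_seqs C n (Dom C a) (Dom C (E ! 0)) \<and>
     (\<exists>u. is_pullback C u (E' ! n) (E ! n) a \<and> u \<cdot>\<^bsub>C\<^esub> (E' ! (n - 1)) = E ! (n - 1)) \<and>
     (\<forall>i<n - 1. E' ! i = E ! i)"

definition seq_pushout ::
  "('o, 'm) addcat \<Rightarrow> nat \<Rightarrow> 'm \<Rightarrow> 'm list \<Rightarrow> 'm list \<Rightarrow> bool" where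
  "seq_pushout C n b E E' \<longleftrightarrow>
     E \<in> ext_seqs C n (Cod C (E ! n)) (Dom C b) \<and>
     E' \<in> ext_seqs C n (Cod C (E ! n)) (Cod C b) \<and>
     (\<exists>v. is_pushout C v (E' ! 0) (E ! 0) b \<and> (E' ! 1) \<cdot>\<^bsub>C\<^esub> v = E ! 1) \<and>
     (\<forall>i. 2 \<le> i \<and> i \<le> n \<longrightarrow> E' ! i = E ! i)"

definition seq_dsum ::
  "('o, 'm) addcat \<Rightarrow> nat \<Rightarrow> 'm list \<Rightarrow> 'm list \<Rightarrow> 'm list \<Rightarrow>
   (nat \<Rightarrow> 'm) \<Rightarrow> (nat \<Rightarrow> 'm) \<Rightarrow> (nat \<Rightarrow> 'm) \<Rightarrow> (nat \<Rightarrow> 'm) \<Rightarrow> bool" where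
  "seq_dsum C n E E' S i\<^sub>1 i\<^sub>2 p\<^sub>1 p\<^sub>2 \<longleftrightarrow> length S = Suc n \<and>
     (\<forall>j\<le>Suc n. is_biproduct C (seq_obj C n E j) (seq_obj C n E' j) (seq_obj C n S j)
        (i\<^sub>1 j) (i\<^sub>2 j) (p\<^sub>1 j) (p\<^sub>2 j)) \<and>
     (\<forall>j\<le>n. S ! j =
        (i\<^sub>1 (Suc j) \<cdot>\<^bsub>C\<^esub> (E ! j) \<cdot>\<^bsub>C\<^esub> p\<^sub>1 j) \<^bold>+\<^bsub>C\<^esub> (i\<^sub>2 (Suc j) \<cdot>\<^bsub>C\<^esub> (E' ! j) \<cdot>\<^bsub>C\<^esub> p\<^sub>2 j))"

text \<open>
  Baer sum: pull \<open>E \<oplus> E'\<close> back along the diagonal of \<open>A\<close> and push the result out along the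
  codiagonal of \<open>B\<close>.
\<close>

definition baer_sum ::
  "('o, 'm) addcat \<Rightarrow> nat \<Rightarrow> 'o \<Rightarrow> 'o \<Rightarrow> 'm list set \<Rightarrow> 'm list set \<Rightarrow> 'm list set" where
  "baer_sum C n A B x y = ext_equiv C n A B ``
     {G. \<exists>E\<in>x. \<exists>E'\<in>y. \<exists>S P i\<^sub>1 i\<^sub>2 p\<^sub>1 p\<^sub>2. seq_dsum C n E E' S i\<^sub>1 i\<^sub>2 p\<^sub>1 p\<^sub>2 \<and>
        seq_pullback C n (i\<^sub>1 (Suc n) \<^bold>+\<^bsub>C\<^esub> i\<^sub>2 (Suc n)) S P \<and>
        seq_pushout C n (p\<^sub>1 0 \<^bold>+\<^bsub>C\<^esub> p\<^sub>2 0) P G}"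

text \<open>
  The neutral element is the class of the split extensions if \<open>n = 1\<close>, and of
  \<open>0 \<rightarrow> B = B \<rightarrow> 0 \<rightarrow> \<dots> \<rightarrow> 0 \<rightarrow> A = A \<rightarrow> 0\<close> if \<open>n \<ge> 2\<close> (exactness forces the objects strictly
  between \<open>B\<close> and \<open>A\<close> to be zero).
\<close>

definition ext_zero :: "('o, 'm) addcat \<Rightarrow> nat \<Rightarrow> 'o \<Rightarrow> 'o \<Rightarrow> 'm list set" where
  "ext_zero C n A B = ext_equiv C n A B ``
     {E \<in> ext_seqs C n A B.
        if n = 1 then \<exists>s\<in>Hom C A (Dom C (E ! 1)). (E ! 1) \<cdot>\<^bsub>C\<^esub> s = Ident C A
        else E ! 0 = Ident C B \<and> E ! n = Ident C A \<and>
          (\<forall>i. 0 < i \<and> i < n \<longrightarrow> E ! i = Zero C (Dom C (E ! i)) (Cod C (E ! i)))}"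

definition YExt :: "('o, 'm) addcat \<Rightarrow> nat \<Rightarrow> 'o \<Rightarrow> 'o \<Rightarrow> 'm list set monoid" where
  "YExt C n A B = \<lparr>carrier = ext_seqs C n A B // ext_equiv C n A B,
     mult = baer_sum C n A B, one = ext_zero C n A B\<rparr>"

text \<open>The map \<open>Ext\<^sup>n(A, B) \<rightarrow> Ext\<^sup>n(A', B')\<close> induced by \<open>a : A' \<rightarrow> A\<close> and \<open>b : B \<rightarrow> B'\<close>.\<close>

definition YExt_map ::
  "('o, 'm) addcat \<Rightarrow> nat \<Rightarrow> 'm \<Rightarrow> 'm \<Rightarrow> 'm list set \<Rightarrow> 'm list set" where
  "YExt_map C n a b x = ext_equiv C n (Dom C a) (Cod C b) ``
     {G. \<exists>E\<in>x. \<exists>P. seq_pullback C n a E P \<and> seq_pushout C n b P G}"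


section \<open>Hereditary abelian model structures\<close>

definition Ext_vanishes :: "('o, 'm) addcat \<Rightarrow> nat \<Rightarrow> 'o \<Rightarrow> 'o \<Rightarrow> bool" where
  "Ext_vanishes C n X Y \<longleftrightarrow> carrier (YExt C n X Y) = {\<one>\<^bsub>YExt C n X Y\<^esub>}"

definition cotorsion_pair :: "('o, 'm) addcat \<Rightarrow> 'o set \<Rightarrow> 'o set \<Rightarrow> bool" where
  "cotorsion_pair C \<X> \<Y> \<longleftrightarrow>
     \<Y> = {Y \<in> Obj C. \<forall>X\<in>\<X>. Ext_vanishes C 1 X Y} \<and>
     \<X> = {X \<in> Obj C. \<forall>Y\<in>\<Y>. Ext_vanishes C 1 X Y}"

definition complete_pair :: "('o, 'm) addcat \<Rightarrow> 'o set \<Rightarrow> 'o set \<Rightarrow> bool" where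
  "complete_pair C \<X> \<Y> \<longleftrightarrow> (\<forall>A\<in>Obj C.
     (\<exists>i p. short_exact C i p \<and> Dom C i \<in> \<Y> \<and> Cod C i \<in> \<X> \<and> Cod C p = A) \<and>
     (\<exists>i p. short_exact C i p \<and> Dom C i = A \<and> Cod C i \<in> \<Y> \<and> Cod C p \<in> \<X>))"

definition hereditary_pair :: "('o, 'm) addcat \<Rightarrow> 'o set \<Rightarrow> 'o set \<Rightarrow> bool" where
  "hereditary_pair C \<X> \<Y> \<longleftrightarrow> (\<forall>X\<in>\<X>. \<forall>Y\<in>\<Y>. \<forall>i\<ge>1. Ext_vanishes C i X Y)"

definition thick :: "('o, 'm) addcat \<Rightarrow> 'o set \<Rightarrow> bool" where
  "thick C W \<longleftrightarrow> (\<forall>f g. short_exact C f g \<longrightarrow>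
     (Dom C f \<in> W \<and> Cod C f \<in> W \<longrightarrow> Cod C g \<in> W) \<and>
     (Dom C f \<in> W \<and> Cod C g \<in> W \<longrightarrow> Cod C f \<in> W) \<and>
     (Cod C f \<in> W \<and> Cod C g \<in> W \<longrightarrow> Dom C f \<in> W))"

definition hereditary_abelian_model_structure ::
  "('o, 'm) addcat \<Rightarrow> 'o set \<Rightarrow> 'o set \<Rightarrow> 'o set \<Rightarrow> bool" where
  "hereditary_abelian_model_structure C Q W R \<longleftrightarrow>
     Q \<subseteq> Obj C \<and> W \<subseteq> Obj C \<and> R \<subseteq> Obj C \<and> thick C W \<and>
     cotorsion_pair C Q (W \<inter> R) \<and> complete_pair C Q (W \<inter> R) \<and> hereditary_pair C Q (W \<inter> R) \<and>
     cotorsion_pair C (Q \<inter> W) R \<and> complete_pair C (Q \<inter> W) R \<and> hereditary_pair C (Q \<inter> W) R"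


section \<open>Resolutions, replacements and the Ext groups of the homotopy category\<close>

text \<open>
  The complex is given by its differentials \<open>d i : W\<^sub>i \<rightarrow> W\<^sub>i\<^sub>-\<^sub>1\<close> for \<open>i :: int\<close>, so that \<open>W\<^sub>i\<close> is
  the domain of \<open>d i\<close>; it is \<open>Q\<^sub>i\<close> for \<open>i \<ge> 0\<close> and \<open>R\<^sub>i\<close> for \<open>i \<le> -1\<close>.
\<close>

definition M_resolution ::
  "('o, 'm) addcat \<Rightarrow> 'o set \<Rightarrow> 'o set \<Rightarrow> 'o set \<Rightarrow> 'o \<Rightarrow> (int \<Rightarrow> 'm) \<Rightarrow> 'm \<Rightarrow> 'm \<Rightarrow> bool" where
  "M_resolution C Q W R A d \<epsilon> \<eta> \<longleftrightarrow>
     (\<forall>i. exact C (d (i + 1)) (d i)) \<and>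
     \<epsilon> \<in> Hom C (Dom C (d 0)) A \<and> \<eta> \<in> Hom C A (Cod C (d 0)) \<and> d 0 = \<eta> \<cdot>\<^bsub>C\<^esub> \<epsilon> \<and>
     exact C (d 1) \<epsilon> \<and> is_epi C \<epsilon> \<and> is_mono C \<eta> \<and> exact C \<eta> (d (- 1)) \<and>
     (\<forall>i\<ge>0. Dom C (d i) \<in> Q \<inter> W) \<and>
     (\<forall>i\<le>- 1. Dom C (d i) \<in> W \<inter> R) \<and>
     (\<forall>k. is_kernel C k \<epsilon> \<longrightarrow> Dom C k \<in> R) \<and>
     (\<forall>i\<ge>1. \<forall>k. is_kernel C k (d i) \<longrightarrow> Dom C k \<in> R) \<and>
     (\<forall>c. is_cokernel C c \<eta> \<longrightarrow> Cod C c \<in> Q) \<and>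
     (\<forall>i\<le>- 1. \<forall>c. is_cokernel C c (d i) \<longrightarrow> Cod C c \<in> Q)"

text \<open>
  The cohomology group \<open>H\<^sup>n[Hom(W, Y)]\<close> of a chain complex as above, where the coboundary
  \<open>Hom(W\<^sub>n, Y) \<rightarrow> Hom(W\<^sub>n\<^sub>+\<^sub>1, Y)\<close> is composition with \<open>d (n + 1)\<close>.
\<close>

definition cocycles :: "('o, 'm) addcat \<Rightarrow> (int \<Rightarrow> 'm) \<Rightarrow> int \<Rightarrow> 'o \<Rightarrow> 'm set" where
  "cocycles C d n Y = kernel (hom_group C (Dom C (d n)) Y) (hom_group C (Dom C (d (n + 1))) Y)
     (\<lambda>f. f \<cdot>\<^bsub>C\<^esub> d (n + 1))"

definition coboundaries :: "('o, 'm) addcat \<Rightarrow> (int \<Rightarrow> 'm) \<Rightarrow> int \<Rightarrow> 'o \<Rightarrow> 'm set" where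
  "coboundaries C d n Y = (\<lambda>f. f \<cdot>\<^bsub>C\<^esub> d n) ` carrier (hom_group C (Dom C (d (n - 1))) Y)"

definition Hom_cohomology ::
  "('o, 'm) addcat \<Rightarrow> (int \<Rightarrow> 'm) \<Rightarrow> int \<Rightarrow> 'o \<Rightarrow> 'm set monoid" where
  "Hom_cohomology C d n Y =
     (hom_group C (Dom C (d n)) Y)\<lparr>carrier := cocycles C d n Y\<rparr> Mod coboundaries C d n Y"

text \<open>
  The map on cohomology induced by \<open>t : W' \<rightarrow> W\<close> and \<open>k : Y \<rightarrow> Y'\<close>; cohomology classes are cosets,
  and \<open>d'\<close> is the differential of \<open>W'\<close>.
\<close>

definition Hom_cohomology_map ::
  "('o, 'm) addcat \<Rightarrow> (int \<Rightarrow> 'm) \<Rightarrow> int \<Rightarrow> (int \<Rightarrow> 'm) \<Rightarrow> 'm \<Rightarrow> 'm set \<Rightarrow> 'm set" where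
  "Hom_cohomology_map C d' n t k x =
     coboundaries C d' n (Cod C k) <#>\<^bsub>hom_group C (Dom C (d' n)) (Cod C k)\<^esub>
       ((\<lambda>f. k \<cdot>\<^bsub>C\<^esub> f \<cdot>\<^bsub>C\<^esub> t n) ` x)"

text \<open>
  A choice, for every object \<open>A\<close>, of sequences \<open>0 \<rightarrow> F \<rightarrow> QA \<rightarrow> A \<rightarrow> 0\<close> and
  \<open>0 \<rightarrow> A \<rightarrow> RA \<rightarrow> K \<rightarrow> 0\<close>, and of a resolution for every cofibrant \<open>A\<close>.
\<close>

record ('o, 'm) choices =
  cof_ker :: "'o \<Rightarrow> 'm"
  cof_rep :: "'o \<Rightarrow> 'm"
  fib_rep :: "'o \<Rightarrow> 'm"
  fib_cok :: "'o \<Rightarrow> 'm"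
  res_d :: "'o \<Rightarrow> int \<Rightarrow> 'm"
  res_eps :: "'o \<Rightarrow> 'm"
  res_eta :: "'o \<Rightarrow> 'm"

definition valid_choices ::
  "('o, 'm) addcat \<Rightarrow> 'o set \<Rightarrow> 'o set \<Rightarrow> 'o set \<Rightarrow> ('o, 'm) choices \<Rightarrow> bool" where
  "valid_choices C Q W R T \<longleftrightarrow>
     (\<forall>A\<in>Obj C. short_exact C (cof_ker T A) (cof_rep T A) \<and> Cod C (cof_rep T A) = A \<and>
        Dom C (cof_rep T A) \<in> Q \<and> Dom C (cof_ker T A) \<in> W \<inter> R) \<and>
     (\<forall>A\<in>Obj C. short_exact C (fib_rep T A) (fib_cok T A) \<and> Dom C (fib_rep T A) = A \<and>
        Cod C (fib_rep T A) \<in> R \<and> Cod C (fib_cok T A) \<in> Q \<inter> W) \<and>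
     (\<forall>A\<in>Q. M_resolution C Q W R A (res_d T A) (res_eps T A) (res_eta T A))"

definition Qob :: "('o, 'm) addcat \<Rightarrow> ('o, 'm) choices \<Rightarrow> 'o \<Rightarrow> 'o" where
  "Qob C T A = Dom C (cof_rep T A)"

definition Rob :: "('o, 'm) addcat \<Rightarrow> ('o, 'm) choices \<Rightarrow> 'o \<Rightarrow> 'o" where
  "Rob C T A = Cod C (fib_rep T A)"

definition RQob :: "('o, 'm) addcat \<Rightarrow> ('o, 'm) choices \<Rightarrow> 'o \<Rightarrow> 'o" where
  "RQob C T A = Rob C T (Qob C T A)"

definition Ext_M :: "('o, 'm) addcat \<Rightarrow> ('o, 'm) choices \<Rightarrow> int \<Rightarrow> 'o \<Rightarrow> 'o \<Rightarrow> 'm set monoid" where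
  "Ext_M C T n A B = Hom_cohomology C (res_d T A) n B"

definition Ext_Ho :: "('o, 'm) addcat \<Rightarrow> ('o, 'm) choices \<Rightarrow> int \<Rightarrow> 'o \<Rightarrow> 'o \<Rightarrow> 'm set monoid" where
  "Ext_Ho C T n A B = Ext_M C T n (RQob C T A) (RQob C T B)"

definition uExt_Ho ::
  "('o, 'm) addcat \<Rightarrow> ('o, 'm) choices \<Rightarrow> nat \<Rightarrow> 'o \<Rightarrow> 'o \<Rightarrow> 'm list set monoid" where
  "uExt_Ho C T n A B = YExt C n (RQob C T A) (RQob C T B)"

text \<open>
  Lifts of an arrow \<open>f\<close> to the chosen cofibrant, fibrant and bifibrant replacements, and of an
  arrow \<open>h\<close> to a chain map of the chosen resolutions. They are not unique, but any two of them
  induce the same map on the Ext groups; \<open>A\<close> and \<open>B\<close> act functorially through them.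
\<close>

definition cof_lift :: "('o, 'm) addcat \<Rightarrow> ('o, 'm) choices \<Rightarrow> 'm \<Rightarrow> 'm \<Rightarrow> bool" where
  "cof_lift C T f q \<longleftrightarrow> q \<in> Hom C (Qob C T (Dom C f)) (Qob C T (Cod C f)) \<and>
     cof_rep T (Cod C f) \<cdot>\<^bsub>C\<^esub> q = f \<cdot>\<^bsub>C\<^esub> cof_rep T (Dom C f)"

definition fib_lift :: "('o, 'm) addcat \<Rightarrow> ('o, 'm) choices \<Rightarrow> 'm \<Rightarrow> 'm \<Rightarrow> bool" where
  "fib_lift C T f r \<longleftrightarrow> r \<in> Hom C (Rob C T (Dom C f)) (Rob C T (Cod C f)) \<and>
     r \<cdot>\<^bsub>C\<^esub> fib_rep T (Dom C f) = fib_rep T (Cod C f) \<cdot>\<^bsub>C\<^esub> f"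

definition bifib_lift :: "('o, 'm) addcat \<Rightarrow> ('o, 'm) choices \<Rightarrow> 'm \<Rightarrow> 'm \<Rightarrow> bool" where
  "bifib_lift C T f h \<longleftrightarrow> (\<exists>q. cof_lift C T f q \<and> fib_lift C T q h)"

definition res_lift :: "('o, 'm) addcat \<Rightarrow> ('o, 'm) choices \<Rightarrow> 'm \<Rightarrow> (int \<Rightarrow> 'm) \<Rightarrow> bool" where
  "res_lift C T h t \<longleftrightarrow> (let X = Dom C h; Y = Cod C h in
     (\<forall>i. t i \<in> Hom C (Dom C (res_d T X i)) (Dom C (res_d T Y i))) \<and>
     (\<forall>i. t (i - 1) \<cdot>\<^bsub>C\<^esub> res_d T X i = res_d T Y i \<cdot>\<^bsub>C\<^esub> t i) \<and>
     res_eps T Y \<cdot>\<^bsub>C\<^esub> t 0 = h \<cdot>\<^bsub>C\<^esub> res_eps T X \<and>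
     t (- 1) \<cdot>\<^bsub>C\<^esub> res_eta T X = res_eta T Y \<cdot>\<^bsub>C\<^esub> h)"

text \<open>The map \<open>Ext\<^sup>n(A, B) \<rightarrow> Ext\<^sup>n(A', B')\<close> given by lifts \<open>t\<close> of \<open>A' \<rightarrow> A\<close> and \<open>k\<close> of \<open>B \<rightarrow> B'\<close>.\<close>

definition Ext_Ho_map ::
  "('o, 'm) addcat \<Rightarrow> ('o, 'm) choices \<Rightarrow> int \<Rightarrow> 'o \<Rightarrow> (int \<Rightarrow> 'm) \<Rightarrow> 'm \<Rightarrow> 'm set \<Rightarrow> 'm set" where
  "Ext_Ho_map C T n A' t k = Hom_cohomology_map C (res_d T (RQob C T A')) n t k"

end

theory Submission
  imports Defs
begin

text \<open>
  Let \<open>P = Q \<inter> W\<close>. If all syzygies of an \<open>n\<close>-fold sequence \<open>0 \<rightarrow> B \<rightarrow> \<dots> \<rightarrow> A \<rightarrow> 0\<close> lie in \<open>R\<close>, then a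
  resolution of \<open>A\<close> by objects of \<open>P\<close> maps to it over \<open>A\<close>, uniquely up to homotopy. Every sequence
  with \<open>B \<in> R\<close> maps, with identities at both ends, to a sequence of this kind, which is weakly
  initial among them. So an element of \<open>Ext\<^sup>n(A, B)\<close> amounts to a map \<open>Z \<rightarrow> B\<close> from the \<open>n\<close>-th syzygy
  of the resolution, modulo the maps that extend over the resolving object containing \<open>Z\<close>, that is,
  to an element of \<open>H\<^sup>n[Hom(W\<^sub>A, B)]\<close>; Baer sums become sums of maps, and base and cobase change
  become compositions.

  For the second isomorphism, \<open>Ext\<^sup>2(RQA/QA, R) = 0\<close> allows one to extend the last step of a
  resolution of \<open>QA\<close> to a resolution of \<open>RQA\<close> with the same syzygy \<open>Z\<close>, and \<open>RQB \<rightarrow> RB\<close> induces a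
  bijection on maps from the cofibrant object \<open>Z\<close> modulo homotopy. Of the higher Yoneda
  groups only \<open>Ext\<^sup>2\<close> is needed, for the closure of \<open>R\<close> under cokernels of monomorphisms and its
      dual.
\<close>

section \<open>Preadditive and abelian categories\<close>

text \<open>The obstacle is the absence of projectives: an arrow from an object of \<open>P\<close>
  lifts through X_i -> Z_i only if the kernel lies in \<open>R\<close>, which an arbitrary Yoneda
  sequence does not provide. The remedy is to enlarge the middle terms to objects of
  \<open>R\<close> with quotient in \<open>P\<close>. An arrow from an old middle term to an object
  of \<open>R\<close> then extends to the enlarged one, whence the initiality; the last middle term
  is left alone, since the end \<open>A\<close> must not change. Two sequences with the same cocycle
  are connected through the pushout of the resolution along it. For n >= 1 the terms of degree n -
  1, n, n + 1 belong to the left half of the complex, and a cocycle is an arrow Z -> B composed with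
  the epimorphism onto Z. The comparison of RQA with QA and of RQB with RB rests on the second
  cotorsion pair: the difference of two choices factors through an object of
  \<open>Q \<inter> W\<close> or of \<open>W \<inter> R\<close>, by thickness then also through one
  of the other kind, and so it vanishes up to homotopy on cofibrant syzygies.\<close>

definition Sub :: "('o, 'm) addcat \<Rightarrow> 'm \<Rightarrow> 'm \<Rightarrow> 'm"  (infixl "\<^bold>-\<index>" 65) where
  "Sub C f g = Add C f (m_inv (hom_group C (Dom C f) (Cod C f)) g)"

text \<open>Unlike \<open>short_exact\<close> this is literally self-dual, so passage to
  \<open>op C\<close> only swaps \<open>m\<close> and \<open>p\<close>. The two notions agree in an
  abelian category by \<open>short_exact_iff_ses\<close>.\<close>

definition ses :: "('o, 'm) addcat \<Rightarrow> 'm \<Rightarrow> 'm \<Rightarrow> bool" where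
  "ses C m p \<longleftrightarrow> is_kernel C m p \<and> is_cokernel C p m"

text \<open>Many statements below are instances in \<open>op C\<close> of their duals. The addition
  of arrows is unchanged, so hom groups and zero arrows only exchange their indices, and the rewrite
  rules that follow turn such an instance back into a statement about \<open>C\<close>.\<close>

definition op :: "('o, 'm) addcat \<Rightarrow> ('o, 'm) addcat" where
  "op C = \<lparr>Obj = Obj C, Arr = Arr C, Dom = Cod C, Cod = Dom C, Ident = Ident C,
     Comp = (\<lambda>f g. Comp C g f), Add = Add C, Zero = (\<lambda>A B. Zero C B A)\<rparr>"

lemma op_sel [simp]:
  "Obj (op C) = Obj C" "Arr (op C) = Arr C" "Dom (op C) = Cod C" "Cod (op C) = Dom C"
  "Ident (op C) = Ident C" "Comp (op C) = (\<lambda>f g. Comp C g f)" "Add (op C) = Add C"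
  "Zero (op C) = (\<lambda>A B. Zero C B A)"
  by (simp_all add: op_def)

lemma op_Hom [simp]: "Hom (op C) A B = Hom C B A"
  by (auto simp: Hom_def)

lemma op_hom_group [simp]: "hom_group (op C) A B = hom_group C B A"
  by (simp add: hom_group_def)

lemma op_props [simp]:
  "is_mono (op C) f = is_epi C f" "is_epi (op C) f = is_mono C f"
  "is_kernel (op C) k f = is_cokernel C k f" "is_cokernel (op C) k f = is_kernel C k f"
  "ses (op C) m p = ses C p m" "is_zero_object (op C) Z = is_zero_object C Z"
  "is_pushout (op C) v i' i b = is_pullback C v i' i b"
  "is_pullback (op C) v i' i b = is_pushout C v i' i b"
  by (auto simp: is_mono_def is_epi_def is_kernel_def is_cokernel_def ses_def is_zero_object_def
      is_pushout_def is_pullback_def)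

lemma op_biproduct [simp]:
  "is_biproduct (op C) A B P i\<^sub>1 i\<^sub>2 p\<^sub>1 p\<^sub>2 = is_biproduct C A B P p\<^sub>1 p\<^sub>2 i\<^sub>1 i\<^sub>2"
  by (auto simp: is_biproduct_def)

section \<open>Additive calculus of arrows; monomorphisms, epimorphisms, kernels and
  cokernels\<close>

context preadditive_category
begin

lemma in_Hom: "f \<in> Hom C X Y \<longleftrightarrow> f \<in> Arr C \<and> Dom C f = X \<and> Cod C f = Y"
  by (simp add: Hom_def)

text \<open>Typing is carried by equations for \<open>Dom\<close> and \<open>Cod\<close> rather than
  by membership in \<open>Hom\<close>, so that the simplifier can discharge the side conditions of
  the composition laws.\<close>

lemma comp_simps [simp]:
  assumes "f \<in> Arr C" "g \<in> Arr C" "Dom C g = Cod C f"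
  shows "g \<cdot> f \<in> Arr C" "Dom C (g \<cdot> f) = Dom C f" "Cod C (g \<cdot> f) = Cod C g"
  using Comp_Hom[of f "Dom C f" "Cod C f" g "Cod C g"] assms by (auto simp: in_Hom)

lemma comp_assoc [simp]:
  "f \<in> Arr C \<Longrightarrow> g \<in> Arr C \<Longrightarrow> h \<in> Arr C \<Longrightarrow> Dom C g = Cod C f \<Longrightarrow> Dom C h = Cod C g \<Longrightarrow>
    (h \<cdot> g) \<cdot> f = h \<cdot> (g \<cdot> f)"
  using Comp_assoc[of f "Dom C f" "Cod C f" g "Cod C g" h "Cod C h"] by (auto simp: in_Hom)

text \<open>Used as a rewrite rule inside the right-nested normal form of compositions.\<close>

lemma comp_reduce:
  "g \<cdot> f = k \<Longrightarrow> f \<in> Arr C \<Longrightarrow> g \<in> Arr C \<Longrightarrow> x \<in> Arr C \<Longrightarrow> Dom C g = Cod C f \<Longrightarrow>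
    Dom C f = Cod C x \<Longrightarrow> g \<cdot> (f \<cdot> x) = k \<cdot> x"
  by (metis comp_assoc)

lemma obj [simp]: "f \<in> Arr C \<Longrightarrow> Dom C f \<in> Obj C" "f \<in> Arr C \<Longrightarrow> Cod C f \<in> Obj C"
  by (auto intro: Dom_Obj Cod_Obj)

lemma Hom_Obj: "f \<in> Hom C X Y \<Longrightarrow> X \<in> Obj C" "f \<in> Hom C X Y \<Longrightarrow> Y \<in> Obj C"
  by (auto simp: in_Hom)

lemma ident_simps [simp]:
  assumes "X \<in> Obj C"
  shows "Ident C X \<in> Arr C" "Dom C (Ident C X) = X" "Cod C (Ident C X) = X"
  using Ident_Hom[OF assms] by (auto simp: in_Hom)

lemma comp_ident [simp]:
  "f \<in> Arr C \<Longrightarrow> Dom C f = X \<Longrightarrow> f \<cdot> Ident C X = f"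
  "f \<in> Arr C \<Longrightarrow> Cod C f = X \<Longrightarrow> Ident C X \<cdot> f = f"
  using Comp_Ident[of f X "Cod C f"] Ident_Comp[of f "Dom C f" X] by (auto simp: in_Hom)

lemma zero_simps [simp]:
  assumes "A \<in> Obj C" "B \<in> Obj C"
  shows "Zero C A B \<in> Arr C" "Dom C (Zero C A B) = A" "Cod C (Zero C A B) = B"
proof -
  interpret comm_group "hom_group C A B" by (rule hom_comm_group[OF assms])
  show "Zero C A B \<in> Arr C" "Dom C (Zero C A B) = A" "Cod C (Zero C A B) = B"
    using one_closed by (auto simp: hom_group_def in_Hom)
qed

lemma add_simps [simp]:
  assumes "f \<in> Arr C" "g \<in> Arr C" "Dom C f = Dom C g" "Cod C f = Cod C g"
  shows "f \<^bold>+ g \<in> Arr C" "Dom C (f \<^bold>+ g) = Dom C g" "Cod C (f \<^bold>+ g) = Cod C g"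
proof -
  interpret comm_group "hom_group C (Dom C g) (Cod C g)"
    using assms by (intro hom_comm_group) auto
  show "f \<^bold>+ g \<in> Arr C" "Dom C (f \<^bold>+ g) = Dom C g" "Cod C (f \<^bold>+ g) = Cod C g"
    using m_closed[of f g] assms by (auto simp: hom_group_def in_Hom)
qed

lemma add_zero [simp]:
  assumes "f \<in> Arr C" "A = Dom C f" "B = Cod C f"
  shows "f \<^bold>+ Zero C A B = f" "Zero C A B \<^bold>+ f = f"
proof -
  interpret comm_group "hom_group C (Dom C f) (Cod C f)"
    using assms by (intro hom_comm_group) auto
  show "f \<^bold>+ Zero C A B = f" "Zero C A B \<^bold>+ f = f"
    using r_one[of f] l_one[of f] assms by (auto simp: hom_group_def in_Hom)
qed

lemma add_assoc:
  assumes "f \<in> Arr C" "g \<in> Arr C" "h \<in> Arr C" "Dom C f = Dom C g" "Cod C f = Cod C g"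
    "Dom C h = Dom C g" "Cod C h = Cod C g"
  shows "(f \<^bold>+ g) \<^bold>+ h = f \<^bold>+ (g \<^bold>+ h)"
proof -
  interpret comm_group "hom_group C (Dom C g) (Cod C g)"
    using assms by (intro hom_comm_group) auto
  show ?thesis using m_assoc[of f g h] assms by (auto simp: hom_group_def in_Hom)
qed

lemma add_commute:
  assumes "f \<in> Arr C" "g \<in> Arr C" "Dom C f = Dom C g" "Cod C f = Cod C g"
  shows "f \<^bold>+ g = g \<^bold>+ f"
proof -
  interpret comm_group "hom_group C (Dom C g) (Cod C g)"
    using assms by (intro hom_comm_group) auto
  show ?thesis using m_comm[of f g] assms by (auto simp: hom_group_def in_Hom)
qed

lemma sub_props:
  assumes "f \<in> Arr C" "g \<in> Arr C" "Dom C f = Dom C g" "Cod C f = Cod C g"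
  shows sub_simps [simp]: "f \<^bold>- g \<in> Arr C" "Dom C (f \<^bold>- g) = Dom C g" "Cod C (f \<^bold>- g) = Cod C g"
    and sub_add [simp]: "(f \<^bold>- g) \<^bold>+ g = f"
    and sub_eq_zero: "f \<^bold>- g = Zero C (Dom C g) (Cod C g) \<longleftrightarrow> f = g"
proof -
  interpret G: comm_group "hom_group C (Dom C g) (Cod C g)"
    using assms by (intro hom_comm_group) auto
  have c: "f \<in> carrier (hom_group C (Dom C g) (Cod C g))"
      "g \<in> carrier (hom_group C (Dom C g) (Cod C g))"
    using assms by (auto simp: hom_group_def in_Hom)
  have e: "f \<^bold>- g = f \<otimes>\<^bsub>hom_group C (Dom C g) (Cod C g)\<^esub> inv\<^bsub>hom_group C (Dom C g) (Cod C g)\<^esub> g"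
    using assms by (simp add: Sub_def) (simp add: hom_group_def)
  have "f \<^bold>- g \<in> carrier (hom_group C (Dom C g) (Cod C g))" unfolding e using c by simp
  then show "f \<^bold>- g \<in> Arr C" "Dom C (f \<^bold>- g) = Dom C g" "Cod C (f \<^bold>- g) = Cod C g"
    by (auto simp: hom_group_def in_Hom)
  have "(f \<^bold>- g) \<otimes>\<^bsub>hom_group C (Dom C g) (Cod C g)\<^esub> g = f" unfolding e using c
    by (simp add: G.m_assoc)
  then show "(f \<^bold>- g) \<^bold>+ g = f" by (simp add: hom_group_def)
  have "(f \<^bold>- g = \<one>\<^bsub>hom_group C (Dom C g) (Cod C g)\<^esub>) = (f = g)"
    unfolding e using c by (metis G.inv_closed G.inv_equality G.inv_inv G.r_inv)
  then show "f \<^bold>- g = Zero C (Dom C g) (Cod C g) \<longleftrightarrow> f = g" by (simp add: hom_group_def)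
qed

lemma add_right_cancel:
  assumes "f \<in> Arr C" "g \<in> Arr C" "h \<in> Arr C" "Dom C f = Dom C h" "Cod C f = Cod C h"
    "Dom C g = Dom C h" "Cod C g = Cod C h"
  shows "f \<^bold>+ h = g \<^bold>+ h \<longleftrightarrow> f = g"
proof -
  interpret comm_group "hom_group C (Dom C h) (Cod C h)"
    using assms by (intro hom_comm_group) auto
  show ?thesis using right_cancel[of h f g] assms by (auto simp: hom_group_def in_Hom)
qed

lemma sub_unique:
  assumes "f = k \<^bold>+ g" "k \<in> Arr C" "g \<in> Arr C" "Dom C k = Dom C g" "Cod C k = Cod C g"
  shows "f \<^bold>- g = k"
proof -
  have f: "f \<in> Arr C" "Dom C f = Dom C g" "Cod C f = Cod C g" using assms by auto
  have "(f \<^bold>- g) \<^bold>+ g = k \<^bold>+ g" using f assms by simp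
  then show ?thesis using f assms by (simp only: add_right_cancel sub_simps)
qed

lemma comp_add:
  "f \<in> Arr C \<Longrightarrow> f' \<in> Arr C \<Longrightarrow> g \<in> Arr C \<Longrightarrow> Dom C f = Dom C f' \<Longrightarrow> Cod C f = Cod C f' \<Longrightarrow>
    Dom C g = Cod C f' \<Longrightarrow> g \<cdot> (f \<^bold>+ f') = (g \<cdot> f) \<^bold>+ (g \<cdot> f')"
  using Comp_Add[of f "Dom C f'" "Cod C f'" f' g "Cod C g"] by (auto simp: in_Hom)

lemma add_comp:
  "f \<in> Arr C \<Longrightarrow> g \<in> Arr C \<Longrightarrow> g' \<in> Arr C \<Longrightarrow> Dom C g = Dom C g' \<Longrightarrow> Cod C g = Cod C g' \<Longrightarrow>
    Dom C g' = Cod C f \<Longrightarrow> (g \<^bold>+ g') \<cdot> f = (g \<cdot> f) \<^bold>+ (g' \<cdot> f)"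
  using Add_Comp[of f "Dom C f" "Cod C f" g "Cod C g'" g'] by (auto simp: in_Hom)

text \<open>The composite equals its own double, and in a group only the neutral element
  does.\<close>

lemma comp_zero [simp]:
  assumes "g \<in> Arr C" "A \<in> Obj C" "Dom C g = B"
  shows "g \<cdot> Zero C A B = Zero C A (Cod C g)"
proof -
  let ?z = "Zero C A B" and ?w = "Zero C A (Cod C g)"
  have B: "B \<in> Obj C" using assms by auto
  have "(g \<cdot> ?z) \<^bold>+ (g \<cdot> ?z) = g \<cdot> (?z \<^bold>+ ?z)" using assms B by (subst comp_add) auto
  also have "\<dots> = ?w \<^bold>+ (g \<cdot> ?z)" using assms B by simp
  finally show ?thesis using assms B add_right_cancel[of "g \<cdot> ?z" ?w "g \<cdot> ?z"] by simp
qed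

lemma zero_comp [simp]:
  assumes "g \<in> Arr C" "B \<in> Obj C" "Cod C g = A"
  shows "Zero C A B \<cdot> g = Zero C (Dom C g) B"
proof -
  let ?z = "Zero C A B" and ?w = "Zero C (Dom C g) B"
  have B: "A \<in> Obj C" using assms by auto
  have "(?z \<cdot> g) \<^bold>+ (?z \<cdot> g) = (?z \<^bold>+ ?z) \<cdot> g" using assms B by (subst add_comp) auto
  also have "\<dots> = ?w \<^bold>+ (?z \<cdot> g)" using assms B by simp
  finally show ?thesis using assms B add_right_cancel[of "?z \<cdot> g" ?w "?z \<cdot> g"] by simp
qed

lemma comp_sub:
  assumes "f \<in> Arr C" "f' \<in> Arr C" "g \<in> Arr C" "Dom C f = Dom C f'" "Cod C f = Cod C f'"
    "Dom C g = Cod C f'"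
  shows "g \<cdot> (f \<^bold>- f') = (g \<cdot> f) \<^bold>- (g \<cdot> f')"
proof -
  have "g \<cdot> f = g \<cdot> ((f \<^bold>- f') \<^bold>+ f')" using assms by simp
  also have "\<dots> = (g \<cdot> (f \<^bold>- f')) \<^bold>+ (g \<cdot> f')" using assms by (subst comp_add) auto
  finally show ?thesis using assms by (intro sub_unique[symmetric]) auto
qed

lemma sub_comp:
  assumes "f \<in> Arr C" "g \<in> Arr C" "g' \<in> Arr C" "Dom C g = Dom C g'" "Cod C g = Cod C g'"
    "Dom C g' = Cod C f"
  shows "(g \<^bold>- g') \<cdot> f = (g \<cdot> f) \<^bold>- (g' \<cdot> f)"
proof -
  have "g \<cdot> f = ((g \<^bold>- g') \<^bold>+ g') \<cdot> f" using assms by simp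
  also have "\<dots> = ((g \<^bold>- g') \<cdot> f) \<^bold>+ (g' \<cdot> f)" using assms by (subst add_comp) auto
  finally show ?thesis using assms by (intro sub_unique[symmetric]) auto
qed

lemma sub_self [simp]: "f \<in> Arr C \<Longrightarrow> f \<^bold>- f = Zero C (Dom C f) (Cod C f)"
  by (simp add: sub_eq_zero)

lemma sub_zero [simp]:
  "f \<in> Arr C \<Longrightarrow> A = Dom C f \<Longrightarrow> B = Cod C f \<Longrightarrow> f \<^bold>- Zero C A B = f"
  by (rule sub_unique) auto

lemma preadditive_op: "preadditive_category (op C)"
proof (rule preadditive_category.intro)
  fix f X Y g Z f' g' h V A B
  show "f \<in> Hom (op C) X Y \<Longrightarrow> g \<in> Hom (op C) Y Z \<Longrightarrow> g \<cdot>\<^bsub>op C\<^esub> f \<in> Hom (op C) X Z"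
    by (auto simp: in_Hom)
  show "f \<in> Hom (op C) X Y \<Longrightarrow> f \<cdot>\<^bsub>op C\<^esub> Ident (op C) X = f"
    "f \<in> Hom (op C) X Y \<Longrightarrow> Ident (op C) Y \<cdot>\<^bsub>op C\<^esub> f = f" by (auto simp: in_Hom)
  show "f \<in> Hom (op C) X Y \<Longrightarrow> g \<in> Hom (op C) Y Z \<Longrightarrow> h \<in> Hom (op C) Z V \<Longrightarrow>
      (h \<cdot>\<^bsub>op C\<^esub> g) \<cdot>\<^bsub>op C\<^esub> f = h \<cdot>\<^bsub>op C\<^esub> (g \<cdot>\<^bsub>op C\<^esub> f)" by (auto simp: in_Hom)
  show "f \<in> Hom (op C) X Y \<Longrightarrow> f' \<in> Hom (op C) X Y \<Longrightarrow> g \<in> Hom (op C) Y Z \<Longrightarrow>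
      g \<cdot>\<^bsub>op C\<^esub> (f \<^bold>+\<^bsub>op C\<^esub> f') = (g \<cdot>\<^bsub>op C\<^esub> f) \<^bold>+\<^bsub>op C\<^esub> (g \<cdot>\<^bsub>op C\<^esub> f')"
    using Add_Comp by auto
  show "f \<in> Hom (op C) X Y \<Longrightarrow> g \<in> Hom (op C) Y Z \<Longrightarrow> g' \<in> Hom (op C) Y Z \<Longrightarrow>
      (g \<^bold>+\<^bsub>op C\<^esub> g') \<cdot>\<^bsub>op C\<^esub> f = (g \<cdot>\<^bsub>op C\<^esub> f) \<^bold>+\<^bsub>op C\<^esub> (g' \<cdot>\<^bsub>op C\<^esub> f)"
    using Comp_Add by auto
qed (auto simp: in_Hom hom_comm_group)

lemma mono_arr: "is_mono C f \<Longrightarrow> f \<in> Arr C" by (simp add: is_mono_def)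
lemma epi_arr: "is_epi C f \<Longrightarrow> f \<in> Arr C" by (simp add: is_epi_def)

lemma mono_cancel:
  "is_mono C f \<Longrightarrow> f \<cdot> g = f \<cdot> h \<Longrightarrow> g \<in> Arr C \<Longrightarrow> h \<in> Arr C \<Longrightarrow> Dom C g = Dom C h \<Longrightarrow>
    Cod C g = Dom C f \<Longrightarrow> Cod C h = Dom C f \<Longrightarrow> g = h"
  by (auto simp: is_mono_def in_Hom)

lemma epi_cancel:
  "is_epi C f \<Longrightarrow> g \<cdot> f = h \<cdot> f \<Longrightarrow> g \<in> Arr C \<Longrightarrow> h \<in> Arr C \<Longrightarrow> Cod C g = Cod C h \<Longrightarrow>
    Dom C g = Cod C f \<Longrightarrow> Dom C h = Cod C f \<Longrightarrow> g = h"
  by (auto simp: is_epi_def in_Hom)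

lemma monoI:
  assumes "f \<in> Arr C"
    and "\<And>g. g \<in> Arr C \<Longrightarrow> Cod C g = Dom C f \<Longrightarrow> f \<cdot> g = Zero C (Dom C g) (Cod C f) \<Longrightarrow>
      g = Zero C (Dom C g) (Dom C f)"
  shows "is_mono C f"
  unfolding is_mono_def
proof (intro conjI allI ballI impI)
  fix X g h assume gh: "g \<in> Hom C X (Dom C f)" "h \<in> Hom C X (Dom C f)" and "f \<cdot> g = f \<cdot> h"
  then have "f \<cdot> (g \<^bold>- h) = Zero C X (Cod C f)"
    using assms(1) by (simp add: comp_sub in_Hom)
  then have "g \<^bold>- h = Zero C (Dom C (g \<^bold>- h)) (Dom C f)"
    using gh by (intro assms(2)) (auto simp: in_Hom)
  then show "g = h" using gh sub_eq_zero[of g h] by (simp add: in_Hom)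
qed (rule assms)

lemma mono_zeroD:
  "is_mono C f \<Longrightarrow> f \<cdot> g = Zero C (Dom C g) (Cod C f) \<Longrightarrow> g \<in> Arr C \<Longrightarrow> Cod C g = Dom C f \<Longrightarrow>
    g = Zero C (Dom C g) (Dom C f)"
  by (rule mono_cancel) (auto simp: mono_arr)

lemma epi_zeroD:
  "is_epi C f \<Longrightarrow> g \<cdot> f = Zero C (Dom C f) (Cod C g) \<Longrightarrow> g \<in> Arr C \<Longrightarrow> Dom C g = Cod C f \<Longrightarrow>
    g = Zero C (Cod C f) (Cod C g)"
  by (rule epi_cancel) (auto simp: epi_arr)

lemma epiI:
  assumes "f \<in> Arr C"
    and "\<And>g. g \<in> Arr C \<Longrightarrow> Dom C g = Cod C f \<Longrightarrow> g \<cdot> f = Zero C (Dom C f) (Cod C g) \<Longrightarrow>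
      g = Zero C (Cod C f) (Cod C g)"
  shows "is_epi C f"
  using preadditive_category.monoI[OF preadditive_op, of f] assms by simp

lemma kernelD:
  assumes "is_kernel C k f"
  shows "k \<in> Arr C" "f \<in> Arr C" "Cod C k = Dom C f" "f \<cdot> k = Zero C (Dom C k) (Cod C f)"
  using assms by (auto simp: is_kernel_def)

lemma kernel_factor:
  assumes "is_kernel C k f" "h \<in> Arr C" "Cod C h = Dom C f" "f \<cdot> h = Zero C (Dom C h) (Cod C f)"
  shows "\<exists>u\<in>Hom C (Dom C h) (Dom C k). k \<cdot> u = h"
proof -
  have "h \<in> Hom C (Dom C h) (Dom C f)" using assms(2,3) by (simp add: in_Hom)
  with assms(1,4) have "\<exists>u. u \<in> Hom C (Dom C h) (Dom C k) \<and> k \<cdot> u = h"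
    unfolding is_kernel_def by blast
  then show ?thesis by blast
qed

lemma kernel_mono:
  assumes "is_kernel C k f" shows "is_mono C k"
  unfolding is_mono_def
proof (intro conjI allI ballI impI)
  fix X g h assume gh: "g \<in> Hom C X (Dom C k)" "h \<in> Hom C X (Dom C k)" and e: "k \<cdot> g = k \<cdot> h"
  note k = kernelD[OF assms]
  have "f \<cdot> (k \<cdot> h) = Zero C X (Cod C f)" using k gh by (simp add: comp_reduce[OF k(4)] in_Hom)
  moreover have "k \<cdot> h \<in> Hom C X (Dom C f)" using k gh by (simp add: in_Hom)
  ultimately have "\<exists>!u. u \<in> Hom C X (Dom C k) \<and> k \<cdot> u = k \<cdot> h"
    using assms by (simp add: is_kernel_def)
  then show "g = h" using gh e by blast
qed (use assms in \<open>simp add: is_kernel_def\<close>)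

lemma kernelI:
  assumes "is_mono C k" "f \<in> Arr C" "Cod C k = Dom C f" "f \<cdot> k = Zero C (Dom C k) (Cod C f)"
    and "\<And>h. h \<in> Arr C \<Longrightarrow> Cod C h = Dom C f \<Longrightarrow> f \<cdot> h = Zero C (Dom C h) (Cod C f) \<Longrightarrow>
      \<exists>u\<in>Hom C (Dom C h) (Dom C k). k \<cdot> u = h"
  shows "is_kernel C k f"
  unfolding is_kernel_def
proof (intro conjI allI ballI impI)
  fix X h assume "h \<in> Hom C X (Dom C f)" "f \<cdot> h = Zero C X (Cod C f)"
  then obtain u where "u \<in> Hom C X (Dom C k)" "k \<cdot> u = h"
    using assms(5)[of h] by (auto simp: in_Hom)
  then show "\<exists>!u. u \<in> Hom C X (Dom C k) \<and> k \<cdot> u = h"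
    using assms(1) by (auto simp: is_mono_def)
qed (use assms in \<open>auto simp: is_mono_def\<close>)

lemma cokernelD:
  assumes "is_cokernel C c f"
  shows "c \<in> Arr C" "f \<in> Arr C" "Dom C c = Cod C f" "c \<cdot> f = Zero C (Dom C f) (Cod C c)"
  using assms by (auto simp: is_cokernel_def)

lemma cokernel_factor:
  assumes "is_cokernel C c f" "h \<in> Arr C" "Dom C h = Cod C f" "h \<cdot> f = Zero C (Dom C f) (Cod C h)"
  shows "\<exists>u\<in>Hom C (Cod C c) (Cod C h). u \<cdot> c = h"
  using preadditive_category.kernel_factor[OF preadditive_op, of c f h] assms by auto

lemma cokernel_epi: "is_cokernel C c f \<Longrightarrow> is_epi C c"
  using preadditive_category.kernel_mono[OF preadditive_op, of c f] by simp

lemma cokernelI: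
  assumes "is_epi C c" "f \<in> Arr C" "Dom C c = Cod C f" "c \<cdot> f = Zero C (Dom C f) (Cod C c)"
    and "\<And>h. h \<in> Arr C \<Longrightarrow> Dom C h = Cod C f \<Longrightarrow> h \<cdot> f = Zero C (Dom C f) (Cod C h) \<Longrightarrow>
      \<exists>u\<in>Hom C (Cod C c) (Cod C h). u \<cdot> c = h"
  shows "is_cokernel C c f"
  using preadditive_category.kernelI[OF preadditive_op, of c f] assms by auto

lemma mono_comp: "is_mono C f \<Longrightarrow> is_mono C g \<Longrightarrow> Dom C g = Cod C f \<Longrightarrow> is_mono C (g \<cdot> f)"
proof (rule monoI)
  fix h assume a: "is_mono C f" "is_mono C g" "Dom C g = Cod C f" "h \<in> Arr C"
      "Cod C h = Dom C (g \<cdot> f)"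
    "(g \<cdot> f) \<cdot> h = Zero C (Dom C h) (Cod C (g \<cdot> f))"
  note arr = a(1,2)[THEN mono_arr]
  have "f \<cdot> h = Zero C (Dom C (f \<cdot> h)) (Dom C g)"
    using a arr by (intro mono_zeroD[OF a(2)]) auto
  then show "h = Zero C (Dom C h) (Dom C (g \<cdot> f))"
    using a arr mono_zeroD[OF a(1), of h] by simp
qed (auto simp: mono_arr)

lemma mono_comp_right:
  "is_mono C (g \<cdot> f) \<Longrightarrow> f \<in> Arr C \<Longrightarrow> g \<in> Arr C \<Longrightarrow> Dom C g = Cod C f \<Longrightarrow> is_mono C f"
proof (rule monoI)
  fix h assume a: "is_mono C (g \<cdot> f)" "f \<in> Arr C" "g \<in> Arr C" "Dom C g = Cod C f"
    "h \<in> Arr C" "Cod C h = Dom C f" "f \<cdot> h = Zero C (Dom C h) (Cod C f)"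
  then have "h = Zero C (Dom C h) (Dom C (g \<cdot> f))"
    by (intro mono_zeroD[OF a(1)]) auto
  then show "h = Zero C (Dom C h) (Dom C f)" using a by simp
qed

lemma sesD:
  assumes "ses C m p"
  shows "m \<in> Arr C" "p \<in> Arr C" "Dom C p = Cod C m" "p \<cdot> m = Zero C (Dom C m) (Cod C p)"
    "is_mono C m" "is_epi C p" "is_kernel C m p" "is_cokernel C p m"
  using assms unfolding ses_def
  by (auto simp: kernelD cokernelD dest: kernel_mono cokernel_epi)

end

section \<open>Normality, images and pushouts in abelian categories\<close>

context abelian_category
begin

lemma abelian_op: "abelian_category (op C)"
proof -
  interpret preadditive_category "op C" by (rule preadditive_op)
  show ?thesis
  proof
    fix A B assume "A \<in> Obj (op C)" "B \<in> Obj (op C)"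
    then show "\<exists>P i\<^sub>1 i\<^sub>2 p\<^sub>1 p\<^sub>2. is_biproduct (op C) A B P i\<^sub>1 i\<^sub>2 p\<^sub>1 p\<^sub>2"
      using biproducts[of A B] by (simp add: in_Hom) blast
  qed (auto simp: zero_object kernels cokernels mono_normal epi_normal)
qed

text \<open>Normality only provides some \<open>g\<close> with kernel \<open>m\<close>. As
  \<open>g\<close> kills \<open>m\<close>, it factors through \<open>c\<close>, so whatever
  \<open>c\<close> kills is killed by \<open>g\<close> and factors through \<open>m\<close>.\<close>

lemma mono_kernel_of_cokernel:
  assumes "is_mono C m" "is_cokernel C c m"
  shows "is_kernel C m c"
proof -
  obtain g where g: "is_kernel C m g" using mono_normal[OF assms(1)] by blast
  note gD = kernelD[OF g] and cD = cokernelD[OF assms(2)]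
  obtain u where u: "u \<in> Hom C (Cod C c) (Cod C g)" "u \<cdot> c = g"
    using cokernel_factor[OF assms(2), of g] gD cD by auto
  show ?thesis
  proof (rule kernelI)
    fix h assume h: "h \<in> Arr C" "Cod C h = Dom C c" "c \<cdot> h = Zero C (Dom C h) (Cod C c)"
    have "g \<cdot> h = u \<cdot> c \<cdot> h" by (rule comp_reduce[OF u(2), symmetric]) (use u(1) h cD in \<open>simp_all
        add: in_Hom\<close>)
    then have "g \<cdot> h = Zero C (Dom C h) (Cod C g)" using h u cD by (simp add: in_Hom)
    then show "\<exists>u\<in>Hom C (Dom C h) (Dom C m). m \<cdot> u = h"
      using kernel_factor[OF g, of h] h gD cD by auto
  qed (use assms cD in \<open>simp_all add: in_Hom\<close>)
qed

lemma epi_cokernel_of_kernel: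
  "is_epi C p \<Longrightarrow> is_kernel C k p \<Longrightarrow> is_cokernel C p k"
  using abelian_category.mono_kernel_of_cokernel[OF abelian_op, of p k] by (simp add: in_Hom)

lemma sesI_mono: "is_mono C m \<Longrightarrow> is_cokernel C p m \<Longrightarrow> ses C m p"
  by (simp add: ses_def mono_kernel_of_cokernel)

lemma sesI_epi: "is_epi C p \<Longrightarrow> is_kernel C m p \<Longrightarrow> ses C m p"
  by (simp add: ses_def epi_cokernel_of_kernel)

text \<open>\<open>f\<close> is the kernel of some \<open>h\<close>, and
  \<open>h \<cdot> f = 0\<close> with \<open>f\<close> epi forces \<open>h = 0\<close>. Hence the
  identity factors through \<open>f\<close>.\<close>

lemma mono_epi_inverse:
  assumes "is_mono C f" "is_epi C f"
  obtains g where "g \<in> Arr C" "Dom C g = Cod C f" "Cod C g = Dom C f"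
    "g \<cdot> f = Ident C (Dom C f)" "f \<cdot> g = Ident C (Cod C f)"
proof -
  obtain h where h: "is_kernel C f h" using mono_normal[OF assms(1)] by blast
  note hD = kernelD[OF h]
  have "h = Zero C (Cod C f) (Cod C h)"
    using hD by - (rule epi_zeroD[OF assms(2)], auto)
  then have "h \<cdot> Ident C (Cod C f) = Zero C (Cod C f) (Cod C h)" using hD by (simp add: in_Hom)
  then obtain u where u: "u \<in> Hom C (Cod C f) (Dom C f)" "f \<cdot> u = Ident C (Cod C f)"
    using kernel_factor[OF h, of "Ident C (Cod C f)"] hD by auto
  have "u \<cdot> f = Ident C (Dom C f)"
    using u hD by - (rule mono_cancel[OF assms(1)], (simp_all add: in_Hom comp_reduce[OF u(2)]))
  then show thesis using that[of u] u by (simp_all add: in_Hom)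
qed

text \<open>To see that \<open>e\<close> is epi, let \<open>w\<close> kill \<open>e\<close> and let
  \<open>l\<close> be the kernel of \<open>w\<close>. Then \<open>f\<close> factors through the
  monomorphism \<open>k \<cdot> l\<close>, the kernel of some \<open>t\<close>. As \<open>t\<close>
  kills \<open>f\<close>, it factors through \<open>c\<close> and kills \<open>k\<close>. So
  \<open>k\<close> factors through \<open>k \<cdot> l\<close>, which gives \<open>l\<close> a right
  inverse and makes \<open>w\<close> zero.\<close>

lemma image_factorization:
  assumes "is_cokernel C c f" "is_kernel C k c"
  obtains e where "is_epi C e" "Dom C e = Dom C f" "Cod C e = Dom C k" "f = k \<cdot> e"
proof -
  note cD = cokernelD[OF assms(1)] and kD = kernelD[OF assms(2)]
  obtain e where e: "e \<in> Hom C (Dom C f) (Dom C k)" "k \<cdot> e = f"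
    using kernel_factor[OF assms(2), of f] cD by auto
  have "is_epi C e"
  proof (rule epiI)
    fix w assume w: "w \<in> Arr C" "Dom C w = Cod C e" "w \<cdot> e = Zero C (Dom C e) (Cod C w)"
    obtain l where l: "is_kernel C l w" using kernels w by blast
    note lD = kernelD[OF l]
    obtain e' where e': "e' \<in> Hom C (Dom C e) (Dom C l)" "l \<cdot> e' = e"
      using kernel_factor[OF l, of e] w e(1)[unfolded in_Hom] by auto
    have "is_mono C (k \<cdot> l)"
      using kernel_mono[OF assms(2)] kernel_mono[OF l] lD w e
        by (intro mono_comp) (simp_all add: in_Hom)
    then obtain t where t: "is_kernel C (k \<cdot> l) t" using mono_normal by blast
    note tD = kernelD[OF t]
    have kl: "Cod C l = Dom C k" using lD w e by (simp add: in_Hom)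
    have "t \<cdot> f = t \<cdot> ((k \<cdot> l) \<cdot> e')" using e e' kD lD kl by (simp add: in_Hom)
    also have "\<dots> = Zero C (Dom C (k \<cdot> l)) (Cod C t) \<cdot> e'"
      by (rule comp_reduce[OF tD(4)]) (use tD kD lD kl e' in \<open>simp_all add: in_Hom\<close>)
    also have "\<dots> = Zero C (Dom C f) (Cod C t)" using tD e'(1) e(1) kD lD kl by (simp add: in_Hom)
    finally have "t \<cdot> f = Zero C (Dom C f) (Cod C t)" .
    then obtain t' where t': "t' \<in> Hom C (Cod C c) (Cod C t)" "t' \<cdot> c = t"
      using cokernel_factor[OF assms(1), of t] tD kD cD lD kl by auto
    have "t \<cdot> k = t' \<cdot> c \<cdot> k" by (rule comp_reduce[OF t'(2), symmetric]) (use t'(1) kD cD in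
        \<open>simp_all add: in_Hom\<close>)
    then have "t \<cdot> k = Zero C (Dom C k) (Cod C t)" using t' kD by (simp add: in_Hom)
    then obtain y where y: "y \<in> Hom C (Dom C k) (Dom C l)" "(k \<cdot> l) \<cdot> y = k"
      using kernel_factor[OF t, of k] tD kD lD kl by auto
    have "l \<cdot> y = Ident C (Dom C k)"
      using y kD lD kl by - (rule mono_cancel[OF kernel_mono[OF assms(2)]], (simp_all add: in_Hom))
    then have "w = w \<cdot> (l \<cdot> y)" using w e(1) kD by (simp add: in_Hom)
    also have "\<dots> = Zero C (Dom C l) (Cod C w) \<cdot> y"
      by (rule comp_reduce[OF lD(4)]) (use y(1) lD w kl e(1) in \<open>simp_all add: in_Hom\<close>)
    also have "\<dots> = Zero C (Cod C e) (Cod C w)"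
      using y(1) lD w kl e(1) by (simp add: in_Hom)
    finally show "w = Zero C (Cod C e) (Cod C w)" .
  qed (use e in \<open>simp_all add: in_Hom\<close>)
  then show thesis using that[of e] e(1)[unfolded in_Hom] e(2)[symmetric] by blast
qed

lemma pushoutD:
  assumes "is_pushout C v i' i b"
  shows "v \<in> Arr C" "i' \<in> Arr C" "i \<in> Arr C" "b \<in> Arr C" "Cod C i' = Cod C v"
    "Dom C v = Cod C i" "Dom C i' = Cod C b" "Dom C i = Dom C b" "v \<cdot> i = i' \<cdot> b"
  using assms by (auto simp: is_pushout_def)

lemma pushout_factor:
  assumes "is_pushout C v i' i b" "x \<in> Arr C" "y \<in> Arr C" "Dom C x = Cod C i" "Dom C y = Cod C b"
    "Cod C x = Cod C y" "x \<cdot> i = y \<cdot> b"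
  shows "\<exists>z\<in>Hom C (Cod C v) (Cod C y). z \<cdot> v = x \<and> z \<cdot> i' = y"
proof -
  have "x \<in> Hom C (Cod C i) (Cod C y)" "y \<in> Hom C (Cod C b) (Cod C y)" using assms
    by (simp_all add: in_Hom)
  then show ?thesis using assms(1,7) unfolding is_pushout_def by blast
qed

lemma pushout_unique:
  assumes "is_pushout C v i' i b" "z \<in> Arr C" "z' \<in> Arr C" "Dom C z = Cod C v" "Dom C z' = Cod C v"
    "Cod C z = Cod C z'" "z \<cdot> v = z' \<cdot> v" "z \<cdot> i' = z' \<cdot> i'"
  shows "z = z'"
proof -
  note D = pushoutD[OF assms(1)]
  have "z' \<cdot> v \<in> Hom C (Cod C i) (Cod C z')" "z' \<cdot> i' \<in> Hom C (Cod C b) (Cod C z')"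
    and "(z' \<cdot> v) \<cdot> i = (z' \<cdot> i') \<cdot> b"
    using assms D by (simp_all add: in_Hom)
  then have "\<exists>!y. y \<in> Hom C (Cod C v) (Cod C z') \<and> y \<cdot> v = z' \<cdot> v \<and> y \<cdot> i' = z' \<cdot> i'"
    using assms(1) unfolding is_pushout_def by blast
  moreover have "z \<in> Hom C (Cod C v) (Cod C z')" "z' \<in> Hom C (Cod C v) (Cod C z')"
    using assms by (simp_all add: in_Hom)
  ultimately show ?thesis using assms(7,8) by blast
qed

lemma pullbackD:
  assumes "is_pullback C u p' p a"
  shows "u \<in> Arr C" "p' \<in> Arr C" "p \<in> Arr C" "a \<in> Arr C" "Dom C p' = Dom C u"
    "Cod C u = Dom C p" "Cod C p' = Dom C a" "Cod C p = Cod C a" "p \<cdot> u = a \<cdot> p'"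
  using assms by (auto simp: is_pullback_def)

lemma pullback_factor:
  assumes "is_pullback C u p' p a" "x \<in> Arr C" "y \<in> Arr C" "Cod C x = Dom C p" "Cod C y = Dom C a"
    "Dom C x = Dom C y" "p \<cdot> x = a \<cdot> y"
  shows "\<exists>z\<in>Hom C (Dom C y) (Dom C u). u \<cdot> z = x \<and> p' \<cdot> z = y"
  using abelian_category.pushout_factor[OF abelian_op, of u p' p a x y] assms by simp

text \<open>The pushout is the cokernel of \<open>(i, -b)\<close> into the biproduct. This arrow is
  mono because \<open>i\<close> is, hence it is the kernel of its cokernel: an arrow into the second
  summand that dies in the pushout comes from some \<open>y\<close> with
  \<open>i \<cdot> y = 0\<close>, and is therefore zero.\<close>

lemma pushout_exists:
  assumes "is_mono C i" "b \<in> Arr C" "Dom C b = Dom C i"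
  shows "\<exists>v i'. is_pushout C v i' i b \<and> is_mono C i'"
proof -
  note iA = mono_arr[OF assms(1)]
  obtain P i\<^sub>1 i\<^sub>2 p\<^sub>1 p\<^sub>2 where P: "is_biproduct C (Cod C i) (Cod C b) P i\<^sub>1 i\<^sub>2 p\<^sub>1 p\<^sub>2"
    using biproducts[of "Cod C i" "Cod C b"] iA assms by auto
  have T: "i\<^sub>1 \<in> Arr C" "Dom C i\<^sub>1 = Cod C i" "Cod C i\<^sub>1 = P" "i\<^sub>2 \<in> Arr C" "Dom C i\<^sub>2 = Cod C b"
      "Cod C i\<^sub>2 = P"
    "p\<^sub>1 \<in> Arr C" "Dom C p\<^sub>1 = P" "Cod C p\<^sub>1 = Cod C i" "p\<^sub>2 \<in> Arr C" "Dom C p\<^sub>2 = P"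
        "Cod C p\<^sub>2 = Cod C b"
    using P by (simp_all add: is_biproduct_def in_Hom)
  have E: "p\<^sub>1 \<cdot> i\<^sub>1 = Ident C (Cod C i)" "p\<^sub>2 \<cdot> i\<^sub>2 = Ident C (Cod C b)"
     "p\<^sub>1 \<cdot> i\<^sub>2 = Zero C (Cod C b) (Cod C i)" "p\<^sub>2 \<cdot> i\<^sub>1 = Zero C (Cod C i) (Cod C b)"
     and E2: "(i\<^sub>1 \<cdot> p\<^sub>1) \<^bold>+ (i\<^sub>2 \<cdot> p\<^sub>2) = Ident C P"
    using P by (simp_all add: is_biproduct_def)
  have PO: "P \<in> Obj C" using obj(2)[OF T(1)] T(3) by simp
  note R = E[THEN comp_reduce]
  define \<delta> where "\<delta> = (i\<^sub>1 \<cdot> i) \<^bold>- (i\<^sub>2 \<cdot> b)"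
  have d: "\<delta> \<in> Arr C" "Dom C \<delta> = Dom C i" "Cod C \<delta> = P" and p1d: "p\<^sub>1 \<cdot> \<delta> = i"
    using T assms iA by (simp_all add: \<delta>_def comp_sub R)
  have dmono: "is_mono C \<delta>" by (rule mono_comp_right[of p\<^sub>1]) (use p1d assms T d in simp_all)
  obtain c where c: "is_cokernel C c \<delta>" using cokernels d by blast
  note cD = cokernelD[OF c] and cE = cokernel_epi[OF c] and dk = mono_kernel_of_cokernel[OF dmono c]
  have "(c \<cdot> i\<^sub>1 \<cdot> i) \<^bold>- (c \<cdot> i\<^sub>2 \<cdot> b) = Zero C (Dom C i) (Cod C c)"
    using cD(4) d T iA assms cD(1,3) by (simp add: \<delta>_def comp_sub)
  then have sq: "(c \<cdot> i\<^sub>1) \<cdot> i = (c \<cdot> i\<^sub>2) \<cdot> b"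
    using sub_eq_zero[of "c \<cdot> i\<^sub>1 \<cdot> i" "c \<cdot> i\<^sub>2 \<cdot> b"] T iA assms cD(1,3) d by simp
  have po: "is_pushout C (c \<cdot> i\<^sub>1) (c \<cdot> i\<^sub>2) i b"
    unfolding is_pushout_def
  proof (intro conjI allI ballI impI sq)
    fix X x y assume x: "x \<in> Hom C (Cod C i) X" and y: "y \<in> Hom C (Cod C b) X" and xy: "x \<cdot> i
        = y \<cdot> b"
    note xA = x[unfolded in_Hom] and yA = y[unfolded in_Hom]
    define w where "w = (x \<cdot> p\<^sub>1) \<^bold>+ (y \<cdot> p\<^sub>2)"
    have w: "w \<in> Arr C" "Dom C w = P" "Cod C w = X" using xA yA T by (auto simp: w_def)
    have w1: "w \<cdot> i\<^sub>1 = x" and w2: "w \<cdot> i\<^sub>2 = y"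
      using xA yA T E iA assms by (auto simp: w_def add_comp)
    have "w \<cdot> \<delta> = Zero C (Dom C \<delta>) (Cod C w)"
      using w T iA assms xA yA xy by (simp add: \<delta>_def comp_sub comp_reduce[OF w1] comp_reduce[OF
          w2])
    then obtain z where z: "z \<in> Hom C (Cod C c) X" "z \<cdot> c = w"
      using cokernel_factor[OF c, of w] w d by auto
    note zA = z(1)[unfolded in_Hom]
    show "\<exists>!z. z \<in> Hom C (Cod C (c \<cdot> i\<^sub>1)) X \<and> z \<cdot> c \<cdot> i\<^sub>1 = x \<and> z \<cdot> c \<cdot> i\<^sub>2 = y"
    proof (rule ex1I[of _ z])
      show "z \<in> Hom C (Cod C (c \<cdot> i\<^sub>1)) X \<and> z \<cdot> c \<cdot> i\<^sub>1 = x \<and> z \<cdot> c \<cdot> i\<^sub>2 = y"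
        using z(1) zA cD T d by (simp add: comp_reduce[OF z(2)] w1 w2)
    next
      fix z' assume z': "z' \<in> Hom C (Cod C (c \<cdot> i\<^sub>1)) X \<and> z' \<cdot> c \<cdot> i\<^sub>1 = x \<and> z' \<cdot> c \<cdot> i\<^sub>2 = y"
      then have z'A: "z' \<in> Arr C" "Dom C z' = Cod C c" "Cod C z' = X" and
        e: "z' \<cdot> c \<cdot> i\<^sub>1 = x" "z' \<cdot> c \<cdot> i\<^sub>2 = y"
        using cD T d by (simp_all add: in_Hom)
      have "z' \<cdot> c = (z' \<cdot> c) \<cdot> ((i\<^sub>1 \<cdot> p\<^sub>1) \<^bold>+ (i\<^sub>2 \<cdot> p\<^sub>2))"
        unfolding E2 using z'A cD d by simp
      also have "\<dots> = ((z' \<cdot> c \<cdot> i\<^sub>1) \<cdot> p\<^sub>1) \<^bold>+ ((z' \<cdot> c \<cdot> i\<^sub>2) \<cdot> p\<^sub>2)"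
        using z'A cD d T by (simp add: comp_add)
      also have "\<dots> = z \<cdot> c" by (simp only: e z(2) w_def)
      finally show "z' = z" using z'A zA cD
        by - (rule epi_cancel[OF cE], simp_all)
    qed
  qed (use iA assms cD T d in simp_all)
  have "is_mono C (c \<cdot> i\<^sub>2)"
  proof (rule monoI)
    fix g assume g: "g \<in> Arr C" "Cod C g = Dom C (c \<cdot> i\<^sub>2)"
      "(c \<cdot> i\<^sub>2) \<cdot> g = Zero C (Dom C g) (Cod C (c \<cdot> i\<^sub>2))"
    then have g2: "Cod C g = Cod C b" "c \<cdot> i\<^sub>2 \<cdot> g = Zero C (Dom C g) (Cod C c)"
      using cD T d by simp_all
    obtain y where y: "y \<in> Hom C (Dom C g) (Dom C \<delta>)" "\<delta> \<cdot> y = i\<^sub>2 \<cdot> g"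
      using kernel_factor[OF dk, of "i\<^sub>2 \<cdot> g"] g g2 T d cD by auto
    note yA = y(1)[unfolded in_Hom]
    have "i \<cdot> y = p\<^sub>1 \<cdot> \<delta> \<cdot> y"
      by (rule comp_reduce[OF p1d, symmetric]) (use yA d T in simp_all)
    also have "\<dots> = Zero C (Dom C y) (Cod C i)" using iA y(2) g(1) g2 T assms yA by (simp add: R)
    finally have "y = Zero C (Dom C y) (Dom C i)"
      using yA d iA by - (rule mono_zeroD[OF assms(1)], simp_all)
    then have "i\<^sub>2 \<cdot> g = Zero C (Dom C g) P" using y(2) d yA iA by (metis comp_zero obj(1) g(1))
    then have "p\<^sub>2 \<cdot> i\<^sub>2 \<cdot> g = Zero C (Dom C g) (Cod C b)" using T g PO by simp
    then show "g = Zero C (Dom C g) (Dom C (c \<cdot> i\<^sub>2))" using T g g2 cD d assms by (simp add: R)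
  qed (use cD d T in simp)
  with po show ?thesis by blast
qed

text \<open>The new epimorphism is induced by \<open>p\<close> and the zero arrow. If
  \<open>h\<close> kills \<open>i'\<close>, then \<open>h \<cdot> v\<close> kills \<open>i\<close>
  and so factors through the old cokernel \<open>p\<close>.\<close>

lemma pushout_ses:
  assumes "is_pushout C v i' i b" "is_mono C i'" "ses C i p"
  shows "\<exists>p'. ses C i' p' \<and> p' \<cdot> v = p \<and> Cod C p' = Cod C p"
proof -
  note D = pushoutD[OF assms(1)] and S = sesD[OF assms(3)]
  obtain q where q: "q \<in> Hom C (Cod C v) (Cod C p)" "q \<cdot> v = p"
      "q \<cdot> i' = Zero C (Cod C b) (Cod C p)"
    using pushout_factor[OF assms(1), of p "Zero C (Cod C b) (Cod C p)"] D S by auto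
  note qA = q(1)[unfolded in_Hom]
  have "is_epi C q"
    using preadditive_category.mono_comp_right[OF preadditive_op, of v q] S(6) q(2) qA D by simp
  then have "is_cokernel C q i'"
  proof (rule cokernelI)
    fix h assume h: "h \<in> Arr C" "Dom C h = Cod C i'" "h \<cdot> i' = Zero C (Dom C i') (Cod C h)"
    have "(h \<cdot> v) \<cdot> i = h \<cdot> (i' \<cdot> b)" using h D by simp
    also have "\<dots> = Zero C (Dom C i') (Cod C h) \<cdot> b"
      by (rule comp_reduce[OF h(3)]) (use h D in simp_all)
    finally have "(h \<cdot> v) \<cdot> i = Zero C (Dom C i) (Cod C h)" using h D by simp
    then obtain u where u: "u \<in> Hom C (Cod C p) (Cod C h)" "u \<cdot> p = h \<cdot> v"
      using cokernel_factor[OF S(8), of "h \<cdot> v"] h D S by auto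
    note uA = u(1)[unfolded in_Hom]
    have "u \<cdot> q = h"
      by (rule pushout_unique[OF assms(1)]) (use u(2) q(2,3) uA qA h D in simp_all)
    then show "\<exists>u\<in>Hom C (Cod C q) (Cod C h). u \<cdot> q = h" using u(1) qA by auto
  qed (use q(3) qA D in simp_all)
  then show ?thesis using sesI_mono[OF assms(2)] q(2) qA by blast
qed

text \<open>As \<open>b\<close> is the cokernel of \<open>k\<close>, an arrow on
  \<open>Cod i\<close> that kills \<open>i \<cdot> k\<close> restricts along \<open>i\<close> to an
  arrow factoring through \<open>b\<close>, and so it descends to the pushout.\<close>

lemma pushout_epi_ses:
  assumes "is_pushout C v i' i b" "is_mono C i" "ses C k b"
  shows "ses C (i \<cdot> k) v"
proof (rule sesI_mono)
  note D = pushoutD[OF assms(1)] and S = sesD[OF assms(3)]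
  show "is_mono C (i \<cdot> k)" using assms(2) S D by (intro mono_comp) simp_all
  have "is_epi C v"
  proof (rule epiI)
    fix h assume h: "h \<in> Arr C" "Dom C h = Cod C v" "h \<cdot> v = Zero C (Dom C v) (Cod C h)"
    have "(h \<cdot> i') \<cdot> b = h \<cdot> (v \<cdot> i)" using h(1,2) D by simp
    also have "\<dots> = Zero C (Dom C v) (Cod C h) \<cdot> i"
      by (rule comp_reduce[OF h(3)]) (use h D in simp_all)
    finally have "h \<cdot> i' = Zero C (Cod C b) (Cod C (h \<cdot> i'))"
      using h(1,2) D S by - (rule epi_zeroD[OF S(6)], simp_all)
    then show "h = Zero C (Cod C v) (Cod C h)"
      using h D by - (rule pushout_unique[OF assms(1)], simp_all)
  qed (rule D)
  then show "is_cokernel C v (i \<cdot> k)"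
  proof (rule cokernelI)
    have "v \<cdot> i \<cdot> k = i' \<cdot> (b \<cdot> k)" using D S by (simp add: comp_reduce[OF D(9)])
    then show "v \<cdot> i \<cdot> k = Zero C (Dom C (i \<cdot> k)) (Cod C v)" using D S by simp
    fix h assume h: "h \<in> Arr C" "Dom C h = Cod C (i \<cdot> k)"
        "h \<cdot> i \<cdot> k = Zero C (Dom C (i \<cdot> k)) (Cod C h)"
    then obtain w where w: "w \<in> Hom C (Cod C b) (Cod C h)" "w \<cdot> b = h \<cdot> i"
      using cokernel_factor[OF S(8), of "h \<cdot> i"] D S by auto
    note wA = w(1)[unfolded in_Hom]
    show "\<exists>u\<in>Hom C (Cod C v) (Cod C h). u \<cdot> v = h"
      using pushout_factor[OF assms(1), of h w] w(2) wA h(1,2) D S by auto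
  qed (use D S in simp_all)
qed

end

section \<open>Morphisms of short exact sequences\<close>

text \<open>Only the outer arrows are recorded. The middle one is not unique, and in the comparison
  of long sequences only the arrows between syzygies matter.\<close>

definition ses_mor ::
  "('o, 'm) addcat \<Rightarrow> 'm \<times> 'm \<Rightarrow> 'm \<times> 'm \<Rightarrow> 'm \<Rightarrow> 'm \<Rightarrow> bool" where
  "ses_mor C e e' b a \<longleftrightarrow> ses C (fst e) (snd e) \<and> ses C (fst e') (snd e') \<and>
     b \<in> Hom C (Dom C (fst e)) (Dom C (fst e')) \<and> a \<in> Hom C (Cod C (snd e)) (Cod C (snd e')) \<and>
     (\<exists>h\<in>Hom C (Cod C (fst e)) (Cod C (fst e')).
        h \<cdot>\<^bsub>C\<^esub> fst e = fst e' \<cdot>\<^bsub>C\<^esub> b \<and> snd e' \<cdot>\<^bsub>C\<^esub> h = a \<cdot>\<^bsub>C\<^esub> snd e)"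

text \<open>The form of \<open>Ext_vanishes C 1 X Y\<close> that lifting arguments use, free of
  equivalence classes. The translation is \<open>Ext_vanishes_1_imp_Ext1_zero\<close> together with
  \<open>Ext1_zero_imp_Ext_vanishes_1\<close>.\<close>

definition Ext1_zero :: "('o, 'm) addcat \<Rightarrow> 'o \<Rightarrow> 'o \<Rightarrow> bool" where
  "Ext1_zero C X Y \<longleftrightarrow> X \<in> Obj C \<and> Y \<in> Obj C \<and>
     (\<forall>m p. ses C m p \<longrightarrow> Dom C m = Y \<longrightarrow> Cod C p = X \<longrightarrow>
       (\<exists>s\<in>Hom C X (Cod C m). p \<cdot>\<^bsub>C\<^esub> s = Ident C X))"

text \<open>
  \<open>Ext\<^sup>2(X, Y) = 0\<close> in the form in which it is used: if the Yoneda product of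
  \<open>Y \<rightarrow> M \<rightarrow> K\<close> and \<open>K \<rightarrow> M' \<rightarrow> X\<close> vanishes, the first sequence is a base change along \<open>K \<rightarrow> M'\<close>.
\<close>

definition Ext2_zero :: "('o, 'm) addcat \<Rightarrow> 'o \<Rightarrow> 'o \<Rightarrow> bool" where
  "Ext2_zero C X Y \<longleftrightarrow> (\<forall>m p m' p'. ses C m p \<longrightarrow> ses C m' p' \<longrightarrow> Cod C p = Dom C m' \<longrightarrow>
     Dom C m = Y \<longrightarrow> Cod C p' = X \<longrightarrow> (\<exists>e. ses_mor C (m, p) e (Ident C Y) m'))"

section \<open>Calculus of morphisms of short exact sequences\<close>

context preadditive_category
begin

text \<open>Dualizing exchanges \<open>Cod m\<close> and \<open>Dom p\<close> as the name of the
  middle object. The two agree only for genuine short exact sequences, hence the case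
  distinction.\<close>

lemma ses_mor_op: "ses_mor (op C) (prod.swap e') (prod.swap e) a b = ses_mor C e e' b a"
proof (cases "ses C (fst e) (snd e) \<and> ses C (fst e') (snd e')")
  case True
  then have "Dom C (snd e) = Cod C (fst e)" "Dom C (snd e') = Cod C (fst e')"
    by (auto dest: sesD(3))
  with True show ?thesis unfolding ses_mor_def by simp blast
qed (auto simp: ses_mor_def)

lemma ses_morI:
  assumes "ses C m p" "ses C m' p'" "b \<in> Hom C (Dom C m) (Dom C m')"
      "a \<in> Hom C (Cod C p) (Cod C p')"
    "h \<in> Hom C (Cod C m) (Cod C m')" "h \<cdot> m = m' \<cdot> b" "p' \<cdot> h = a \<cdot> p"
  shows "ses_mor C (m, p) (m', p') b a"
  using assms by (auto simp: ses_mor_def)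

lemma ses_morE:
  assumes "ses_mor C (m, p) (m', p') b a"
  obtains h where "ses C m p" "ses C m' p'" "b \<in> Hom C (Dom C m) (Dom C m')"
      "a \<in> Hom C (Cod C p) (Cod C p')"
    "h \<in> Hom C (Cod C m) (Cod C m')" "h \<cdot> m = m' \<cdot> b" "p' \<cdot> h = a \<cdot> p"
  using assms by (auto simp: ses_mor_def)

lemma ses_mor_id:
  assumes "ses C m p"
  shows "ses_mor C (m, p) (m, p) (Ident C (Dom C m)) (Ident C (Cod C p))"
  by (rule ses_morI[where h = "Ident C (Cod C m)"]) (use assms sesD[OF assms] in \<open>simp_all add:
      in_Hom\<close>)

lemma ses_mor_comp:
  assumes "ses_mor C e e' b a" "ses_mor C e' e'' b' a'"
  shows "ses_mor C e e'' (b' \<cdot> b) (a' \<cdot> a)"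
proof -
  obtain m p m' p' m'' p'' where e: "e = (m, p)" "e' = (m', p')" "e'' = (m'', p'')"
    by (metis surj_pair)
  obtain h where h: "ses C m p" "ses C m' p'" "b \<in> Hom C (Dom C m) (Dom C m')"
      "a \<in> Hom C (Cod C p) (Cod C p')"
    "h \<in> Hom C (Cod C m) (Cod C m')" "h \<cdot> m = m' \<cdot> b" "p' \<cdot> h = a \<cdot> p"
    using assms(1)[unfolded e] by (rule ses_morE)
  obtain k where k: "ses C m' p'" "ses C m'' p''" "b' \<in> Hom C (Dom C m') (Dom C m'')"
      "a' \<in> Hom C (Cod C p') (Cod C p'')"
    "k \<in> Hom C (Cod C m') (Cod C m'')" "k \<cdot> m' = m'' \<cdot> b'" "p'' \<cdot> k = a' \<cdot> p'"
    using assms(2)[unfolded e] by (rule ses_morE)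
  note S = sesD[OF h(1)] sesD[OF h(2)] sesD[OF k(2)]
  note H = h(3,4,5)[unfolded in_Hom] k(3,4,5)[unfolded in_Hom]
  show ?thesis unfolding e
    by (rule ses_morI[where h = "k \<cdot> h"])
      (use h(1,6,7) k(2,6,7) S H in \<open>simp_all add: in_Hom comp_reduce[OF k(6)] comp_reduce[OF
          k(7)]\<close>)
qed

lemma ses_mor_sub:
  assumes "ses_mor C e e' b a" "ses_mor C e e' b' a'"
  shows "ses_mor C e e' (b \<^bold>- b') (a \<^bold>- a')"
proof -
  obtain m p m' p' where e: "e = (m, p)" "e' = (m', p')" by (metis surj_pair)
  obtain h where h: "ses C m p" "ses C m' p'" "b \<in> Hom C (Dom C m) (Dom C m')"
      "a \<in> Hom C (Cod C p) (Cod C p')"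
    "h \<in> Hom C (Cod C m) (Cod C m')" "h \<cdot> m = m' \<cdot> b" "p' \<cdot> h = a \<cdot> p"
    using assms(1)[unfolded e] by (rule ses_morE)
  obtain k where k: "b' \<in> Hom C (Dom C m) (Dom C m')" "a' \<in> Hom C (Cod C p) (Cod C p')"
    "k \<in> Hom C (Cod C m) (Cod C m')" "k \<cdot> m = m' \<cdot> b'" "p' \<cdot> k = a' \<cdot> p"
    using assms(2)[unfolded e] by (rule ses_morE)
  note S = sesD[OF h(1)] sesD[OF h(2)]
  note H = h(3,4,5)[unfolded in_Hom] k(1,2,3)[unfolded in_Hom]
  show ?thesis unfolding e
    by (rule ses_morI[where h = "h \<^bold>- k"])
      (use h(1,2,6,7) k(4,5) S H in \<open>simp_all add: in_Hom comp_sub sub_comp\<close>)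
qed

text \<open>One half of the short five lemma; the half about epimorphisms is this statement in
  \<open>op C\<close>. If \<open>h\<close> kills \<open>g\<close>, then \<open>g\<close> comes from
  \<open>Dom m\<close> because \<open>a\<close> is mono, and there \<open>m' \<cdot> b\<close> is
  mono.\<close>

lemma ses_mor_mid_mono:
  assumes "ses C m p" "ses C m' p'" "b \<in> Hom C (Dom C m) (Dom C m')"
      "a \<in> Hom C (Cod C p) (Cod C p')"
    "h \<in> Hom C (Cod C m) (Cod C m')" "h \<cdot> m = m' \<cdot> b" "p' \<cdot> h = a \<cdot> p" "is_mono C b" "is_mono C a"
  shows "is_mono C h"
proof (rule monoI)
  note S = sesD[OF assms(1)] and S' = sesD[OF assms(2)] and H = assms(3-5)[unfolded in_Hom]
  fix g assume g: "g \<in> Arr C" "Cod C g = Dom C h" "h \<cdot> g = Zero C (Dom C g) (Cod C h)"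
  have "a \<cdot> (p \<cdot> g) = p' \<cdot> (h \<cdot> g)"
    using S S' H g(1,2) by (simp add: comp_reduce[OF assms(7)])
  also have "\<dots> = Zero C (Dom C (p \<cdot> g)) (Cod C a)" using S S' H g by simp
  finally have "p \<cdot> g = Zero C (Dom C (p \<cdot> g)) (Dom C a)"
    using S S' H g by - (rule mono_zeroD[OF assms(9)], simp_all)
  then obtain y where y: "y \<in> Hom C (Dom C g) (Dom C m)" "m \<cdot> y = g"
    using kernel_factor[OF S(7), of g] S H g by auto
  note yA = y(1)[unfolded in_Hom]
  have "(m' \<cdot> b) \<cdot> y = h \<cdot> (m \<cdot> y)"
    by (rule comp_reduce[OF assms(6), symmetric]) (use yA S H in simp_all)
  then have "(m' \<cdot> b) \<cdot> y = Zero C (Dom C y) (Cod C (m' \<cdot> b))"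
    using y(2) yA g S S' H by simp
  then have "y = Zero C (Dom C y) (Dom C (m' \<cdot> b))"
    using yA S S' H mono_comp[OF assms(8) S'(5)] by - (rule mono_zeroD, simp_all)
  then have "y = Zero C (Dom C g) (Dom C m)" using yA S S' H by simp
  then have "g = m \<cdot> Zero C (Dom C g) (Dom C m)" using y(2) by simp
  then show "g = Zero C (Dom C g) (Dom C h)" using S H g(1) by simp
qed (use assms(5) in \<open>simp add: in_Hom\<close>)

lemma ident_mono: "X \<in> Obj C \<Longrightarrow> is_mono C (Ident C X)"
  by (auto simp: is_mono_def in_Hom)

lemma pushout_ses_mor:
  assumes "is_pushout C v m' m b" "p' \<cdot> v = p" "Cod C p' = Cod C p" "ses C m p" "ses C m' p'"
  shows "ses_mor C (m, p) (m', p') b (Ident C (Cod C p))"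
  using assms(3-5) sesD[OF assms(4)] sesD[OF assms(5)] assms(1)[unfolded is_pushout_def] assms(2)
  by (intro ses_morI[where h = v]) (simp_all add: in_Hom)

end

context abelian_category
begin

text \<open>The middle arrow is induced on the pushout by \<open>h\<close> and
  \<open>m'' \<cdot> c\<close>, and the right-hand square is checked on both legs. Cobase change
  along \<open>b\<close> is thus universal among morphisms whose left component factors through
  \<open>b\<close>.\<close>

lemma pushout_ses_mor_univ:
  assumes "is_pushout C v m' m b" "p' \<cdot> v = p" "Cod C p' = Cod C p" "ses C m p" "ses C m' p'"
    and "ses_mor C (m, p) (m'', p'') (c \<cdot> b) a" "c \<in> Hom C (Cod C b) (Dom C m'')"
  shows "ses_mor C (m', p') (m'', p'') c a"
proof -
  note D = pushoutD[OF assms(1)] and S = sesD[OF assms(4)] and S' = sesD[OF assms(5)]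
  obtain h where h: "ses C m'' p''" "a \<in> Hom C (Cod C p) (Cod C p'')"
    "h \<in> Hom C (Cod C m) (Cod C m'')" "h \<cdot> m = m'' \<cdot> c \<cdot> b" "p'' \<cdot> h = a \<cdot> p"
    using assms(6) by (rule ses_morE)
  note S'' = sesD[OF h(1)] and H = h(2,3)[unfolded in_Hom] assms(7)[unfolded in_Hom]
  have e: "h \<cdot> m = (m'' \<cdot> c) \<cdot> b" using h(4) H S'' D by simp
  obtain z where z: "z \<in> Hom C (Cod C v) (Cod C m'')" "z \<cdot> v = h" "z \<cdot> m' = m'' \<cdot> c"
    using pushout_factor[OF assms(1), of h "m'' \<cdot> c"] e D S'' H by auto
  note zA = z(1)[unfolded in_Hom]
  have "p'' \<cdot> z = a \<cdot> p'"
  proof (rule pushout_unique[OF assms(1)])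
    show "(p'' \<cdot> z) \<cdot> v = (a \<cdot> p') \<cdot> v"
      using S S' S'' D zA H assms(2,3) z(2) h(5) by simp
    show "(p'' \<cdot> z) \<cdot> m' = (a \<cdot> p') \<cdot> m'"
      using S S' S'' D zA H assms(3) z(3) by (simp add: comp_reduce[OF S''(4)])
  qed (use S S' S'' D zA H assms(3) in simp_all)
  then show ?thesis
    by (intro ses_morI[where h = z]) (use assms(3,5) h(1) z zA H D S S' in \<open>simp_all add: in_Hom\<close>)
qed

lemma ses_pushout:
  assumes "ses C m p" "b \<in> Arr C" "Dom C b = Dom C m"
  shows "\<exists>v m' p'. is_pushout C v m' m b \<and> p' \<cdot> v = p \<and> Cod C p' = Cod C p \<and> ses C m' p'"
  using pushout_exists[of m b] pushout_ses sesD[OF assms(1)] assms by blast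

lemma pullback_ses_mor_univ:
  assumes "is_pullback C v p' p a" "v \<cdot> m' = m" "Dom C m' = Dom C m" "ses C m p" "ses C m' p'"
    and "ses_mor C (m'', p'') (m, p) b (a \<cdot> c)" "c \<in> Hom C (Cod C p'') (Dom C a)"
  shows "ses_mor C (m'', p'') (m', p') b c"
  using abelian_category.pushout_ses_mor_univ[OF abelian_op, of v p' p a m' m p'' m'' c b] assms
    ses_mor_op[of "(m', p')" "(m'', p'')"] ses_mor_op[of "(m, p)" "(m'', p'')"] by simp

lemma ses_pullback:
  assumes "ses C m p" "a \<in> Arr C" "Cod C a = Cod C p"
  shows "\<exists>v m' p'. is_pullback C v p' p a \<and> v \<cdot> m' = m \<and> Dom C m' = Dom C m \<and> ses C m' p'"
  using abelian_category.ses_pushout[OF abelian_op, of p m a] assms by simp blast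

text \<open>By the short five lemma, the comparison map into the actual pullback is invertible.\<close>

lemma ses_mor_is_pullback:
  assumes "ses C m p" "ses C m' p'" "Dom C m = Dom C m'" "a \<in> Hom C (Cod C p) (Cod C p')"
    "h \<in> Hom C (Cod C m) (Cod C m')" "h \<cdot> m = m'" "p' \<cdot> h = a \<cdot> p"
  shows "is_pullback C h p p' a"
proof -
  note S = sesD[OF assms(1)] and S' = sesD[OF assms(2)] and H = assms(4,5)[unfolded in_Hom]
  obtain v m'' p'' where P: "is_pullback C v p'' p' a" "v \<cdot> m'' = m'" "Dom C m'' = Dom C m'"
      "ses C m'' p''"
    using ses_pullback[OF assms(2), of a] H by auto
  note PD = pullbackD(1-7,9)[OF P(1)] and S'' = sesD[OF P(4)]
  obtain k where k: "k \<in> Hom C (Cod C m) (Dom C v)" "v \<cdot> k = h" "p'' \<cdot> k = p"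
    using pullback_factor[OF P(1), of h p] S S' H PD assms(7) by auto
  note kA = k(1)[unfolded in_Hom]
  have vm: "v \<in> Arr C" "Dom C v = Cod C m''" "Cod C v = Cod C m'"
    using PD S' S'' by simp_all
  \<comment> \<open>Tested on the two legs of the pullback. It makes \<open>k\<close> a morphism of
    sequences with identities at both ends, to which the five lemma applies.\<close>
  have km: "k \<cdot> m = m''"
  proof -
    have "v \<cdot> (k \<cdot> m) = v \<cdot> m''" "p'' \<cdot> (k \<cdot> m) = p'' \<cdot> m''"
      using k(2,3) kA PD S S'' H assms(3,6) P(2,3)
        by (simp_all add: comp_reduce[OF k(2)] comp_reduce[OF k(3)])
    then show ?thesis
      using abelian_category.pushout_unique[OF abelian_op, of v p'' p' a "k \<cdot> m" m''] P(1,3) kA S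
          S'' PD assms(3) vm by simp
  qed
  have I: "Ident C (Dom C m') \<in> Hom C (Dom C m) (Dom C m'')"
      "Ident C (Cod C p) \<in> Hom C (Cod C p) (Cod C p'')"
    using S S' P(3) assms(3) PD H by (simp_all add: in_Hom)
  have kk: "k \<in> Hom C (Cod C m) (Cod C m'')" using kA vm by (simp add: in_Hom)
  have e: "k \<cdot> m = m'' \<cdot> Ident C (Dom C m')" "p'' \<cdot> k = Ident C (Cod C p) \<cdot> p"
    using km k(3) S S'' P(3) by simp_all
  have "is_mono C k"
    using S S' by (intro ses_mor_mid_mono[OF assms(1) P(4) I kk e] ident_mono) simp_all
  moreover have "is_epi C k"
  proof -
    have "is_mono (op C) k"
      by (rule preadditive_category.ses_mor_mid_mono[OF preadditive_op, of p'' m'' p m "Ident C (Cod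
          C p)" "Ident C (Dom C m')"])
        (use assms(1) P(4) I kk e S S' S'' P(3) in \<open>simp_all add: preadditive_category.ident_mono[OF
            preadditive_op, simplified]\<close>)
    then show ?thesis by simp
  qed
  ultimately obtain l where l: "l \<in> Arr C" "Dom C l = Cod C k" "Cod C l = Dom C k"
    "l \<cdot> k = Ident C (Dom C k)" "k \<cdot> l = Ident C (Cod C k)"
    by (rule mono_epi_inverse)
  show ?thesis unfolding is_pullback_def
  proof (intro conjI allI ballI impI)
    fix X x y assume x: "x \<in> Hom C X (Dom C p')" and y: "y \<in> Hom C X (Dom C a)" and xy: "p' \<cdot> x
        = a \<cdot> y"
    note xA = x[unfolded in_Hom] and yA = y[unfolded in_Hom]
    obtain z where z: "z \<in> Hom C X (Dom C v)" "v \<cdot> z = x" "p'' \<cdot> z = y"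
      using pullback_factor[OF P(1), of x y] xA yA xy H PD by auto
    note zA = z(1)[unfolded in_Hom]
    show "\<exists>!z. z \<in> Hom C X (Dom C h) \<and> h \<cdot> z = x \<and> p \<cdot> z = y"
    proof (rule ex1I[of _ "l \<cdot> z"])
      have "h \<cdot> l \<cdot> z = x"
        unfolding k(2)[symmetric] using z kA l zA PD by (simp add: comp_reduce[OF l(5)])
      moreover have "p \<cdot> l \<cdot> z = y"
        unfolding k(3)[symmetric] using z kA l zA PD by (simp add: comp_reduce[OF l(5)])
      ultimately show "l \<cdot> z \<in> Hom C X (Dom C h) \<and> h \<cdot> l \<cdot> z = x \<and> p \<cdot> l \<cdot> z = y"
        using l zA kA H by (simp add: in_Hom)
    next
      fix w assume w: "w \<in> Hom C X (Dom C h) \<and> h \<cdot> w = x \<and> p \<cdot> w = y"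
      then have wA: "w \<in> Arr C" "Dom C w = X" "Cod C w = Dom C h" by (simp_all add: in_Hom)
      have "v \<cdot> k \<cdot> w = v \<cdot> z" "p'' \<cdot> k \<cdot> w = p'' \<cdot> z"
        using w wA z(2,3) kA PD H S by (simp_all add: comp_reduce[OF k(2)] comp_reduce[OF k(3)])
      then have "k \<cdot> w = z"
        using abelian_category.pushout_unique[OF abelian_op, of v p'' p' a "k \<cdot> w" z] P(1) kA wA zA
            H by simp
      then have "l \<cdot> z = l \<cdot> k \<cdot> w" by simp
      then show "w = l \<cdot> z" using l kA wA H by (simp add: comp_reduce[OF l(4)])
    qed
  qed (use S S' H assms(7) in simp_all)
qed

lemma pullback_mono_ses:
  "is_pullback C v p' p a \<Longrightarrow> is_epi C p \<Longrightarrow> ses C a k \<Longrightarrow> ses C v (k \<cdot> p)"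
  using abelian_category.pushout_epi_ses[OF abelian_op, of v p' p a k] by simp

section \<open>Vanishing of Ext in degrees one and two\<close>

lemma Ext1_zero_lift:
  assumes "Ext1_zero C X (Dom C m)" "ses C m p" "x \<in> Hom C X (Cod C p)"
  shows "\<exists>y\<in>Hom C X (Cod C m). p \<cdot> y = x"
proof -
  note S = sesD[OF assms(2)] and xA = assms(3)[unfolded in_Hom]
  \<comment> \<open>After base change along \<open>x\<close>, a section of the new epimorphism
    followed by \<open>v\<close> is a lift of \<open>x\<close>.\<close>
  obtain v m' p' where P: "is_pullback C v p' p x" "v \<cdot> m' = m" "Dom C m' = Dom C m" "ses C m' p'"
    using ses_pullback[OF assms(2), of x] xA by auto
  note PD = pullbackD[OF P(1)] and S' = sesD[OF P(4)]
  obtain s where s: "s \<in> Hom C X (Cod C m')" "p' \<cdot> s = Ident C X"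
    using assms(1) P xA PD unfolding Ext1_zero_def by metis
  note sA = s(1)[unfolded in_Hom]
  have "p \<cdot> v \<cdot> s = x" using PD S' S sA xA s(2) by (simp add: comp_reduce[OF PD(9)])
  moreover have "v \<cdot> s \<in> Hom C X (Cod C m)" using PD S' S sA by (simp add: in_Hom)
  ultimately show ?thesis by blast
qed

text \<open>\<open>Ident - s \<cdot> p\<close> is killed by \<open>p\<close>, so it factors through
  the kernel \<open>m\<close>.\<close>

lemma split_retraction:
  assumes "ses C m p" "s \<in> Hom C (Cod C p) (Cod C m)" "p \<cdot> s = Ident C (Cod C p)"
  shows "\<exists>r\<in>Hom C (Cod C m) (Dom C m). r \<cdot> m = Ident C (Dom C m)"
proof -
  note S = sesD[OF assms(1)] and sA = assms(2)[unfolded in_Hom]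
  have "p \<cdot> (Ident C (Cod C m) \<^bold>- (s \<cdot> p)) = Zero C (Cod C m) (Cod C p)"
    using S sA by (simp add: comp_sub comp_reduce[OF assms(3)])
  then obtain r where r: "r \<in> Hom C (Cod C m) (Dom C m)" "m \<cdot> r = Ident C (Cod C m) \<^bold>- (s \<cdot> p)"
    using kernel_factor[OF S(7), of "Ident C (Cod C m) \<^bold>- (s \<cdot> p)"] S sA by auto
  note rA = r(1)[unfolded in_Hom]
  have "m \<cdot> (r \<cdot> m) = (Ident C (Cod C m) \<^bold>- (s \<cdot> p)) \<cdot> m"
    by (rule comp_reduce[OF r(2)]) (use rA S in simp_all)
  also have "\<dots> = m \<cdot> Ident C (Dom C m)" using S sA by (simp add: sub_comp)
  finally have "r \<cdot> m = Ident C (Dom C m)"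
    using rA S by - (rule mono_cancel[OF S(5)], simp_all)
  with r(1) show ?thesis by blast
qed

text \<open>A short exact sequence has a section exactly if it has a retraction, so splitting is a
  self-dual notion.\<close>

lemma Ext1_zero_op: "Ext1_zero (op C) Y X = Ext1_zero C X Y"
proof
  show "Ext1_zero C X Y" if "Ext1_zero (op C) Y X"
    unfolding Ext1_zero_def
  proof (intro conjI allI impI)
    fix m p assume S: "ses C m p" "Dom C m = Y" "Cod C p = X"
    have "ses (op C) p m \<longrightarrow> Dom (op C) p = X \<longrightarrow> Cod (op C) m = Y \<longrightarrow>
        (\<exists>s\<in>Hom (op C) Y (Cod (op C) p). m \<cdot>\<^bsub>op C\<^esub> s = Ident (op C) Y)"
      using that unfolding Ext1_zero_def by blast
    then have "\<exists>s\<in>Hom C (Cod C m) Y. s \<cdot> m = Ident C Y"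
      using S sesD[OF S(1)] by simp
    then have "\<exists>s\<in>Hom (op C) (Cod (op C) m) (Cod (op C) p). m \<cdot>\<^bsub>op C\<^esub> s
        = Ident (op C) (Cod (op C) m)"
      using S sesD[OF S(1)] by simp
    then show "\<exists>s\<in>Hom C X (Cod C m). p \<cdot> s = Ident C X"
      using abelian_category.split_retraction[OF abelian_op, of p m] S sesD[OF S(1)] by auto
  qed (use that in \<open>auto simp: Ext1_zero_def\<close>)
  show "Ext1_zero (op C) Y X" if "Ext1_zero C X Y"
    unfolding Ext1_zero_def
  proof (intro conjI allI impI)
    fix m p assume S: "ses (op C) m p" "Dom (op C) m = X" "Cod (op C) p = Y"
    then have "\<exists>s\<in>Hom C X (Cod C p). m \<cdot> s = Ident C X"
      using that unfolding Ext1_zero_def by simp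
    then show "\<exists>s\<in>Hom (op C) Y (Cod (op C) m). p \<cdot>\<^bsub>op C\<^esub> s = Ident (op C) Y"
      using split_retraction[of p m] S sesD[of p m] by auto
  qed (use that in \<open>auto simp: Ext1_zero_def\<close>)
qed

lemma Ext1_zero_extend:
  assumes "Ext1_zero C (Cod C p) Y" "ses C m p" "y \<in> Hom C (Dom C m) Y"
  shows "\<exists>z\<in>Hom C (Cod C m) Y. z \<cdot> m = y"
  using abelian_category.Ext1_zero_lift[OF abelian_op, of Y p m y] assms sesD[OF assms(2)]
  by (simp add: Ext1_zero_op)

text \<open>Exactness of Ext^1(X, -) in the middle. Pushed out along \<open>q\<close>, the extension
  becomes one by \<open>Cod q\<close> and acquires a section, which lifts along \<open>v\<close>
  because the kernel of \<open>v\<close> is \<open>Dom k\<close>.\<close>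

lemma Ext1_zero_extension_right:
  assumes "ses C k q" "Ext1_zero C X (Dom C k)" "Ext1_zero C X (Cod C q)"
  shows "Ext1_zero C X (Cod C k)"
  unfolding Ext1_zero_def
proof (intro conjI allI impI)
  note K = sesD[OF assms(1)]
  show "X \<in> Obj C" "Cod C k \<in> Obj C" using assms K by (auto simp: Ext1_zero_def)
  fix m p assume S: "ses C m p" "Dom C m = Cod C k" "Cod C p = X"
  note SD = sesD[OF S(1)]
  obtain v m' p' where P: "is_pushout C v m' m q" "p' \<cdot> v = p" "Cod C p' = Cod C p" "ses C m' p'"
    using ses_pushout[OF S(1), of q] K S(2) by auto
  note PD = pushoutD[OF P(1)]
  obtain s where s: "s \<in> Hom C X (Cod C m')" "p' \<cdot> s = Ident C X"
    using assms(3) P(3,4) S(3) PD unfolding Ext1_zero_def by metis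
  note sA = s(1)[unfolded in_Hom]
  have E: "ses C (m \<cdot> k) v" using pushout_epi_ses[OF P(1) SD(5) assms(1)] .
  have "Ext1_zero C X (Dom C (m \<cdot> k))" using assms(2) K SD S(2) by simp
  then obtain y where y: "y \<in> Hom C X (Cod C (m \<cdot> k))" "v \<cdot> y = s"
    using Ext1_zero_lift[OF _ E, of X s] s(1) PD by auto
  note yA = y(1)[unfolded in_Hom]
  have "p \<cdot> y = p' \<cdot> v \<cdot> y"
    by (rule comp_reduce[OF P(2), symmetric]) (use yA SD K S PD sesD[OF P(4)] in simp_all)
  then have "p \<cdot> y = Ident C X" using y(2) s(2) by simp
  moreover have "y \<in> Hom C X (Cod C m)" using y(1) SD K S by simp
  ultimately show "\<exists>s\<in>Hom C X (Cod C m). p \<cdot> s = Ident C X" by blast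
qed

lemma Ext1_zero_extension_left:
  assumes "ses C k q" "Ext1_zero C (Dom C k) Y" "Ext1_zero C (Cod C q) Y"
  shows "Ext1_zero C (Cod C k) Y"
  using abelian_category.Ext1_zero_extension_right[OF abelian_op, of q k Y] assms sesD[OF assms(1)]
  by (simp add: Ext1_zero_op)

text \<open>With the identity on the left, such a morphism is a pullback square along the
  monomorphism \<open>m'\<close>, so \<open>h\<close> is mono with cokernel
  \<open>p' \<cdot> q\<close>. The object \<open>Cod k\<close> then has a filtration with subobjects
  \<open>Dom m\<close> and \<open>Cod m\<close> and successive quotients \<open>Cod p\<close> and
  \<open>Cod p'\<close>; this is what the vanishing of a Yoneda product provides.\<close>

lemma ses_mor_splice:
  assumes "ses_mor C (m, p) e (Ident C (Dom C m)) m'" "ses C m' p'" "Cod C p = Dom C m'"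
  obtains k q h where "e = (k, q)" "ses C h (p' \<cdot> q)" "Dom C h = Cod C m" "Cod C h = Cod C k"
    "ses C k q" "q \<cdot> h = m' \<cdot> p" "h \<cdot> m = k" "Cod C q = Cod C m'" "Dom C k = Dom C m"
proof -
  obtain k q where e: "e = (k, q)" by (metis surj_pair)
  obtain h where h: "ses C m p" "ses C k q" "Ident C (Dom C m) \<in> Hom C (Dom C m) (Dom C k)"
    "m' \<in> Hom C (Cod C p) (Cod C q)"
    "h \<in> Hom C (Cod C m) (Cod C k)" "h \<cdot> m = k \<cdot> Ident C (Dom C m)" "q \<cdot> h = m' \<cdot> p"
    using assms(1)[unfolded e] by (rule ses_morE)
  note S = sesD[OF h(1)] sesD[OF h(2)]
  have d: "Dom C k = Dom C m" using h(3) S by (simp add: in_Hom)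
  then have hm: "h \<cdot> m = k" using h(6) S by simp
  have "is_pullback C h p q m'" by (rule ses_mor_is_pullback[OF h(1,2) d[symmetric] h(4,5) hm h(7)])
  then have "ses C h (p' \<cdot> q)" using pullback_mono_ses S assms(2) by blast
  then show thesis using that[of k q h] e h d hm by (auto simp: in_Hom)
qed

text \<open>The filtered object of \<open>ses_mor_splice\<close> read from its other end: dividing
  by \<open>Dom m\<close> presents the second sequence as a cobase change of
  \<open>(h, p' \<cdot> q)\<close> along \<open>p\<close>.\<close>

lemma Ext2_zero_dual:
  assumes "Ext2_zero C X Y" "ses C m p" "ses C m' p'" "Cod C p = Dom C m'" "Dom C m = Y"
      "Cod C p' = X"
  shows "\<exists>e. ses_mor C e (m', p') p (Ident C X)"
proof -
  obtain e where e: "ses_mor C (m, p) e (Ident C (Dom C m)) m'"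
    using assms unfolding Ext2_zero_def by blast
  obtain k q h where h: "e = (k, q)" "ses C h (p' \<cdot> q)" "Dom C h = Cod C m" "Cod C h = Cod C k"
    "ses C k q" "q \<cdot> h = m' \<cdot> p" "h \<cdot> m = k" "Cod C q = Cod C m'"
    by (rule ses_mor_splice[OF e assms(3,4)])
  note S = sesD[OF assms(2)] sesD[OF assms(3)] sesD[OF h(5)] sesD[OF h(2)]
  have "ses_mor C (h, p' \<cdot> q) (m', p') p (Ident C X)"
    by (rule ses_morI[where h = q]) (use S h(2-6,8) assms obj(2)[OF S(10)] in \<open>simp_all add:
        in_Hom\<close>)
  then show ?thesis by blast
qed

lemma Ext2_zero_op: "Ext2_zero C X Y \<Longrightarrow> Ext2_zero (op C) Y X"
  unfolding Ext2_zero_def[of "op C"]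
proof (intro allI impI)
  fix m p m' p' assume a: "Ext2_zero C X Y" "ses (op C) m p" "ses (op C) m' p'"
      "Cod (op C) p = Dom (op C) m'"
    "Dom (op C) m = X" "Cod (op C) p' = Y"
  then obtain e where "ses_mor C e (p, m) m' (Ident C X)"
    using Ext2_zero_dual[of X Y p' m' p m] by auto
  then have "ses_mor (op C) (m, p) (prod.swap e) (Ident (op C) X) m'"
    using ses_mor_op[of "(p, m)" e] by simp
  then show "\<exists>e. ses_mor (op C) (m, p) e (Ident (op C) X) m'" by blast
qed

text \<open>The segment Ext^1(X, Cod k) -> Ext^1(X, Cod q) -> Ext^2(X, Dom k) of the long exact
  sequence. By \<open>Ext2_zero_dual\<close> the given extension receives one by
  \<open>Cod k\<close> over the identity of \<open>X\<close>, and a section of the latter is carried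
  over by \<open>h\<close>.\<close>

lemma Ext1_zero_cokernel_right:
  assumes "ses C k q" "Ext2_zero C X (Dom C k)" "Ext1_zero C X (Cod C k)"
  shows "Ext1_zero C X (Cod C q)"
  unfolding Ext1_zero_def
proof (intro conjI allI impI)
  note K = sesD[OF assms(1)]
  show "X \<in> Obj C" "Cod C q \<in> Obj C" using assms K by (auto simp: Ext1_zero_def)
  fix m p assume S: "ses C m p" "Dom C m = Cod C q" "Cod C p = X"
  note SD = sesD[OF S(1)]
  obtain e where "ses_mor C e (m, p) q (Ident C X)"
    using Ext2_zero_dual[OF assms(2,1) S(1)] S by auto
  then obtain m' p' h where h: "ses C m' p'" "q \<in> Hom C (Dom C m') (Dom C m)"
    "Ident C X \<in> Hom C (Cod C p') (Cod C p)"
    "h \<in> Hom C (Cod C m') (Cod C m)" "h \<cdot> m' = m \<cdot> q" "p \<cdot> h = Ident C X \<cdot> p'"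
    by (metis ses_morE surj_pair)
  note S' = sesD[OF h(1)] and H = h(2-4)[unfolded in_Hom]
  have XO: "X \<in> Obj C" using SD S by auto
  have "Dom C m' = Cod C k" "Cod C p' = X" using H K XO by simp_all
  then obtain s where s: "s \<in> Hom C X (Cod C m')" "p' \<cdot> s = Ident C X"
    using assms(3) h(1) unfolding Ext1_zero_def by metis
  note sA = s(1)[unfolded in_Hom]
  have "p \<cdot> h \<cdot> s = Ident C X"
    using s(2) sA H SD S' S XO by (simp add: comp_reduce[OF h(6)])
  moreover have "h \<cdot> s \<in> Hom C X (Cod C m)" using sA H by (simp add: in_Hom)
  ultimately show "\<exists>s\<in>Hom C X (Cod C m). p \<cdot> s = Ident C X" by blast
qed

lemma Ext1_zero_kernel_left:
  assumes "ses C k q" "Ext2_zero C (Cod C q) Y" "Ext1_zero C (Cod C k) Y"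
  shows "Ext1_zero C (Dom C k) Y"
  using abelian_category.Ext1_zero_cokernel_right[OF abelian_op, of q k Y] assms sesD[OF assms(1)]
  by (simp add: Ext1_zero_op Ext2_zero_op)

end

section \<open>Sequences with syzygies in the right half of a cotorsion pair\<close>

text \<open>
  An \<open>n\<close>-fold exact sequence is handled through its factorization into \<open>n\<close> short exact sequences
  \<open>Z\<^sub>i \<rightarrow> X\<^sub>i\<^sub>+\<^sub>1 \<rightarrow> Z\<^sub>i\<^sub>+\<^sub>1\<close> with \<open>Z\<^sub>0 = B\<close> and \<open>Z\<^sub>n = A\<close>.
\<close>

fun path :: "('o, 'm) addcat \<Rightarrow> 'o \<Rightarrow> ('m \<times> 'm) list \<Rightarrow> 'o \<Rightarrow> bool" where
  "path C B [] A \<longleftrightarrow> A = B"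
| "path C B (e # es) A \<longleftrightarrow> ses C (fst e) (snd e) \<and> Dom C (fst e) = B \<and> path C (Cod C (snd e)) es A"

fun path_mor :: "('o, 'm) addcat \<Rightarrow> ('m \<times> 'm) list \<Rightarrow> ('m \<times> 'm) list \<Rightarrow> 'm \<Rightarrow> 'm \<Rightarrow> bool" where
  "path_mor C [] [] b a \<longleftrightarrow> b = a"
| "path_mor C (e # es) (e' # es') b a \<longleftrightarrow> (\<exists>z. ses_mor C e e' b z \<and> path_mor C es es' z a)"
| "path_mor C _ _ b a \<longleftrightarrow> False"

text \<open>Equality of cocycles modulo coboundaries: with \<open>m\<close> the first monomorphism Z
  -> P of a resolution, the arrows \<open>s \<cdot> m\<close> are those that extend over P. The
  typing conditions are included so that the relation carries them along.\<close>

definition homotopic :: "('o, 'm) addcat \<Rightarrow> 'm \<Rightarrow> 'm \<Rightarrow> 'm \<Rightarrow> bool" where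
  "homotopic C m f f' \<longleftrightarrow> m \<in> Arr C \<and> f' \<in> Hom C (Dom C m) (Cod C f') \<and>
     (\<exists>s\<in>Hom C (Cod C m) (Cod C f'). f = (s \<cdot>\<^bsub>C\<^esub> m) \<^bold>+\<^bsub>C\<^esub> f')"

section \<open>Homotopies, and morphisms of chains of short exact sequences\<close>

context preadditive_category
begin

lemma homotopicI:
  "m \<in> Arr C \<Longrightarrow> f' \<in> Hom C (Dom C m) B \<Longrightarrow> s \<in> Hom C (Cod C m) B \<Longrightarrow> f = (s \<cdot> m) \<^bold>+ f'
      \<Longrightarrow> homotopic C m f f'"
  by (auto simp: homotopic_def in_Hom)

lemma homotopicE:
  assumes "homotopic C m f f'"
  obtains s where "m \<in> Arr C" "f' \<in> Arr C" "Dom C f' = Dom C m" "s \<in> Arr C" "Dom C s = Cod C m"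
    "Cod C s = Cod C f'" "f = (s \<cdot> m) \<^bold>+ f'" "f \<in> Arr C" "Dom C f = Dom C m" "Cod C f = Cod C f'"
proof -
  obtain s where s: "m \<in> Arr C" "f' \<in> Arr C" "Dom C f' = Dom C m" "s \<in> Arr C" "Dom C s = Cod C m"
    "Cod C s = Cod C f'" "f = (s \<cdot> m) \<^bold>+ f'"
    using assms by (fastforce simp: homotopic_def in_Hom)
  show thesis by (rule that[OF s]) (use s in simp_all)
qed

lemma homotopic_refl:
  assumes "m \<in> Arr C" "f \<in> Arr C" "Dom C f = Dom C m"
  shows "homotopic C m f f"
  by (rule homotopicI[where s = "Zero C (Cod C m) (Cod C f)" and B = "Cod C f"])
    (use assms in \<open>simp_all add: in_Hom\<close>)

lemma homotopic_sym:
  assumes "homotopic C m f f'"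
  shows "homotopic C m f' f"
proof -
  obtain s where s: "m \<in> Arr C" "f' \<in> Arr C" "Dom C f' = Dom C m" "s \<in> Arr C" "Dom C s = Cod C m"
    "Cod C s = Cod C f'" "f = (s \<cdot> m) \<^bold>+ f'" "f \<in> Arr C" "Dom C f = Dom C m" "Cod C f = Cod C f'"
    using assms by (rule homotopicE)
  define t where "t = Zero C (Cod C m) (Cod C f') \<^bold>- s"
  have t: "t \<in> Arr C" "Dom C t = Cod C m" "Cod C t = Cod C f'" and ts: "t \<^bold>+ s
      = Zero C (Cod C m) (Cod C f')"
    using s by (simp_all add: t_def)
  have "(t \<cdot> m) \<^bold>+ f = ((t \<cdot> m) \<^bold>+ (s \<cdot> m)) \<^bold>+ f'"
    using s t by (simp add: add_assoc)
  also have "(t \<cdot> m) \<^bold>+ (s \<cdot> m) = (t \<^bold>+ s) \<cdot> m" using s t by (simp add: add_comp)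
  also have "\<dots> = Zero C (Dom C m) (Cod C f')" unfolding ts using s by simp
  finally have "f' = (t \<cdot> m) \<^bold>+ f" using s by simp
  then show ?thesis by (intro homotopicI[where s = t and B
      = "Cod C f'"]) (use s t in \<open>simp_all add: in_Hom\<close>)
qed

lemma homotopic_trans:
  assumes "homotopic C m f f'" "homotopic C m f' f''"
  shows "homotopic C m f f''"
proof -
  obtain s where s: "m \<in> Arr C" "f' \<in> Arr C" "Dom C f' = Dom C m" "s \<in> Arr C" "Dom C s = Cod C m"
    "Cod C s = Cod C f'" "f = (s \<cdot> m) \<^bold>+ f'" "f \<in> Arr C" "Dom C f = Dom C m" "Cod C f = Cod C f'"
    using assms(1) by (rule homotopicE)
  obtain t where t: "f'' \<in> Arr C" "Dom C f'' = Dom C m" "t \<in> Arr C" "Dom C t = Cod C m"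
    "Cod C t = Cod C f''" "f' = (t \<cdot> m) \<^bold>+ f''" "Cod C f' = Cod C f''"
    using assms(2) by (rule homotopicE)
  have "f = ((s \<^bold>+ t) \<cdot> m) \<^bold>+ f''"
    unfolding s(7) unfolding t(6) using s(1-6) t by (simp add: add_comp add_assoc)
  then show ?thesis
    by (intro homotopicI[where s = "s \<^bold>+ t" and B
        = "Cod C f''"]) (use s(1-6) t(1-5,7) in \<open>simp_all add: in_Hom\<close>)
qed

lemma homotopic_comp:
  assumes "homotopic C m f f'" "k \<in> Arr C" "Dom C k = Cod C f'"
  shows "homotopic C m (k \<cdot> f) (k \<cdot> f')"
proof -
  obtain s where s: "m \<in> Arr C" "f' \<in> Arr C" "Dom C f' = Dom C m" "s \<in> Arr C" "Dom C s = Cod C m"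
    "Cod C s = Cod C f'" "f = (s \<cdot> m) \<^bold>+ f'" 
    using assms(1) by (rule homotopicE)
  show ?thesis unfolding s(7)
    by (rule homotopicI[where s = "k \<cdot> s" and B
        = "Cod C k"]) (use s(1-6) assms in \<open>simp_all add: in_Hom comp_add\<close>)
qed

lemma homotopic_add:
  assumes "homotopic C m f f'" "homotopic C m g g'" "Cod C g = Cod C f"
  shows "homotopic C m (f \<^bold>+ g) (f' \<^bold>+ g')"
proof -
  obtain s where s: "m \<in> Arr C" "f' \<in> Arr C" "Dom C f' = Dom C m" "s \<in> Arr C" "Dom C s = Cod C m"
    "Cod C s = Cod C f'" "f = (s \<cdot> m) \<^bold>+ f'" "Cod C f = Cod C f'"
    using assms(1) by (rule homotopicE)
  obtain t where t: "g' \<in> Arr C" "Dom C g' = Dom C m" "t \<in> Arr C" "Dom C t = Cod C m"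
    "Cod C t = Cod C g'" "g = (t \<cdot> m) \<^bold>+ g'" "Cod C g = Cod C g'"
    using assms(2) by (rule homotopicE)
  have c: "Cod C g' = Cod C f'" using s t assms(3) by simp
  have "f \<^bold>+ g = (s \<cdot> m) \<^bold>+ (f' \<^bold>+ ((t \<cdot> m) \<^bold>+ g'))"
    unfolding s(7) t(6) using s(1-6) t(1-5) c by (simp add: add_assoc)
  also have "f' \<^bold>+ ((t \<cdot> m) \<^bold>+ g') = ((t \<cdot> m) \<^bold>+ f') \<^bold>+ g'"
    using s(1-6) t(1-5) c by (simp add: add_assoc[symmetric] add_commute[of f'])
  also have "(s \<cdot> m) \<^bold>+ (((t \<cdot> m) \<^bold>+ f') \<^bold>+ g') = ((s \<^bold>+ t) \<cdot> m) \<^bold>+ (f' \<^bold>+ g')"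
    using s(1-6) t(1-5) c by (simp add: add_assoc add_comp)
  finally show ?thesis
    by (intro homotopicI[where s = "s \<^bold>+ t" and B
        = "Cod C f'"]) (use s(1-6) t(1-5) c in \<open>simp_all add: in_Hom\<close>)
qed

lemma homotopic_of_sub:
  assumes "m \<in> Arr C" "f \<in> Hom C (Dom C m) B" "f' \<in> Hom C (Dom C m) B" "s \<in> Hom C (Cod C m) B"
    "f \<^bold>- f' = s \<cdot> m"
  shows "homotopic C m f f'"
  by (rule homotopicI[where s = s and B = B])
    (use assms sub_add[of f f'] in \<open>simp_all add: in_Hom\<close>)

lemma path_mor_length: "path_mor C es es' b a \<Longrightarrow> length es' = length es"
  by (induction C es es' b a rule: path_mor.induct) auto

lemma path_mor_hom:
  "path_mor C es es' b a \<Longrightarrow> path C B es A \<Longrightarrow> path C B' es' A' \<Longrightarrow> a \<in> Hom C A A' \<Longrightarrow> b \<in> Hom C B B'"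
  by (cases es; cases es') (auto simp: ses_mor_def)

lemma path_mor_id:
  "path C B es A \<Longrightarrow> path_mor C es es (Ident C B) (Ident C A)"
proof (induction es arbitrary: B)
  case (Cons e es)
  then have "ses C (fst e) (snd e)" by simp
  then have "ses_mor C e e (Ident C (Dom C (fst e))) (Ident C (Cod C (snd e)))"
    using ses_mor_id[of "fst e" "snd e"] by simp
  with Cons show ?case by auto
qed simp

lemma path_mor_comp:
  "path_mor C es es' b a \<Longrightarrow> path_mor C es' es'' b' a' \<Longrightarrow> path_mor C es es'' (b' \<cdot> b) (a' \<cdot> a)"
proof (induction es arbitrary: es' es'' b b')
  case Nil
  then show ?case by (cases es'; cases es'') auto
next
  case (Cons e es)
  then obtain e1 es1 e2 es2 where [simp]: "es' = e1 # es1" "es'' = e2 # es2"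
    by (cases es'; cases es''; simp)
  obtain z z' where "ses_mor C e e1 b z" "path_mor C es es1 z a" "ses_mor C e1 e2 b' z'"
      "path_mor C es1 es2 z' a'"
    using Cons.prems by auto
  then show ?case using Cons.IH[of es1 z es2 z'] ses_mor_comp[of e e1 b z e2 b' z'] by auto
qed

lemma path_mor_sub:
  "path_mor C es es' b a \<Longrightarrow> path_mor C es es' b' a' \<Longrightarrow> path_mor C es es' (b \<^bold>- b') (a \<^bold>- a')"
proof (induction es arbitrary: es' b b')
  case Nil
  then show ?case by (cases es') auto
next
  case (Cons e es)
  then obtain e1 es1 where [simp]: "es' = e1 # es1" by (cases es') auto
  obtain z z' where "ses_mor C e e1 b z" "path_mor C es es1 z a" "ses_mor C e e1 b' z'"
      "path_mor C es es1 z' a'"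
    using Cons.prems by auto
  then show ?case using Cons.IH[of es1 z z'] ses_mor_sub[of e e1 b z b' z'] by auto
qed

end

text \<open>What the proof takes from a complete hereditary cotorsion pair. The model structure
  supplies two instances: \<open>Q \<inter> W\<close> and \<open>R\<close>, where resolutions live,
  and \<open>Q\<close> and \<open>W \<inter> R\<close>, which governs cofibrant syzygies.\<close>

locale cotorsion_setup = abelian_category C for C :: "('o, 'm) addcat" (structure) +
  fixes P R :: "'o set"
  assumes P_Obj: "P \<subseteq> Obj C" and R_Obj: "R \<subseteq> Obj C"
    and ext1: "X \<in> P \<Longrightarrow> Y \<in> R \<Longrightarrow> Ext1_zero C X Y"
    and ext2: "X \<in> P \<Longrightarrow> Y \<in> R \<Longrightarrow> Ext2_zero C X Y"
    and P_I: "X \<in> Obj C \<Longrightarrow> (\<And>Y. Y \<in> R \<Longrightarrow> Ext1_zero C X Y) \<Longrightarrow> X \<in> P"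
    and R_I: "Y \<in> Obj C \<Longrightarrow> (\<And>X. X \<in> P \<Longrightarrow> Ext1_zero C X Y) \<Longrightarrow> Y \<in> R"
    and enough: "A \<in> Obj C \<Longrightarrow> \<exists>i p. ses C i p \<and> Dom C i = A \<and> Cod C i \<in> R \<and> Cod C p \<in> P"
    and enough': "A \<in> Obj C \<Longrightarrow> \<exists>i p. ses C i p \<and> Cod C p = A \<and> Cod C i \<in> P \<and> Dom C i \<in> R"
begin

lemma R_extension:
  assumes "ses C k q" "Dom C k \<in> R" "Cod C q \<in> R" shows "Cod C k \<in> R"
  by (rule R_I) (use sesD(1)[OF assms(1)] Ext1_zero_extension_right[OF assms(1)] assms ext1 in
      simp_all)

lemma R_cokernel:
  assumes "ses C k q" "Dom C k \<in> R" "Cod C k \<in> R" shows "Cod C q \<in> R"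
  by (rule R_I) (use sesD(2)[OF assms(1)] Ext1_zero_cokernel_right[OF assms(1)] assms ext1 ext2 in
      simp_all)

lemma P_extension:
  assumes "ses C k q" "Dom C k \<in> P" "Cod C q \<in> P" shows "Cod C k \<in> P"
  by (rule P_I) (use sesD(1)[OF assms(1)] Ext1_zero_extension_left[OF assms(1)] assms ext1 in
      simp_all)

lemma P_kernel:
  assumes "ses C k q" "Cod C k \<in> P" "Cod C q \<in> P" shows "Dom C k \<in> P"
  by (rule P_I) (use sesD(1)[OF assms(1)] Ext1_zero_kernel_left[OF assms(1)] assms ext1 ext2 in
      simp_all)

lemma lift: "X \<in> P \<Longrightarrow> ses C m p \<Longrightarrow> Dom C m \<in> R \<Longrightarrow> x \<in> Hom C X (Cod C p) \<Longrightarrow>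
    \<exists>y\<in>Hom C X (Cod C m). p \<cdot> y = x"
  using ext1 Ext1_zero_lift by blast

lemma extend: "Y \<in> R \<Longrightarrow> ses C m p \<Longrightarrow> Cod C p \<in> P \<Longrightarrow> y \<in> Hom C (Dom C m) Y \<Longrightarrow>
    \<exists>z\<in>Hom C (Cod C m) Y. z \<cdot> m = y"
  using ext1 Ext1_zero_extend by blast

text \<open>The right end of the list is exempt. The condition concerns exactly the kernels against
  which arrows out of objects of \<open>P\<close> have to be lifted.\<close>

definition special :: "('m \<times> 'm) list \<Rightarrow> bool" where
  "special S \<longleftrightarrow> (\<forall>e\<in>set S. Dom C (fst e) \<in> R)"

definition P_middle :: "('m \<times> 'm) list \<Rightarrow> bool" where
  "P_middle \<sigma> \<longleftrightarrow> (\<forall>e\<in>set \<sigma>. Cod C (fst e) \<in> P)"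

text \<open>As \<open>Dom m'\<close> is in \<open>R\<close>, the arrow \<open>z \<cdot> p\<close>
  from the object \<open>Cod m\<close> of \<open>P\<close> lifts along \<open>p'\<close>; the lift
  then restricts to the kernels.\<close>

lemma ses_mor_lift:
  assumes "ses C m p" "ses C m' p'" "Cod C m \<in> P" "Dom C m' \<in> R" "z \<in> Hom C (Cod C p) (Cod C p')"
  shows "\<exists>g\<in>Hom C (Dom C m) (Dom C m'). ses_mor C (m, p) (m', p') g z"
proof -
  note S = sesD[OF assms(1)] and S' = sesD[OF assms(2)] and zA = assms(5)[unfolded in_Hom]
  obtain h where h: "h \<in> Hom C (Cod C m) (Cod C m')" "p' \<cdot> h = z \<cdot> p"
    using lift[OF assms(3,2,4), of "z \<cdot> p"] S S' zA by (auto simp: in_Hom)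
  note hA = h(1)[unfolded in_Hom]
  have "p' \<cdot> (h \<cdot> m) = Zero C (Dom C m) (Cod C p')"
    using S S' zA hA by (simp add: comp_reduce[OF h(2)])
  then obtain g where g: "g \<in> Hom C (Dom C m) (Dom C m')" "m' \<cdot> g = h \<cdot> m"
    using kernel_factor[OF S'(7), of "h \<cdot> m"] S S' hA by auto
  then show ?thesis using ses_morI[OF assms(1,2) g(1) assms(5) h(1)] h(2) by auto
qed

text \<open>The comparison theorem for resolutions. Lifting proceeds from the right end to the left,
  so the induction hypothesis for the tail yields the arrow \<open>z\<close> over which the first
  sequence is lifted.\<close>

lemma path_mor_lift:
  assumes "path C Z \<sigma> A" "P_middle \<sigma>" "path C B S A'" "special S" "length S = length \<sigma>"
      "a \<in> Hom C A A'"
  shows "\<exists>g\<in>Hom C Z B. path_mor C \<sigma> S g a"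
  using assms
proof (induction \<sigma> arbitrary: Z B S)
  case (Cons e \<sigma>)
  obtain e' S' where S: "S = e' # S'" using Cons.prems(5) by (cases S) auto
  obtain z where z: "z \<in> Hom C (Cod C (snd e)) (Cod C (snd e'))" "path_mor C \<sigma> S' z a"
    using Cons.IH[of "Cod C (snd e)" "Cod C (snd e')" S'] Cons.prems
    by (auto simp: S P_middle_def special_def)
  then obtain g where "g \<in> Hom C Z B" "ses_mor C (fst e, snd e) (fst e', snd e') g z"
    using ses_mor_lift[of "fst e" "snd e" "fst e'" "snd e'" z] Cons.prems
    by (auto simp: S P_middle_def special_def)
  with z show ?case by (auto simp: S)
qed auto

text \<open>\<open>h\<close> and \<open>w \<cdot> p\<close> agree after \<open>p'\<close>, so their
  difference is \<open>m' \<cdot> s\<close>. On \<open>Dom m\<close> the summand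
  \<open>w \<cdot> p\<close> disappears, and \<open>m'\<close> can be cancelled.\<close>

lemma ses_mor_null:
  assumes "ses_mor C (m, p) (m', p') g (p' \<cdot> w)" "w \<in> Hom C (Cod C p) (Cod C m')"
  shows "\<exists>s\<in>Hom C (Cod C m) (Dom C m'). g = s \<cdot> m"
proof -
  obtain h where h: "ses C m p" "ses C m' p'" "g \<in> Hom C (Dom C m) (Dom C m')"
    "h \<in> Hom C (Cod C m) (Cod C m')" "h \<cdot> m = m' \<cdot> g" "p' \<cdot> h = (p' \<cdot> w) \<cdot> p"
    using assms(1) by (rule ses_morE)
  note S = sesD[OF h(1)] and S' = sesD[OF h(2)] and H
      = h(3,4)[unfolded in_Hom] assms(2)[unfolded in_Hom]
  have "p' \<cdot> (h \<^bold>- (w \<cdot> p)) = Zero C (Cod C m) (Cod C p')"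
    using S S' H h(6) by (simp add: comp_sub)
  then obtain s where s: "s \<in> Hom C (Cod C m) (Dom C m')" "m' \<cdot> s = h \<^bold>- (w \<cdot> p)"
    using kernel_factor[OF S'(7), of "h \<^bold>- (w \<cdot> p)"] S S' H by auto
  note sA = s(1)[unfolded in_Hom]
  have "m' \<cdot> (s \<cdot> m) = (h \<^bold>- (w \<cdot> p)) \<cdot> m"
    by (rule comp_reduce[OF s(2)]) (use sA S S' in simp_all)
  also have "\<dots> = m' \<cdot> g" using S S' H h(5) by (simp add: sub_comp)
  finally have "s \<cdot> m = g" using S S' H sA by - (rule mono_cancel[OF S'(5)], simp_all)
  with s(1) show ?thesis by blast
qed

text \<open>A null homotopy travels to the left: the tail gives
  \<open>z = s \<cdot> fst (hd \<sigma>)\<close>, and lifting \<open>s\<close> along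
  \<open>snd e'\<close> turns this into a factorization as required by \<open>ses_mor_null\<close>.
  A general \<open>w\<close> at the right end, and not just zero, serves
  \<open>homotopic_agree_on_cofibrant\<close>.\<close>

lemma path_mor_null:
  assumes "path_mor C \<sigma> S g a" "\<sigma> \<noteq> []" "path C Z \<sigma> A" "P_middle \<sigma>" "path C B S A'" "special S"
    "a = snd (last S) \<cdot> w" "w \<in> Hom C A (Cod C (fst (last S)))"
  shows "\<exists>s\<in>Hom C (Cod C (fst (hd \<sigma>))) B. g = s \<cdot> fst (hd \<sigma>)"
  using assms
proof (induction \<sigma> arbitrary: Z B S g)
  case (Cons e \<sigma>)
  obtain e' S' where S: "S = e' # S'" using Cons.prems(1) by (cases S) auto
  obtain z where z: "ses_mor C e e' g z" "path_mor C \<sigma> S' z a" using Cons.prems(1) by (auto simp: S)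
  have E: "ses C (fst e') (snd e')" "Dom C (fst e') \<in> R" "ses C (fst e) (snd e)"
      "Dom C (fst e') = B"
    using Cons.prems by (auto simp: S special_def)
  have "\<exists>w\<in>Hom C (Cod C (snd e)) (Cod C (fst e')). z = snd e' \<cdot> w"
  proof (cases "\<sigma> = []")
    case True
    then have "S' = []" using path_mor_length[OF z(2)] by simp
    with True z(2) Cons.prems show ?thesis by (auto simp: S)
  next
    case False
    then have "S' \<noteq> []" using path_mor_length[OF z(2)] by auto
    then obtain s where s: "s \<in> Hom C (Cod C (fst (hd \<sigma>))) (Cod C (snd e'))" "z = s \<cdot> fst (hd \<sigma>)"
      using Cons.IH[OF z(2) False, of "Cod C (snd e)" "Cod C (snd e')"] Cons.prems
      by (auto simp: S P_middle_def special_def)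
    have "Cod C (fst (hd \<sigma>)) \<in> P" and D: "fst (hd \<sigma>) \<in> Arr C" "Dom C (fst (hd \<sigma>)) = Cod C (snd e)"
      using Cons.prems False sesD by (cases \<sigma>; auto simp: P_middle_def)+
    then obtain t where t: "t \<in> Hom C (Cod C (fst (hd \<sigma>))) (Cod C (fst e'))" "snd e' \<cdot> t = s"
      using lift[OF _ E(1,2) s(1)] by blast
    have "snd e' \<cdot> (t \<cdot> fst (hd \<sigma>)) = z"
      unfolding s(2) by (rule comp_reduce[OF t(2)]) (use t(1) D sesD[OF E(1)] in \<open>simp_all add:
          in_Hom\<close>)
    moreover have "t \<cdot> fst (hd \<sigma>) \<in> Hom C (Cod C (snd e)) (Cod C (fst e'))"
      using t(1) D by (simp add: in_Hom)
    ultimately show ?thesis by blast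
  qed
  then obtain w where "w \<in> Hom C (Cod C (snd e)) (Cod C (fst e'))" "z = snd e' \<cdot> w" by blast
  then show ?case using ses_mor_null[of "fst e" "snd e" "fst e'" "snd e'" g w] z(1) E by simp
qed simp

text \<open>Adding \<open>s \<cdot> m\<close> to \<open>f\<close> is compensated by adding
  \<open>m' \<cdot> s\<close> to the middle arrow, which \<open>p'\<close> does not see.\<close>

lemma path_mor_shift:
  assumes "path_mor C \<sigma> S f a" "homotopic C (fst (hd \<sigma>)) f' f" "\<sigma> \<noteq> []" "path C Z \<sigma> A"
      "path C B S A'"
  shows "path_mor C \<sigma> S f' a"
proof -
  obtain e \<tau> where \<sigma>: "\<sigma> = e # \<tau>" using assms(3) by (cases \<sigma>) auto
  obtain e' S' where S: "S = e' # S'" using assms(1) by (cases S) (auto simp: \<sigma>)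
  obtain z where z: "ses_mor C e e' f z" "path_mor C \<tau> S' z a" using assms(1) by (auto simp: \<sigma> S)
  obtain m p m' p' where e: "e = (m, p)" "e' = (m', p')" by (metis surj_pair)
  obtain h where h: "ses C m p" "ses C m' p'" "f \<in> Hom C (Dom C m) (Dom C m')"
      "z \<in> Hom C (Cod C p) (Cod C p')"
    "h \<in> Hom C (Cod C m) (Cod C m')" "h \<cdot> m = m' \<cdot> f" "p' \<cdot> h = z \<cdot> p"
    using z(1)[unfolded e] by (rule ses_morE)
  obtain s where s: "s \<in> Arr C" "Dom C s = Cod C m"
    "Cod C s = Cod C f" "f' = (s \<cdot> m) \<^bold>+ f"
    using assms(2) by (auto simp: \<sigma> e elim: homotopicE)
  note S' = sesD[OF h(1)] sesD[OF h(2)] and H = h(3-5)[unfolded in_Hom]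
  have "ses_mor C (m, p) (m', p') f' z"
    by (rule ses_morI[where h = "(m' \<cdot> s) \<^bold>+ h"])
      (use h(1,2,6,7) S' H s in \<open>simp_all add: in_Hom comp_add add_comp comp_reduce[OF S'(12)]\<close>)
  with z(2) show ?thesis by (auto simp: \<sigma> S e)
qed

text \<open>The difference of the two comparison maps lies over \<open>a - a = 0\<close>, which
  factors through the last middle term by the zero arrow.\<close>

lemma path_mor_unique:
  assumes "path_mor C \<sigma> S f a" "path_mor C \<sigma> S f' a" "\<sigma> \<noteq> []" "path C Z \<sigma> A" "P_middle \<sigma>"
      "path C B S A'" "special S"
    "a \<in> Hom C A A'"
  shows "homotopic C (fst (hd \<sigma>)) f f'"
proof -
  have f: "f \<in> Hom C Z B" "f' \<in> Hom C Z B" using assms path_mor_hom by blast+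
  have \<sigma>: "fst (hd \<sigma>) \<in> Arr C" "Dom C (fst (hd \<sigma>)) = Z"
    using assms(3,4) sesD by (cases \<sigma>; auto)+
  have "S \<noteq> []" using path_mor_length[OF assms(1)] assms(3) by auto
  have "path C B S A' \<Longrightarrow> S \<noteq> [] \<Longrightarrow> ses C (fst (last S)) (snd (last S)) \<and> Cod C (snd (last S)) = A'"
    for B S
  proof (induction S arbitrary: B)
    case (Cons e S) then show ?case by (cases S) auto
  qed simp
  then have L: "ses C (fst (last S)) (snd (last S))" "Cod C (snd (last S)) = A'"
    using assms(6) \<open>S \<noteq> []\<close> by auto
  note LD = sesD[OF L(1)] and aA = assms(8)[unfolded in_Hom]
  have A: "A \<in> Obj C" using aA by auto
  have "path_mor C \<sigma> S (f \<^bold>- f') (a \<^bold>- a)" using assms path_mor_sub by blast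
  moreover have "a \<^bold>- a = snd (last S) \<cdot> Zero C A (Cod C (fst (last S)))"
    using aA LD L(2) A by simp
  moreover have "Zero C A (Cod C (fst (last S))) \<in> Hom C A (Cod C (fst (last S)))"
    using LD A by (simp add: in_Hom)
  ultimately obtain s where "s\<in>Hom C (Cod C (fst (hd \<sigma>))) B" "f \<^bold>- f' = s \<cdot> fst (hd \<sigma>)"
    using path_mor_null assms(3-7) by blast
  then show ?thesis using homotopic_of_sub f \<sigma> by blast
qed

text \<open>
  The sequence \<open>S\<close> is built from the left: push out along \<open>b\<close>, embed the middle term in an
  object of \<open>R\<close> with cokernel in \<open>P\<close>, and continue with the induced map of syzygies.
\<close>

lemma special_envelope:
  assumes "path C B es A" "es \<noteq> []" "b \<in> Hom C B B0" "B0 \<in> R" "A \<in> Obj C"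
  shows "\<exists>S. path C B0 S A \<and> special S \<and> path_mor C es S b (Ident C A) \<and>
    (\<forall>S' B' A' c a. path C B' S' A' \<longrightarrow> special S' \<longrightarrow> c \<in> Hom C B0 B' \<longrightarrow> path_mor C es S' (c \<cdot> b) a \<longrightarrow>
      path_mor C S S' c a)"
  using assms(1-4)
proof (induction es arbitrary: B b B0)
  case (Cons e es)
  obtain m p where e: "e = (m, p)" by (cases e)
  have E: "ses C m p" "Dom C m = B" "path C (Cod C p) es A" using Cons.prems by (auto simp: e)
  note S = sesD[OF E(1)] and bA = Cons.prems(3)[unfolded in_Hom]
  obtain v m1 p1 where e1: "is_pushout C v m1 m b" "p1 \<cdot> v = p" "Cod C p1 = Cod C p" "ses C m1 p1"
    using ses_pushout[OF E(1), of b] bA E(2) by auto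
  note PD = pushoutD[OF e1(1)] and S1 = sesD[OF e1(4)]
  have push: "ses_mor C (m, p) (m1, p1) b (Ident C (Cod C p))"
    by (rule pushout_ses_mor[OF e1(1,2,3) E(1) e1(4)])
  have d1: "Dom C m1 = B0" using PD bA by simp
  show ?case
  \<comment> \<open>In the last sequence the right end \<open>A\<close> has to stay, so there is
    only a pushout; in all earlier ones the middle term is enlarged as well.\<close>
  proof (cases "es = []")
    case True
    then have A: "A = Cod C p" using E(3) by simp
    show ?thesis
    proof (intro exI conjI allI impI)
      show "path C B0 [(m1, p1)] A" using e1 d1 A by simp
      show "special [(m1, p1)]" using d1 Cons.prems by (simp add: special_def)
      show "path_mor C (e # es) [(m1, p1)] b (Ident C A)" using push by (simp add: True e A)
      fix S' B' A' c a assume S': "path C B' S' A'" "special S'" "c \<in> Hom C B0 B'"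
          "path_mor C (e # es) S' (c \<cdot> b) a"
      obtain m2 p2 where S'e: "S' = [(m2, p2)]" using path_mor_length[OF S'(4)] True
        by (cases S') auto
      have "ses_mor C (m1, p1) (m2, p2) c a"
        by (rule pushout_ses_mor_univ[OF e1(1,2,3) E(1) e1(4)]) (use S' bA in \<open>auto simp: S'e True
            e\<close>)
      then show "path_mor C [(m1, p1)] S' c a" by (simp add: S'e)
    qed
  next
    case False
    obtain y t where y: "ses C y t" "Dom C y = Cod C m1" "Cod C y \<in> R" "Cod C t \<in> P"
      using enough[of "Cod C m1"] S1 by auto
    note Y = sesD[OF y(1)]
    define n where "n = y \<cdot> m1"
    have n: "n \<in> Arr C" "Dom C n = B0" "Cod C n = Cod C y" using Y S1 y d1 by (simp_all add: n_def)
    have nm: "is_mono C n" unfolding n_def using Y S1 y by (intro mono_comp) simp_all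
    obtain q where q: "is_cokernel C q n" using cokernels n by blast
    have nq: "ses C n q" by (rule sesI_mono[OF nm q])
    note N = sesD[OF nq]
    \<comment> \<open>Here the hereditary condition enters: the new syzygy is the cokernel of a
      monomorphism between objects of \<open>R\<close>.\<close>
    have qR: "Cod C q \<in> R" using R_cokernel[OF nq] n y Cons.prems(4) by simp
    have "(q \<cdot> y) \<cdot> m1 = Zero C (Dom C m1) (Cod C (q \<cdot> y))"
      using N Y S1 y d1 n by (simp add: n_def)
    then obtain z where z: "z \<in> Hom C (Cod C p1) (Cod C (q \<cdot> y))" "z \<cdot> p1 = q \<cdot> y"
      using cokernel_factor[OF S1(8), of "q \<cdot> y"] N Y y n by auto
    have zH: "z \<in> Hom C (Cod C p) (Cod C q)" using z(1) N Y n e1(3) by simp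
    note zA = zH[unfolded in_Hom]
    have sz: "ses_mor C (m1, p1) (n, q) (Ident C B0) z"
      by (rule ses_morI[where h = y])
        (use e1(3,4) nq z(2) zA N Y y n d1 S1 subsetD[OF R_Obj Cons.prems(4)] in \<open>simp_all add:
            in_Hom n_def[symmetric]\<close>)
    have "ses_mor C (m, p) (n, q) (Ident C B0 \<cdot> b) (z \<cdot> Ident C (Cod C p))"
      by (rule ses_mor_comp[OF push sz])
    then have ez: "ses_mor C e (n, q) b z" using zA bA by (simp add: e)
    \<comment> \<open>The old syzygy maps to the new one by \<open>z\<close> and not by an identity;
      this is why the statement allows an arbitrary \<open>b\<close>.\<close>
    obtain S0 where S0: "path C (Cod C q) S0 A" "special S0" "path_mor C es S0 z (Ident C A)"
      and univ: "\<And>S' B' A' c a. path C B' S' A' \<Longrightarrow> special S' \<Longrightarrow> c \<in> Hom C (Cod C q) B' \<Longrightarrow>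
        path_mor C es S' (c \<cdot> z) a \<Longrightarrow> path_mor C S0 S' c a"
      using Cons.IH[OF E(3) False zH qR] by blast
    show ?thesis
    proof (intro exI conjI allI impI)
      show "path C B0 ((n, q) # S0) A" using S0 nq n by simp
      show "special ((n, q) # S0)" using S0 n Cons.prems by (simp add: special_def)
      show "path_mor C (e # es) ((n, q) # S0) b (Ident C A)" using ez S0 by auto
      fix S' B' A' c a assume S': "path C B' S' A'" "special S'" "c \<in> Hom C B0 B'"
          "path_mor C (e # es) S' (c \<cdot> b) a"
      obtain m2 p2 S'' where S'e: "S' = (m2, p2) # S''" using S'(4) by (cases S') auto
      then obtain w where w: "ses_mor C (m, p) (m2, p2) (c \<cdot> b) w" "path_mor C es S'' w a"
        using S'(4) by (auto simp: e)
      have "ses_mor C (m1, p1) (m2, p2) c w"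
        by (rule pushout_ses_mor_univ[OF e1(1,2,3) E(1) e1(4) w(1)]) (use S' bA in \<open>auto simp: S'e\<close>)
      then obtain h where h: "ses C m2 p2" "c \<in> Hom C (Dom C m1) (Dom C m2)"
          "w \<in> Hom C (Cod C p1) (Cod C p2)"
        "h \<in> Hom C (Cod C m1) (Cod C m2)" "h \<cdot> m1 = m2 \<cdot> c" "p2 \<cdot> h = w \<cdot> p1"
        by (rule ses_morE)
      note H = h(2-4)[unfolded in_Hom] and S2 = sesD[OF h(1)]
      \<comment> \<open>\<open>Cod C p2\<close> is the left end of \<open>S''\<close>, hence in
        \<open>R\<close>. So is \<open>Cod C m2\<close> as an extension, and therefore
        \<open>h\<close> extends along \<open>y\<close> to the enlarged object.\<close>
      have "S'' \<noteq> []" using path_mor_length[OF w(2)] False by auto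
      then have "Cod C p2 \<in> R" using S'(1,2) by (cases S'') (auto simp: S'e special_def)
      then have "Cod C m2 \<in> R" using R_extension[OF h(1)] S'(2) by (simp add: S'e special_def)
      then obtain k where k: "k \<in> Hom C (Cod C y) (Cod C m2)" "k \<cdot> y = h"
        using extend[OF _ y(1,4), of "Cod C m2" h] h(4) y(2) by auto
      note kA = k(1)[unfolded in_Hom]
      have kn: "k \<cdot> n = m2 \<cdot> c"
        unfolding n_def using comp_reduce[OF k(2)] kA Y S1 y(2) h(5) by simp
      have "(p2 \<cdot> k) \<cdot> n = p2 \<cdot> (m2 \<cdot> c)" using kn kA n S2 by simp
      then have "(p2 \<cdot> k) \<cdot> n = Zero C (Dom C n) (Cod C (p2 \<cdot> k))"
        using S2 H d1 n kA by (simp add: comp_reduce[OF S2(4)])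
      then obtain x where x: "x \<in> Hom C (Cod C q) (Cod C (p2 \<cdot> k))" "x \<cdot> q = p2 \<cdot> k"
        using cokernel_factor[OF q, of "p2 \<cdot> k"] S2 kA n by auto
      have xH: "x \<in> Hom C (Cod C q) (Cod C p2)" using x(1) kA S2 by simp
      note xA = xH[unfolded in_Hom]
      have sx: "ses_mor C (n, q) (m2, p2) c x"
        by (rule ses_morI[where h = k]) (use nq h(1) x(2) xH H kA kn n d1 in \<open>simp_all add: in_Hom\<close>)
      \<comment> \<open>The universal property of the tail needs its left component in the form
        \<open>x \<cdot> z\<close>.\<close>
      have "(x \<cdot> z) \<cdot> p1 = w \<cdot> p1"
      proof -
        have "(x \<cdot> z) \<cdot> p1 = x \<cdot> (q \<cdot> y)" using xA zA S1 e1(3) z(2) by simp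
        also have "\<dots> = (p2 \<cdot> k) \<cdot> y" by (rule comp_reduce[OF x(2)]) (use xA N Y n in simp_all)
        also have "\<dots> = w \<cdot> p1" using kA S2 Y k(2) h(6) by simp
        finally show ?thesis .
      qed
      then have "x \<cdot> z = w"
        using xA zA H S1 e1(3) by - (rule epi_cancel[OF S1(6)], simp_all)
      then have "path_mor C S0 S'' x a"
        using univ[of "Cod C p2" S'' A' x a] S' w(2) xH by (auto simp: S'e special_def)
      then show "path_mor C ((n, q) # S0) S' c a" using sx by (auto simp: S'e)
    qed
  qed
qed simp

end

section \<open>Classification by maps from the syzygy of a resolution\<close>

definition part :: "('o, 'm) addcat \<Rightarrow> ('m \<times> 'm) list \<Rightarrow> nat \<Rightarrow> 'm" where
  "part C es j = (if j = 0 then fst (es ! 0) else if j = length es then snd (es ! (j - 1))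
     else fst (es ! j) \<cdot>\<^bsub>C\<^esub> snd (es ! (j - 1)))"

text \<open>The Yoneda splice. It forgets the intermediate syzygies, so it determines the chain only
  up to isomorphism.\<close>

definition flat :: "('o, 'm) addcat \<Rightarrow> ('m \<times> 'm) list \<Rightarrow> 'm list" where
  "flat C es = map (part C es) [0..<Suc (length es)]"

lemma length_flat [simp]: "length (flat C es) = Suc (length es)"
  by (simp add: flat_def)

lemma nth_flat [simp]: "j \<le> length es \<Longrightarrow> flat C es ! j = part C es j"
  unfolding flat_def by (subst nth_map) (simp_all del: upt_Suc)

section \<open>Classifying arrows: naturality, existence, uniqueness, sums\<close>

context cotorsion_setup
begin

definition resolution_of :: "'o \<Rightarrow> ('m \<times> 'm) list \<Rightarrow> 'o \<Rightarrow> bool" where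
  "resolution_of Z \<sigma> A \<longleftrightarrow> path C Z \<sigma> A \<and> P_middle \<sigma> \<and> \<sigma> \<noteq> [] \<and> A \<in> Obj C"

text \<open>
  The cocycle \<open>f\<close> represents \<open>es\<close>. Comparison maps from the resolution \<open>\<sigma>\<close> need not exist for \<open>es\<close>
  itself, hence the passage to \<open>S\<close>.
\<close>

definition classifies :: "'o \<Rightarrow> 'o \<Rightarrow> ('m \<times> 'm) list \<Rightarrow> ('m \<times> 'm) list \<Rightarrow> 'm \<Rightarrow> bool" where
  "classifies A B \<sigma> es f \<longleftrightarrow> (\<exists>S. path C B S A \<and> special S \<and> path_mor C es S (Ident C B) (Ident C A) \<and>
     path_mor C \<sigma> S f (Ident C A))"

lemma resolution_of_hd:
  assumes "resolution_of Z \<sigma> A"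
  shows "fst (hd \<sigma>) \<in> Arr C" "Dom C (fst (hd \<sigma>)) = Z" "Cod C (fst (hd \<sigma>)) \<in> P" "Z \<in> Obj C"
proof -
  obtain e \<tau> where [simp]: "\<sigma> = e # \<tau>" using assms by (cases \<sigma>) (auto simp: resolution_of_def)
  have "ses C (fst e) (snd e)" "Dom C (fst e) = Z" using assms by (auto simp: resolution_of_def)
  then show "fst (hd \<sigma>) \<in> Arr C" "Dom C (fst (hd \<sigma>)) = Z" "Z \<in> Obj C" using sesD(1) by auto
  show "Cod C (fst (hd \<sigma>)) \<in> P" using assms by (auto simp: resolution_of_def P_middle_def)
qed

lemma classifies_length: "classifies A B \<sigma> es f \<Longrightarrow> length es = length \<sigma>"
  unfolding classifies_def using path_mor_length by metis

lemma classifies_hom: "classifies A B \<sigma> es f \<Longrightarrow> resolution_of Z \<sigma> A \<Longrightarrow> f \<in> Hom C Z B"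
  unfolding classifies_def resolution_of_def by (auto elim!: path_mor_hom simp: Ident_Hom)

lemma envelope:
  assumes "path C B es A" "es \<noteq> []" "B \<in> R" "A \<in> Obj C"
  obtains S where "path C B S A" "special S" "path_mor C es S (Ident C B) (Ident C A)"
    "\<And>S' B' A' c a. path C B' S' A' \<Longrightarrow> special S' \<Longrightarrow> c \<in> Hom C B B' \<Longrightarrow> path_mor C es S' c a
        \<Longrightarrow> path_mor C S S' c a"
proof -
  have B: "B \<in> Obj C" using assms(3) R_Obj by auto
  obtain S where S: "path C B S A" "special S" "path_mor C es S (Ident C B) (Ident C A)"
    and univ: "\<forall>S' B' A' c a. path C B' S' A' \<longrightarrow> special S' \<longrightarrow> c \<in> Hom C B B' \<longrightarrow>
      path_mor C es S' (c \<cdot> Ident C B) a \<longrightarrow> path_mor C S S' c a"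
    using special_envelope[OF assms(1,2) Ident_Hom[OF B] assms(3,4)] by blast
  show thesis
  proof (rule that[OF S])
    fix S' B' A' c a assume "path C B' S' A'" "special S'" "c \<in> Hom C B B'" "path_mor C es S' c a"
    moreover from this have "c \<cdot> Ident C B = c" by (simp add: in_Hom)
    ultimately show "path_mor C S S' c a" using univ by metis
  qed
qed

text \<open>The sequences \<open>S\<close> and \<open>S1\<close> that witness the two
  classifications are unrelated choices. The envelope \<open>S0\<close> of \<open>es'\<close> maps
  to both: its comparison map \<open>p\<close> is homotopic to \<open>g\<close> by way of
  \<open>S1\<close>, and \<open>b \<cdot> p\<close> is homotopic to \<open>f \<cdot> \<tau>\<close>
  by way of \<open>S\<close>.\<close>

lemma classifies_naturality:
  assumes "resolution_of Z \<sigma> A" "resolution_of Z' \<sigma>' A'" "path C B es A" "path C B' es' A'" "B' \<in> R"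
    and "path_mor C es' es b a" "path_mor C \<sigma>' \<sigma> \<tau> a" "a \<in> Hom C A' A"
    and "classifies A B \<sigma> es f" "classifies A' B' \<sigma>' es' g"
  shows "homotopic C (fst (hd \<sigma>')) (b \<cdot> g) (f \<cdot> \<tau>)"
proof -
  note r = assms(1,2)[unfolded resolution_of_def] and aA = assms(8)[unfolded in_Hom]
  have b: "b \<in> Hom C B' B" and t: "\<tau> \<in> Hom C Z' Z" using path_mor_hom assms r by blast+
  have f: "f \<in> Hom C Z B" and g: "g \<in> Hom C Z' B'" using classifies_hom assms by blast+
  note bA = b[unfolded in_Hom] and tA = t[unfolded in_Hom] and fA = f[unfolded in_Hom] and gA
      = g[unfolded in_Hom]
  obtain S where S: "path C B S A" "special S" "path_mor C es S (Ident C B) (Ident C A)"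
    "path_mor C \<sigma> S f (Ident C A)" using assms(9) by (auto simp: classifies_def)
  obtain S1 where S1: "path C B' S1 A'" "special S1" "path_mor C es' S1 (Ident C B') (Ident C A')"
    "path_mor C \<sigma>' S1 g (Ident C A')" using assms(10) by (auto simp: classifies_def)
  have "es' \<noteq> []" using classifies_length[OF assms(10)] r by auto
  then obtain S0 where S0: "path C B' S0 A'" "special S0"
      "path_mor C es' S0 (Ident C B') (Ident C A')"
    and univ: "\<And>S' B1 A1 c a. path C B1 S' A1 \<Longrightarrow> special S' \<Longrightarrow> c \<in> Hom C B' B1 \<Longrightarrow>
      path_mor C es' S' c a \<Longrightarrow> path_mor C S0 S' c a"
    using envelope[OF assms(4) _ assms(5)] r by metis
  have "path_mor C es' S (Ident C B \<cdot> b) (Ident C A \<cdot> a)" by (rule path_mor_comp[OF assms(6) S(3)])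
  then have "path_mor C es' S b a" using bA aA by simp
  then have S0S: "path_mor C S0 S b a" using univ S b by blast
  have S0S1: "path_mor C S0 S1 (Ident C B') (Ident C A')" using univ S1 bA by (auto simp: Ident_Hom)
  have len: "length S0 = length \<sigma>'" using classifies_length[OF assms(10)] path_mor_length[OF S0(3)]
    by simp
  obtain p where p: "p \<in> Hom C Z' B'" "path_mor C \<sigma>' S0 p (Ident C A')"
    using path_mor_lift[OF _ _ S0(1,2) len] r Ident_Hom by blast
  note pA = p(1)[unfolded in_Hom]
  have "path_mor C \<sigma>' S1 (Ident C B' \<cdot> p) (Ident C A' \<cdot> Ident C A')"
    by (rule path_mor_comp[OF p(2) S0S1])
  then have "path_mor C \<sigma>' S1 p (Ident C A')" using pA r by simp
  then have "homotopic C (fst (hd \<sigma>')) p g"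
    using path_mor_unique[OF _ S1(4) _ _ _ S1(1,2)] r Ident_Hom by blast
  then have 1: "homotopic C (fst (hd \<sigma>')) (b \<cdot> p) (b \<cdot> g)"
    by (rule homotopic_comp) (use bA gA in simp_all)
  have "path_mor C \<sigma>' S (b \<cdot> p) (a \<cdot> Ident C A')" by (rule path_mor_comp[OF p(2) S0S])
  then have 2: "path_mor C \<sigma>' S (b \<cdot> p) a" using aA by simp
  have "path_mor C \<sigma>' S (f \<cdot> \<tau>) (Ident C A \<cdot> a)" by (rule path_mor_comp[OF assms(7) S(4)])
  then have "path_mor C \<sigma>' S (f \<cdot> \<tau>) a" using aA by simp
  then have "homotopic C (fst (hd \<sigma>')) (b \<cdot> p) (f \<cdot> \<tau>)"
    using path_mor_unique[OF 2 _ _ _ _ S(1,2)] r assms(8) by blast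
  with 1 show ?thesis using homotopic_trans homotopic_sym by blast
qed

lemma classifies_shift:
  assumes "classifies A B \<sigma> es f" "homotopic C (fst (hd \<sigma>)) f' f" "resolution_of Z \<sigma> A"
  shows "classifies A B \<sigma> es f'"
  using assms path_mor_shift unfolding classifies_def resolution_of_def by blast

lemma classifies_exists:
  assumes "resolution_of Z \<sigma> A" "path C B es A" "B \<in> R" "length es = length \<sigma>"
  shows "\<exists>f\<in>Hom C Z B. classifies A B \<sigma> es f"
proof -
  note r = assms(1)[unfolded resolution_of_def]
  have "es \<noteq> []" using assms(4) r by auto
  then obtain S where S: "path C B S A" "special S" "path_mor C es S (Ident C B) (Ident C A)"
    using envelope[OF assms(2) _ assms(3)] r by metis
  obtain p where "p \<in> Hom C Z B" "path_mor C \<sigma> S p (Ident C A)"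
    using path_mor_lift[OF _ _ S(1,2), of Z \<sigma> A] path_mor_length[OF S(3)] assms(4) r Ident_Hom
      by auto
  with S show ?thesis unfolding classifies_def by blast
qed

text \<open>The cobase change of the first short exact sequence along \<open>f\<close> keeps its
  right end, so the rest of \<open>\<sigma>\<close> is reused. The result is weakly initial among
  the sequences with left end \<open>B\<close> that receive \<open>\<sigma>\<close> over
  \<open>f\<close>.\<close>

lemma push_path:
  assumes "path C Z \<sigma> A" "\<sigma> \<noteq> []" "f \<in> Hom C Z B" "A \<in> Obj C"
  obtains F where "path C B F A" "length F = length \<sigma>" "path_mor C \<sigma> F f (Ident C A)"
    "\<And>S B' A' a. path C B S A' \<Longrightarrow> path_mor C \<sigma> S f a \<Longrightarrow> path_mor C F S (Ident C B) a"
proof -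
  obtain m p \<tau> where \<sigma>: "\<sigma> = (m, p) # \<tau>" using assms(2) by (cases \<sigma>) auto
  have E: "ses C m p" "Dom C m = Z" "path C (Cod C p) \<tau> A" using assms by (auto simp: \<sigma>)
  note S = sesD[OF E(1)] and fA = assms(3)[unfolded in_Hom]
  obtain v m1 p1 where e1: "is_pushout C v m1 m f" "p1 \<cdot> v = p" "Cod C p1 = Cod C p" "ses C m1 p1"
    using ses_pushout[OF E(1), of f] fA E(2) by auto
  note PD = pushoutD[OF e1(1)] 
  have push: "ses_mor C (m, p) (m1, p1) f (Ident C (Cod C p))"
    by (rule pushout_ses_mor[OF e1(1,2,3) E(1) e1(4)])
  show thesis
  proof (rule that[of "(m1, p1) # \<tau>"])
    show "path C B ((m1, p1) # \<tau>) A" using E e1 PD fA by simp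
    show "path_mor C \<sigma> ((m1, p1) # \<tau>) f (Ident C A)" using push path_mor_id[OF E(3)]
      by (auto simp: \<sigma>)
    fix S A' a assume "path C B S A'" "path_mor C \<sigma> S f a"
    then obtain m2 p2 S' w where w: "S = (m2, p2) # S'" "ses_mor C (m, p) (m2, p2) f w"
        "path_mor C \<tau> S' w a" "Dom C m2 = B"
      by (cases S) (auto simp: \<sigma>)
    have "ses_mor C (m, p) (m2, p2) (Ident C B \<cdot> f) w" using w(2) fA by simp
    then have "ses_mor C (m1, p1) (m2, p2) (Ident C B) w"
      by (rule pushout_ses_mor_univ[OF e1(1,2,3) E(1) e1(4)]) (use fA w(4) obj(2)[of f] in \<open>simp_all
          add: in_Hom\<close>)
    with w show "path_mor C ((m1, p1) # \<tau>) S (Ident C B) a" by auto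
  qed (simp add: \<sigma>)
qed

text \<open>Surjectivity of the classification: the resolution is pushed out along \<open>f\<close>,
  and the envelope of the result supplies the witness.\<close>

lemma classifies_realize:
  assumes "resolution_of Z \<sigma> A" "f \<in> Hom C Z B" "B \<in> R"
  obtains F where "path C B F A" "length F = length \<sigma>" "classifies A B \<sigma> F f"
    "\<And>S A' a. path C B S A' \<Longrightarrow> path_mor C \<sigma> S f a \<Longrightarrow> path_mor C F S (Ident C B) a"
proof -
  note r = assms(1)[unfolded resolution_of_def] and fA = assms(2)[unfolded in_Hom]
  obtain F where F: "path C B F A" "length F = length \<sigma>" "path_mor C \<sigma> F f (Ident C A)"
    "\<And>S A' a. path C B S A' \<Longrightarrow> path_mor C \<sigma> S f a \<Longrightarrow> path_mor C F S (Ident C B) a"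
    using push_path[OF _ _ assms(2)] r by metis
  have "F \<noteq> []" using F(2) r by auto
  then obtain S where S: "path C B S A" "special S" "path_mor C F S (Ident C B) (Ident C A)"
    using envelope[OF F(1) _ assms(3)] r by metis
  have "path_mor C \<sigma> S (Ident C B \<cdot> f) (Ident C A \<cdot> Ident C A)"
    by (rule path_mor_comp[OF F(3) S(3)])
  then have "classifies A B \<sigma> F f" using S fA r by (auto simp: classifies_def)
  then show thesis using that F by blast
qed

text \<open>Naturality along identities.\<close>

lemma classifies_unique:
  assumes "classifies A B \<sigma> es f" "classifies A B \<sigma> es f'" "resolution_of Z \<sigma> A" "path C B es A"
      "B \<in> R"
  shows "homotopic C (fst (hd \<sigma>)) f f'"
proof -
  note r = assms(3)[unfolded resolution_of_def]
  have f: "f \<in> Hom C Z B" "f' \<in> Hom C Z B" using classifies_hom assms by blast+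
  have "homotopic C (fst (hd \<sigma>)) (Ident C B \<cdot> f) (f' \<cdot> Ident C Z)"
    by (rule classifies_naturality[OF assms(3,3,4,4,5) path_mor_id[OF assms(4)] path_mor_id _
        assms(2,1)])
      (use r Ident_Hom in auto)
  then show ?thesis using f by (simp add: in_Hom)
qed

lemma classifies_backward:
  assumes "classifies A B \<sigma> es' f" "path_mor C es es' (Ident C B) (Ident C A)" "A \<in> Obj C"
      "B \<in> Obj C"
  shows "classifies A B \<sigma> es f"
proof -
  obtain S where S: "path C B S A" "special S" "path_mor C es' S (Ident C B) (Ident C A)"
    "path_mor C \<sigma> S f (Ident C A)" using assms(1) by (auto simp: classifies_def)
  have "path_mor C es S (Ident C B \<cdot> Ident C B) (Ident C A \<cdot> Ident C A)"
    by (rule path_mor_comp[OF assms(2) S(3)])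
  with S assms(3,4) show ?thesis by (auto simp: classifies_def)
qed

text \<open>A witness for \<open>es\<close> need not receive a morphism from \<open>es'\<close>.
  Instead some \<open>f'\<close> is taken for \<open>es'\<close>; it also classifies
  \<open>es\<close>, hence is homotopic to \<open>f\<close>.\<close>

lemma classifies_forward:
  assumes "classifies A B \<sigma> es f" "path_mor C es es' (Ident C B) (Ident C A)" "resolution_of Z \<sigma> A"
      "path C B es A"
    "path C B es' A" "B \<in> R"
  shows "classifies A B \<sigma> es' f"
proof -
  have O: "A \<in> Obj C" "B \<in> Obj C" using assms(3,6) R_Obj by (auto simp: resolution_of_def)
  obtain f' where f': "classifies A B \<sigma> es' f'"
    using classifies_exists[OF assms(3,5,6)] classifies_length[OF assms(1)] path_mor_length[OF
        assms(2)] by auto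
  then have "classifies A B \<sigma> es f'" using classifies_backward assms(2) O by blast
  then have "homotopic C (fst (hd \<sigma>)) f f'" using classifies_unique assms by blast
  then show ?thesis using classifies_shift f' assms(3) by blast
qed

text \<open>Injectivity of the classification, by the zigzag
  \<open>es -> S <- F -> S' <- es'\<close> in which \<open>F\<close> is the pushout of the
  resolution along the common arrow \<open>f\<close>.\<close>

lemma classifies_connected:
  assumes "classifies A B \<sigma> es f" "classifies A B \<sigma> es' f" "resolution_of Z \<sigma> A" "B \<in> R"
  obtains S F S' where "path C B S A" "path C B F A" "path C B S' A"
    "path_mor C es S (Ident C B) (Ident C A)" "path_mor C F S (Ident C B) (Ident C A)"
    "path_mor C F S' (Ident C B) (Ident C A)" "path_mor C es' S' (Ident C B) (Ident C A)"
proof -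
  obtain S where S: "path C B S A" "path_mor C es S (Ident C B) (Ident C A)"
    "path_mor C \<sigma> S f (Ident C A)" using assms(1) by (auto simp: classifies_def)
  obtain S' where S': "path C B S' A" "path_mor C es' S' (Ident C B) (Ident C A)"
    "path_mor C \<sigma> S' f (Ident C A)" using assms(2) by (auto simp: classifies_def)
  obtain F where F: "path C B F A"
    "\<And>S A' a. path C B S A' \<Longrightarrow> path_mor C \<sigma> S f a \<Longrightarrow> path_mor C F S (Ident C B) a"
    using classifies_realize[OF assms(3) classifies_hom[OF assms(1,3)] assms(4)] by metis
  show thesis using that[OF S(1) F(1) S'(1) S(2) _ _ S'(2)] F(2) S S' by blast
qed

text \<open>\<open>es'\<close> plays the base change of \<open>es\<close> along \<open>a\<close>,
  and \<open>G\<close> the cobase change of \<open>es'\<close> along \<open>k\<close>. Naturality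
  asks only for the two morphisms of sequences and is applied once to each.\<close>

lemma classifies_induced:
  assumes "resolution_of Z \<sigma> A" "resolution_of Z' \<sigma>' A'" "path C B es A" "path C B es' A'"
      "path C B' G A'"
    "B \<in> R" "B' \<in> R"
    and "path_mor C es' es (Ident C B) a" "path_mor C es' G k (Ident C A')" "a \<in> Hom C A' A"
    and "path_mor C \<sigma>' \<sigma> \<tau> a" "classifies A B \<sigma> es f"
  shows "classifies A' B' \<sigma>' G (k \<cdot> f \<cdot> \<tau>)"
proof -
  note r = assms(1,2)[unfolded resolution_of_def] and aA = assms(10)[unfolded in_Hom]
  have t: "\<tau> \<in> Hom C Z' Z" and k: "k \<in> Hom C B B'" using path_mor_hom assms r Ident_Hom by blast+
  have f: "f \<in> Hom C Z B" using classifies_hom assms by blast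
  have len: "length es' = length \<sigma>'"
    using path_mor_length[OF assms(8)] path_mor_length[OF assms(11)] classifies_length[OF assms(12)]
      by simp
  obtain g where g: "classifies A' B \<sigma>' es' g" using classifies_exists[OF assms(2,4,6) len] by auto
  have gA: "g \<in> Hom C Z' B" using classifies_hom g assms(2) by blast
  obtain g' where g': "classifies A' B' \<sigma>' G g'"
    using classifies_exists[OF assms(2,5,7)] len path_mor_length[OF assms(9)] by auto
  have g'A: "g' \<in> Hom C Z' B'" using classifies_hom g' assms(2) by blast
  have "homotopic C (fst (hd \<sigma>')) (Ident C B \<cdot> g) (f \<cdot> \<tau>)"
    by (rule classifies_naturality[OF assms(1,2,3,4,6,8,11,10,12) g])
  then have "homotopic C (fst (hd \<sigma>')) g (f \<cdot> \<tau>)" using gA by (simp add: in_Hom)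
  then have 1: "homotopic C (fst (hd \<sigma>')) (k \<cdot> g) (k \<cdot> f \<cdot> \<tau>)"
    using k f t by (intro homotopic_comp) (simp_all add: in_Hom)
  have "homotopic C (fst (hd \<sigma>')) (k \<cdot> g) (g' \<cdot> Ident C Z')"
    by (rule classifies_naturality[OF assms(2,2,5,4,6,9) path_mor_id _ g' g]) (use r Ident_Hom in
        auto)
  then have "homotopic C (fst (hd \<sigma>')) (k \<cdot> g) g'" using g'A by (simp add: in_Hom)
  then have "homotopic C (fst (hd \<sigma>')) (k \<cdot> f \<cdot> \<tau>) g'" using 1 homotopic_trans homotopic_sym
    by blast
  then show ?thesis using classifies_shift g' assms(2) by blast
qed

text \<open>\<open>D\<close> plays the base change of a direct sum along the diagonal, with
  \<open>p\<close> and \<open>p'\<close> the projections at its left end and \<open>p + p'\<close>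
  the codiagonal. If \<open>g\<close> classifies \<open>D\<close>, then \<open>E\<close>,
  \<open>E'\<close> and \<open>G\<close> are classified by \<open>p \<cdot> g\<close>,
  \<open>p' \<cdot> g\<close> and their sum.\<close>

lemma classifies_sum:
  assumes "resolution_of Z \<sigma> A" "path C B E A" "path C B E' A" "path C B G A" "path C B0 D A"
      "B \<in> R" "B0 \<in> R"
    "classifies A B \<sigma> E f" "classifies A B \<sigma> E' f'"
    "path_mor C D E p (Ident C A)" "path_mor C D E' p' (Ident C A)"
        "path_mor C D G (p \<^bold>+ p') (Ident C A)"
  shows "classifies A B \<sigma> G (f \<^bold>+ f')"
proof -
  note r = assms(1)[unfolded resolution_of_def]
  have len: "length D = length \<sigma>" using classifies_length[OF assms(8)] path_mor_length[OF assms(10)]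
    by simp
  obtain g where g: "g \<in> Hom C Z B0" "classifies A B0 \<sigma> D g"
    using classifies_exists[OF assms(1,5,7) len] by auto
  obtain h where h: "h \<in> Hom C Z B" "classifies A B \<sigma> G h"
    using classifies_exists[OF assms(1,4,6)] len path_mor_length[OF assms(12)] by auto
  have f: "f \<in> Hom C Z B" "f' \<in> Hom C Z B" using classifies_hom assms by blast+
  have p: "p \<in> Hom C B0 B" "p' \<in> Hom C B0 B" using path_mor_hom assms r Ident_Hom by blast+
  have *: "homotopic C (fst (hd \<sigma>)) (q \<cdot> g) x"
    if "path C B X A" "path_mor C D X q (Ident C A)" "classifies A B \<sigma> X x" for X q x
  proof -
    have "homotopic C (fst (hd \<sigma>)) (q \<cdot> g) (x \<cdot> Ident C Z)"
      by (rule classifies_naturality[OF assms(1,1) that(1) assms(5,7) that(2) path_mor_id _ that(3)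
          g(2)])
        (use r Ident_Hom in auto)
    then show ?thesis using classifies_hom[OF that(3) assms(1)] by (simp add: in_Hom)
  qed
  have "homotopic C (fst (hd \<sigma>)) ((p \<cdot> g) \<^bold>+ (p' \<cdot> g)) (f \<^bold>+ f')"
    by (rule homotopic_add[OF *[OF assms(2,10,8)] *[OF assms(3,11,9)]]) (use p g in \<open>simp add:
        in_Hom\<close>)
  moreover have "(p \<cdot> g) \<^bold>+ (p' \<cdot> g) = (p \<^bold>+ p') \<cdot> g" using p g by (simp add: in_Hom add_comp)
  moreover have "homotopic C (fst (hd \<sigma>)) ((p \<^bold>+ p') \<cdot> g) h" by (rule *[OF assms(4,12) h(2)])
  ultimately have "homotopic C (fst (hd \<sigma>)) (f \<^bold>+ f') h" using homotopic_trans homotopic_sym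
    by metis
  then show ?thesis using classifies_shift h assms(1) by blast
qed

end

section \<open>Yoneda extensions\<close>

definition seq_mor :: "('o, 'm) addcat \<Rightarrow> nat \<Rightarrow> 'm list \<Rightarrow> 'm list \<Rightarrow> 'm \<Rightarrow> 'm \<Rightarrow> bool" where
  "seq_mor C n E E' b a \<longleftrightarrow> (\<exists>h. seq_morphism C n E E' h \<and> h 0 = b \<and> h (Suc n) = a)"

text \<open>The recursive form of \<open>path\<close> suits inductions from one end, whereas
  \<open>ext_seqs\<close> and \<open>flat\<close> are indexed by position.\<close>

lemma path_iff:
  "es \<noteq> [] \<Longrightarrow> path C B es A \<longleftrightarrow> (\<forall>i<length es. ses C (fst (es ! i)) (snd (es ! i))) \<and>
     (\<forall>i. Suc i < length es \<longrightarrow> Cod C (snd (es ! i)) = Dom C (fst (es ! Suc i))) \<and>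
     Dom C (fst (es ! 0)) = B \<and> Cod C (snd (es ! (length es - 1))) = A"
proof (induction es arbitrary: B rule: induct_list012)
  case (3 x y zs)
  have 1: "(\<forall>i<length (x # y # zs). Q i) \<longleftrightarrow> Q 0 \<and> (\<forall>i<length (y # zs). Q (Suc i))" for Q
    by (simp add: All_less_Suc2)
  have 2: "(\<forall>i. Suc i < length (x # y # zs) \<longrightarrow> Q i) \<longleftrightarrow> Q 0 \<and> (\<forall>i. Suc i < length (y # zs)
      \<longrightarrow> Q (Suc i))" for Q
    by (simp add: All_less_Suc2)
  have 3: "path C (Cod C (snd x)) (y # zs) A \<longleftrightarrow>
    (\<forall>i<length (y # zs). ses C (fst ((y # zs) ! i)) (snd ((y # zs) ! i))) \<and>
     (\<forall>i. Suc i < length (y # zs) \<longrightarrow> Cod C (snd ((y # zs) ! i)) = Dom C (fst ((y # zs) ! Suc i))) \<and>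
     Dom C (fst ((y # zs) ! 0)) = Cod C (snd x) \<and> Cod C (snd ((y # zs) ! (length (y # zs) - 1)))
         = A"
    by (rule 3) simp
  show ?case unfolding path.simps(2)[of C B x] 1 2 3
    apply (simp only: nth_Cons_0 nth_Cons_Suc list.size One_nat_def add_Suc_right diff_Suc_Suc
        diff_zero add_0_right)
    by (simp only: conj_ac eq_commute[of "Dom C (fst y)" "Cod C (snd x)"])
qed auto

lemma path_append: "path C B (xs @ ys) A \<longleftrightarrow> (\<exists>D. path C B xs D \<and> path C D ys A)"
  by (induction xs arbitrary: B) auto

lemma path_mor_iff:
  "path_mor C es es' b a \<longleftrightarrow> length es' = length es \<and> (\<exists>z. z 0 = b \<and> z (length es) = a \<and>
     (\<forall>i<length es. ses_mor C (es ! i) (es' ! i) (z i) (z (Suc i))))"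
proof (induction es arbitrary: es' b)
  case Nil
  show ?case by (cases es') auto
next
  case (Cons e es)
  show ?case
  proof (cases es')
    case Nil then show ?thesis by simp
  next
    case (Cons e' es'')
    show ?thesis
    proof
      assume "path_mor C (e # es) es' b a"
      then obtain w z where w: "ses_mor C e e' b w" "length es'' = length es" "z 0 = w"
          "z (length es) = a"
        "\<forall>i<length es. ses_mor C (es ! i) (es'' ! i) (z i) (z (Suc i))"
        unfolding Cons using Cons.IH by auto
      have "\<forall>i<length (e # es). ses_mor C ((e # es) ! i) (es' ! i) (case_nat b z i) (case_nat b z
          (Suc i))"
        using w by (auto simp: less_Suc_eq_0_disj Cons)
      then show "length es' = length (e # es) \<and> (\<exists>z. z 0 = b \<and> z (length (e # es)) = a \<and>
          (\<forall>i<length (e # es). ses_mor C ((e # es) ! i) (es' ! i) (z i) (z (Suc i))))"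
        using w by (intro conjI exI[of _ "case_nat b z"]) (auto simp: Cons)
    next
      assume "length es' = length (e # es) \<and> (\<exists>z. z 0 = b \<and> z (length (e # es)) = a \<and>
          (\<forall>i<length (e # es). ses_mor C ((e # es) ! i) (es' ! i) (z i) (z (Suc i))))"
      then obtain z where z: "length es'' = length es" "z 0 = b" "z (Suc (length es)) = a"
        "\<forall>i<Suc (length es). ses_mor C ((e # es) ! i) (es' ! i) (z i) (z (Suc i))"
        by (auto simp: Cons)
      have "ses_mor C e e' b (z 1)" using z(2) z(4)[rule_format, of 0] by (simp add: Cons)
      moreover have "path_mor C es es'' (z 1) a"
        using z z(4)[rule_format, of "Suc i" for i]
          by (auto simp: Cons.IH Cons intro!: exI[of _ "z \<circ> Suc"])
      ultimately show "path_mor C (e # es) es' b a" by (auto simp: Cons)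
    qed
  qed
qed

context preadditive_category
begin

text \<open>\<open>exact\<close> supplies one common kernel of the cokernel and of the next arrow.
  Any other kernel of the cokernel factors through it and conversely, so exactness can be read with
  a preferred kernel, such as a given monomorphism.\<close>

lemma kernel_transfer:
  assumes "is_kernel C k c" "is_kernel C k' c" "is_kernel C k f"
  shows "is_kernel C k' f"
proof -
  note D = kernelD[OF assms(1)] kernelD[OF assms(2)] kernelD[OF assms(3)]
  obtain u where u: "u \<in> Hom C (Dom C k') (Dom C k)" "k \<cdot> u = k'"
    using kernel_factor[OF assms(1), of k'] D by auto
  obtain w where w: "w \<in> Hom C (Dom C k) (Dom C k')" "k' \<cdot> w = k"
    using kernel_factor[OF assms(2), of k] D by auto
  note uA = u(1)[unfolded in_Hom] and wA = w(1)[unfolded in_Hom]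
  show ?thesis
  proof (rule kernelI[OF kernel_mono[OF assms(2)]])
    have "f \<cdot> k' = f \<cdot> k \<cdot> u" using u(2) by simp
    also have "\<dots> = Zero C (Dom C k) (Cod C f) \<cdot> u"
      by (rule comp_reduce[OF D(12)]) (use D uA in simp_all)
    finally show "f \<cdot> k' = Zero C (Dom C k') (Cod C f)" using uA D by simp
    fix h assume h: "h \<in> Arr C" "Cod C h = Dom C f" "f \<cdot> h = Zero C (Dom C h) (Cod C f)"
    obtain y where y: "y \<in> Hom C (Dom C h) (Dom C k)" "k \<cdot> y = h"
      using kernel_factor[OF assms(3) h] by auto
    note yA = y(1)[unfolded in_Hom]
    have "k' \<cdot> w \<cdot> y = k \<cdot> y" by (rule comp_reduce[OF w(2)]) (use wA yA D in simp_all)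
    then show "\<exists>u\<in>Hom C (Dom C h) (Dom C k'). k' \<cdot> u = h"
      using y(2) wA yA by (intro bexI[of _ "w \<cdot> y"]) (simp_all add: in_Hom)
  qed (use D in simp_all)
qed

lemma kernel_mono_comp:
  assumes "is_mono C m" "p \<in> Arr C" "Cod C p = Dom C m"
  shows "is_kernel C k (m \<cdot> p) \<longleftrightarrow> is_kernel C k p"
proof -
  note mA = mono_arr[OF assms(1)]
  have *: "(m \<cdot> p) \<cdot> h = Zero C (Dom C h) (Cod C (m \<cdot> p)) \<longleftrightarrow> p \<cdot> h = Zero C (Dom C h) (Cod C p)"
    if "h \<in> Arr C" "Cod C h = Dom C p" for h
  proof
    assume "(m \<cdot> p) \<cdot> h = Zero C (Dom C h) (Cod C (m \<cdot> p))"
    then have "p \<cdot> h = Zero C (Dom C (p \<cdot> h)) (Dom C m)"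
      using assms mA that by - (rule mono_zeroD[OF assms(1)], simp_all)
    then show "p \<cdot> h = Zero C (Dom C h) (Cod C p)" using that assms by simp
  qed (use assms mA that in simp)
  show ?thesis
  proof
    assume k: "is_kernel C k (m \<cdot> p)"
    note kD = kernelD[OF k]
    show "is_kernel C k p"
    proof (rule kernelI[OF kernel_mono[OF k]])
      show "p \<cdot> k = Zero C (Dom C k) (Cod C p)" using kD *[of k] assms mA by simp
      show "\<exists>u\<in>Hom C (Dom C h) (Dom C k). k \<cdot> u = h"
        if "h \<in> Arr C" "Cod C h = Dom C p" "p \<cdot> h = Zero C (Dom C h) (Cod C p)" for h
        using kernel_factor[OF k, of h] *[of h] that assms mA by simp
    qed (use kD assms mA in simp_all)
  next
    assume k: "is_kernel C k p"
    note kD = kernelD[OF k]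
    show "is_kernel C k (m \<cdot> p)"
    proof (rule kernelI[OF kernel_mono[OF k]])
      show "(m \<cdot> p) \<cdot> k = Zero C (Dom C k) (Cod C (m \<cdot> p))" using kD *[of k] by simp
      show "\<exists>u\<in>Hom C (Dom C h) (Dom C k). k \<cdot> u = h"
        if "h \<in> Arr C" "Cod C h = Dom C (m \<cdot> p)" "(m \<cdot> p) \<cdot> h = Zero C (Dom C h) (Cod C (m \<cdot> p))"
          for h
        using kernel_factor[OF k, of h] *[of h] that assms mA by simp
    qed (use kD assms mA in simp_all)
  qed
qed

lemma cokernel_epi_comp:
  "is_epi C q \<Longrightarrow> m \<in> Arr C \<Longrightarrow> Dom C m = Cod C q \<Longrightarrow> is_cokernel C c (m \<cdot> q) \<longleftrightarrow> is_cokernel C c m"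
  using preadditive_category.kernel_mono_comp[OF preadditive_op, of q m c] by simp

lemma part_simps:
  assumes "path C B es A" "es \<noteq> []" "j \<le> length es"
  shows "part C es j \<in> Arr C"
    "Dom C (part C es j) = (if j = 0 then B else Cod C (fst (es ! (j - 1))))"
    "Cod C (part C es j) = (if j = length es then A else Cod C (fst (es ! j)))"
proof -
  note p = assms(1)[unfolded path_iff[OF assms(2)]]
  have s: "fst (es ! i) \<in> Arr C" "snd (es ! i) \<in> Arr C"
      "Dom C (snd (es ! i)) = Cod C (fst (es ! i))"
    if "i < length es" for i using p that sesD by auto
  have c: "Dom C (fst (es ! j)) = Cod C (snd (es ! (j - 1)))" if "0 < j" "j < length es"
    using p that by (cases j) auto
  show "part C es j \<in> Arr C"
    "Dom C (part C es j) = (if j = 0 then B else Cod C (fst (es ! (j - 1))))"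
    "Cod C (part C es j) = (if j = length es then A else Cod C (fst (es ! j)))"
    using assms(2,3) p s[of j] s[of "j - 1"] s[of 0] c by (auto simp: part_def)
qed

lemma seq_obj_flat:
  assumes "path C B es A" "es \<noteq> []" "j \<le> Suc (length es)"
  shows "seq_obj C (length es) (flat C es) j =
    (if j = 0 then B else if j = Suc (length es) then A else Cod C (fst (es ! (j - 1))))"
  using part_simps[OF assms(1,2)] assms(3) by (auto simp: seq_obj_def)

lemma part_kernel:
  assumes "path C B es A" "i < length es"
  shows "is_kernel C (fst (es ! i)) (part C es (Suc i))"
proof -
  have ne: "es \<noteq> []" using assms(2) by auto
  note p = assms(1)[unfolded path_iff[OF ne]]
  have S: "ses C (fst (es ! j)) (snd (es ! j))" if "j < length es" for j using p that by auto
  note D = sesD[OF S[OF assms(2)]]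
  show ?thesis
  proof (cases "Suc i = length es")
    case False
    then have "Suc i < length es" "Dom C (fst (es ! Suc i)) = Cod C (snd (es ! i))" using p assms(2)
      by auto
    then show ?thesis using D sesD[OF S[of "Suc i"]] by (simp add: part_def kernel_mono_comp)
  next
    case True
    then have "length es - Suc 0 = i" by simp
    then show ?thesis using D True ne by (simp add: part_def)
  qed
qed

lemma flat_ext_seqs:
  assumes "path C B es A" "es \<noteq> []"
  shows "flat C es \<in> ext_seqs C (length es) A B"
proof -
  note p = assms(1)[unfolded path_iff[OF assms(2)]]
  note ps = part_simps[OF assms]
  have s: "ses C (fst (es ! i)) (snd (es ! i))" if "i < length es" for i using p that by auto
  have "set (flat C es) \<subseteq> Arr C" using ps by (auto simp: flat_def)
  moreover have "exact C (part C es i) (part C es (Suc i))" if i: "i < length es" for i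
  proof -
    note S = sesD[OF s[OF i]]
    have "is_cokernel C (snd (es ! i)) (part C es i)"
    proof (cases i)
      case (Suc k)
      then have "k < length es" "Dom C (fst (es ! i)) = Cod C (snd (es ! k))" using p i by auto
      then show ?thesis using S sesD[OF s[of k]] i Suc by (simp add: part_def cokernel_epi_comp)
    qed (use S in \<open>simp add: part_def\<close>)
    moreover have "is_kernel C (fst (es ! i)) (part C es (Suc i))"
      by (rule part_kernel[OF assms(1) i])
    moreover have "Cod C (part C es i) = Dom C (part C es (Suc i))" using ps i by simp
    ultimately show ?thesis unfolding exact_def using ps[of i] ps[of "Suc i"] i S(7) by auto
  qed
  moreover have "is_mono C (part C es 0)" "is_epi C (part C es (length es))"
    using s[of 0] s[of "length es - 1"] assms(2) sesD by (auto simp: part_def)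
  ultimately show ?thesis using ps[of 0] ps[of "length es"] by (auto simp: ext_seqs_def)
qed

lemma path_mor_imp_seq_mor:
  assumes "path_mor C es es' b a" "path C B es A" "path C B' es' A'" "es \<noteq> []"
  shows "seq_mor C (length es) (flat C es) (flat C es') b a"
proof -
  have len: "length es' = length es" using path_mor_length[OF assms(1)] .
  then have ne: "es' \<noteq> []" using assms(4) by auto
  obtain z where z: "z 0 = b" "z (length es) = a"
    "\<And>i. i < length es \<Longrightarrow> ses_mor C (es ! i) (es' ! i) (z i) (z (Suc i))"
    using assms(1)[unfolded path_mor_iff] by auto
  have "\<forall>i. \<exists>h. i < length es \<longrightarrow> h \<in> Hom C (Cod C (fst (es ! i))) (Cod C (fst (es' ! i))) \<and>
    h \<cdot> fst (es ! i) = fst (es' ! i) \<cdot> z i \<and> snd (es' ! i) \<cdot> h = z (Suc i) \<cdot> snd (es ! i)"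
    using z(3) unfolding ses_mor_def by blast
  then obtain H where H: "\<And>i. i < length es \<Longrightarrow> H i \<in> Hom C (Cod C (fst (es ! i))) (Cod C (fst (es' !
      i)))"
    "\<And>i. i < length es \<Longrightarrow> H i \<cdot> fst (es ! i) = fst (es' ! i) \<cdot> z i"
    "\<And>i. i < length es \<Longrightarrow> snd (es' ! i) \<cdot> H i = z (Suc i) \<cdot> snd (es ! i)"
    by metis
  \<comment> \<open>Index shift: for \<open>0 < j\<close>, object \<open>j\<close> of the flat
    sequence is the middle term of the short exact sequence number \<open>j - 1\<close>.\<close>
  define h where "h j = (if j = 0 then b else if j = Suc (length es) then a else H (j - 1))" for j
  note p = assms(2)[unfolded path_iff[OF assms(4)]] and p'
      = assms(3)[unfolded path_iff[OF ne], unfolded len]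
  have "b \<in> Hom C B B'" using z(3)[of 0] z(1) assms(4) p p' by (auto simp: ses_mor_def)
  moreover have "a \<in> Hom C A A'"
    using z(3)[of "length es - 1"] z(2) assms(4) p p' by (auto simp: ses_mor_def)
  ultimately have "\<forall>j\<le>Suc (length es). h j \<in> Hom C (seq_obj C (length es) (flat C es) j) (seq_obj C
      (length es) (flat C es') j)"
    using H(1) seq_obj_flat[OF assms(2,4)] seq_obj_flat[OF assms(3) ne] by (auto simp: h_def len)
  moreover have "h (Suc j) \<cdot> flat C es ! j = flat C es' ! j \<cdot> h j" if j: "j \<le> length es" for j
  proof -
    consider "j = 0" | k where "j = Suc k" "Suc k = length es" | k where "j = Suc k"
        "Suc k < length es"
      using j by (cases j) force+
    then show ?thesis
    proof cases
      case 1
      then show ?thesis using H(2)[of 0] z(1) assms(4) by (simp add: h_def part_def len)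
    next
      case 2
      then have "length es - Suc 0 = k" by simp
      then show ?thesis using 2 H(3)[of k] z(2) assms(4) by (simp add: h_def part_def len)
    next
      case 3
      have S: "ses C (fst (es ! k)) (snd (es ! k))" "ses C (fst (es ! j)) (snd (es ! j))"
        "ses C (fst (es' ! k)) (snd (es' ! k))" "ses C (fst (es' ! j)) (snd (es' ! j))"
        "Cod C (snd (es ! k)) = Dom C (fst (es ! j))"
            "Cod C (snd (es' ! k)) = Dom C (fst (es' ! j))"
        using p p' 3 by auto
      note D = sesD(1-3)[OF S(1)] sesD(1-3)[OF S(2)] sesD(1-3)[OF S(3)] sesD(1-3)[OF S(4)]
      have zA: "z j \<in> Hom C (Dom C (fst (es ! j))) (Dom C (fst (es' ! j)))"
        using z(3)[of j] 3 by (simp add: ses_mor_def)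
      note A = H(1)[of k, unfolded in_Hom] H(1)[of j, unfolded in_Hom] zA[unfolded in_Hom]
      have "H j \<cdot> fst (es ! j) \<cdot> snd (es ! k) = (fst (es' ! j) \<cdot> z j) \<cdot> snd (es ! k)"
        by (rule comp_reduce[OF H(2)]) (use A D 3 S(5,6) in simp_all)
      also have "\<dots> = (fst (es' ! j) \<cdot> snd (es' ! k)) \<cdot> H k"
        using A D 3 S(5,6) H(3)[of k] by simp
      finally show ?thesis using 3 by (simp add: h_def part_def len)
    qed
  qed
  ultimately show ?thesis unfolding seq_mor_def seq_morphism_def
    by (intro exI[of _ h]) (simp add: h_def)
qed

lemma seq_mor_imp_path_mor:
  assumes "seq_mor C (length es) (flat C es) (flat C es') b a" "path C B es A" "path C B' es' A'"
    "es \<noteq> []" "length es' = length es"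
  shows "path_mor C es es' b a"
proof -
  have ne: "es' \<noteq> []" using assms(4,5) by auto
  obtain h where h: "seq_morphism C (length es) (flat C es) (flat C es') h" "h 0 = b"
      "h (Suc (length es)) = a"
    using assms(1) by (auto simp: seq_mor_def)
  note p = assms(2)[unfolded path_iff[OF assms(4)]] and p'
      = assms(3)[unfolded path_iff[OF ne], unfolded assms(5)]
  have S: "ses C (fst (es ! i)) (snd (es ! i))" "ses C (fst (es' ! i)) (snd (es' ! i))"
    if "i < length es" for i using p p' that by auto
  have hH: "h j \<in> Hom C (seq_obj C (length es) (flat C es) j) (seq_obj C (length es) (flat C es')
      j)"
    if "j \<le> Suc (length es)" for j using h(1) that by (simp add: seq_morphism_def)
  have hS: "h (Suc i) \<in> Hom C (Cod C (fst (es ! i))) (Cod C (fst (es' ! i)))" if "i < length es"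
    for i
    using hH[of "Suc i"] seq_obj_flat[OF assms(2,4), of "Suc i"] seq_obj_flat[OF assms(3) ne, of
        "Suc i"] that assms(5) by simp
  have b: "b \<in> Hom C B B'" using hH[of 0] seq_obj_flat[OF assms(2,4), of 0] seq_obj_flat[OF assms(3)
      ne, of 0] h(2) assms(5) by simp
  have a: "a \<in> Hom C A A'" using hH[of "Suc (length es)"] seq_obj_flat[OF assms(2,4), of "Suc
      (length es)"]
      seq_obj_flat[OF assms(3) ne, of "Suc (length es)"] h(3) assms(5) by simp
  have sq: "h (Suc j) \<cdot> part C es j = part C es' j \<cdot> h j" if "j \<le> length es" for j
    using h(1) that assms(5) by (auto simp: seq_morphism_def)
  text \<open>The map on syzygies exists because \<open>h\<close> maps the image of \<open>Z\<^sub>i \<rightarrow> X\<^sub>i\<^sub>+\<^sub>1\<close> into that of its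
      counterpart.\<close>
  have left: "\<exists>z\<in>Hom C (Dom C (fst (es ! i))) (Dom C (fst (es' ! i))). fst (es' ! i) \<cdot> z
      = h (Suc i) \<cdot> fst (es ! i) \<and>
      (0 < i \<longrightarrow> z \<cdot> snd (es ! (i - 1)) = snd (es' ! (i - 1)) \<cdot> h i) \<and> (i = 0 \<longrightarrow> z
          = b)" if i: "i < length es" for i
  proof (cases i)
    case 0
    then show ?thesis using sq[of 0] b h(2) p p' assms(4) i
      by (intro bexI[of _ b]) (auto simp: part_def)
  next
    case (Suc k)
    have k: "k < length es" using i Suc by simp
    note D = sesD[OF S(1)[OF k]] and D' = sesD[OF S(2)[OF k]] and F = sesD[OF S(1)[OF i]] and F'
        = sesD[OF S(2)[OF i]]
    have c: "Cod C (snd (es ! k)) = Dom C (fst (es ! i))"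
        "Cod C (snd (es' ! k)) = Dom C (fst (es' ! i))"
      using p p' i Suc by auto
    note hk = hS[OF k, unfolded in_Hom] and hi = hS[OF i, unfolded in_Hom]
    have q: "h (Suc i) \<cdot> fst (es ! i) \<cdot> snd (es ! k) = (fst (es' ! i) \<cdot> snd (es' ! k)) \<cdot> h i"
      using sq[of i] i Suc assms(5) by (simp add: part_def)
    have "fst (es' ! i) \<cdot> (snd (es' ! k) \<cdot> h i \<cdot> fst (es ! k))
        = ((fst (es' ! i) \<cdot> snd (es' ! k)) \<cdot> h i) \<cdot> fst (es ! k)"
      using D D' F' hk c Suc by simp
    also have "\<dots> = h (Suc i) \<cdot> fst (es ! i) \<cdot> snd (es ! k) \<cdot> fst (es ! k)"
      unfolding q[symmetric] using D F hi c by simp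
    also have "\<dots> = Zero C (Dom C (fst (es ! k))) (Cod C (fst (es' ! i)))" using D F hi c by simp
    finally have "snd (es' ! k) \<cdot> h i \<cdot> fst (es ! k)
        = Zero C (Dom C (snd (es' ! k) \<cdot> h i \<cdot> fst (es ! k))) (Dom C (fst (es' ! i)))"
      using D D' F' hk c Suc by - (rule mono_zeroD[OF F'(5)], simp_all)
    then obtain z where z: "z \<in> Hom C (Cod C (snd (es ! k))) (Cod C (snd (es' ! k) \<cdot> h i))"
        "z \<cdot> snd (es ! k) = snd (es' ! k) \<cdot> h i"
      using cokernel_factor[OF D(8), of "snd (es' ! k) \<cdot> h i"] D D' hk c Suc by auto
    have zH: "z \<in> Hom C (Dom C (fst (es ! i))) (Dom C (fst (es' ! i)))"
      using z(1) D' hk c Suc by (simp add: in_Hom)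
    note zA = zH[unfolded in_Hom]
    have "(fst (es' ! i) \<cdot> z) \<cdot> snd (es ! k) = (fst (es' ! i) \<cdot> snd (es' ! k)) \<cdot> h i"
      using zA F' D D' c hk Suc z(2) by simp
    also have "\<dots> = (h (Suc i) \<cdot> fst (es ! i)) \<cdot> snd (es ! k)"
      unfolding q[symmetric] using D F hi c by simp
    finally have "fst (es' ! i) \<cdot> z = h (Suc i) \<cdot> fst (es ! i)"
      using zA F F' D hi c by - (rule epi_cancel[OF D(6)], simp_all)
    then show ?thesis using z(2) zH Suc by auto
  qed
  have "\<forall>i. \<exists>z. i < length es \<longrightarrow> z \<in> Hom C (Dom C (fst (es ! i))) (Dom C (fst (es' ! i)))
      \<and> fst (es' ! i) \<cdot> z = h (Suc i) \<cdot> fst (es ! i) \<and>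
      (0 < i \<longrightarrow> z \<cdot> snd (es ! (i - 1)) = snd (es' ! (i - 1)) \<cdot> h i) \<and> (i = 0 \<longrightarrow> z = b)"
    using left by blast
  then obtain z0 where z0: "\<And>i. i < length es
      \<Longrightarrow> z0 i \<in> Hom C (Dom C (fst (es ! i))) (Dom C (fst (es' ! i))) \<and> fst (es' ! i) \<cdot> z0 i
      = h (Suc i) \<cdot> fst (es ! i) \<and>
      (0 < i \<longrightarrow> z0 i \<cdot> snd (es ! (i - 1)) = snd (es' ! (i - 1)) \<cdot> h i) \<and> (i = 0 \<longrightarrow> z0 i = b)"
    by metis
  \<comment> \<open>The last syzygy is not the left end of a further short exact sequence, so its
    arrow is read off from the end of \<open>h\<close>.\<close>
  define z where "z i = (if i = length es then a else z0 i)" for i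
  have "ses_mor C (es ! i) (es' ! i) (z i) (z (Suc i))" if i: "i < length es" for i
  proof -
    have zi: "z i = z0 i" using i by (simp add: z_def)
    have r: "z (Suc i) \<in> Hom C (Cod C (snd (es ! i))) (Cod C (snd (es' ! i)))
        \<and> snd (es' ! i) \<cdot> h (Suc i) = z (Suc i) \<cdot> snd (es ! i)"
    proof (cases "Suc i = length es")
      case True
      then have "i = length es - 1" by simp
      then show ?thesis using True a sq[of "length es"] h(3) p p' assms(4,5)
        by (simp add: z_def part_def)
    next
      case False
      then show ?thesis using i z0[of "Suc i"] p p' by (simp add: z_def)
    qed
    show ?thesis unfolding ses_mor_def zi using S[OF i] z0[OF i] r hS[OF i]
      by (intro conjI bexI[of _ "h (Suc i)"]) simp_all
  qed
  moreover have "z 0 = b" "z (length es) = a" using z0[of 0] assms(4) by (auto simp: z_def)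
  ultimately show ?thesis unfolding path_mor_iff using assms(5) by blast
qed

end

context abelian_category
begin

text \<open>Each arrow is factored through its image, and exactness makes the monomorphism of one
  factorization a kernel of the next arrow.\<close>

lemma ext_seqs_factorization:
  assumes "E \<in> ext_seqs C n A B" "n \<ge> 1"
  obtains es where "path C B es A" "length es = n" "flat C es = E"
proof -
  have E: "length E = Suc n" "set E \<subseteq> Arr C" "Dom C (E ! 0) = B" "Cod C (E ! n) = A"
     "is_mono C (E ! 0)" "\<And>i. i < n \<Longrightarrow> exact C (E ! i) (E ! Suc i)" "is_epi C (E ! n)"
    using assms by (auto simp: ext_seqs_def)
  have EA: "E ! i \<in> Arr C" if "i \<le> n" for i using E(1,2) that by auto
  have "\<forall>i. \<exists>k e. i < n \<longrightarrow> is_epi C e \<and> Dom C e = Dom C (E ! i) \<and> Cod C e = Dom C k \<and> E ! i = k \<cdot> e \<and>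
    is_kernel C k (E ! Suc i) \<and> (i = 0 \<longrightarrow> is_kernel C (E ! 0) (E ! 1))"
  proof
    fix i
    show "\<exists>k e. i < n \<longrightarrow> is_epi C e \<and> Dom C e = Dom C (E ! i) \<and> Cod C e = Dom C k \<and> E ! i = k \<cdot> e \<and>
      is_kernel C k (E ! Suc i) \<and> (i = 0 \<longrightarrow> is_kernel C (E ! 0) (E ! 1))"
    proof (cases "i < n")
      case True
      obtain c k where ck: "is_cokernel C c (E ! i)" "is_kernel C k c" "is_kernel C k (E ! Suc i)"
        using E(6)[OF True] by (auto simp: exact_def)
      obtain e where e: "is_epi C e" "Dom C e = Dom C (E ! i)" "Cod C e = Dom C k" "E ! i = k \<cdot> e"
        by (rule image_factorization[OF ck(1,2)])
      have "is_kernel C (E ! 0) (E ! 1)" if "i = 0"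
        using kernel_transfer[OF ck(2) mono_kernel_of_cokernel[OF E(5)] ck(3)] ck(1) that by simp
      with ck(3) e show ?thesis by blast
    qed simp
  qed
  then obtain k e where ke: "\<And>i. i < n \<Longrightarrow> is_epi C (e i) \<and> Dom C (e i) = Dom C (E ! i) \<and> Cod C (e i)
      = Dom C (k i) \<and> E ! i = k i \<cdot> e i \<and>
    is_kernel C (k i) (E ! Suc i) \<and> (i = 0 \<longrightarrow> is_kernel C (E ! 0) (E ! 1))" by metis
  \<comment> \<open>At the two ends the arrows themselves are used instead of image factors, so that
    the chain starts at \<open>B\<close> and stops at \<open>A\<close> on the nose and not just up
    to isomorphism.\<close>
  define m where "m i = (if i = 0 then E ! 0 else k i)" for i
  define p where "p i = (if Suc i < n then e (Suc i) else E ! n)" for i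
  have mk: "is_kernel C (m i) (E ! Suc i)" if "i < n" for i using ke[OF that] by (auto simp: m_def)
  have Ep: "E ! Suc i = m (Suc i) \<cdot> p i" if "Suc i < n" for i using ke[OF that] that
    by (simp add: m_def p_def)
  have pe: "is_epi C (p i)" if "i < n" for i using ke[of "Suc i"] that E(7) by (auto simp: p_def)
  have pm: "Cod C (p i) = Dom C (m (Suc i))" if "Suc i < n" for i using ke[OF that] that
    by (simp add: m_def p_def)
  have ses: "ses C (m i) (p i)" if i: "i < n" for i
  proof (rule sesI_epi[OF pe[OF i]])
    show "is_kernel C (m i) (p i)"
    proof (cases "Suc i < n")
      case True
      have "is_kernel C (m i) (m (Suc i) \<cdot> p i)" using mk[OF i] Ep[OF True] by simp
      then show ?thesis
        using kernel_mono_comp[OF kernel_mono[OF mk[OF True]] epi_arr[OF pe[OF i]] pm[OF True]]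
          by simp
    next
      case False
      then have "Suc i = n" using i by simp
      then show ?thesis using mk[OF i] by (simp add: p_def)
    qed
  qed
  define es where "es = map (\<lambda>i. (m i, p i)) [0..<n]"
  have len: "length es = n" by (simp add: es_def)
  then have ne: "es \<noteq> []" using assms(2) by auto
  have nth: "es ! i = (m i, p i)" if "i < n" for i using that by (simp add: es_def)
  have "path C B es A"
    unfolding path_iff[OF ne] using ses pm nth E(3,4) assms(2) by (simp add: len m_def p_def)
  moreover have "flat C es = E"
  proof (rule nth_equalityI)
    fix j assume "j < length (flat C es)"
    then have j: "j \<le> n" by (simp add: len)
    have "part C es j = E ! j"
    proof (cases j)
      case 0
      then show ?thesis using nth[of 0] assms(2) by (simp add: part_def m_def)
    next
      case (Suc i)
      then show ?thesis using nth[of i] nth[of j] Ep[of i] j by (auto simp: part_def len p_def)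
    qed
    then show "flat C es ! j = E ! j" using j by (simp add: len)
  qed (simp add: len E)
  ultimately show thesis using that len by blast
qed

lemma seq_mor_iff_path_mor:
  assumes "path C B es A" "path C B' es' A'" "length es = n" "length es' = n" "n \<ge> 1"
  shows "seq_mor C n (flat C es) (flat C es') b a \<longleftrightarrow> path_mor C es es' b a"
  using seq_mor_imp_path_mor[of es es' b a B A B' A'] path_mor_imp_seq_mor[of es es' b a B A B' A']
      assms by fastforce

section \<open>Base change and cobase change of Yoneda sequences\<close>

lemma pullback_seq_mor:
  assumes "seq_pullback C n a E P" "n \<ge> 1"
  shows "seq_mor C n P E (Ident C (Dom C (E ! 0))) a"
proof -
  obtain u where u: "is_pullback C u (P ! n) (E ! n) a" "u \<cdot> (P ! (n - 1)) = E ! (n - 1)"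
    and eq: "\<And>i. i < n - 1 \<Longrightarrow> P ! i = E ! i" and E: "E \<in> ext_seqs C n (Cod C a) (Dom C (E ! 0))"
    and P: "P \<in> ext_seqs C n (Dom C a) (Dom C (E ! 0))"
    using assms(1) by (auto simp: seq_pullback_def)
  note PD = pullbackD[OF u(1)]
  have len: "length E = Suc n" "length P = Suc n" using E P by (auto simp: ext_seqs_def)
  have EA: "E ! i \<in> Arr C" "P ! i \<in> Arr C" if "i \<le> n" for i
    using E P that len by (auto simp: ext_seqs_def)
  have EC: "Cod C (E ! i) = Dom C (E ! Suc i)" "Cod C (P ! i) = Dom C (P ! Suc i)" if "i < n" for i
    using E P that by (auto simp: ext_seqs_def exact_def)
  have n: "Suc (n - 1) = n" using assms(2) by simp
  have uA: "u \<in> Hom C (Dom C (P ! n)) (Dom C (E ! n))" using PD by (simp add: in_Hom)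
  have D: "Dom C (P ! i) = Dom C (E ! i)" if "i < n" for i
  proof (cases "i = n - 1")
    case True
    have "Dom C (u \<cdot> (P ! (n - 1))) = Dom C (P ! (n - 1))" using uA EA[of "n - 1"] EC[of "n - 1"] n
      by (simp add: in_Hom)
    then show ?thesis using u(2) True by simp
  next
    case False
    then show ?thesis using eq[of i] that by simp
  qed
  define h where "h j = (if j < n then Ident C (Dom C (E ! j)) else if j = n then u else a)" for j
  have "h j \<in> Hom C (seq_obj C n P j) (seq_obj C n E j)" if j: "j \<le> Suc n" for j
  proof -
    consider "j < n" | "j = n" | "j = Suc n" using j by linarith
    then show ?thesis
      by cases (use uA D[of j] EA[of j] EA[of n] PD P E in \<open>auto simp: seq_obj_def h_def in_Hom
          ext_seqs_def\<close>)
  qed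
  moreover have "h (Suc j) \<cdot> P ! j = E ! j \<cdot> h j" if j: "j \<le> n" for j
  proof -
    consider "j < n - 1" | "j = n - 1" "j < n" | "j = n" using j by linarith
    then show ?thesis
    proof cases
      case 1
      then have "Suc j < n" by linarith
      then show ?thesis using 1 eq[of j] EA(1)[of j] EC(1)[of j] by (simp add: h_def)
    next
      case 2
      then show ?thesis using u(2) EA[of j] n by (simp add: h_def)
    next
      case 3
      then show ?thesis using PD by (simp add: h_def)
    qed
  qed
  ultimately show ?thesis unfolding seq_mor_def seq_morphism_def
    using assms(2) by (intro exI[of _ h]) (simp add: h_def)
qed

lemma pushout_seq_mor:
  assumes "seq_pushout C n b E P" "n \<ge> 1"
  shows "seq_mor C n E P b (Ident C (Cod C (E ! n)))"
proof -
  obtain v where v: "is_pushout C v (P ! 0) (E ! 0) b" "(P ! 1) \<cdot> v = E ! 1"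
    and eq: "\<And>i. 2 \<le> i \<Longrightarrow> i \<le> n \<Longrightarrow> P ! i = E ! i" and E: "E \<in> ext_seqs C n (Cod C (E ! n)) (Dom C b)"
    and P: "P \<in> ext_seqs C n (Cod C (E ! n)) (Cod C b)"
    using assms(1) by (auto simp: seq_pushout_def)
  note PD = pushoutD[OF v(1)]
  have len: "length E = Suc n" "length P = Suc n" using E P by (auto simp: ext_seqs_def)
  have EA: "E ! i \<in> Arr C" "P ! i \<in> Arr C" if "i \<le> n" for i
    using E P that len by (auto simp: ext_seqs_def)
  have EC: "Cod C (E ! i) = Dom C (E ! Suc i)" "Cod C (P ! i) = Dom C (P ! Suc i)" if "i < n" for i
    using E P that by (auto simp: ext_seqs_def exact_def)
  have CC: "Cod C (P ! n) = Cod C (E ! n)" "Dom C (E ! 0) = Dom C b" "Dom C (P ! 0) = Cod C b"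
    using P E by (auto simp: ext_seqs_def)
  have vA: "v \<in> Hom C (Dom C (E ! 1)) (Dom C (P ! 1))" using PD EC[of 0] assms(2)
    by (simp add: in_Hom)
  have D: "Cod C (P ! i) = Cod C (E ! i)" if "0 < i" "i \<le> n" for i
  proof (cases "i = 1")
    case True
    have "Cod C (P ! 1 \<cdot> v) = Cod C (P ! 1)" using vA EA[of 1] assms(2) by (simp add: in_Hom)
    then show ?thesis using v(2) True by simp
  next
    case False
    then show ?thesis using eq[of i] that by simp
  qed
  define h where "h j = (if j = 0 then b else if j = 1 then v else Ident C (Cod C (E ! (j - 1))))"
    for j
  have "h j \<in> Hom C (seq_obj C n E j) (seq_obj C n P j)" if j: "j \<le> Suc n" for j
  proof -
    consider "j = 0" | "j = 1" | i where "j = Suc i" "0 < i" "i < n" | "j = Suc n" "0 < n"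
      using j assms(2) by (cases j) force+
    then show ?thesis
    proof cases
      case (3 i)
      then show ?thesis using EA[of i] EA(2)[of "Suc i"] EC[of i] D[of i]
        by (simp add: h_def seq_obj_def in_Hom)
    qed (use vA EA[of n] CC PD assms(2) in \<open>auto simp: seq_obj_def h_def in_Hom\<close>)
  qed
  moreover have "h (Suc j) \<cdot> E ! j = P ! j \<cdot> h j" if j: "j \<le> n" for j
  proof -
    consider "j = 0" | "j = 1" | i where "j = Suc i" "0 < i" using j by (cases j) force+
    then show ?thesis
    proof cases
      case 1
      then show ?thesis using PD by (simp add: h_def)
    next
      case 2
      then show ?thesis using v(2) EA[of 1] assms(2) by (simp add: h_def)
    next
      case (3 i)
      then show ?thesis using eq[of j] EA[of i] EA[of j] EC[of i] j by (simp add: h_def)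
    qed
  qed
  ultimately show ?thesis unfolding seq_mor_def seq_morphism_def
    using assms(2) by (intro exI[of _ h]) (simp add: h_def)
qed

text \<open>Base change of the last short exact sequence keeps its left end, so the preceding ones
  can be retained.\<close>

lemma seq_pullback_exists:
  assumes "E \<in> ext_seqs C n A B" "a \<in> Hom C A' A" "n \<ge> 1"
  obtains P where "seq_pullback C n a E P" "P \<in> ext_seqs C n A' B"
proof -
  obtain es where es: "path C B es A" "length es = n" "flat C es = E"
    by (rule ext_seqs_factorization[OF assms(1,3)])
  obtain es0 m p where s: "es = es0 @ [(m, p)]" using es(2) assms(3)
    by (cases es rule: rev_cases) auto
  have p0: "path C B es0 (Dom C m)" "ses C m p" "Cod C p = A" using es(1)
    by (auto simp: s path_append)
  note aA = assms(2)[unfolded in_Hom]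
  obtain v m1 p1 where P: "is_pullback C v p1 p a" "v \<cdot> m1 = m" "Dom C m1 = Dom C m" "ses C m1 p1"
    using ses_pullback[OF p0(2), of a] aA p0(3) by auto
  note PD = pullbackD[OF P(1)] and M = sesD[OF P(4)]
  define fs where "fs = es0 @ [(m1, p1)]"
  have fs: "path C B fs A'" unfolding fs_def path_append using p0 P PD aA
    by (intro exI[of _ "Dom C m"]) simp
  have len: "length fs = n" "n = Suc (length es0)" using es(2) by (simp_all add: fs_def s)
  have ext: "flat C fs \<in> ext_seqs C n A' B" using flat_ext_seqs[OF fs] len by (simp add: fs_def)
  have nth: "E ! j = part C es j" "flat C fs ! j = part C fs j" if "j \<le> n" for j
    using that es(2,3) len by auto
  have last: "part C es n = p" "part C fs n = p1" using len
    by (simp_all add: part_def s fs_def nth_append)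
  \<comment> \<open>Besides the last arrow only arrow \<open>n - 1\<close> is affected, since it
    ends in the changed object. For \<open>n = 1\<close> it is the first monomorphism itself,
    otherwise an epimorphism precedes it.\<close>
  have "v \<cdot> part C fs (n - 1) = part C es (n - 1)"
  proof (cases es0 rule: rev_cases)
    case Nil
    then show ?thesis using len P(2) by (simp add: part_def s fs_def)
  next
    case (snoc ys y)
    then have "ses C (fst y) (snd y)" "Cod C (snd y) = Dom C m" using p0(1)
      by (auto simp: path_append)
    then show ?thesis using len P(2,3) PD M sesD(2)[of "fst y"
        "snd y"] comp_reduce[OF P(2), of "snd y"] sesD(3)[OF P(4)]
      by (simp add: part_def s fs_def nth_append snoc)
  qed
  moreover have "part C fs i = part C es i" if "i < n - 1" for i
    using that len by (auto simp: part_def s fs_def nth_append)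
  moreover have "Dom C (E ! 0) = B" using assms(1) by (simp add: ext_seqs_def)
  ultimately have "seq_pullback C n a E (flat C fs)"
    unfolding seq_pullback_def using assms(1) ext P(1) aA nth len last by auto
  then show thesis using that ext by blast
qed

lemma seq_pushout_exists:
  assumes "E \<in> ext_seqs C n A B" "b \<in> Hom C B B'" "n \<ge> 1"
  obtains P where "seq_pushout C n b E P" "P \<in> ext_seqs C n A B'"
proof -
  obtain es where es: "path C B es A" "length es = n" "flat C es = E"
    by (rule ext_seqs_factorization[OF assms(1,3)])
  obtain es0 m p where s: "es = (m, p) # es0" using es(2) assms(3) by (cases es) auto
  have p0: "path C (Cod C p) es0 A" "ses C m p" "Dom C m = B" using es(1) by (auto simp: s)
  note bA = assms(2)[unfolded in_Hom]
  obtain v m1 p1 where P: "is_pushout C v m1 m b" "p1 \<cdot> v = p" "Cod C p1 = Cod C p" "ses C m1 p1"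
    using ses_pushout[OF p0(2), of b] bA p0(3) by auto
  note PD = pushoutD[OF P(1)] and M = sesD[OF P(4)]
  define fs where "fs = (m1, p1) # es0"
  have fs: "path C B' fs A" unfolding fs_def using p0 P PD bA by simp
  have len: "length fs = n" "n = Suc (length es0)" using es(2) by (simp_all add: fs_def s)
  have ext: "flat C fs \<in> ext_seqs C n A B'" using flat_ext_seqs[OF fs] len by (simp add: fs_def)
  have nth: "E ! j = part C es j" "flat C fs ! j = part C fs j" if "j \<le> n" for j
    using that es(2,3) len by auto
  have "part C fs 1 \<cdot> v = part C es 1"
  proof (cases es0)
    case Nil
    then show ?thesis using len P(2) by (simp add: part_def s fs_def)
  next
    case (Cons y ys)
    then have "ses C (fst y) (snd y)" "Dom C (fst y) = Cod C p" using p0(1) by auto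
    then show ?thesis using len P(2,3) PD M sesD(1)[of "fst y" "snd y"]
      by (simp add: part_def s fs_def Cons)
  qed
  moreover have "part C fs i = part C es i" if "2 \<le> i" for i
    using that len by (auto simp: part_def s fs_def nth_Cons split: nat.splits)
  moreover have "Cod C (E ! n) = A" "part C es 0 = m" "part C fs 0 = m1"
    using assms(1) by (simp_all add: ext_seqs_def part_def s fs_def)
  ultimately have "seq_pushout C n b E (flat C fs)"
    unfolding seq_pushout_def using assms(1,3) ext P(1) bA nth len by auto
  then show thesis using that ext by blast
qed

end

section \<open>Direct sums of exact sequences\<close>

context abelian_category
begin

lemma biproductD:
  assumes "is_biproduct C X Y P i\<^sub>1 i\<^sub>2 p\<^sub>1 p\<^sub>2"
  shows "i\<^sub>1 \<in> Arr C" "Dom C i\<^sub>1 = X" "Cod C i\<^sub>1 = P" "i\<^sub>2 \<in> Arr C" "Dom C i\<^sub>2 = Y" "Cod C i\<^sub>2 = P"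
    "p\<^sub>1 \<in> Arr C" "Dom C p\<^sub>1 = P" "Cod C p\<^sub>1 = X" "p\<^sub>2 \<in> Arr C" "Dom C p\<^sub>2 = P" "Cod C p\<^sub>2 = Y"
    "X \<in> Obj C" "Y \<in> Obj C" "P \<in> Obj C"
  using assms obj by (auto simp: is_biproduct_def in_Hom)

lemma biproduct_eqs:
  assumes "is_biproduct C X Y P i\<^sub>1 i\<^sub>2 p\<^sub>1 p\<^sub>2"
  shows "p\<^sub>1 \<cdot> i\<^sub>1 = Ident C X" "p\<^sub>2 \<cdot> i\<^sub>2 = Ident C Y" "p\<^sub>1 \<cdot> i\<^sub>2 = Zero C Y X"
      "p\<^sub>2 \<cdot> i\<^sub>1 = Zero C X Y"
    "(i\<^sub>1 \<cdot> p\<^sub>1) \<^bold>+ (i\<^sub>2 \<cdot> p\<^sub>2) = Ident C P"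
  using assms by (auto simp: is_biproduct_def)

lemma biproduct_joint_mono:
  assumes "is_biproduct C X Y P i\<^sub>1 i\<^sub>2 p\<^sub>1 p\<^sub>2" "x \<in> Arr C" "y \<in> Arr C" "Cod C x = P" "Cod C y = P"
    "Dom C x = Dom C y" "p\<^sub>1 \<cdot> x = p\<^sub>1 \<cdot> y" "p\<^sub>2 \<cdot> x = p\<^sub>2 \<cdot> y"
  shows "x = y"
proof -
  note D = biproductD[OF assms(1)] and E = biproduct_eqs[OF assms(1)]
  have *: "z = (i\<^sub>1 \<cdot> (p\<^sub>1 \<cdot> z)) \<^bold>+ (i\<^sub>2 \<cdot> (p\<^sub>2 \<cdot> z))" if "z \<in> Arr C" "Cod C z = P" for z
  proof -
    have "z = ((i\<^sub>1 \<cdot> p\<^sub>1) \<^bold>+ (i\<^sub>2 \<cdot> p\<^sub>2)) \<cdot> z" unfolding E(5) using that D by simp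
    also have "\<dots> = (i\<^sub>1 \<cdot> (p\<^sub>1 \<cdot> z)) \<^bold>+ (i\<^sub>2 \<cdot> (p\<^sub>2 \<cdot> z))" using that D by (simp add: add_comp)
    finally show ?thesis .
  qed
  show ?thesis using *[OF assms(2,4)] *[OF assms(3,5)] assms(7,8) by metis
qed

lemma biproduct_ses:
  assumes "is_biproduct C X Y S i\<^sub>1 i\<^sub>2 p\<^sub>1 p\<^sub>2"
  shows "ses C i\<^sub>1 p\<^sub>2"
proof -
  note D = biproductD[OF assms(1)] and E = biproduct_eqs[OF assms(1)]
  have "is_kernel C i\<^sub>1 p\<^sub>2"
  proof (rule kernelI)
    show "is_mono C i\<^sub>1" by (rule mono_comp_right[of p\<^sub>1]) (use D E ident_mono in simp_all)
    fix h assume h: "h \<in> Arr C" "Cod C h = Dom C p\<^sub>2" "p\<^sub>2 \<cdot> h = Zero C (Dom C h) (Cod C p\<^sub>2)"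
    have "i\<^sub>1 \<cdot> (p\<^sub>1 \<cdot> h) = h"
      by (rule biproduct_joint_mono[OF assms(1)])
        (use h D in \<open>simp_all add: comp_reduce[OF E(1)] comp_reduce[OF E(4)]\<close>)
    then show "\<exists>u\<in>Hom C (Dom C h) (Dom C i\<^sub>1). i\<^sub>1 \<cdot> u = h"
      using h D by (intro bexI[of _ "p\<^sub>1 \<cdot> h"]) (simp_all add: in_Hom)
  qed (use D E in simp_all)
  moreover have "is_epi C p\<^sub>2"
    using preadditive_category.mono_comp_right[OF preadditive_op, of i\<^sub>2 p\<^sub>2] D E
      preadditive_category.ident_mono[OF preadditive_op, of Y] by simp
  ultimately show ?thesis by (intro sesI_epi)
qed

lemma dsum_proj:
  assumes "is_biproduct C X Y S i\<^sub>1 i\<^sub>2 p\<^sub>1 p\<^sub>2" "is_biproduct C X' Y' T j\<^sub>1 j\<^sub>2 q\<^sub>1 q\<^sub>2"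
    "f \<in> Hom C X X'" "g \<in> Hom C Y Y'"
  shows "(j\<^sub>1 \<cdot> f \<cdot> p\<^sub>1) \<^bold>+ (j\<^sub>2 \<cdot> g \<cdot> p\<^sub>2) \<in> Hom C S T"
    "q\<^sub>1 \<cdot> ((j\<^sub>1 \<cdot> f \<cdot> p\<^sub>1) \<^bold>+ (j\<^sub>2 \<cdot> g \<cdot> p\<^sub>2)) = f \<cdot> p\<^sub>1"
    "q\<^sub>2 \<cdot> ((j\<^sub>1 \<cdot> f \<cdot> p\<^sub>1) \<^bold>+ (j\<^sub>2 \<cdot> g \<cdot> p\<^sub>2)) = g \<cdot> p\<^sub>2"
  using biproductD[OF assms(1)] biproductD[OF assms(2)] assms(3,4)
  by (simp_all add: in_Hom comp_add biproduct_eqs(1-4)[OF assms(2), THEN comp_reduce])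

lemma dsum_comp:
  assumes "is_biproduct C X Y S i\<^sub>1 i\<^sub>2 p\<^sub>1 p\<^sub>2" "is_biproduct C X' Y' T j\<^sub>1 j\<^sub>2 q\<^sub>1 q\<^sub>2"
    "is_biproduct C X'' Y'' U k\<^sub>1 k\<^sub>2 r\<^sub>1 r\<^sub>2"
    "f \<in> Hom C X X'" "g \<in> Hom C Y Y'" "f' \<in> Hom C X' X''" "g' \<in> Hom C Y' Y''"
  shows "((k\<^sub>1 \<cdot> f' \<cdot> q\<^sub>1) \<^bold>+ (k\<^sub>2 \<cdot> g' \<cdot> q\<^sub>2)) \<cdot> ((j\<^sub>1 \<cdot> f \<cdot> p\<^sub>1) \<^bold>+ (j\<^sub>2 \<cdot> g \<cdot> p\<^sub>2)) =
    (k\<^sub>1 \<cdot> (f' \<cdot> f) \<cdot> p\<^sub>1) \<^bold>+ (k\<^sub>2 \<cdot> (g' \<cdot> g) \<cdot> p\<^sub>2)"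
proof -
  note D = biproductD[OF assms(1)] biproductD[OF assms(2)] biproductD[OF assms(3)]
  note A = assms(4-7)[unfolded in_Hom] and P = dsum_proj[OF assms(1,2,4,5)]
  let ?M = "(j\<^sub>1 \<cdot> f \<cdot> p\<^sub>1) \<^bold>+ (j\<^sub>2 \<cdot> g \<cdot> p\<^sub>2)"
  have "((k\<^sub>1 \<cdot> f' \<cdot> q\<^sub>1) \<^bold>+ (k\<^sub>2 \<cdot> g' \<cdot> q\<^sub>2)) \<cdot> ?M
      = (k\<^sub>1 \<cdot> f' \<cdot> (q\<^sub>1 \<cdot> ?M)) \<^bold>+ (k\<^sub>2 \<cdot> g' \<cdot> (q\<^sub>2 \<cdot> ?M))"
    using D A P(1)[unfolded in_Hom] by (simp add: add_comp)
  then show ?thesis unfolding P(2,3) using D A by simp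
qed

text \<open>Arrows into a biproduct are tested by the two projections, where the claim separates
  into the kernel properties of \<open>m\<close> and of \<open>m'\<close>.\<close>

lemma dsum_kernel:
  assumes "is_biproduct C (Dom C m) (Dom C m') S i\<^sub>1 i\<^sub>2 p\<^sub>1 p\<^sub>2"
    "is_biproduct C (Cod C m) (Cod C m') T j\<^sub>1 j\<^sub>2 q\<^sub>1 q\<^sub>2"
    "is_biproduct C (Cod C p) (Cod C p') U k\<^sub>1 k\<^sub>2 r\<^sub>1 r\<^sub>2"
    "is_kernel C m p" "is_kernel C m' p'"
  shows "is_kernel C ((j\<^sub>1 \<cdot> m \<cdot> p\<^sub>1) \<^bold>+ (j\<^sub>2 \<cdot> m' \<cdot> p\<^sub>2)) ((k\<^sub>1 \<cdot> p \<cdot> q\<^sub>1) \<^bold>+ (k\<^sub>2 \<cdot> p' \<cdot> q\<^sub>2))"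
proof -
  note D = biproductD[OF assms(1)] biproductD[OF assms(2)] biproductD[OF assms(3)]
  note K = kernelD[OF assms(4)] kernelD[OF assms(5)]
  have h: "m \<in> Hom C (Dom C m) (Cod C m)" "m' \<in> Hom C (Dom C m') (Cod C m')"
    "p \<in> Hom C (Cod C m) (Cod C p)" "p' \<in> Hom C (Cod C m') (Cod C p')" using K
      by (simp_all add: in_Hom)
  define M where "M = (j\<^sub>1 \<cdot> m \<cdot> p\<^sub>1) \<^bold>+ (j\<^sub>2 \<cdot> m' \<cdot> p\<^sub>2)"
  define N where "N = (k\<^sub>1 \<cdot> p \<cdot> q\<^sub>1) \<^bold>+ (k\<^sub>2 \<cdot> p' \<cdot> q\<^sub>2)"
  have M: "M \<in> Hom C S T" "q\<^sub>1 \<cdot> M = m \<cdot> p\<^sub>1" "q\<^sub>2 \<cdot> M = m' \<cdot> p\<^sub>2"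
    unfolding M_def by (rule dsum_proj[OF assms(1,2) h(1,2)])+
  have N: "N \<in> Hom C T U" "r\<^sub>1 \<cdot> N = p \<cdot> q\<^sub>1" "r\<^sub>2 \<cdot> N = p' \<cdot> q\<^sub>2"
    unfolding N_def by (rule dsum_proj[OF assms(2,3) h(3,4)])+
  note MA = M(1)[unfolded in_Hom] and NA = N(1)[unfolded in_Hom]
  note red = comp_reduce[OF M(2)] comp_reduce[OF M(3)] comp_reduce[OF N(2)] comp_reduce[OF N(3)]
      comp_reduce[OF K(4)] comp_reduce[OF K(8)]
  have "is_kernel C M N"
  proof (rule kernelI)
    show "is_mono C M"
    proof (rule monoI)
      fix g assume g: "g \<in> Arr C" "Cod C g = Dom C M" "M \<cdot> g = Zero C (Dom C g) (Cod C M)"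
      have g': "Cod C g = S" using g MA by simp
      have "m \<cdot> (p\<^sub>1 \<cdot> g) = q\<^sub>1 \<cdot> (M \<cdot> g)" "m' \<cdot> (p\<^sub>2 \<cdot> g) = q\<^sub>2 \<cdot> (M \<cdot> g)"
        using g(1) g' MA D K by (simp_all add: red)
      then have e: "m \<cdot> (p\<^sub>1 \<cdot> g) = Zero C (Dom C (p\<^sub>1 \<cdot> g)) (Cod C m)"
          "m' \<cdot> (p\<^sub>2 \<cdot> g) = Zero C (Dom C (p\<^sub>2 \<cdot> g)) (Cod C m')"
        using g g' MA D by simp_all
      have "p\<^sub>1 \<cdot> g = Zero C (Dom C g) (Dom C m)"
        using mono_zeroD[OF kernel_mono[OF assms(4)] e(1)] g(1) g' D by simp
      moreover have "p\<^sub>2 \<cdot> g = Zero C (Dom C g) (Dom C m')"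
        using mono_zeroD[OF kernel_mono[OF assms(5)] e(2)] g(1) g' D by simp
      ultimately have "g = Zero C (Dom C g) S"
        using biproduct_joint_mono[OF assms(1), of g "Zero C (Dom C g) S"] g(1) g' D by simp
      then show "g = Zero C (Dom C g) (Dom C M)" using MA by simp
    qed (use MA in simp)
    have "N \<cdot> M = Zero C S U"
      by (rule biproduct_joint_mono[OF assms(3)]) (use MA NA D K M(2,3) in \<open>simp_all add: red\<close>)
    then show "N \<cdot> M = Zero C (Dom C M) (Cod C N)" using MA NA by simp
    fix h assume h: "h \<in> Arr C" "Cod C h = Dom C N" "N \<cdot> h = Zero C (Dom C h) (Cod C N)"
    have h': "Cod C h = T" using h NA by simp
    have "p \<cdot> (q\<^sub>1 \<cdot> h) = r\<^sub>1 \<cdot> (N \<cdot> h)" "p' \<cdot> (q\<^sub>2 \<cdot> h) = r\<^sub>2 \<cdot> (N \<cdot> h)"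
      using h(1) h' NA D K by (simp_all add: red)
    then have e: "p \<cdot> (q\<^sub>1 \<cdot> h) = Zero C (Dom C (q\<^sub>1 \<cdot> h)) (Cod C p)"
        "p' \<cdot> (q\<^sub>2 \<cdot> h) = Zero C (Dom C (q\<^sub>2 \<cdot> h)) (Cod C p')"
      using h h' NA D by simp_all
    obtain u where u: "u \<in> Hom C (Dom C h) (Dom C m)" "m \<cdot> u = q\<^sub>1 \<cdot> h"
      using kernel_factor[OF assms(4) _ _ e(1)] h(1) h' D K by auto
    obtain u' where u': "u' \<in> Hom C (Dom C h) (Dom C m')" "m' \<cdot> u' = q\<^sub>2 \<cdot> h"
      using kernel_factor[OF assms(5) _ _ e(2)] h(1) h' D K by auto
    note uA = u(1)[unfolded in_Hom] u'(1)[unfolded in_Hom]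
    define w where "w = (i\<^sub>1 \<cdot> u) \<^bold>+ (i\<^sub>2 \<cdot> u')"
    have w: "w \<in> Arr C" "Dom C w = Dom C h" "Cod C w = S" "p\<^sub>1 \<cdot> w = u" "p\<^sub>2 \<cdot> w = u'"
      using uA D by (simp_all add: w_def comp_add biproduct_eqs(1-4)[OF assms(1), THEN comp_reduce])
    have "M \<cdot> w = h"
      by (rule biproduct_joint_mono[OF assms(2)])
        (use w MA h(1) h' D K u(2) u'(2) in \<open>simp_all add: red\<close>)
    then show "\<exists>u\<in>Hom C (Dom C h) (Dom C M). M \<cdot> u = h"
      using w MA by (intro bexI[of _ w]) (simp_all add: in_Hom)
  qed (use MA NA in simp_all)
  then show ?thesis by (simp add: M_def N_def)
qed

text \<open>The cokernel half is \<open>dsum_kernel\<close> in \<open>op C\<close>, where injections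
  and projections trade places.\<close>

lemma dsum_ses:
  assumes "is_biproduct C (Dom C m) (Dom C m') S i\<^sub>1 i\<^sub>2 p\<^sub>1 p\<^sub>2"
    "is_biproduct C (Cod C m) (Cod C m') T j\<^sub>1 j\<^sub>2 q\<^sub>1 q\<^sub>2"
    "is_biproduct C (Cod C p) (Cod C p') U k\<^sub>1 k\<^sub>2 r\<^sub>1 r\<^sub>2"
    "ses C m p" "ses C m' p'"
  shows "ses C ((j\<^sub>1 \<cdot> m \<cdot> p\<^sub>1) \<^bold>+ (j\<^sub>2 \<cdot> m' \<cdot> p\<^sub>2)) ((k\<^sub>1 \<cdot> p \<cdot> q\<^sub>1) \<^bold>+ (k\<^sub>2 \<cdot> p' \<cdot> q\<^sub>2))"
proof -
  note D = biproductD[OF assms(1)] biproductD[OF assms(2)] biproductD[OF assms(3)]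
  note K = sesD[OF assms(4)] sesD[OF assms(5)]
  have "is_cokernel C ((k\<^sub>1 \<cdot> p \<cdot> q\<^sub>1) \<^bold>+ (k\<^sub>2 \<cdot> p' \<cdot> q\<^sub>2)) ((j\<^sub>1 \<cdot> m \<cdot> p\<^sub>1) \<^bold>+ (j\<^sub>2 \<cdot> m' \<cdot> p\<^sub>2))"
    using abelian_category.dsum_kernel[OF abelian_op, of p p' U r\<^sub>1 r\<^sub>2 k\<^sub>1 k\<^sub>2 T q\<^sub>1 q\<^sub>2 j\<^sub>1 j\<^sub>2 m
        m' S p\<^sub>1 p\<^sub>2 i\<^sub>1 i\<^sub>2]
      assms D K by simp
  then show ?thesis using dsum_kernel[OF assms(1-3)] K by (simp add: ses_def)
qed

lemma seq_dsum_exists: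
  assumes "E \<in> ext_seqs C n A B" "E' \<in> ext_seqs C n A' B'" "n \<ge> 1"
  obtains S i\<^sub>1 i\<^sub>2 p\<^sub>1 p\<^sub>2 where "seq_dsum C n E E' S i\<^sub>1 i\<^sub>2 p\<^sub>1 p\<^sub>2"
    "S \<in> ext_seqs C n (Cod C (i\<^sub>1 (Suc n))) (Cod C (i\<^sub>1 0))"
proof -
  obtain es where es: "path C B es A" "length es = n" "flat C es = E"
    by (rule ext_seqs_factorization[OF assms(1,3)])
  obtain es' where es': "path C B' es' A'" "length es' = n" "flat C es' = E'"
    by (rule ext_seqs_factorization[OF assms(2,3)])
  have ne: "es \<noteq> []" "es' \<noteq> []" using es(2) es'(2) assms(3) by auto
  note p = es(1)[unfolded path_iff[OF ne(1)], unfolded es(2)] and p'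
      = es'(1)[unfolded path_iff[OF ne(2)], unfolded es'(2)]
  have S: "ses C (fst (es ! i)) (snd (es ! i))" "ses C (fst (es' ! i)) (snd (es' ! i))" if "i < n"
    for i
    using p p' that by auto
  \<comment> \<open>One biproduct is fixed for every pair of objects, so that the right end of each
    summed sequence is literally the left end of the next.\<close>
  have "\<forall>X Y. \<exists>t. X \<in> Obj C \<and> Y \<in> Obj C \<longrightarrow> (case t of (P, i\<^sub>1, i\<^sub>2, p\<^sub>1, p\<^sub>2) \<Rightarrow> is_biproduct C X Y P
      i\<^sub>1 i\<^sub>2 p\<^sub>1 p\<^sub>2)"
    using biproducts by simp
  then obtain bt where bt: "\<And>X Y. X \<in> Obj C \<Longrightarrow> Y \<in> Obj C \<Longrightarrow>
    (case bt X Y of (P, i\<^sub>1, i\<^sub>2, p\<^sub>1, p\<^sub>2) \<Rightarrow> is_biproduct C X Y P i\<^sub>1 i\<^sub>2 p\<^sub>1 p\<^sub>2)" by metis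
  define bo where "bo X Y = fst (bt X Y)" for X Y
  define b1 where "b1 X Y = fst (snd (bt X Y))" for X Y
  define b2 where "b2 X Y = fst (snd (snd (bt X Y)))" for X Y
  define c1 where "c1 X Y = fst (snd (snd (snd (bt X Y))))" for X Y
  define c2 where "c2 X Y = snd (snd (snd (snd (bt X Y))))" for X Y
  have bp: "is_biproduct C X Y (bo X Y) (b1 X Y) (b2 X Y) (c1 X Y) (c2 X Y)"
    if "X \<in> Obj C" "Y \<in> Obj C" for X Y
    using bt[OF that] by (simp add: bo_def b1_def b2_def c1_def c2_def case_prod_beta)
  define Z where "Z i = (if i < n then Dom C (fst (es ! i)) else A)" for i
  define Z' where "Z' i = (if i < n then Dom C (fst (es' ! i)) else A')" for i
  define X where "X i = Cod C (fst (es ! i))" for i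
  define X' where "X' i = Cod C (fst (es' ! i))" for i
  have n1: "n - 1 < n" "Suc (n - 1) = n" using assms(3) by auto
  have ZS: "Cod C (snd (es ! i)) = Z (Suc i)" "Cod C (snd (es' ! i)) = Z' (Suc i)" if i: "i < n"
    for i
  proof -
    consider "Suc i < n" | "i = n - 1" using i by linarith
    then show "Cod C (snd (es ! i)) = Z (Suc i)" "Cod C (snd (es' ! i)) = Z' (Suc i)"
      using p p' n1 by (cases; simp add: Z_def Z'_def)+
  qed
  have h: "fst (es ! i) \<in> Hom C (Z i) (X i)" "fst (es' ! i) \<in> Hom C (Z' i) (X' i)"
    "snd (es ! i) \<in> Hom C (X i) (Z (Suc i))" "snd (es' ! i) \<in> Hom C (X' i) (Z' (Suc i))" if "i < n"
      for i
    using sesD(1-3)[OF S(1)[OF that]] sesD(1-3)[OF S(2)[OF that]] ZS[OF that] that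
    by (simp_all add: in_Hom Z_def Z'_def X_def X'_def)
  have o: "X i \<in> Obj C" "X' i \<in> Obj C" "Z i \<in> Obj C" "Z' i \<in> Obj C" "Z (Suc i) \<in> Obj C"
      "Z' (Suc i) \<in> Obj C" if "i < n" for i
    using h[OF that, THEN Hom_Obj(1)] h[OF that, THEN Hom_Obj(2)] by simp_all
  define D where "D i = ((b1 (X i) (X' i) \<cdot> fst (es ! i) \<cdot> c1 (Z i) (Z' i)) \<^bold>+ (b2 (X i) (X' i) \<cdot>
      fst (es' ! i) \<cdot> c2 (Z i) (Z' i)),
    (b1 (Z (Suc i)) (Z' (Suc i)) \<cdot> snd (es ! i) \<cdot> c1 (X i) (X' i)) \<^bold>+ (b2 (Z (Suc i)) (Z' (Suc i)) \<cdot>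
        snd (es' ! i) \<cdot> c2 (X i) (X' i)))" for i
  define ds where "ds = map D [0..<n]"
  have len: "length ds = n" and nth: "\<And>i. i < n \<Longrightarrow> ds ! i = D i" by (simp_all add: ds_def)
  have dne: "ds \<noteq> []" using len assms(3) by auto
  have Dses: "ses C (fst (D i)) (snd (D i))" if i: "i < n" for i
  proof -
    have e: "Dom C (fst (es ! i)) = Z i" "Cod C (fst (es ! i)) = X i" "Dom C (fst (es' ! i)) = Z' i"
        "Cod C (fst (es' ! i)) = X' i"
      "Cod C (snd (es ! i)) = Z (Suc i)" "Cod C (snd (es' ! i)) = Z' (Suc i)"
      using h[OF i] by (simp_all add: in_Hom)
    show ?thesis unfolding D_def fst_conv snd_conv
      by (rule dsum_ses[OF _ _ _ S[OF i]]) (use bp o[OF i] e in simp_all)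
  qed
  have DH: "fst (D i) \<in> Hom C (bo (Z i) (Z' i)) (bo (X i) (X' i))"
    "snd (D i) \<in> Hom C (bo (X i) (X' i)) (bo (Z (Suc i)) (Z' (Suc i)))" if i: "i < n" for i
    unfolding D_def fst_conv snd_conv
    by (rule dsum_proj(1)[OF bp bp]; use o[OF i] h[OF i] in simp)+
  have path: "path C (bo (Z 0) (Z' 0)) ds (bo (Z n) (Z' n))"
    unfolding path_iff[OF dne] len
    using Dses DH n1 nth assms(3) by (auto simp: in_Hom)
  define V where "V j = seq_obj C n E j" for j
  define V' where "V' j = seq_obj C n E' j" for j
  have V: "V j = (if j = 0 then Z 0 else if j = Suc n then Z n else X (j - 1))"
    "V' j = (if j = 0 then Z' 0 else if j = Suc n then Z' n else X' (j - 1))" if "j \<le> Suc n" for j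
    using seq_obj_flat[OF es(1) ne(1), of j] seq_obj_flat[OF es'(1) ne(2), of j] that p p' assms(3)
    unfolding es es' V_def V'_def by (auto simp: Z_def Z'_def X_def X'_def)
  have OO: "V j \<in> Obj C" "V' j \<in> Obj C" if "j \<le> Suc n" for j
    using V[OF that] o[of "j - 1"] o[of 0] o[OF n1(1)] n1(2) that assms(3) by auto
  have sd: "seq_obj C n (flat C ds) j = bo (V j) (V' j)" if "j \<le> Suc n" for j
    using seq_obj_flat[OF path dne, of j] that DH[of "j - 1"] nth[of "j - 1"] V[OF that]
      by (auto simp: len in_Hom)
  have form: "flat C ds ! j = (b1 (V (Suc j)) (V' (Suc j)) \<cdot> (E ! j) \<cdot> c1 (V j) (V' j)) \<^bold>+
      (b2 (V (Suc j)) (V' (Suc j)) \<cdot> (E' ! j) \<cdot> c2 (V j) (V' j))" if j: "j \<le> n" for j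
  proof -
    have nE: "flat C ds ! j = part C ds j" "E ! j = part C es j" "E' ! j = part C es' j"
      using j len es(2,3) es'(2,3) nth_flat by metis+
    consider "j = 0" | k where "j = Suc k" "Suc k = n" | k where "j = Suc k" "Suc k < n"
      using j by (cases j) force+
    then show ?thesis
    proof cases
      case 1
      then show ?thesis unfolding nE using nth[of 0] V[of 0] V[of 1] assms(3)
        by (simp add: part_def D_def)
    next
      case 2
      then have "k = n - Suc 0" by simp
      then show ?thesis unfolding nE using 2 nth[of k] V[of n] V[of "Suc n"] len es(2) es'(2) ne dne
        by (simp add: part_def D_def)
    next
      case 3
      have k: "k < n" "j < n" using 3 by auto
      have "fst (D j) \<cdot> snd (D k) = (b1 (X j) (X' j) \<cdot> (fst (es ! j) \<cdot> snd (es ! k)) \<cdot> c1 (X k) (X'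
          k)) \<^bold>+
        (b2 (X j) (X' j) \<cdot> (fst (es' ! j) \<cdot> snd (es' ! k)) \<cdot> c2 (X k) (X' k))"
        unfolding D_def fst_conv snd_conv 3(1)
        by (rule dsum_comp[OF bp bp bp];
          use o[OF k(1)] o[OF k(2)[unfolded 3(1)]] h[OF k(1)] h[OF k(2)[unfolded 3(1)]] in simp)
      then show ?thesis unfolding nE using 3 k nth[of k] nth[of j] V[of j] V[of "Suc j"] len es(2)
          es'(2)
        by (simp add: part_def)
    qed
  qed
  have "seq_dsum C n E E' (flat C ds) (\<lambda>j. b1 (V j) (V' j)) (\<lambda>j. b2 (V j) (V' j)) (\<lambda>j. c1 (V j) (V'
      j)) (\<lambda>j. c2 (V j) (V' j))"
    unfolding seq_dsum_def
    using bp OO sd form by (simp add: len V_def[symmetric] V'_def[symmetric])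
  moreover have "flat C ds \<in> ext_seqs C n (bo (Z n) (Z' n)) (bo (Z 0) (Z' 0))"
    using flat_ext_seqs[OF path dne] len by simp
  then have "flat C ds \<in> ext_seqs C n (Cod C (b1 (V (Suc n)) (V' (Suc n)))) (Cod C (b1 (V 0) (V'
      0)))"
    using biproductD(3)[OF bp[OF OO[of 0]]] biproductD(3)[OF bp[OF OO[of "Suc n"]]] V[of 0] V[of
        "Suc n"] by simp
  ultimately show thesis by (rule that)
qed

end

section \<open>Yoneda Ext groups in terms of classifying arrows\<close>

context cotorsion_setup
begin

text \<open>A Yoneda sequence does not come with a factorization. By
  \<open>classifies_seq_factorization\<close> every factorization is classified by the same
  arrows.\<close>

definition classifies_seq :: "'o \<Rightarrow> 'o \<Rightarrow> ('m \<times> 'm) list \<Rightarrow> 'm list \<Rightarrow> 'm \<Rightarrow> bool" where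
  "classifies_seq A B \<sigma> E f \<longleftrightarrow> (\<exists>es. path C B es A \<and> flat C es = E \<and> classifies A B \<sigma> es f)"

definition ext_class :: "'o \<Rightarrow> 'o \<Rightarrow> ('m \<times> 'm) list \<Rightarrow> 'm \<Rightarrow> 'm list set" where
  "ext_class A B \<sigma> f = {E. classifies_seq A B \<sigma> E f}"

context
  fixes Z \<sigma> A B n
  assumes \<sigma>: "resolution_of Z \<sigma> A" "length \<sigma> = n" and B: "B \<in> R"
begin

lemma n_pos: "n \<ge> 1"
  using \<sigma> by (cases \<sigma>) (auto simp: resolution_of_def)

lemma AB: "A \<in> Obj C" "B \<in> Obj C"
  using \<sigma> B R_Obj by (auto simp: resolution_of_def)

lemma classifies_seq_seq: "classifies_seq A B \<sigma> E f \<Longrightarrow> E \<in> ext_seqs C n A B"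
  unfolding classifies_seq_def using flat_ext_seqs classifies_length \<sigma> n_pos by fastforce

lemma classifies_seq_hom: "classifies_seq A B \<sigma> E f \<Longrightarrow> f \<in> Hom C Z B"
  unfolding classifies_seq_def using classifies_hom \<sigma> by blast

lemma seq_mor_classifies_seq:
  assumes "seq_mor C n E E' (Ident C B) (Ident C A)" "E \<in> ext_seqs C n A B" "E' \<in> ext_seqs C n A B"
  shows "classifies_seq A B \<sigma> E f \<longleftrightarrow> classifies_seq A B \<sigma> E' f"
proof -
  have *: "path_mor C es es' (Ident C B) (Ident C A)"
    if "path C B es A" "flat C es = E" "path C B es' A" "flat C es' = E'" for es es'
  proof -
    have "length es = n" "length es' = n" using that(2,4) assms(2,3) length_flat[of C es]
        length_flat[of C es']
      by (auto simp: ext_seqs_def)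
    then show ?thesis using seq_mor_iff_path_mor[OF that(1,3)] assms(1) that n_pos by auto
  qed
  obtain es where es: "path C B es A" "flat C es = E"
    by (rule ext_seqs_factorization[OF assms(2) n_pos])
  obtain es' where es': "path C B es' A" "flat C es' = E'"
    by (rule ext_seqs_factorization[OF assms(3) n_pos])
  show ?thesis
    unfolding classifies_seq_def using * classifies_forward[OF _ _ \<sigma>(1) _ _ B] classifies_backward
        AB es es' by blast
qed

lemma classifies_seq_equiv:
  assumes "(E, E') \<in> ext_equiv C n A B" "classifies_seq A B \<sigma> E f"
  shows "classifies_seq A B \<sigma> E' f"
proof -
  have "(E, E') \<in> (ext_step C n A B \<union> (ext_step C n A B)\<inverse>)\<^sup>*" using assms(1)
    by (auto simp: ext_equiv_def)
  then show ?thesis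
  proof induction
    case (step F G)
    then have "F \<in> ext_seqs C n A B" "G \<in> ext_seqs C n A B"
      "seq_mor C n F G (Ident C B) (Ident C A) \<or> seq_mor C n G F (Ident C B) (Ident C A)"
      by (auto simp: ext_step_def seq_mor_def)
    then show ?case using seq_mor_classifies_seq step.IH by blast
  qed (rule assms)
qed

lemma classifies_seq_connected:
  assumes "classifies_seq A B \<sigma> E f" "classifies_seq A B \<sigma> E' f"
  shows "(E, E') \<in> ext_equiv C n A B"
proof -
  obtain es where es: "path C B es A" "flat C es = E" "classifies A B \<sigma> es f" using assms(1)
    by (auto simp: classifies_seq_def)
  obtain es' where es': "path C B es' A" "flat C es' = E'" "classifies A B \<sigma> es' f" using assms(2)
    by (auto simp: classifies_seq_def)
  obtain S F S' where S: "path C B S A" "path C B F A" "path C B S' A"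
    "path_mor C es S (Ident C B) (Ident C A)" "path_mor C F S (Ident C B) (Ident C A)"
    "path_mor C F S' (Ident C B) (Ident C A)" "path_mor C es' S' (Ident C B) (Ident C A)"
    by (rule classifies_connected[OF es(3) es'(3) \<sigma>(1) B])
  have len: "length es = n" "length es' = n" using classifies_length es(3) es'(3) \<sigma> by auto
  then have len2: "length S = n" "length S' = n" "length F = n" using S path_mor_length by metis+
  have st: "(flat C a, flat C b) \<in> ext_step C n A B"
    if "path C B a A" "path C B b A" "length a = n" "length b = n"
        "path_mor C a b (Ident C B) (Ident C A)" for a b
  proof -
    have "a \<noteq> []" "b \<noteq> []" using that(3,4) n_pos by auto
    then have "flat C a \<in> ext_seqs C n A B" "flat C b \<in> ext_seqs C n A B"
      using flat_ext_seqs[OF that(1)] flat_ext_seqs[OF that(2)] that(3,4) by auto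
    moreover have "seq_mor C n (flat C a) (flat C b) (Ident C B) (Ident C A)"
      using seq_mor_iff_path_mor[OF that(1,2)] that n_pos by auto
    ultimately show ?thesis by (auto simp: ext_step_def seq_mor_def)
  qed
  let ?r = "ext_step C n A B \<union> (ext_step C n A B)\<inverse>"
  have "(E, flat C S) \<in> ?r" "(flat C S, flat C F) \<in> ?r" "(flat C F, flat C S') \<in> ?r"
      "(flat C S', E') \<in> ?r"
    using st es es' S len len2 by blast+
  then have "(E, E') \<in> ?r\<^sup>*" by (meson rtrancl.simps)
  then show ?thesis using classifies_seq_seq assms by (auto simp: ext_equiv_def)
qed

text \<open>\<open>baer_sum\<close> and \<open>YExt_map\<close> are defined as closures of sets of
  constructed sequences. With this lemma their computation reduces to finding one such sequence and
  classifying each of them by the same arrow.\<close>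

lemma ext_equiv_image:
  assumes "G \<noteq> {}" "\<And>E. E \<in> G \<Longrightarrow> classifies_seq A B \<sigma> E f"
  shows "ext_equiv C n A B `` G = ext_class A B \<sigma> f"
proof
  show "ext_equiv C n A B `` G \<subseteq> ext_class A B \<sigma> f" using assms(2) classifies_seq_equiv
    by (auto simp: ext_class_def)
  show "ext_class A B \<sigma> f \<subseteq> ext_equiv C n A B `` G" using assms classifies_seq_connected
    unfolding ext_class_def by blast
qed

lemma ext_class_nonempty:
  assumes "f \<in> Hom C Z B"
  shows "ext_class A B \<sigma> f \<noteq> {}"
proof -
  obtain F where "path C B F A" "classifies A B \<sigma> F f" using classifies_realize[OF \<sigma>(1) assms B]
    by metis
  then show ?thesis unfolding ext_class_def classifies_seq_def by blast
qed

lemma ext_class_carrier: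
  assumes "f \<in> Hom C Z B"
  shows "ext_class A B \<sigma> f \<in> carrier (YExt C n A B)"
proof -
  obtain E where E: "classifies_seq A B \<sigma> E f" using ext_class_nonempty[OF assms]
    by (auto simp: ext_class_def)
  then have "ext_equiv C n A B `` {E} = ext_class A B \<sigma> f" by (intro ext_equiv_image) auto
  then show ?thesis using classifies_seq_seq[OF E] by (auto simp: YExt_def quotient_def)
qed

lemma carrier_ext_class:
  assumes "x \<in> carrier (YExt C n A B)"
  obtains f where "f \<in> Hom C Z B" "x = ext_class A B \<sigma> f"
proof -
  obtain E where E: "E \<in> ext_seqs C n A B" "x = ext_equiv C n A B `` {E}"
    using assms by (auto simp: YExt_def quotient_def)
  obtain es where es: "path C B es A" "length es = n" "flat C es = E"
    by (rule ext_seqs_factorization[OF E(1) n_pos])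
  obtain f where f: "f \<in> Hom C Z B" "classifies A B \<sigma> es f"
    using classifies_exists[OF \<sigma>(1) es(1) B] es(2) \<sigma>(2) by auto
  then have "classifies_seq A B \<sigma> E f" using es by (auto simp: classifies_seq_def)
  then have "ext_equiv C n A B `` {E} = ext_class A B \<sigma> f" by (intro ext_equiv_image) auto
  then show thesis using that f(1) E(2) by simp
qed

lemma ext_class_eq_iff:
  assumes "f \<in> Hom C Z B" "f' \<in> Hom C Z B"
  shows "ext_class A B \<sigma> f = ext_class A B \<sigma> f' \<longleftrightarrow> homotopic C (fst (hd \<sigma>)) f f'"
proof
  assume eq: "ext_class A B \<sigma> f = ext_class A B \<sigma> f'"
  obtain F where F: "path C B F A" "classifies A B \<sigma> F f"
    using classifies_realize[OF \<sigma>(1) assms(1) B] by metis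
  then have "flat C F \<in> ext_class A B \<sigma> f" by (auto simp: ext_class_def classifies_seq_def)
  then obtain es where es: "path C B es A" "flat C es = flat C F" "classifies A B \<sigma> es f'"
    unfolding eq by (auto simp: ext_class_def classifies_seq_def)
  have l: "length F = n" "length es = n" using classifies_length F(2) es(3) \<sigma>(2) by auto
  \<comment> \<open>\<open>es\<close> and \<open>F\<close> factor the same sequence, whose identity
    therefore becomes a morphism between the two chains.\<close>
  have "seq_mor C n (flat C es) (flat C F) (Ident C B) (Ident C A)"
    using seq_mor_iff_path_mor[OF es(1,1) l(2,2) n_pos] path_mor_id[OF es(1)] es(2) by simp
  then have "path_mor C es F (Ident C B) (Ident C A)"
    using seq_mor_iff_path_mor[OF es(1) F(1) l(2,1) n_pos] by simp
  then have "classifies A B \<sigma> F f'" using classifies_forward es(1,3) F(1) \<sigma>(1) B by blast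
  then show "homotopic C (fst (hd \<sigma>)) f f'" using classifies_unique F \<sigma>(1) B by blast
next
  assume h: "homotopic C (fst (hd \<sigma>)) f f'"
  have "classifies_seq A B \<sigma> E f \<longleftrightarrow> classifies_seq A B \<sigma> E f'" for E
    unfolding classifies_seq_def using classifies_shift[OF _ h \<sigma>(1)] classifies_shift[OF _
        homotopic_sym[OF h] \<sigma>(1)] by blast
  then show "ext_class A B \<sigma> f = ext_class A B \<sigma> f'" by (simp add: ext_class_def)
qed

end

lemma classifies_seq_factorization:
  assumes "classifies_seq A B \<sigma> E f" "resolution_of Z \<sigma> A" "length \<sigma> = n" "B \<in> R" "path C B es A"
      "flat C es = E"
  shows "classifies A B \<sigma> es f"
proof -
  obtain es' where es': "path C B es' A" "flat C es' = E" "classifies A B \<sigma> es' f" using assms(1)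
    by (auto simp: classifies_seq_def)
  note n = n_pos[OF assms(2-4)]
  have l: "length es' = n" "length es = n" using classifies_length[OF es'(3)] es'(2) assms(3,6) 
      length_flat[of C es] length_flat[of C es'] by auto
  have "seq_mor C n (flat C es') (flat C es) (Ident C B) (Ident C A)"
    using seq_mor_iff_path_mor[OF es'(1,1) l(1,1) n] path_mor_id[OF es'(1)] es'(2) assms(6) by simp
  then have "path_mor C es' es (Ident C B) (Ident C A)"
    using seq_mor_iff_path_mor[OF es'(1) assms(5) l n] by simp
  then show ?thesis using classifies_forward es' assms by blast
qed

lemma YExt_map_ext_class:
  assumes "resolution_of Z \<sigma> A" "length \<sigma> = n" "B \<in> R" "resolution_of Z' \<sigma>' A'" "length \<sigma>' = n"
      "B' \<in> R"
    "a \<in> Hom C A' A" "k \<in> Hom C B B'" "path_mor C \<sigma>' \<sigma> \<tau> a" "f \<in> Hom C Z B"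
  shows "YExt_map C n a k (ext_class A B \<sigma> f) = ext_class A' B' \<sigma>' (k \<cdot> f \<cdot> \<tau>)"
proof -
  note n = n_pos[OF assms(1-3)]
  let ?G = "{G. \<exists>E\<in>ext_class A B \<sigma> f. \<exists>P. seq_pullback C n a E P \<and> seq_pushout C n k P G}"
  note aA = assms(7)[unfolded in_Hom] and kA = assms(8)[unfolded in_Hom]
  have "ext_equiv C n A' B' `` ?G = ext_class A' B' \<sigma>' (k \<cdot> f \<cdot> \<tau>)"
  proof (rule ext_equiv_image[OF assms(4-6)])
    obtain E where E: "E \<in> ext_class A B \<sigma> f" using ext_class_nonempty[OF assms(1-3,10)] by blast
    then have Es: "E \<in> ext_seqs C n A B" using classifies_seq_seq[OF assms(1-3)]
      by (auto simp: ext_class_def)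
    obtain P where P: "seq_pullback C n a E P" "P \<in> ext_seqs C n A' B"
      by (rule seq_pullback_exists[OF Es assms(7) n])
    obtain G where G: "seq_pushout C n k P G" by (rule seq_pushout_exists[OF P(2) assms(8) n])
    show "?G \<noteq> {}" using E P G by blast
  next
    fix G assume "G \<in> ?G"
    then obtain E P where E: "classifies_seq A B \<sigma> E f" and P: "seq_pullback C n a E P" and G:
        "seq_pushout C n k P G"
      by (auto simp: ext_class_def)
    have Es: "E \<in> ext_seqs C n A B" using classifies_seq_seq[OF assms(1-3) E] .
    then have d: "Dom C (E ! 0) = B" by (simp add: ext_seqs_def)
    have Ps: "P \<in> ext_seqs C n A' B" using P d aA by (simp add: seq_pullback_def)
    then have c: "Cod C (P ! n) = A'" by (simp add: ext_seqs_def)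
    have Gs: "G \<in> ext_seqs C n A' B'" using G c kA by (simp add: seq_pushout_def)
    obtain es where es: "path C B es A" "length es = n" "flat C es = E"
      by (rule ext_seqs_factorization[OF Es n])
    obtain ps where ps: "path C B ps A'" "length ps = n" "flat C ps = P"
      by (rule ext_seqs_factorization[OF Ps n])
    obtain gs where gs: "path C B' gs A'" "length gs = n" "flat C gs = G"
      by (rule ext_seqs_factorization[OF Gs n])
    have "path_mor C ps es (Ident C B) a"
      using pullback_seq_mor[OF P n] seq_mor_iff_path_mor[OF ps(1) es(1) ps(2) es(2) n] es ps d
        by simp
    moreover have "path_mor C ps gs k (Ident C A')"
      using pushout_seq_mor[OF G n] seq_mor_iff_path_mor[OF ps(1) gs(1) ps(2) gs(2) n] gs ps c
        by simp
    moreover have "classifies A B \<sigma> es f" by (rule classifies_seq_factorization[OF E assms(1-3)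
        es(1,3)])
    ultimately have "classifies A' B' \<sigma>' gs (k \<cdot> f \<cdot> \<tau>)"
      using classifies_induced[OF assms(1,4) es(1) ps(1) gs(1) assms(3,6)] assms(7,9) by blast
    then show "classifies_seq A' B' \<sigma>' G (k \<cdot> f \<cdot> \<tau>)" using gs by (auto simp: classifies_seq_def)
  qed
  then show ?thesis unfolding YExt_map_def using aA kA by simp
qed

lemma R_biproduct:
  assumes "is_biproduct C X Y S i\<^sub>1 i\<^sub>2 p\<^sub>1 p\<^sub>2" "X \<in> R" "Y \<in> R"
  shows "S \<in> R"
  using R_extension[OF biproduct_ses[OF assms(1)]] biproductD[OF assms(1)] assms(2,3) by simp

lemma baer_sum_ext_class:
  assumes "resolution_of Z \<sigma> A" "length \<sigma> = n" "B \<in> R" "f \<in> Hom C Z B" "f' \<in> Hom C Z B"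
  shows "baer_sum C n A B (ext_class A B \<sigma> f) (ext_class A B \<sigma> f') = ext_class A B \<sigma> (f \<^bold>+ f')"
  unfolding baer_sum_def
proof (rule ext_equiv_image[OF assms(1-3)])
  note n = n_pos[OF assms(1-3)] and AB = AB[OF assms(1-3)]
  have objs: "seq_obj C n E 0 = B" "seq_obj C n E (Suc n) = A" if "E \<in> ext_seqs C n A B" for E
    using that by (simp_all add: seq_obj_def ext_seqs_def)
  let ?G = "{G. \<exists>E\<in>ext_class A B \<sigma> f. \<exists>E'\<in>ext_class A B \<sigma> f'. \<exists>S P i\<^sub>1 i\<^sub>2 p\<^sub>1 p\<^sub>2. seq_dsum C n E
      E' S i\<^sub>1 i\<^sub>2 p\<^sub>1 p\<^sub>2 \<and>
        seq_pullback C n (i\<^sub>1 (Suc n) \<^bold>+ i\<^sub>2 (Suc n)) S P \<and> seq_pushout C n (p\<^sub>1 0 \<^bold>+ p\<^sub>2 0) P G}"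
  have bp: "is_biproduct C A A (seq_obj C n S (Suc n)) (i\<^sub>1 (Suc n)) (i\<^sub>2 (Suc n)) (p\<^sub>1 (Suc n))
      (p\<^sub>2 (Suc n))"
    "is_biproduct C B B (seq_obj C n S 0) (i\<^sub>1 0) (i\<^sub>2 0) (p\<^sub>1 0) (p\<^sub>2 0)"
    if "seq_dsum C n E E' S i\<^sub>1 i\<^sub>2 p\<^sub>1 p\<^sub>2" "E \<in> ext_seqs C n A B" "E' \<in> ext_seqs C n A B"
      for E E' S i\<^sub>1 i\<^sub>2 p\<^sub>1 p\<^sub>2
    using that(1) objs[OF that(2)] objs[OF that(3)] unfolding seq_dsum_def by (metis le_refl le0)+
  show "?G \<noteq> {}"
  proof -
    obtain E E' where E: "E \<in> ext_class A B \<sigma> f" "E' \<in> ext_class A B \<sigma> f'"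
      using ext_class_nonempty[OF assms(1-3)] assms(4,5) by blast
    then have Es: "E \<in> ext_seqs C n A B" "E' \<in> ext_seqs C n A B"
      using classifies_seq_seq[OF assms(1-3)] by (auto simp: ext_class_def)
    obtain S i\<^sub>1 i\<^sub>2 p\<^sub>1 p\<^sub>2 where S: "seq_dsum C n E E' S i\<^sub>1 i\<^sub>2 p\<^sub>1 p\<^sub>2"
      "S \<in> ext_seqs C n (Cod C (i\<^sub>1 (Suc n))) (Cod C (i\<^sub>1 0))" by (rule seq_dsum_exists[OF Es n])
    note b = biproductD[OF bp(1)[OF S(1) Es]] biproductD[OF bp(2)[OF S(1) Es]]
    obtain P where P: "seq_pullback C n (i\<^sub>1 (Suc n) \<^bold>+ i\<^sub>2 (Suc n)) S P"
        "P \<in> ext_seqs C n A (Cod C (i\<^sub>1 0))"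
      by (rule seq_pullback_exists[OF S(2) _ n, of "i\<^sub>1 (Suc n) \<^bold>+ i\<^sub>2 (Suc n)" A]) (use b in \<open>simp
          add: in_Hom\<close>)
    obtain G where "seq_pushout C n (p\<^sub>1 0 \<^bold>+ p\<^sub>2 0) P G"
      by (rule seq_pushout_exists[OF P(2) _ n, of "p\<^sub>1 0 \<^bold>+ p\<^sub>2 0" B]) (use b in \<open>simp add: in_Hom\<close>)
    then show ?thesis using E S P by blast
  qed
  fix G assume "G \<in> ?G"
  then obtain E E' S P i\<^sub>1 i\<^sub>2 p\<^sub>1 p\<^sub>2 where E: "classifies_seq A B \<sigma> E f"
      "classifies_seq A B \<sigma> E' f'" and S: "seq_dsum C n E E' S i\<^sub>1 i\<^sub>2 p\<^sub>1 p\<^sub>2"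
    and P: "seq_pullback C n (i\<^sub>1 (Suc n) \<^bold>+ i\<^sub>2 (Suc n)) S P" and G: "seq_pushout C n (p\<^sub>1 0 \<^bold>+ p\<^sub>2
        0) P G"
    by (auto simp: ext_class_def)
  have Es: "E \<in> ext_seqs C n A B" "E' \<in> ext_seqs C n A B" using classifies_seq_seq[OF assms(1-3)] E
    by auto
  note bpA = bp(1)[OF S Es] and bpB = bp(2)[OF S Es]
  note bA = biproductD[OF bpA] and bB = biproductD[OF bpB] and eA = biproduct_eqs[OF bpA]
  define B0 where "B0 = seq_obj C n S 0"
  define A0 where "A0 = seq_obj C n S (Suc n)"
  have d0: "Dom C (S ! 0) = B0" by (simp add: B0_def seq_obj_def)
  have Ss: "S \<in> ext_seqs C n A0 B0" using P bA d0 by (simp add: seq_pullback_def A0_def)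
  have Ps: "P \<in> ext_seqs C n A B0" using P bA d0 by (simp add: seq_pullback_def)
  then have c: "Cod C (P ! n) = A" by (simp add: ext_seqs_def)
  have Gs: "G \<in> ext_seqs C n A B" using G c bB by (simp add: seq_pushout_def)
  have sd: "is_biproduct C (seq_obj C n E j) (seq_obj C n E' j) (seq_obj C n S j) (i\<^sub>1 j) (i\<^sub>2 j)
      (p\<^sub>1 j) (p\<^sub>2 j)"
    if "j \<le> Suc n" for j using S that by (simp add: seq_dsum_def)
  have sf: "S ! j = (i\<^sub>1 (Suc j) \<cdot> (E ! j) \<cdot> p\<^sub>1 j) \<^bold>+ (i\<^sub>2 (Suc j) \<cdot> (E' ! j) \<cdot> p\<^sub>2 j)"
    if "j \<le> n" for j using S that by (simp add: seq_dsum_def)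
  have EH: "X ! j \<in> Hom C (seq_obj C n X j) (seq_obj C n X (Suc j))"
    if "X \<in> ext_seqs C n A B" "j \<le> n" for X j
  proof -
    have "X ! j \<in> Arr C" using that by (auto simp: ext_seqs_def)
    moreover have "j < n \<Longrightarrow> Cod C (X ! j) = Dom C (X ! Suc j)" using that
      by (auto simp: ext_seqs_def exact_def)
    moreover have "j < n \<or> j = n" using that by auto
    ultimately show ?thesis by (auto simp: in_Hom seq_obj_def)
  qed
  \<comment> \<open>The projections of the direct sum are morphisms of sequences. Composed with the
    base change along the diagonal they induce the identity on \<open>A\<close>, as
    \<open>classifies_sum\<close> requires.\<close>
  have "seq_morphism C n S E p\<^sub>1" "seq_morphism C n S E' p\<^sub>2"
    unfolding seq_morphism_def
    using dsum_proj[OF sd sd EH[OF Es(1)] EH[OF Es(2)]] biproductD[OF sd] sf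
      by (simp_all add: in_Hom)
  then have m: "seq_mor C n S E (p\<^sub>1 0) (p\<^sub>1 (Suc n))" "seq_mor C n S E' (p\<^sub>2 0) (p\<^sub>2 (Suc n))"
    by (auto simp: seq_mor_def)
  obtain es where es: "path C B es A" "length es = n" "flat C es = E"
    by (rule ext_seqs_factorization[OF Es(1) n])
  obtain es' where es': "path C B es' A" "length es' = n" "flat C es' = E'"
    by (rule ext_seqs_factorization[OF Es(2) n])
  obtain ps where ps: "path C B0 ps A" "length ps = n" "flat C ps = P"
    by (rule ext_seqs_factorization[OF Ps n])
  obtain gs where gs: "path C B gs A" "length gs = n" "flat C gs = G"
    by (rule ext_seqs_factorization[OF Gs n])
  obtain ss where ss: "path C B0 ss A0" "length ss = n" "flat C ss = S"
    by (rule ext_seqs_factorization[OF Ss n])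
  have "path_mor C ps ss (Ident C B0) (i\<^sub>1 (Suc n) \<^bold>+ i\<^sub>2 (Suc n))"
    using pullback_seq_mor[OF P n] seq_mor_iff_path_mor[OF ps(1) ss(1) ps(2) ss(2) n] ss ps d0
      by simp
  moreover have "path_mor C ss es (p\<^sub>1 0) (p\<^sub>1 (Suc n))" "path_mor C ss es' (p\<^sub>2 0) (p\<^sub>2 (Suc n))"
    using m seq_mor_iff_path_mor[OF ss(1) es(1) ss(2) es(2) n] seq_mor_iff_path_mor[OF ss(1) es'(1)
        ss(2) es'(2) n] ss es es' by auto
  ultimately have "path_mor C ps es (p\<^sub>1 0 \<cdot> Ident C B0) (p\<^sub>1 (Suc n) \<cdot> (i\<^sub>1 (Suc n) \<^bold>+ i\<^sub>2 (Suc
      n)))"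
    "path_mor C ps es' (p\<^sub>2 0 \<cdot> Ident C B0) (p\<^sub>2 (Suc n) \<cdot> (i\<^sub>1 (Suc n) \<^bold>+ i\<^sub>2 (Suc n)))"
    using path_mor_comp by blast+
  then have 1: "path_mor C ps es (p\<^sub>1 0) (Ident C A)" "path_mor C ps es' (p\<^sub>2 0) (Ident C A)"
    using bA bB eA by (simp_all add: B0_def comp_add)
  have 2: "path_mor C ps gs (p\<^sub>1 0 \<^bold>+ p\<^sub>2 0) (Ident C A)"
    using pushout_seq_mor[OF G n] seq_mor_iff_path_mor[OF ps(1) gs(1) ps(2) gs(2) n] gs ps c by simp
  have "B0 \<in> R" using R_biproduct[OF bpB assms(3,3)] by (simp add: B0_def)
  then have "classifies A B \<sigma> gs (f \<^bold>+ f')"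
    using classifies_sum[OF assms(1) es(1) es'(1) gs(1) ps(1) assms(3) _ _ _ 1 2]
      classifies_seq_factorization[OF E(1) assms(1-3) es(1,3)] classifies_seq_factorization[OF E(2)
          assms(1-3) es'(1,3)] by blast
  then show "classifies_seq A B \<sigma> G (f \<^bold>+ f')" using gs by (auto simp: classifies_seq_def)
qed

end

section \<open>Vanishing of the Yoneda groups in degrees one and two\<close>

context abelian_category
begin

lemma short_exact_iff_ses: "short_exact C f g \<longleftrightarrow> ses C f g"
proof
  assume a: "short_exact C f g"
  then obtain c k where ck: "is_cokernel C c f" "is_kernel C k c" "is_kernel C k g"
    by (auto simp: short_exact_def exact_def)
  have "is_kernel C f g"
    using kernel_transfer[OF ck(2) mono_kernel_of_cokernel ck(3)] a ck(1)
      by (simp add: short_exact_def)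
  then show "ses C f g" using a sesI_epi by (simp add: short_exact_def)
next
  assume a: "ses C f g"
  note D = sesD[OF a]
  have "exact C f g" unfolding exact_def using D by auto
  then show "short_exact C f g" using D by (simp add: short_exact_def)
qed

lemma ext_seqs_1:
  assumes "E \<in> ext_seqs C 1 X Y"
  obtains m p where "E = [m, p]" "ses C m p" "Dom C m = Y" "Cod C p = X"
proof -
  obtain es where es: "path C Y es X" "length es = 1" "flat C es = E"
    by (rule ext_seqs_factorization[OF assms]) simp
  then obtain m p where [simp]: "es = [(m, p)]" by (cases es) auto
  have "E = [m, p]" using es(3) by (simp add: flat_def part_def)
  then show thesis using that es(1) by simp
qed

lemma ses_ext_seqs_1: "ses C m p \<Longrightarrow> [m, p] \<in> ext_seqs C 1 (Cod C p) (Dom C m)"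
  using flat_ext_seqs[of "Dom C m" "[(m, p)]" "Cod C p"] by (simp add: flat_def part_def)

lemma seq_mor_1:
  assumes "seq_mor C 1 [m, p] [m', p'] (Ident C Y) (Ident C X)" "ses C m p" "ses C m' p'"
    "Dom C m = Y" "Dom C m' = Y" "Cod C p = X" "Cod C p' = X"
  shows "ses_mor C (m, p) (m', p') (Ident C Y) (Ident C X)"
  using seq_mor_iff_path_mor[of Y "[(m, p)]" X Y "[(m', p')]" X 1 "Ident C Y" "Ident C X"] assms
  by (simp add: flat_def part_def)

text \<open>A section is carried forward by \<open>h\<close>. In the other direction it is a
  retraction that can be carried along, and by duality a retraction yields a section.\<close>

lemma ses_mor_split_iff:
  assumes "ses_mor C (m, p) (m', p') (Ident C (Dom C m)) (Ident C (Cod C p))"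
  shows "(\<exists>s\<in>Hom C (Cod C p) (Cod C m). p \<cdot> s = Ident C (Cod C p)) \<longleftrightarrow>
    (\<exists>s\<in>Hom C (Cod C p') (Cod C m'). p' \<cdot> s = Ident C (Cod C p'))"
proof -
  obtain h where h: "ses C m p" "ses C m' p'" "Ident C (Dom C m) \<in> Hom C (Dom C m) (Dom C m')"
    "Ident C (Cod C p) \<in> Hom C (Cod C p) (Cod C p')"
    "h \<in> Hom C (Cod C m) (Cod C m')" "h \<cdot> m = m' \<cdot> Ident C (Dom C m)"
        "p' \<cdot> h = Ident C (Cod C p) \<cdot> p"
    using assms by (rule ses_morE)
  note S = sesD[OF h(1)] and S' = sesD[OF h(2)]
  have d: "Dom C m' = Dom C m" "Cod C p' = Cod C p" using h(3,4) S by (auto simp: in_Hom)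
  have H: "h \<in> Arr C" "Dom C h = Cod C m" "Cod C h = Cod C m'" "h \<cdot> m = m'" "p' \<cdot> h = p"
    using h(5-7) S S' d by (simp_all add: in_Hom)
  show ?thesis
  proof
    assume "\<exists>s\<in>Hom C (Cod C p) (Cod C m). p \<cdot> s = Ident C (Cod C p)"
    then obtain s where s: "s \<in> Hom C (Cod C p) (Cod C m)" "p \<cdot> s = Ident C (Cod C p)" by blast
    note sA = s(1)[unfolded in_Hom]
    have "p' \<cdot> (h \<cdot> s) = Ident C (Cod C p')" using s(2) sA H S S' d
      by (simp add: comp_reduce[OF H(5)])
    then show "\<exists>s\<in>Hom C (Cod C p') (Cod C m'). p' \<cdot> s = Ident C (Cod C p')"
      using sA H d by (intro bexI[of _ "h \<cdot> s"]) (simp_all add: in_Hom)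
  next
    assume "\<exists>s\<in>Hom C (Cod C p') (Cod C m'). p' \<cdot> s = Ident C (Cod C p')"
    then obtain r where r: "r \<in> Hom C (Cod C m') (Dom C m')" "r \<cdot> m' = Ident C (Dom C m')"
      using split_retraction[OF h(2)] by blast
    note rA = r(1)[unfolded in_Hom]
    have "(r \<cdot> h) \<cdot> m = Ident C (Dom C m)" using r(2) rA H S S' d by simp
    moreover have "r \<cdot> h \<in> Hom C (Cod C m) (Dom C m)" using rA H d by (simp add: in_Hom)
    ultimately show "\<exists>s\<in>Hom C (Cod C p) (Cod C m). p \<cdot> s = Ident C (Cod C p)"
      using abelian_category.split_retraction[OF abelian_op, of p m "r \<cdot> h"] h(1) S by auto
  qed
qed

text \<open>Splitting is invariant under \<open>ext_step\<close> in both directions, and every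
  sequence is now equivalent to a split one.\<close>

lemma Ext_vanishes_1_imp_Ext1_zero:
  assumes "Ext_vanishes C 1 X Y" "X \<in> Obj C" "Y \<in> Obj C"
  shows "Ext1_zero C X Y"
  unfolding Ext1_zero_def
proof (intro conjI allI impI assms(2,3))
  fix m p assume S: "ses C m p" "Dom C m = Y" "Cod C p = X"
  have E: "[m, p] \<in> ext_seqs C 1 X Y" using ses_ext_seqs_1[OF S(1)] S by simp
  have "ext_equiv C 1 X Y `` {[m, p]} \<in> carrier (YExt C 1 X Y)"
    using E by (auto simp: YExt_def quotient_def)
  then have "ext_equiv C 1 X Y `` {[m, p]} = ext_zero C 1 X Y"
    using assms(1) by (auto simp: Ext_vanishes_def YExt_def)
  moreover have "[m, p] \<in> ext_equiv C 1 X Y `` {[m, p]}" using E by (auto simp: ext_equiv_def)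
  ultimately obtain E0 where E0: "E0 \<in> ext_seqs C 1 X Y"
      "\<exists>s\<in>Hom C X (Dom C (E0 ! 1)). (E0 ! 1) \<cdot> s = Ident C X"
    "(E0, [m, p]) \<in> ext_equiv C 1 X Y"
    by (auto simp: ext_zero_def)
  define split where "split E \<longleftrightarrow> (\<exists>s\<in>Hom C X (Dom C (E ! 1)). (E ! 1) \<cdot> s = Ident C X)" for E
  have step: "split F \<longleftrightarrow> split G" if "(F, G) \<in> ext_step C 1 X Y" for F G
  proof -
    have FG: "F \<in> ext_seqs C 1 X Y" "G \<in> ext_seqs C 1 X Y" using that unfolding ext_step_def
      by blast+
    obtain a b where ab: "F = [a, b]" "ses C a b" "Dom C a = Y" "Cod C b = X"
      by (rule ext_seqs_1[OF FG(1)])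
    obtain a' b' where ab': "G = [a', b']" "ses C a' b'" "Dom C a' = Y" "Cod C b' = X"
      by (rule ext_seqs_1[OF FG(2)])
    have "seq_mor C 1 [a, b] [a', b'] (Ident C Y) (Ident C X)"
      using that ab ab' by (auto simp: ext_step_def seq_mor_def)
    then have "ses_mor C (a, b) (a', b') (Ident C (Dom C a)) (Ident C (Cod C b))"
      using seq_mor_1 ab ab' by simp
    from ses_mor_split_iff[OF this] show ?thesis
      using sesD[OF ab(2)] sesD[OF ab'(2)] ab ab' by (simp add: split_def)
  qed
  have "(E0, [m, p]) \<in> (ext_step C 1 X Y \<union> (ext_step C 1 X Y)\<inverse>)\<^sup>*" using E0(3)
    by (auto simp: ext_equiv_def)
  then have "split [m, p]"
    by induction (use E0 step split_def in blast)+
  then show "\<exists>s\<in>Hom C X (Cod C m). p \<cdot> s = Ident C X" using sesD[OF S(1)] by (simp add: split_def)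
qed

text \<open>With a retraction \<open>r\<close> of the source and a section \<open>s'\<close> of the
  target, \<open>m' \<cdot> r + s' \<cdot> p\<close> is a morphism with identities at both ends, so
  any two sequences are equivalent. The biproduct shows that there is at least one.\<close>

lemma Ext1_zero_imp_Ext_vanishes_1:
  assumes "Ext1_zero C X Y"
  shows "Ext_vanishes C 1 X Y"
proof -
  have O: "X \<in> Obj C" "Y \<in> Obj C" using assms by (auto simp: Ext1_zero_def)
  have sec: "\<exists>s\<in>Hom C X (Dom C (E ! 1)). (E ! 1) \<cdot> s = Ident C X" if E: "E \<in> ext_seqs C 1 X Y" for E
  proof -
    obtain m p where mp: "E = [m, p]" "ses C m p" "Dom C m = Y" "Cod C p = X"
      by (rule ext_seqs_1[OF E])
    then show ?thesis using assms sesD[OF mp(2)] by (simp add: Ext1_zero_def)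
  qed
  have all: "(E, E') \<in> ext_equiv C 1 X Y" if E: "E \<in> ext_seqs C 1 X Y" "E' \<in> ext_seqs C 1 X Y"
    for E E'
  proof -
    obtain m p where mp: "E = [m, p]" "ses C m p" "Dom C m = Y" "Cod C p = X"
      by (rule ext_seqs_1[OF E(1)])
    obtain m' p' where mp': "E' = [m', p']" "ses C m' p'" "Dom C m' = Y" "Cod C p' = X"
      by (rule ext_seqs_1[OF E(2)])
    note S = sesD[OF mp(2)] and S' = sesD[OF mp'(2)]
    obtain s where s: "s \<in> Hom C X (Cod C m)" "p \<cdot> s = Ident C X" using sec[OF E(1)] mp S by auto
    obtain s' where s': "s' \<in> Hom C X (Cod C m')" "p' \<cdot> s' = Ident C X" using sec[OF E(2)] mp' S'
      by auto
    obtain r where r: "r \<in> Hom C (Cod C m) Y" "r \<cdot> m = Ident C Y"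
      using split_retraction[OF mp(2), of s] s mp by auto
    note A = s'(1)[unfolded in_Hom] r(1)[unfolded in_Hom]
    have "ses_mor C (m, p) (m', p') (Ident C Y) (Ident C X)"
      by (rule ses_morI[where h = "(m' \<cdot> r) \<^bold>+ (s' \<cdot> p)"])
        (use mp(2-4) mp'(2-4) S S' A O r(2) s'(2) in
          \<open>simp_all add: in_Hom add_comp comp_add comp_reduce[OF s'(2)] comp_reduce[OF S'(4)]\<close>)
    then have "seq_mor C 1 E E' (Ident C Y) (Ident C X)"
      using seq_mor_iff_path_mor[of Y "[(m, p)]" X Y "[(m', p')]" X 1 "Ident C Y"
          "Ident C X"] mp mp'
      by (simp add: flat_def part_def)
    then have "(E, E') \<in> ext_step C 1 X Y" using E by (auto simp: ext_step_def seq_mor_def)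
    then show ?thesis using E by (auto simp: ext_equiv_def)
  qed
  obtain S i\<^sub>1 i\<^sub>2 p\<^sub>1 p\<^sub>2 where bp: "is_biproduct C Y X S i\<^sub>1 i\<^sub>2 p\<^sub>1 p\<^sub>2" using biproducts O
    by blast
  have ex: "[i\<^sub>1, p\<^sub>2] \<in> ext_seqs C 1 X Y"
    using ses_ext_seqs_1[OF biproduct_ses[OF bp]] biproductD[OF bp] by simp
  have "ext_zero C 1 X Y = ext_equiv C 1 X Y `` ext_seqs C 1 X Y"
    unfolding ext_zero_def using sec by auto
  also have "\<dots> = ext_seqs C 1 X Y" using all ex by (auto simp: ext_equiv_def)
  finally have z: "ext_zero C 1 X Y = ext_seqs C 1 X Y" .
  have "ext_equiv C 1 X Y `` {E} = ext_seqs C 1 X Y" if "E \<in> ext_seqs C 1 X Y" for E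
    using all that by (auto simp: ext_equiv_def)
  then have "carrier (YExt C 1 X Y) = {ext_seqs C 1 X Y}"
    using ex by (auto simp: YExt_def quotient_def)
  then show ?thesis by (simp add: Ext_vanishes_def YExt_def z[simplified])
qed

text \<open>The vanishing of a Yoneda product as in \<open>Ext2_zero\<close>. This form passes from
  the target of a morphism of sequences to its source, the dual form \<open>splices'\<close> from
  source to target; invariance under \<open>ext_equiv\<close> requires both directions.\<close>

definition splices :: "'m \<times> 'm \<Rightarrow> 'm \<times> 'm \<Rightarrow> bool" where
  "splices e e' \<longleftrightarrow> (\<exists>d. ses_mor C e d (Ident C (Dom C (fst e))) (fst e'))"

definition splices' :: "'m \<times> 'm \<Rightarrow> 'm \<times> 'm \<Rightarrow> bool" where
  "splices' e e' \<longleftrightarrow> (\<exists>d. ses_mor C d e' (snd e) (Ident C (Cod C (snd e'))))"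

end

lemma splices_op:
  assumes "abelian_category C"
  shows "abelian_category.splices (op C) (prod.swap e') (prod.swap e)
      = abelian_category.splices' C e e'"
proof -
  interpret abelian_category C by fact
  interpret o: abelian_category "op C" by (rule abelian_op)
  have "(\<exists>d. ses_mor (op C) (prod.swap e') d a b)
      = (\<exists>d. ses_mor (op C) (prod.swap e') (prod.swap d) a b)" for a b
    by (metis swap_swap)
  then show ?thesis unfolding o.splices_def splices'_def by (simp add: ses_mor_op)
qed

context abelian_category
begin

lemma splices_imp_splices':
  assumes "splices e e'" "ses C (fst e') (snd e')" "Cod C (snd e) = Dom C (fst e')"
  shows "splices' e e'"
proof -
  obtain m p m' p' where e: "e = (m, p)" "e' = (m', p')" by (metis surj_pair)
  obtain d where d: "ses_mor C (m, p) d (Ident C (Dom C m)) m'" using assms(1)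
    by (auto simp: splices_def e)
  have S': "ses C m' p'" "Cod C p = Dom C m'" using assms by (auto simp: e)
  obtain k q h where h: "d = (k, q)" "ses C h (p' \<cdot> q)" "Dom C h = Cod C m" "Cod C h = Cod C k"
    "ses C k q" "q \<cdot> h = m' \<cdot> p" "h \<cdot> m = k" "Cod C q = Cod C m'"
    by (rule ses_mor_splice[OF d S'])
  have "ses C m p" using d by (simp add: ses_mor_def)
  note S = sesD[OF this] sesD[OF S'(1)] sesD[OF h(5)] sesD[OF h(2)]
  have "ses_mor C (h, p' \<cdot> q) (m', p') p (Ident C (Cod C p'))"
    by (rule ses_morI[where h = q]) (use S h(2-6,8) S' in \<open>simp_all add: in_Hom\<close>)
  then show ?thesis by (auto simp: splices'_def e)
qed

text \<open>The composite morphism into \<open>(k, q)\<close> lies over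
  \<open>m2' \<cdot> z = h \<cdot> m2\<close>. After base change of \<open>(k, q)\<close> along
  \<open>h\<close> it lies over \<open>m2\<close>.\<close>

lemma splices_pull:
  assumes "ses_mor C e1 e1' (Ident C Y) z" "ses_mor C e2 e2' z (Ident C X)" "splices e1' e2'"
    "Dom C (fst e1) = Y" "Dom C (fst e1') = Y"
  shows "splices e1 e2"
proof -
  obtain m1 p1 m2 p2 m1' p1' m2' p2' where e: "e1 = (m1, p1)" "e2 = (m2, p2)" "e1' = (m1', p1')"
      "e2' = (m2', p2')"
    by (metis surj_pair)
  obtain k q where d: "ses_mor C (m1', p1') (k, q) (Ident C Y) m2'"
    using assms(3,5) by (auto simp: splices_def e)
  obtain h where h: "ses C m2 p2" "ses C m2' p2'" "z \<in> Hom C (Dom C m2) (Dom C m2')"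
    "h \<in> Hom C (Cod C m2) (Cod C m2')" "h \<cdot> m2 = m2' \<cdot> z"
    using assms(2)[unfolded e] by (rule ses_morE)
  note H = h(3,4)[unfolded in_Hom] and S2 = sesD[OF h(1)]
  have "ses C m1 p1" "Dom C m1 = Y" using assms(1,4) by (auto simp: ses_mor_def e)
  then have Y: "Y \<in> Obj C" using sesD(1) by auto
  have dm: "ses C k q" "Cod C q = Cod C m2'" "ses C m1 p1" "Dom C m1 = Y" "Cod C p1 = Dom C m2"
      "Dom C k = Y"
    using d assms(1,4) H unfolding e by (auto simp: ses_mor_def in_Hom)
  have "ses_mor C (m1, p1) (k, q) (Ident C Y \<cdot> Ident C Y) (m2' \<cdot> z)"
    by (rule ses_mor_comp[OF assms(1)[unfolded e] d])
  then have c: "ses_mor C (m1, p1) (k, q) (Ident C Y) (h \<cdot> m2)" using Y h(5) by simp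
  obtain v k' q' where P: "is_pullback C v q' q h" "v \<cdot> k' = k" "Dom C k' = Dom C k" "ses C k' q'"
    using ses_pullback[OF dm(1), of h] H dm by auto
  have "ses_mor C (m1, p1) (k', q') (Ident C Y) m2"
    by (rule pullback_ses_mor_univ[OF P(1,2,3) dm(1) P(4) c]) (use S2 dm H in \<open>simp add: in_Hom\<close>)
  then show ?thesis using dm by (auto simp: splices_def e)
qed

lemma splices'_imp_splices:
  assumes "splices' e e'" "ses C (fst e) (snd e)" "Cod C (snd e) = Dom C (fst e')"
  shows "splices e e'"
proof -
  interpret o: abelian_category "op C" by (rule abelian_op)
  have "o.splices (prod.swap e') (prod.swap e)"
    using assms(1) splices_op[OF abelian_category_axioms] by simp
  then have "o.splices' (prod.swap e') (prod.swap e)"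
    using o.splices_imp_splices' assms(2,3) by simp
  then obtain d where "ses_mor (op C) d (prod.swap e) (fst e') (Ident C (Dom C (fst e)))"
    unfolding o.splices'_def by auto
  then have "ses_mor C e (prod.swap d) (Ident C (Dom C (fst e))) (fst e')"
    using ses_mor_op[of "prod.swap d" e] by simp
  then show ?thesis unfolding splices_def by blast
qed

lemma splices'_push:
  assumes "ses_mor C e1 e1' (Ident C Y) z" "ses_mor C e2 e2' z (Ident C X)" "splices' e1 e2"
    "Cod C (snd e2) = X" "Cod C (snd e2') = X"
  shows "splices' e1' e2'"
proof -
  interpret o: abelian_category "op C" by (rule abelian_op)
  have "o.splices (prod.swap e2') (prod.swap e1')"
  proof (rule o.splices_pull)
    show "ses_mor (op C) (prod.swap e2') (prod.swap e2) (Ident (op C) X) z"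
      using assms(2) ses_mor_op by simp
    show "ses_mor (op C) (prod.swap e1') (prod.swap e1) z (Ident (op C) Y)"
      using assms(1) ses_mor_op by simp
    show "o.splices (prod.swap e2) (prod.swap e1)"
      using assms(3) splices_op[OF abelian_category_axioms] by simp
  qed (use assms in auto)
  then show ?thesis using splices_op[OF abelian_category_axioms] by simp
qed

lemma ext_seqs_2:
  assumes "E \<in> ext_seqs C 2 X Y"
  obtains e e' where "E = flat C [e, e']" "path C Y [e, e'] X"
proof -
  obtain es where es: "path C Y es X" "length es = 2" "flat C es = E"
    by (rule ext_seqs_factorization[OF assms]) simp
  then obtain e e' where eq: "es = [e, e']" by (auto simp: numeral_2_eq_2 length_Suc_conv)
  show thesis by (rule that[OF es(3)[unfolded eq, symmetric] es(1)[unfolded eq]])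
qed

lemma flat_2: "flat C [e, e'] = [fst e, fst e' \<cdot> snd e, snd e']"
  by (simp add: flat_def part_def)

text \<open>\<open>Phi\<close> holds for the sequence that represents zero and is invariant under
  \<open>ext_step\<close>, hence it holds on the class of zero, which is everything.\<close>

lemma Ext_vanishes_2_imp_Ext2_zero:
  assumes "Ext_vanishes C 2 X Y" "X \<in> Obj C" "Y \<in> Obj C"
  shows "Ext2_zero C X Y"
  unfolding Ext2_zero_def
proof (intro allI impI)
  fix m p m' p' assume S: "ses C m p" "ses C m' p'" "Cod C p = Dom C m'" "Dom C m = Y"
      "Cod C p' = X"
  define E where "E = flat C [(m, p), (m', p')]"
  have pE: "path C Y [(m, p), (m', p')] X" using S by simp
  then have E: "E \<in> ext_seqs C 2 X Y" using flat_ext_seqs[OF pE] by (simp add: E_def numeral_2_eq_2)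
  have "ext_equiv C 2 X Y `` {E} \<in> carrier (YExt C 2 X Y)"
    using E by (auto simp: YExt_def quotient_def)
  then have "ext_equiv C 2 X Y `` {E} = ext_zero C 2 X Y"
    using assms(1) by (auto simp: Ext_vanishes_def YExt_def)
  moreover have "E \<in> ext_equiv C 2 X Y `` {E}" using E by (auto simp: ext_equiv_def)
  ultimately obtain E0 where E0: "E0 \<in> ext_seqs C 2 X Y" "E0 ! 0 = Ident C Y" "E0 ! 2 = Ident C X"
    "(E0, E) \<in> ext_equiv C 2 X Y"
    by (auto simp: ext_zero_def)
  \<comment> \<open>Quantifying over all factorizations makes \<open>Phi\<close> a property of the
    flat sequence; the comparison in \<open>key\<close> works for any pair of them.\<close>
  define Phi where "Phi F \<longleftrightarrow> (\<forall>e e'. F = flat C [e, e'] \<longrightarrow> path C Y [e, e'] X \<longrightarrow> splices e e')" for F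
  have "Phi E0"
    unfolding Phi_def
  proof (intro allI impI)
    fix e e' assume f: "E0 = flat C [e, e']" and P: "path C Y [e, e'] X"
    obtain n q n' q' where e: "e = (n, q)" "e' = (n', q')" by (metis surj_pair)
    have N: "ses C n q" "ses C n' q'" "Cod C q = Dom C n'" "n = Ident C Y" "q' = Ident C X"
      using E0(2,3) P by (auto simp: f flat_2 e)
    note D = sesD[OF N(1)] sesD[OF N(2)]
    \<comment> \<open>As \<open>n\<close> is an identity, \<open>q\<close> vanishes, and the split
      extension of \<open>X\<close> by \<open>Y\<close> is the sequence sought.\<close>
    have q: "q = Zero C Y (Dom C n')" using D(4) D(3) D(2) N(3,4) assms(3) by simp
    have n': "Cod C n' = X" using D(11) N(5) assms(2) by simp
    obtain B i\<^sub>1 i\<^sub>2 p\<^sub>1 p\<^sub>2 where bp: "is_biproduct C Y X B i\<^sub>1 i\<^sub>2 p\<^sub>1 p\<^sub>2" using biproducts assms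
      by blast
    note b = biproductD[OF bp] and be = biproduct_eqs[OF bp]
    have "ses_mor C (n, q) (i\<^sub>1, p\<^sub>2) (Ident C Y) n'"
      by (rule ses_morI[where h = i\<^sub>1]) (use N(1,3,4) biproduct_ses[OF bp] b be D n' q assms in
          \<open>simp_all add: in_Hom\<close>)
    then show "splices e e'" using N(4) assms by (auto simp: splices_def e)
  qed
  have step: "Phi F \<longleftrightarrow> Phi G" if st: "(F, G) \<in> ext_step C 2 X Y" for F G
  proof -
    have FG: "F \<in> ext_seqs C 2 X Y" "G \<in> ext_seqs C 2 X Y" "seq_mor C 2 F G (Ident C Y) (Ident C X)"
      using st by (auto simp: ext_step_def seq_mor_def)
    have key: "splices a a' \<longleftrightarrow> splices b b'"
      if ab: "F = flat C [a, a']" "path C Y [a, a'] X" "G = flat C [b, b']" "path C Y [b, b'] X"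
        for a a' b b'
    proof -
      have "path_mor C [a, a'] [b, b'] (Ident C Y) (Ident C X)"
        using seq_mor_iff_path_mor[OF ab(2,4), of 2] FG(3) ab by simp
      then obtain z where z: "ses_mor C a b (Ident C Y) z" "ses_mor C a' b' z (Ident C X)" by auto
      have P: "ses C (fst a) (snd a)" "ses C (fst a') (snd a')" "Cod C (snd a) = Dom C (fst a')"
          "Dom C (fst a) = Y" "Cod C (snd a') = X"
        "ses C (fst b) (snd b)" "ses C (fst b') (snd b')" "Cod C (snd b) = Dom C (fst b')"
            "Dom C (fst b) = Y" "Cod C (snd b') = X"
        using ab by auto
      show ?thesis
      proof
        assume "splices a a'"
        then have "splices' a a'" using splices_imp_splices' P by blast
        then have "splices' b b'" using splices'_push[OF z] P by blast
        then show "splices b b'" using splices'_imp_splices P by blast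
      next
        assume "splices b b'"
        then show "splices a a'" using splices_pull[OF z] P by blast
      qed
    qed
    show ?thesis unfolding Phi_def using key ext_seqs_2[OF FG(1)] ext_seqs_2[OF FG(2)] by metis
  qed
  have "(E0, E) \<in> (ext_step C 2 X Y \<union> (ext_step C 2 X Y)\<inverse>)\<^sup>*" using E0(4)
    by (auto simp: ext_equiv_def)
  then have "Phi E" by induction (use \<open>Phi E0\<close> step in blast)+
  then have "splices (m, p) (m', p')" using pE by (simp add: Phi_def E_def)
  then show "\<exists>e. ses_mor C (m, p) e (Ident C Y) m'" using S by (simp add: splices_def)
qed

text \<open>The hereditary condition is used in degrees one and two. The criteria \<open>P_I\<close>
  and \<open>R_I\<close> rest on the converse translation, from splitting back to vanishing of the
  Yoneda group.\<close>

lemma cotorsion_setupI: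
  assumes "cotorsion_pair C \<X> \<Y>" "complete_pair C \<X> \<Y>" "hereditary_pair C \<X> \<Y>" "\<X> \<subseteq> Obj C"
      "\<Y> \<subseteq> Obj C"
  shows "cotorsion_setup C \<X> \<Y>"
proof unfold_locales
  show "Ext1_zero C X Y" if "X \<in> \<X>" "Y \<in> \<Y>" for X Y
    using assms that by (intro Ext_vanishes_1_imp_Ext1_zero) (auto simp: hereditary_pair_def)
  show "Ext2_zero C X Y" if "X \<in> \<X>" "Y \<in> \<Y>" for X Y
    using assms that by (intro Ext_vanishes_2_imp_Ext2_zero) (auto simp: hereditary_pair_def)
  show "X \<in> \<X>" if "X \<in> Obj C" "\<And>Y. Y \<in> \<Y> \<Longrightarrow> Ext1_zero C X Y" for X
  proof -
    have "Ext_vanishes C 1 X Y" if "Y \<in> \<Y>" for Y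
      using \<open>\<And>Y. Y \<in> \<Y> \<Longrightarrow> Ext1_zero C X Y\<close>[OF that] Ext1_zero_imp_Ext_vanishes_1 by blast
    then show ?thesis using assms(1) that(1) unfolding cotorsion_pair_def by blast
  qed
  show "Y \<in> \<Y>" if "Y \<in> Obj C" "\<And>X. X \<in> \<X> \<Longrightarrow> Ext1_zero C X Y" for Y
  proof -
    have "Ext_vanishes C 1 X Y" if "X \<in> \<X>" for X
      using \<open>\<And>X. X \<in> \<X> \<Longrightarrow> Ext1_zero C X Y\<close>[OF that] Ext1_zero_imp_Ext_vanishes_1 by blast
    then show ?thesis using assms(1) that(1) unfolding cotorsion_pair_def by blast
  qed
  show "\<exists>i p. ses C i p \<and> Dom C i = A \<and> Cod C i \<in> \<Y> \<and> Cod C p \<in> \<X>"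
    "\<exists>i p. ses C i p \<and> Cod C p = A \<and> Cod C i \<in> \<X> \<and> Dom C i \<in> \<Y>" if "A \<in> Obj C" for A
    using assms(2) that unfolding complete_pair_def short_exact_iff_ses by blast+
qed (use assms in auto)

end

section \<open>Changing resolutions\<close>

context preadditive_category
begin

text \<open>\<open>u\<close> covers \<open>\<tau>\<close> on the resolving objects and turns an
  extension along \<open>m\<close> into one along \<open>m'\<close>.\<close>

lemma homotopic_precomp:
  assumes "homotopic C m g g'" "\<tau> \<in> Arr C" "Cod C \<tau> = Dom C m" "Dom C \<tau> = Dom C m'" "m' \<in> Arr C"
    "u \<in> Hom C (Cod C m') (Cod C m)" "m \<cdot> \<tau> = u \<cdot> m'"
  shows "homotopic C m' (g \<cdot> \<tau>) (g' \<cdot> \<tau>)"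
proof -
  obtain s where s: "m \<in> Arr C" "g' \<in> Arr C" "Dom C g' = Dom C m" "s \<in> Arr C" "Dom C s = Cod C m"
    "Cod C s = Cod C g'" "g = (s \<cdot> m) \<^bold>+ g'" using assms(1) by (rule homotopicE)
  note uA = assms(6)[unfolded in_Hom]
  have "g \<cdot> \<tau> = (s \<cdot> (m \<cdot> \<tau>)) \<^bold>+ (g' \<cdot> \<tau>)" unfolding s(7) using s(1-6) assms(2-4)
    by (simp add: add_comp)
  also have "\<dots> = ((s \<cdot> u) \<cdot> m') \<^bold>+ (g' \<cdot> \<tau>)" unfolding assms(7) using s(1-6) uA assms(5) by simp
  finally show ?thesis
    by (intro homotopicI[where s = "s \<cdot> u" and B
        = "Cod C g'"]) (use s(1-6) uA assms(2-5) in \<open>simp_all add: in_Hom\<close>)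
qed

end

context cotorsion_setup
begin

text \<open>Its use is with the pair of \<open>Q\<close> and \<open>W \<inter> R\<close>: the
  syzygies in a resolution of a cofibrant object are cofibrant. They are kernels of epimorphisms in
  the class, treated from the right end.\<close>

lemma P_path:
  assumes "path C Z \<sigma> A" "\<forall>e\<in>set \<sigma>. Cod C (fst e) \<in> P" "A \<in> P"
  shows "Z \<in> P \<and> (\<forall>e\<in>set \<sigma>. Cod C (snd e) \<in> P)"
  using assms
proof (induction \<sigma> arbitrary: Z)
  case (Cons e \<sigma>)
  then have IH: "Cod C (snd e) \<in> P" "\<forall>e\<in>set \<sigma>. Cod C (snd e) \<in> P" by auto
  then show ?case using P_kernel[of "fst e" "snd e"] Cons.prems by auto
qed auto

lemma last_ses:
  "path C Z \<sigma> A \<Longrightarrow> \<sigma> \<noteq> [] \<Longrightarrow> ses C (fst (last \<sigma>)) (snd (last \<sigma>)) \<and> Cod C (snd (last \<sigma>)) = A"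
  by (induction \<sigma> arbitrary: Z) (auto split: if_splits)

text \<open>
  Only the last short exact sequence changes: it is extended along \<open>i\<close>, which is possible because
  the product with \<open>(i, c)\<close> vanishes, and its middle term stays in \<open>P\<close>.
\<close>

lemma resolution_change_end:
  assumes "resolution_of Z \<sigma> A" "special \<sigma>" "ses C i c" "Dom C i = A" "Cod C c \<in> P"
  obtains \<sigma>' where "resolution_of Z \<sigma>' (Cod C i)" "length \<sigma>' = length \<sigma>"
      "path_mor C \<sigma> \<sigma>' (Ident C Z) i"
    "\<And>f f'. Cod C f' \<in> R \<Longrightarrow> homotopic C (fst (hd \<sigma>)) f f' \<longleftrightarrow> homotopic C (fst (hd \<sigma>')) f f'"
proof -
  note r = assms(1)[unfolded resolution_of_def] and I = sesD[OF assms(3)]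
  obtain \<tau> m p where \<sigma>: "\<sigma> = \<tau> @ [(m, p)]" using r by (cases \<sigma> rule: rev_cases) auto
  have mp: "path C Z \<tau> (Dom C m)" "ses C m p" "Cod C p = A" "Dom C m \<in> R" "Cod C m \<in> P"
      "\<forall>e\<in>set \<tau>. Cod C (fst e) \<in> P"
    using r assms(2) by (auto simp: \<sigma> path_append special_def P_middle_def)
  note M = sesD[OF mp(2)]
  have pi: "Cod C p = Dom C i" using mp(3) assms(4) by simp
  obtain e where e: "ses_mor C (m, p) e (Ident C (Dom C m)) i"
    using ext2[OF assms(5) mp(4)] mp(2) assms(3) pi unfolding Ext2_zero_def by blast
  from ses_mor_splice[OF e assms(3) pi]
  obtain k q h where h: "e = (k, q)" "ses C h (c \<cdot> q)" "Dom C h = Cod C m" "Cod C h = Cod C k"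
    "ses C k q" "q \<cdot> h = i \<cdot> p" "h \<cdot> m = k" "Cod C q = Cod C i" "Dom C k = Dom C m" by metis
  note H = sesD[OF h(2)] and K = sesD[OF h(5)]
  have hc: "Cod C (c \<cdot> q) = Cod C c" using K I h(8) by simp
  have kP: "Cod C k \<in> P" using P_extension[OF h(2)] mp(5) assms(5) h(3,4) hc by simp
  define \<sigma>' where "\<sigma>' = \<tau> @ [(k, q)]"
  have "path C Z \<sigma>' (Cod C i)" unfolding \<sigma>'_def path_append using mp(1) h(5,8,9)
    by (intro exI[of _ "Dom C m"]) simp
  then have res: "resolution_of Z \<sigma>' (Cod C i)" using mp(6) kP I
    by (auto simp: resolution_of_def P_middle_def \<sigma>'_def)
  have app: "path_mor C xs xs' b z \<Longrightarrow> ses_mor C x x' z a \<Longrightarrow> path_mor C (xs @ [x]) (xs' @ [x']) b a"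
    for xs xs' x x' b z a
    by (induction xs arbitrary: xs' b) (case_tac xs'; auto)+
  have fm: "path_mor C \<sigma> \<sigma>' (Ident C Z) i"
    unfolding \<sigma> \<sigma>'_def by (rule app[OF path_mor_id[OF mp(1)] e[unfolded h(1)]])
  have "homotopic C (fst (hd \<sigma>)) f f' \<longleftrightarrow> homotopic C (fst (hd \<sigma>')) f f'" if Y: "Cod C f' \<in> R"
    for f f'
  \<comment> \<open>Only in length one is the changed sequence also the first one. Then
    \<open>k = h \<cdot> m\<close>, and arrows from \<open>Cod m\<close> to objects of
    \<open>R\<close> extend along \<open>h\<close>, whose cokernel is in \<open>P\<close>.\<close>
  proof (cases "\<tau> = []")
    case True
    have "homotopic C m f f' \<longleftrightarrow> homotopic C k f f'"
    proof
      assume "homotopic C m f f'"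
      then obtain s where s: "f' \<in> Arr C" "Dom C f' = Dom C m" "s \<in> Arr C" "Dom C s = Cod C m"
        "Cod C s = Cod C f'" "f = (s \<cdot> m) \<^bold>+ f'" by (rule homotopicE)
      obtain t where t: "t \<in> Hom C (Cod C h) (Cod C f')" "t \<cdot> h = s"
        using extend[OF Y h(2), of s] s h(3) hc assms(5) by (auto simp: in_Hom)
      note tA = t(1)[unfolded in_Hom]
      have "s \<cdot> m = t \<cdot> k" unfolding t(2)[symmetric] h(7)[symmetric] using tA H M h(3,4) by simp
      then show "homotopic C k f f'"
        by (intro homotopicI[where s = t and B
            = "Cod C f'"]) (use s tA K h(4,9) in \<open>simp_all add: in_Hom\<close>)
    next
      assume "homotopic C k f f'"
      then obtain s where s: "f' \<in> Arr C" "Dom C f' = Dom C k" "s \<in> Arr C" "Dom C s = Cod C k"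
        "Cod C s = Cod C f'" "f = (s \<cdot> k) \<^bold>+ f'" by (rule homotopicE)
      have "s \<cdot> k = (s \<cdot> h) \<cdot> m" unfolding h(7)[symmetric] using s H M h(3,4) by simp
      then show "homotopic C m f f'"
        by (intro homotopicI[where s = "s \<cdot> h" and B
            = "Cod C f'"]) (use s H M h(3,4,9) in \<open>simp_all add: in_Hom\<close>)
    qed
    then show ?thesis by (simp add: \<sigma> \<sigma>'_def True)
  next
    case False
    then show ?thesis by (simp add: \<sigma> \<sigma>'_def)
  qed
  then show thesis using that[OF res _ fm] by (simp add: \<sigma> \<sigma>'_def)
qed

end

section \<open>Model structures\<close>

locale model_setup = abelian_category C +
    t: cotorsion_setup C "Q \<inter> W" R + f: cotorsion_setup C Q "W \<inter> R"
  for C :: "('o, 'm) addcat" (structure) and Q W R :: "'o set" +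
  assumes thick: "thick C W"
begin

lemma W_cases:
  assumes "ses C m p"
  shows "Dom C m \<in> W \<Longrightarrow> Cod C p \<in> W \<Longrightarrow> Cod C m \<in> W" "Cod C m \<in> W \<Longrightarrow> Cod C p \<in> W \<Longrightarrow> Dom C m \<in> W"
  using thick assms unfolding thick_def short_exact_iff_ses by blast+

text \<open>An embedding of \<open>C'\<close> into an object of \<open>R\<close> with cokernel in
  \<open>Q \<inter> W\<close> does not leave \<open>W\<close>, by thickness. Objects of
  \<open>W \<inter> R\<close> are useful because arrows into them extend along monomorphisms with
  cofibrant cokernel.\<close>

lemma factor_trivial_cofibrant:
  assumes "C' \<in> Q \<inter> W" "Y \<in> R" "x \<in> Hom C C' Y"
  obtains V j y where "V \<in> W \<inter> R" "j \<in> Hom C C' V" "y \<in> Hom C V Y" "y \<cdot> j = x"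
proof -
  have "C' \<in> Obj C" using assms(1) t.P_Obj by auto
  then obtain j q where j: "ses C j q" "Dom C j = C'" "Cod C j \<in> R" "Cod C q \<in> Q \<inter> W" using t.enough
    by blast
  have "Cod C j \<in> W" using W_cases(1)[OF j(1)] j assms(1) by auto
  moreover obtain y where "y \<in> Hom C (Cod C j) Y" "y \<cdot> j = x"
    using t.extend[OF assms(2) j(1,4)] j(2) assms(3) by auto
  ultimately show thesis using that[of "Cod C j" j y] j sesD[OF j(1)] by (auto simp: in_Hom)
qed

text \<open>The dual factorization. Arrows out of an object of \<open>Q \<inter> W\<close> lift
  along epimorphisms with kernel in \<open>R\<close>.\<close>

lemma factor_trivial_fibrant:
  assumes "X \<in> Q" "F \<in> W \<inter> R" "x \<in> Hom C X F"
  obtains V u v where "V \<in> Q \<inter> W" "u \<in> Hom C X V" "v \<in> Hom C V F" "v \<cdot> u = x"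
proof -
  have "F \<in> Obj C" using assms(2) f.R_Obj by auto
  then obtain k v where k: "ses C k v" "Cod C v = F" "Cod C k \<in> Q \<inter> W" "Dom C k \<in> R" using t.enough'
    by blast
  have "Dom C k \<in> W \<inter> R" using W_cases(2)[OF k(1)] k assms(2) by auto
  then obtain u where "u \<in> Hom C X (Cod C k)" "v \<cdot> u = x"
    using f.lift[OF assms(1) k(1)] k(2) assms(3) by auto
  then show thesis using that[of "Cod C k" u v] k sesD[OF k(1)] by (auto simp: in_Hom)
qed

text \<open>\<open>d - d'\<close> factors through \<open>Cod c\<close>, hence through an object of
  \<open>W \<inter> R\<close>. The resulting arrow from \<open>Dom m\<close> to that object extends
  along \<open>m\<close>, because \<open>Cod q\<close> is cofibrant.\<close>

lemma homotopic_agree_on_cofibration: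
  assumes "ses C j c" "Cod C c \<in> Q \<inter> W" "Y \<in> R" "d \<in> Hom C (Cod C j) Y" "d' \<in> Hom C (Cod C j) Y"
    "d \<cdot> j = d' \<cdot> j" "ses C m q" "Cod C q \<in> Q" "g \<in> Hom C (Dom C m) (Cod C j)"
  shows "homotopic C m (d \<cdot> g) (d' \<cdot> g)"
proof -
  note J = sesD[OF assms(1)] and M = sesD[OF assms(7)] and A = assms(4,5,9)[unfolded in_Hom]
  have "(d \<^bold>- d') \<cdot> j = Zero C (Dom C j) (Cod C (d \<^bold>- d'))" using J A assms(6)
    by (simp add: sub_comp)
  then obtain x where x: "x \<in> Hom C (Cod C c) Y" "x \<cdot> c = d \<^bold>- d'"
    using cokernel_factor[OF J(8), of "d \<^bold>- d'"] A J by auto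
  obtain V i y where V: "V \<in> W \<inter> R" "i \<in> Hom C (Cod C c) V" "y \<in> Hom C V Y" "y \<cdot> i = x"
    by (rule factor_trivial_cofibrant[OF assms(2,3) x(1)])
  note VA = V(2,3)[unfolded in_Hom] x(1)[unfolded in_Hom]
  have "i \<cdot> c \<cdot> g \<in> Hom C (Dom C m) V" using VA J A by (simp add: in_Hom)
  then obtain s where s: "s \<in> Hom C (Cod C m) V" "s \<cdot> m = i \<cdot> c \<cdot> g"
    using f.extend[OF V(1) assms(7,8)] by blast
  note sA = s(1)[unfolded in_Hom]
  have "(d \<cdot> g) \<^bold>- (d' \<cdot> g) = (d \<^bold>- d') \<cdot> g" using A by (simp add: sub_comp)
  also have "\<dots> = (y \<cdot> i) \<cdot> c \<cdot> g" unfolding x(2)[symmetric] V(4) using VA J A by simp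
  also have "\<dots> = (y \<cdot> s) \<cdot> m" using VA J A sA s(2) M by simp
  finally show ?thesis
    by (rule homotopic_of_sub[rotated 4]) (use A M VA sA in \<open>simp_all add: in_Hom\<close>)
qed

text \<open>\<open>q - q'\<close> factors through \<open>Dom k\<close>, hence through an object of
  \<open>Q \<inter> W\<close>, and from there its image under \<open>i\<close> lifts to the last
  middle term of \<open>S\<close>. This lift provides the arrow required by
  \<open>path_mor_null\<close>.\<close>

lemma homotopic_agree_on_cofibrant:
  assumes "t.resolution_of Z \<sigma> X" "path C B S A" "t.special S" "X \<in> Q"
    and "ses C k p" "Dom C k \<in> W \<inter> R" "q \<in> Hom C X (Cod C k)" "q' \<in> Hom C X (Cod C k)"
        "p \<cdot> q = p \<cdot> q'"
    and "i \<in> Hom C (Cod C k) A" "path_mor C \<sigma> S g (i \<cdot> q)" "path_mor C \<sigma> S g' (i \<cdot> q')"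
  shows "homotopic C (fst (hd \<sigma>)) g g'"
proof -
  note r = assms(1)[unfolded t.resolution_of_def] and K = sesD[OF assms(5)] and A
      = assms(7,8,10)[unfolded in_Hom]
  have "S \<noteq> []" using path_mor_length[OF assms(11)] r by auto
  then have L: "ses C (fst (last S)) (snd (last S))" "Cod C (snd (last S)) = A"
      "Dom C (fst (last S)) \<in> R"
    using t.last_ses[OF assms(2)] assms(3) by (auto simp: t.special_def)
  note LD = sesD[OF L(1)]
  have "p \<cdot> (q \<^bold>- q') = Zero C (Dom C (q \<^bold>- q')) (Cod C p)" using A K assms(9)
    by (simp add: comp_sub)
  then obtain x where x: "x \<in> Hom C X (Dom C k)" "k \<cdot> x = q \<^bold>- q'"
    using kernel_factor[OF K(7), of "q \<^bold>- q'"] A K by auto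
  obtain V u v where V: "V \<in> Q \<inter> W" "u \<in> Hom C X V" "v \<in> Hom C V (Dom C k)" "v \<cdot> u = x"
    by (rule factor_trivial_fibrant[OF assms(4,6) x(1)])
  note VA = V(2,3)[unfolded in_Hom] x(1)[unfolded in_Hom]
  have "i \<cdot> k \<cdot> v \<in> Hom C V (Cod C (snd (last S)))" using VA K A L(2) by (simp add: in_Hom)
  then obtain w where w: "w \<in> Hom C V (Cod C (fst (last S)))" "snd (last S) \<cdot> w = i \<cdot> k \<cdot> v"
    using t.lift[OF V(1) L(1,3)] by blast
  note wA = w(1)[unfolded in_Hom]
  have "snd (last S) \<cdot> (w \<cdot> u) = (i \<cdot> k \<cdot> v) \<cdot> u"
    by (rule comp_reduce[OF w(2)]) (use wA VA LD in simp_all)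
  also have "\<dots> = i \<cdot> (k \<cdot> x)" unfolding V(4)[symmetric] using VA K A by simp
  also have "\<dots> = (i \<cdot> q) \<^bold>- (i \<cdot> q')" unfolding x(2) using A by (simp add: comp_sub)
  finally have e: "(i \<cdot> q) \<^bold>- (i \<cdot> q') = snd (last S) \<cdot> (w \<cdot> u)" by simp
  have "w \<cdot> u \<in> Hom C X (Cod C (fst (last S)))" using wA VA by (simp add: in_Hom)
  then obtain s where s: "s \<in> Hom C (Cod C (fst (hd \<sigma>))) B" "g \<^bold>- g' = s \<cdot> fst (hd \<sigma>)"
    using t.path_mor_null[OF path_mor_sub[OF assms(11,12)] _ _ _ assms(2,3) e] r by blast
  have "g \<in> Hom C Z B" "g' \<in> Hom C Z B"
    using path_mor_hom[OF assms(11) _ assms(2)] path_mor_hom[OF assms(12) _ assms(2)] r A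
      by (auto simp: in_Hom)
  then show ?thesis using homotopic_of_sub[OF _ _ _ s] t.resolution_of_hd[OF assms(1)] by simp
qed

text \<open>
  A map \<open>r : RQB \<rightarrow> RB\<close> over \<open>QB \<rightarrow> B\<close> is compared with the quotient of \<open>RQB\<close> by the kernel of
  \<open>QB \<rightarrow> B\<close>, which is another fibrant replacement of \<open>B\<close>.
\<close>

lemma weak_equivalence:
  assumes "ses C k p" "ses C i c" "ses C \<eta> c'" "Cod C k = Dom C i" "Dom C \<eta> = Cod C p"
    and "Dom C k \<in> W \<inter> R" "Cod C c \<in> Q \<inter> W" "Cod C c' \<in> Q \<inter> W" "Cod C i \<in> R" "Cod C \<eta> \<in> R"
    and "r \<in> Hom C (Cod C i) (Cod C \<eta>)" "r \<cdot> i = \<eta> \<cdot> p"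
    and "ses C m q" "Dom C m \<in> Q" "Cod C m \<in> Q" "Cod C q \<in> Q"
  shows "f \<in> Hom C (Dom C m) (Cod C i) \<Longrightarrow> f' \<in> Hom C (Dom C m) (Cod C i) \<Longrightarrow>
      homotopic C m (r \<cdot> f) (r \<cdot> f') \<Longrightarrow> homotopic C m f f'"
    and "g \<in> Hom C (Dom C m) (Cod C \<eta>) \<Longrightarrow> \<exists>f\<in>Hom C (Dom C m) (Cod C i). homotopic C m (r \<cdot> f) g"
proof -
  note K = sesD[OF assms(1)] and I = sesD[OF assms(2)] and N = sesD[OF assms(3)] and M
      = sesD[OF assms(13)]
  note rA = assms(11)[unfolded in_Hom]
  have pI: "Dom C p = Dom C i" using K assms(4) by simp
  obtain v i' c'' where P: "is_pushout C v i' i p" "c'' \<cdot> v = c" "Cod C c'' = Cod C c"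
      "ses C i' c''"
    using ses_pushout[OF assms(2) K(2) pI] by blast
  note PD = pushoutD(1-2,5-7,9)[OF P(1)] and I' = sesD[OF P(4)]
  \<comment> \<open>The kernel of \<open>v\<close> is \<open>Dom k\<close>, in
    \<open>W \<inter> R\<close>: arrows from cofibrant objects lift along \<open>v\<close>, and the
    target of \<open>v\<close> stays in \<open>R\<close>.\<close>
  have V: "ses C (i \<cdot> k) v" by (rule pushout_epi_ses[OF P(1) I(5) assms(1)])
  note VD = sesD[OF V]
  have vA: "v \<in> Arr C" "Dom C v = Cod C i" "Cod C v = Cod C i'" and ik: "Dom C (i \<cdot> k) = Dom C k"
      "Cod C (i \<cdot> k) = Cod C i"
    using PD K I assms(4) by simp_all
  have B'': "Cod C i' \<in> R" using t.R_cokernel[OF V] ik vA assms(6,9) by simp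
  have di: "Dom C i' = Cod C p" using PD by simp
  \<comment> \<open>\<open>u\<close> and \<open>w\<close> compare the two fibrant replacements of
    \<open>Dom \<eta>\<close>. Each composite restricts to the inclusion, so \<open>u\<close> and
    \<open>w\<close> act as mutually inverse on homotopy classes of arrows from the syzygy.\<close>
  obtain u where u: "u \<in> Hom C (Cod C i') (Cod C \<eta>)" "u \<cdot> i' = \<eta>"
    using t.extend[OF assms(10) P(4), of \<eta>] P(3) assms(5,7) di N by (auto simp: in_Hom)
  obtain w where w: "w \<in> Hom C (Cod C \<eta>) (Cod C i')" "w \<cdot> \<eta> = i'"
    using t.extend[OF B'' assms(3,8), of i'] assms(5) di I' by (auto simp: in_Hom)
  note uA = u(1)[unfolded in_Hom] and wA = w(1)[unfolded in_Hom]
  have ruv: "r \<cdot> i = (u \<cdot> v) \<cdot> i"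
  proof -
    have "(u \<cdot> v) \<cdot> i = u \<cdot> (i' \<cdot> p)" using uA vA I PD(6) by simp
    also have "\<dots> = \<eta> \<cdot> p" by (rule comp_reduce[OF u(2)]) (use uA I' K di in simp_all)
    finally show ?thesis using assms(12) by simp
  qed
  have rf: "homotopic C m (r \<cdot> f) (u \<cdot> v \<cdot> f)" if f: "f \<in> Hom C (Dom C m) (Cod C i)" for f
  proof -
    have "homotopic C m (r \<cdot> f) ((u \<cdot> v) \<cdot> f)"
      by (rule homotopic_agree_on_cofibration[OF assms(2,7,10,11) _ ruv assms(13,16) f]) (use uA vA
          in \<open>simp add: in_Hom\<close>)
    then show ?thesis using f uA vA by (simp add: in_Hom)
  qed
  \<comment> \<open>A preimage of \<open>g\<close> is found by moving it with \<open>w\<close> to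
    the quotient and lifting along \<open>v\<close>.\<close>
  show "\<exists>f\<in>Hom C (Dom C m) (Cod C i). homotopic C m (r \<cdot> f) g" if g: "g \<in> Hom C (Dom C m) (Cod C \<eta>)"
  proof -
    note gA = g[unfolded in_Hom]
    have "w \<cdot> g \<in> Hom C (Dom C m) (Cod C v)" using gA wA vA by (simp add: in_Hom)
    then obtain f where f: "f \<in> Hom C (Dom C m) (Cod C i)" "v \<cdot> f = w \<cdot> g"
      using f.lift[OF assms(14) V, of "w \<cdot> g"] ik assms(6) by auto
    have e: "(u \<cdot> w) \<cdot> \<eta> = Ident C (Cod C \<eta>) \<cdot> \<eta>" using uA wA N w(2) u(2) by simp
    have "homotopic C m ((u \<cdot> w) \<cdot> g) (Ident C (Cod C \<eta>) \<cdot> g)"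
      by (rule homotopic_agree_on_cofibration[OF assms(3,8,10) _ _ e assms(13,16) g]) (use uA wA N
          in \<open>simp_all add: in_Hom\<close>)
    then have "homotopic C m (u \<cdot> v \<cdot> f) g" using f(2) uA wA gA by simp
    then show ?thesis using rf[OF f(1)] f(1) homotopic_trans by blast
  qed
  show "homotopic C m f f'" if f: "f \<in> Hom C (Dom C m) (Cod C i)" "f' \<in> Hom C (Dom C m) (Cod C i)"
    and h: "homotopic C m (r \<cdot> f) (r \<cdot> f')"
  proof -
    note fA = f[unfolded in_Hom]
    have "homotopic C m (u \<cdot> v \<cdot> f) (u \<cdot> v \<cdot> f')"
      using rf[OF f(1)] rf[OF f(2)] h homotopic_trans homotopic_sym by blast
    then have 1: "homotopic C m (w \<cdot> u \<cdot> v \<cdot> f) (w \<cdot> u \<cdot> v \<cdot> f')"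
      by (rule homotopic_comp) (use fA uA vA wA in simp_all)
    have wu: "homotopic C m (w \<cdot> u \<cdot> v \<cdot> x) (v \<cdot> x)" if "x \<in> Hom C (Dom C m) (Cod C i)" for x
    proof -
      note xA = that[unfolded in_Hom]
      have e: "(w \<cdot> u) \<cdot> i' = Ident C (Cod C i') \<cdot> i'" using uA wA I' w(2) u(2) by simp
      have "homotopic C m ((w \<cdot> u) \<cdot> (v \<cdot> x)) (Ident C (Cod C i') \<cdot> (v \<cdot> x))"
        by (rule homotopic_agree_on_cofibration[OF P(4) _ B'' _ _ e assms(13,16)])
          (use uA wA I' P(3) assms(7) vA xA in \<open>simp_all add: in_Hom\<close>)
      then show ?thesis using uA wA vA xA by simp
    qed
    have "homotopic C m (v \<cdot> f) (v \<cdot> f')" using 1 wu[OF f(1)] wu[OF f(2)] homotopic_trans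
        homotopic_sym by blast
    then obtain s where s: "s \<in> Arr C" "Dom C s = Cod C m" "Cod C s = Cod C (v \<cdot> f')"
        "v \<cdot> f = (s \<cdot> m) \<^bold>+ (v \<cdot> f')"
      by (rule homotopicE)
    obtain s' where s': "s' \<in> Hom C (Cod C m) (Cod C i)" "v \<cdot> s' = s"
      using f.lift[OF assms(15) V, of s] ik assms(6) s fA vA by (auto simp: in_Hom)
    note s'A = s'(1)[unfolded in_Hom]
    \<comment> \<open>The homotopy lifts along \<open>v\<close> to \<open>s'\<close>. What remains
      is an error \<open>x\<close> killed by \<open>v\<close>, thus an arrow into
      \<open>Dom k\<close>, and this extends along \<open>m\<close>.\<close>
    define x where "x = f \<^bold>- ((s' \<cdot> m) \<^bold>+ f')"
    have xA: "x \<in> Arr C" "Dom C x = Dom C m" "Cod C x = Cod C i" and fx: "f = x \<^bold>+ ((s' \<cdot> m) \<^bold>+ f')"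
      using fA s'A M by (simp_all add: x_def)
    have "v \<cdot> x = (v \<cdot> f) \<^bold>- ((s \<cdot> m) \<^bold>+ (v \<cdot> f'))"
      unfolding x_def using fA s'A M vA by (simp add: comp_sub comp_add comp_reduce[OF s'(2)])
    then have "v \<cdot> x = Zero C (Dom C x) (Cod C v)" using s fA vA xA M by simp
    then obtain y where y: "y \<in> Hom C (Dom C m) (Dom C k)" "(i \<cdot> k) \<cdot> y = x"
      using kernel_factor[OF VD(7), of x] xA vA ik by auto
    obtain y' where y': "y' \<in> Hom C (Cod C m) (Dom C k)" "y' \<cdot> m = y"
      using f.extend[OF assms(6,13,16) y(1)] by blast
    note y'A = y'(1)[unfolded in_Hom]
    define z where "z = ((i \<cdot> k) \<cdot> y') \<^bold>+ s'"
    have z: "z \<in> Hom C (Cod C m) (Cod C i)" using y'A s'A ik VD by (simp add: z_def in_Hom)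
    have "x = ((i \<cdot> k) \<cdot> y') \<cdot> m" unfolding y(2)[symmetric] y'(2)[symmetric] using y'A M ik VD(1)
      by (simp only: comp_assoc comp_simps)
    then have "x \<^bold>+ (s' \<cdot> m) = z \<cdot> m" unfolding z_def using y'A s'A M ik VD(1)
      by (simp only: add_comp comp_simps)
    then have "f = (z \<cdot> m) \<^bold>+ f'" using fx xA s'A M fA by (simp flip: add_assoc)
    then show ?thesis by (intro homotopicI[where s = z and B = "Cod C i"]) (use M f z in simp_all)
  qed
qed

end

section \<open>Cohomology of an M-resolution in positive degrees\<close>

context model_setup
begin

text \<open>The left half of the complex cut off at its n-th syzygy \<open>Z\<close>, the domain of
  \<open>fst (hd \<sigma>)\<close>. The differential \<open>d n\<close> is the epimorphism
  \<open>e\<close> onto \<open>Z\<close> followed by the first monomorphism of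
  \<open>\<sigma>\<close>, and the last arrow is the augmentation \<open>\<epsilon>\<close> in place
  of \<open>d 0\<close>.\<close>

definition res_data :: "nat \<Rightarrow> 'o \<Rightarrow> (int \<Rightarrow> 'm) \<Rightarrow> 'm \<Rightarrow> ('m \<times> 'm) list \<Rightarrow> 'm \<Rightarrow> bool" where
  "res_data n A d \<epsilon> \<sigma> e \<longleftrightarrow> t.resolution_of (Dom C (fst (hd \<sigma>))) \<sigma> A \<and> length \<sigma> = n \<and> t.special \<sigma> \<and>
     is_cokernel C e (d (int n + 1)) \<and> d (int n) = fst (hd \<sigma>) \<cdot> e \<and> Cod C e = Dom C (fst (hd \<sigma>)) \<and>
     Dom C e = Dom C (d (int n)) \<and> Dom C (d (int n - 1)) = Cod C (fst (hd \<sigma>)) \<and> Dom C \<epsilon>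
         = Dom C (d 0) \<and>
     part C \<sigma> n = \<epsilon> \<and> (\<forall>j. 0 < j \<and> j < n \<longrightarrow> part C \<sigma> j = d (int n - int j))"

lemma M_resolution_data:
  assumes "M_resolution C Q W R A d \<epsilon> \<eta>" "n \<ge> 1"
  shows "\<exists>\<sigma> e. res_data n A d \<epsilon> \<sigma> e"
proof -
  have ex: "exact C (d (i + 1)) (d i)" for i using assms(1) by (simp add: M_resolution_def)
  have ep: "\<epsilon> \<in> Hom C (Dom C (d 0)) A" "exact C (d 1) \<epsilon>" "is_epi C \<epsilon>"
    using assms(1) unfolding M_resolution_def by blast+
  have inP: "Dom C (d i) \<in> Q \<inter> W" if "i \<ge> 0" for i using assms(1) that
    by (simp add: M_resolution_def)
  have kerR: "is_kernel C k \<epsilon> \<Longrightarrow> Dom C k \<in> R" "i \<ge> 1 \<Longrightarrow> is_kernel C k (d i) \<Longrightarrow> Dom C k \<in> R" for k i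
    using assms(1) unfolding M_resolution_def by blast+
  \<comment> \<open>The arrow that follows \<open>d n\<close> in the cut-off sequence. In degree one
    it is the augmentation, since \<open>d 0\<close> leads on into the right half of the
    complex.\<close>
  define nxt where "nxt = (if n = 1 then \<epsilon> else d (int n - 1))"
  have "exact C (d (int n)) nxt" using ep(2) ex[of "int n - 1"] by (simp add: nxt_def)
  then obtain c k where ck: "is_cokernel C c (d (int n))" "is_kernel C k c" "is_kernel C k nxt"
    by (auto simp: exact_def)
  obtain e where e: "is_epi C e" "Dom C e = Dom C (d (int n))" "Cod C e = Dom C k"
      "d (int n) = k \<cdot> e"
    by (rule image_factorization[OF ck(1,2)])
  obtain c' k' where ck': "is_cokernel C c' (d (int n + 1))" "is_kernel C k' c'"
      "is_kernel C k' (d (int n))"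
    using ex[of "int n"] by (auto simp: exact_def)
  obtain e' where e': "is_epi C e'" "Dom C e' = Dom C (d (int n + 1))" "Cod C e' = Dom C k'"
      "d (int n + 1) = k' \<cdot> e'"
    by (rule image_factorization[OF ck'(1,2)])
  note km = kernel_mono[OF ck(2)] and kD = kernelD[OF ck(2)] and k'D = kernelD[OF ck'(2)]
  \<comment> \<open>\<open>k\<close> is mono, so \<open>k'\<close> is a kernel of \<open>e\<close>
    too and \<open>e\<close> its cokernel; and as \<open>e'\<close> is epi, a cokernel of
    \<open>k'\<close> is one of \<open>d (n + 1)\<close>.\<close>
  have "is_kernel C k' e" using ck'(3) unfolding e(4)
    using kernel_mono_comp[OF km epi_arr[OF e(1)] e(3)] by simp
  then have ce: "is_cokernel C e (d (int n + 1))"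
    unfolding e'(4) using epi_cokernel_of_kernel[OF e(1)] cokernel_epi_comp[OF e'(1) k'D(1)] e'(3)
      by simp
  define Ef where "Ef j = (if j = 0 then k else if j = n then \<epsilon> else d (int n - int j))" for j
  define E where "E = map Ef [0..<Suc n]"
  have nth: "E ! j = Ef j" if "j \<le> n" for j unfolding E_def using that
    by (subst nth_map) (simp_all del: upt_Suc)
  have dA: "d i \<in> Arr C" for i using ex[of i] by (simp add: exact_def)
  have EA: "Ef j \<in> Arr C" for j using kD ep dA by (simp add: Ef_def in_Hom)
  have exE: "exact C (Ef i) (Ef (Suc i))" if i: "i < n" for i
  proof -
    consider "i = 0" | "0 < i" "Suc i = n" | "0 < i" "Suc i < n" using i by linarith
    then show ?thesis
    proof cases
      case 1
      obtain c0 where c0: "is_cokernel C c0 k" using cokernels kD by blast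
      have "Ef (Suc i) = nxt" using 1 by (auto simp: Ef_def nxt_def)
      then show ?thesis using 1 c0 mono_kernel_of_cokernel[OF km c0] ck(3) kernelD[OF ck(3)]
        by (auto simp: exact_def Ef_def)
    next
      case 2
      then have eq: "int n - int i = 1" by linarith
      have "Ef i = d 1" unfolding Ef_def eq using 2 by simp
      then show ?thesis using 2 ep(2) by (simp add: Ef_def)
    next
      case 3
      have eq: "int n - int i = (int n - int (Suc i)) + 1" by simp
      have "Ef i = d ((int n - int (Suc i)) + 1)" unfolding Ef_def eq using 3 by simp
      moreover have "Ef (Suc i) = d (int n - int (Suc i))" using 3 by (simp add: Ef_def)
      ultimately show ?thesis using ex[of "int n - int (Suc i)"] by simp
    qed
  qed
  have ends: "Ef 0 = k" "Ef n = \<epsilon>" using assms(2) by (auto simp: Ef_def)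
  have "set E \<subseteq> Arr C" "length E = Suc n" unfolding E_def using EA by (auto simp del: upt_Suc)
  then have E: "E \<in> ext_seqs C n A (Dom C k)"
    unfolding ext_seqs_def using exE nth ends km ep by (simp add: in_Hom)
  obtain \<sigma> where \<sigma>: "path C (Dom C k) \<sigma> A" "length \<sigma> = n" "flat C \<sigma> = E"
    by (rule ext_seqs_factorization[OF E assms(2)])
  have ne: "\<sigma> \<noteq> []" using \<sigma>(2) assms(2) by auto
  have part: "part C \<sigma> j = Ef j" if "j \<le> n" for j using nth[OF that] nth_flat[of j \<sigma> C] \<sigma> that
    by simp
  have hd: "fst (hd \<sigma>) = k" using part[of 0] ne by (simp add: part_def hd_conv_nth Ef_def)
  have mid: "Cod C (fst (\<sigma> ! i)) \<in> Q \<inter> W" "Dom C (fst (\<sigma> ! i)) \<in> R" if i: "i < n" for i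
  proof -
    have "Cod C (fst (\<sigma> ! i)) = Dom C (Ef (Suc i))"
      using part_simps(2)[OF \<sigma>(1) ne, of "Suc i"] part[of "Suc i"] \<sigma>(2) i by simp
    moreover have "Dom C (Ef (Suc i)) \<in> Q \<inter> W" using inP[of 0] inP[of "int n - int (Suc i)"] ep(1) i
      by (simp add: Ef_def in_Hom)
    ultimately show "Cod C (fst (\<sigma> ! i)) \<in> Q \<inter> W" by simp
    have "is_kernel C (fst (\<sigma> ! i)) (Ef (Suc i))"
      using part_kernel[OF \<sigma>(1), of i] part[of "Suc i"] \<sigma>(2) i by simp
    then show "Dom C (fst (\<sigma> ! i)) \<in> R"
      using kerR(1) kerR(2)[of "int n - int (Suc i)"] i by (cases "Suc i = n") (auto simp: Ef_def)
  qed
  have "t.resolution_of (Dom C k) \<sigma> A" "t.special \<sigma>"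
    using \<sigma> ne mid Hom_Obj(2)[OF ep(1)]
    by (simp_all add: t.resolution_of_def t.P_middle_def t.special_def all_set_conv_all_nth)
  moreover have "Dom C (d (int n - 1)) = Cod C k"
    using ex[of "int n - 1"] e(4) kD epi_arr[OF e(1)] e(3) by (simp add: exact_def)
  ultimately show ?thesis
    unfolding res_data_def using hd \<sigma>(2) ce e(2,3,4) ep(1) part assms(2)
    by (intro exI[of _ \<sigma>] exI[of _ e]) (auto simp: in_Hom Ef_def)
qed

text \<open>\<open>t n\<close> respects boundaries and so induces \<open>\<tau>\<close> on the
  syzygies, which are cokernels. With the lower components of \<open>t\<close> and with
  \<open>h\<close> at the right end it forms a morphism of the cut-off sequences.\<close>

lemma res_data_map:
  assumes "res_data n X d \<epsilon> \<sigma> e" "res_data n Y d' \<epsilon>' \<sigma>' e'" "h \<in> Hom C X Y"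
    "\<And>i. t i \<in> Hom C (Dom C (d i)) (Dom C (d' i))" "\<And>i. t (i - 1) \<cdot> d i = d' i \<cdot> t i"
        "\<epsilon>' \<cdot> t 0 = h \<cdot> \<epsilon>"
    "n \<ge> 1"
  obtains \<tau> where "\<tau> \<in> Hom C (Dom C (fst (hd \<sigma>))) (Dom C (fst (hd \<sigma>')))" "path_mor C \<sigma> \<sigma>' \<tau> h"
    "\<tau> \<cdot> e = e' \<cdot> t (int n)" "fst (hd \<sigma>') \<cdot> \<tau> = t (int n - 1) \<cdot> fst (hd \<sigma>)"
proof -
  define m where "m = fst (hd \<sigma>)"
  define m' where "m' = fst (hd \<sigma>')"
  have D: "path C (Dom C m) \<sigma> X" "\<sigma> \<noteq> []" "length \<sigma> = n" "is_cokernel C e (d (int n + 1))"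
      "d (int n) = m \<cdot> e"
    "Cod C e = Dom C m" "Dom C e = Dom C (d (int n))" "Dom C (d (int n - 1)) = Cod C m"
        "Dom C \<epsilon> = Dom C (d 0)"
    "part C \<sigma> n = \<epsilon>" "\<And>j. 0 < j \<Longrightarrow> j < n \<Longrightarrow> part C \<sigma> j = d (int n - int j)" "m \<in> Arr C"
    using assms(1) t.resolution_of_hd by (auto simp: res_data_def t.resolution_of_def m_def)
  have D': "path C (Dom C m') \<sigma>' Y" "\<sigma>' \<noteq> []" "length \<sigma>' = n" "is_cokernel C e' (d' (int n + 1))"
      "d' (int n) = m' \<cdot> e'"
    "Cod C e' = Dom C m'" "Dom C e' = Dom C (d' (int n))" "Dom C (d' (int n - 1)) = Cod C m'"
        "Dom C \<epsilon>' = Dom C (d' 0)"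
    "part C \<sigma>' n = \<epsilon>'" "\<And>j. 0 < j \<Longrightarrow> j < n \<Longrightarrow> part C \<sigma>' j = d' (int n - int j)" "m' \<in> Arr C"
    using assms(2) t.resolution_of_hd by (auto simp: res_data_def t.resolution_of_def m'_def)
  have hm: "fst (\<sigma> ! 0) = m" "fst (\<sigma>' ! 0) = m'" using D(2) D'(2)
    by (simp_all add: m_def m'_def hd_conv_nth)
  note c = cokernelD[OF D(4)] and c' = cokernelD[OF D'(4)]
  have tA: "t i \<in> Arr C" "Dom C (t i) = Dom C (d i)" "Cod C (t i) = Dom C (d' i)" for i
    using assms(4)[of i] by (simp_all add: in_Hom)
  have s1: "t (int n) \<cdot> d (int n + 1) = d' (int n + 1) \<cdot> t (int n + 1)"
    using assms(5)[of "int n + 1"] by simp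
  have "e' \<cdot> (t (int n) \<cdot> d (int n + 1)) = Zero C (Dom C (d (int n + 1))) (Cod C e')"
    unfolding s1 using c c' tA D'(7) by (simp add: comp_reduce[OF c'(4)])
  then obtain \<tau> where \<tau>: "\<tau> \<in> Hom C (Dom C m) (Dom C m')" "\<tau> \<cdot> e = e' \<cdot> t (int n)"
    using cokernel_factor[OF D(4), of "e' \<cdot> t (int n)"] c c' tA D(6,7) D'(6,7) by auto
  note \<tau>A = \<tau>(1)[unfolded in_Hom]
  have "(m' \<cdot> \<tau>) \<cdot> e = d' (int n) \<cdot> t (int n)" unfolding D'(5) using \<tau> \<tau>A c c' D(6) D'(6,7,12) tA
    by simp
  also have "\<dots> = (t (int n - 1) \<cdot> m) \<cdot> e" unfolding assms(5)[symmetric] D(5) using tA D(6,8,12) c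
    by simp
  finally have mt: "m' \<cdot> \<tau> = t (int n - 1) \<cdot> m"
    using \<tau>A c D(6,8,12) D'(8,12) tA by - (rule epi_cancel[OF cokernel_epi[OF D(4)]], simp_all)
  \<comment> \<open>Position \<open>j\<close> of the sequence carries chain degree
    \<open>n - j\<close>.\<close>
  define H where "H j = (if j = 0 then \<tau> else if j = Suc n then h else t (int n - int j))" for j
  have so: "seq_obj C n (flat C \<sigma>) j = (if j = 0 then Dom C m else if j
      = Suc n then X else Dom C (d (int n - int j)))"
    if "j \<le> Suc n" for j
  proof (cases "0 < j \<and> j < Suc n")
    case True
    then show ?thesis using D(3,9,10) D(11)[of j] by (cases "j = n") (auto simp: seq_obj_def)
  next
    case False
    then show ?thesis using that seq_obj_flat[OF D(1,2), of j] D(3) by auto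
  qed
  have so': "seq_obj C n (flat C \<sigma>') j = (if j = 0 then Dom C m' else if j
      = Suc n then Y else Dom C (d' (int n - int j)))"
    if "j \<le> Suc n" for j
  proof (cases "0 < j \<and> j < Suc n")
    case True
    then show ?thesis using D'(3,9,10) D'(11)[of j] by (cases "j = n") (auto simp: seq_obj_def)
  next
    case False
    then show ?thesis using that seq_obj_flat[OF D'(1,2), of j] D'(3) by auto
  qed
  have "\<forall>j\<le>Suc n. H j \<in> Hom C (seq_obj C n (flat C \<sigma>) j) (seq_obj C n (flat C \<sigma>') j)"
    using so so' \<tau>(1) assms(3,4) by (auto simp: H_def)
  moreover have "H (Suc j) \<cdot> flat C \<sigma> ! j = flat C \<sigma>' ! j \<cdot> H j" if j: "j \<le> n" for j
  proof -
    consider "j = 0" | "0 < j" "j < n" | "j = n" "0 < n" using j assms(7) by linarith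
    then show ?thesis
    proof cases
      case 1
      then show ?thesis using mt hm D(3) D'(3) assms(7) by (simp add: H_def part_def)
    next
      case 2
      have "H (Suc j) = t (int n - int j - 1)" using 2
        by (auto simp: H_def intro!: arg_cong[where f = t])
      moreover have "H j = t (int n - int j)" using 2 by (simp add: H_def)
      ultimately show ?thesis using 2 D(3,11) D'(3,11) assms(5)[of "int n - int j"] by simp
    next
      case 3
      then show ?thesis using D(3,10) D'(3,10) assms(6) by (simp add: H_def)
    qed
  qed
  ultimately have "seq_mor C n (flat C \<sigma>) (flat C \<sigma>') \<tau> h"
    unfolding seq_mor_def seq_morphism_def by (intro exI[of _ H]) (simp add: H_def)
  then have "path_mor C \<sigma> \<sigma>' \<tau> h" using seq_mor_iff_path_mor[OF D(1) D'(1) D(3) D'(3) assms(7)]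
    by simp
  then show thesis using that \<tau> mt by (simp add: m_def m'_def)
qed

text \<open>A cocycle factors uniquely through the epimorphism \<open>e\<close>, and its factor
  classifies Yoneda sequences. Collecting over the whole coset avoids the choice of a
  representative.\<close>

definition coset_ext :: "'o \<Rightarrow> 'o \<Rightarrow> ('m \<times> 'm) list \<Rightarrow> 'm \<Rightarrow> 'm set \<Rightarrow> 'm list set" where
  "coset_ext A B \<sigma> e x = {E. \<exists>f\<in>x. \<exists>g. f = g \<cdot> e \<and> t.classifies_seq A B \<sigma> E g}"

text \<open>The cohomology class of the cocycle \<open>g \<cdot> e\<close>, as identified by
  \<open>coset_eq\<close>.\<close>

definition hcoset :: "('m \<times> 'm) list \<Rightarrow> 'm \<Rightarrow> 'm \<Rightarrow> 'm set" where
  "hcoset \<sigma> e g = {g' \<cdot> e | g'. homotopic C (fst (hd \<sigma>)) g' g}"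

context
  fixes n A d \<epsilon> \<sigma> e B
  assumes dat: "res_data n A d \<epsilon> \<sigma> e" and B: "B \<in> R" and n: "n \<ge> 1"
begin

abbreviation (input) m where "m \<equiv> fst (hd \<sigma>)"

lemma dataD:
  shows "t.resolution_of (Dom C m) \<sigma> A" "length \<sigma> = n" "is_cokernel C e (d (int n + 1))"
      "d (int n) = m \<cdot> e"
    "Cod C e = Dom C m" "Dom C e = Dom C (d (int n))" "Dom C (d (int n - 1)) = Cod C m"
    "e \<in> Arr C" "d (int n + 1) \<in> Arr C" "Dom C e = Cod C (d (int n + 1))" "is_epi C e"
    "m \<in> Arr C" "B \<in> Obj C"
proof -
  note r = dat[unfolded res_data_def]
  show c: "is_cokernel C e (d (int n + 1))" and res: "t.resolution_of (Dom C m) \<sigma> A" using r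
    by blast+
  show "length \<sigma> = n" "d (int n) = m \<cdot> e" "Cod C e = Dom C m" "Dom C e = Dom C (d (int n))"
    "Dom C (d (int n - 1)) = Cod C m" using r by blast+
  show "e \<in> Arr C" "d (int n + 1) \<in> Arr C" "Dom C e = Cod C (d (int n + 1))" "is_epi C e"
    by (rule cokernelD[OF c] cokernel_epi[OF c])+
  show "m \<in> Arr C" by (rule t.resolution_of_hd(1)[OF res])
  show "B \<in> Obj C" using B t.R_Obj by blast
qed

text \<open>Stated for arbitrary nonempty sets of mutually homotopic cocycles, so that it applies
  directly to products of cosets and to the values of \<open>Hom_cohomology_map\<close>.\<close>

lemma coset_ext_ext_class:
  assumes "x \<noteq> {}" "\<And>f. f \<in> x \<Longrightarrow> \<exists>g'. f = g' \<cdot> e \<and> homotopic C m g' g" "g \<in> Hom C (Dom C m) B"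
  shows "coset_ext A B \<sigma> e x = t.ext_class A B \<sigma> g"
proof -
  have *: "t.classifies_seq A B \<sigma> E g' \<longleftrightarrow> t.classifies_seq A B \<sigma> E g" if h: "homotopic C m g' g"
    for E g'
  proof -
    have "g' \<in> Hom C (Dom C m) B" using h assms(3) by (auto elim!: homotopicE simp: in_Hom)
    then have "t.ext_class A B \<sigma> g' = t.ext_class A B \<sigma> g"
      using t.ext_class_eq_iff[OF dataD(1,2) B _ assms(3)] h by blast
    then show ?thesis by (auto simp: t.ext_class_def)
  qed
  have "(\<exists>g1. f = g1 \<cdot> e \<and> t.classifies_seq A B \<sigma> E g1) \<longleftrightarrow> t.classifies_seq A B \<sigma> E g" if "f \<in> x"
    for f E
  proof -
    obtain g' where g': "f = g' \<cdot> e" "homotopic C m g' g" using assms(2) \<open>f \<in> x\<close> by blast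
    have g'A: "g' \<in> Arr C" "Dom C g' = Dom C m" "Cod C g' = B" using g'(2) assms(3)
      by (auto elim!: homotopicE simp: in_Hom)
    show ?thesis
    proof
      assume "\<exists>g1. f = g1 \<cdot> e \<and> t.classifies_seq A B \<sigma> E g1"
      then obtain g1 where g1: "f = g1 \<cdot> e" "t.classifies_seq A B \<sigma> E g1" by blast
      have "g1 \<in> Hom C (Dom C m) B" using t.classifies_seq_hom[OF dataD(1,2) B g1(2)] .
      then have "g1 = g'" using g1(1) g'(1) g'A dataD(5)
        by - (rule epi_cancel[OF dataD(11)], simp_all add: in_Hom)
      then show "t.classifies_seq A B \<sigma> E g" using g1(2) * g'(2) by simp
    next
      assume "t.classifies_seq A B \<sigma> E g"
      then show "\<exists>g1. f = g1 \<cdot> e \<and> t.classifies_seq A B \<sigma> E g1" using g' * by blast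
    qed
  qed
  then show ?thesis using assms(1) by (auto simp: coset_ext_def t.ext_class_def)
qed

lemma coset_ext_hcoset:
  assumes "g \<in> Hom C (Dom C m) B"
  shows "coset_ext A B \<sigma> e (hcoset \<sigma> e g) = t.ext_class A B \<sigma> g"
  by (rule coset_ext_ext_class) (use assms homotopic_refl[OF dataD(12), of g] in \<open>auto simp:
      hcoset_def in_Hom\<close>)

lemma cocycles_eq: "cocycles C d (int n) B = {g \<cdot> e | g. g \<in> Hom C (Dom C m) B}"
proof -
  have "cocycles C d (int n) B = {f \<in> Hom C (Dom C e) B. f \<cdot> d (int n + 1)
      = Zero C (Dom C (d (int n + 1))) B}"
    by (simp add: cocycles_def kernel_def hom_group_def dataD(6))
  also have "\<dots> = {g \<cdot> e | g. g \<in> Hom C (Dom C m) B}"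
  proof (intro equalityI subsetI)
    fix f assume "f \<in> {f \<in> Hom C (Dom C e) B. f \<cdot> d (int n + 1) = Zero C (Dom C (d (int n + 1))) B}"
    then have f: "f \<in> Arr C" "Dom C f = Dom C e" "Cod C f = B"
        "f \<cdot> d (int n + 1) = Zero C (Dom C (d (int n + 1))) B"
      by (auto simp: in_Hom)
    then obtain g where "g \<in> Hom C (Cod C e) B" "g \<cdot> e = f"
      using cokernel_factor[OF dataD(3), of f] dataD(10) by auto
    then show "f \<in> {g \<cdot> e | g. g \<in> Hom C (Dom C m) B}" using dataD(5) by auto
  next
    fix f assume "f \<in> {g \<cdot> e | g. g \<in> Hom C (Dom C m) B}"
    then obtain g where g: "g \<in> Arr C" "Dom C g = Dom C m" "Cod C g = B" "f = g \<cdot> e"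
      by (auto simp: in_Hom)
    have "g \<cdot> (e \<cdot> d (int n + 1)) = Zero C (Dom C (d (int n + 1))) B"
      using g dataD(5,9) by (simp add: cokernelD(4)[OF dataD(3)])
    then show "f \<in> {f \<in> Hom C (Dom C e) B. f \<cdot> d (int n + 1) = Zero C (Dom C (d (int n + 1))) B}"
      using g dataD(5,8,9,10) by (simp add: in_Hom)
  qed
  finally show ?thesis .
qed

lemma coboundaries_eq: "coboundaries C d (int n) B = {(s \<cdot> m) \<cdot> e | s. s \<in> Hom C (Cod C m) B}"
proof -
  have "f \<cdot> d (int n) = (f \<cdot> m) \<cdot> e" if "f \<in> Hom C (Cod C m) B" for f
    using that dataD(4,5,8,12) by (simp add: in_Hom)
  then show ?thesis
    unfolding coboundaries_def dataD(7) Setcompr_eq_image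
      by (simp add: hom_group_def cong: image_cong_simp)
qed

lemma coset_eq:
  assumes "g \<in> Hom C (Dom C m) B"
  shows "(\<Union>h\<in>coboundaries C d (int n) B. {h \<^bold>+ (g \<cdot> e)}) = hcoset \<sigma> e g"
proof -
  note gA = assms[unfolded in_Hom]
  have *: "((s \<cdot> m) \<cdot> e) \<^bold>+ (g \<cdot> e) = ((s \<cdot> m) \<^bold>+ g) \<cdot> e" if "s \<in> Hom C (Cod C m) B" for s
    using that gA dataD(5,8,12) by (simp add: in_Hom add_comp)
  have "(\<Union>h\<in>coboundaries C d (int n) B. {h \<^bold>+ (g \<cdot> e)})
      = {((s \<cdot> m) \<^bold>+ g) \<cdot> e | s. s \<in> Hom C (Cod C m) B}"
    unfolding coboundaries_eq using * by auto
  moreover have "homotopic C m g' g \<longleftrightarrow> (\<exists>s\<in>Hom C (Cod C m) B. g' = (s \<cdot> m) \<^bold>+ g)" for g'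
    using gA dataD(12) by (simp add: homotopic_def in_Hom)
  ultimately show ?thesis unfolding hcoset_def by auto
qed

lemma cohomology_simps:
  "carrier (Hom_cohomology C d (int n) B) = hcoset \<sigma> e ` Hom C (Dom C m) B"
  "x \<otimes>\<^bsub>Hom_cohomology C d (int n) B\<^esub> y = (\<Union>a\<in>x. \<Union>b\<in>y. {a \<^bold>+ b})"
proof -
  have "carrier (Hom_cohomology C d (int n) B) =
      (\<Union>a\<in>cocycles C d (int n) B. {\<Union>h\<in>coboundaries C d (int n) B. {h \<^bold>+ a}})"
    by (simp add: Hom_cohomology_def FactGroup_def RCOSETS_def r_coset_def hom_group_def)
  also have "\<dots> = hcoset \<sigma> e ` Hom C (Dom C m) B" unfolding cocycles_eq using coset_eq by auto
  finally show "carrier (Hom_cohomology C d (int n) B) = hcoset \<sigma> e ` Hom C (Dom C m) B" .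
  show "x \<otimes>\<^bsub>Hom_cohomology C d (int n) B\<^esub> y = (\<Union>a\<in>x. \<Union>b\<in>y. {a \<^bold>+ b})"
    by (simp add: Hom_cohomology_def FactGroup_def set_mult_def hom_group_def)
qed

text \<open>Both groups are the arrows from the syzygy to \<open>B\<close> modulo
  \<open>homotopic\<close>: the first by \<open>cohomology_simps\<close>, the second by
  \<open>t.ext_class_eq_iff\<close> and \<open>t.baer_sum_ext_class\<close>.\<close>

lemma coset_ext_iso: "coset_ext A B \<sigma> e \<in> iso (Hom_cohomology C d (int n) B) (YExt C n A B)"
proof (rule isoI)
  let ?H = "Hom_cohomology C d (int n) B"
  note ne = dataD(1,2)
  show "coset_ext A B \<sigma> e \<in> hom ?H (YExt C n A B)"
  proof (rule homI)
    fix x assume "x \<in> carrier ?H"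
    then show "coset_ext A B \<sigma> e x \<in> carrier (YExt C n A B)"
      unfolding cohomology_simps using coset_ext_hcoset t.ext_class_carrier[OF ne B] by auto
  next
    fix x y assume "x \<in> carrier ?H" "y \<in> carrier ?H"
    then obtain g g' where g: "g \<in> Hom C (Dom C m) B" "x = hcoset \<sigma> e g" "g' \<in> Hom C (Dom C m) B"
        "y = hcoset \<sigma> e g'"
      unfolding cohomology_simps by auto
    note gA = g(1,3)[unfolded in_Hom]
    have "coset_ext A B \<sigma> e (x \<otimes>\<^bsub>?H\<^esub> y) = t.ext_class A B \<sigma> (g \<^bold>+ g')"
    proof (rule coset_ext_ext_class)
      have "g \<cdot> e \<in> x" "g' \<cdot> e \<in> y" using g gA homotopic_refl[OF dataD(12)]
        by (auto simp: hcoset_def)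
      then show "x \<otimes>\<^bsub>?H\<^esub> y \<noteq> {}" unfolding cohomology_simps by blast
      show "g \<^bold>+ g' \<in> Hom C (Dom C m) B" using gA by (simp add: in_Hom)
      fix f assume "f \<in> x \<otimes>\<^bsub>?H\<^esub> y"
      then obtain a b where ab: "f = (a \<cdot> e) \<^bold>+ (b \<cdot> e)" "homotopic C m a g" "homotopic C m b g'"
        unfolding cohomology_simps using g by (auto simp: hcoset_def)
      have A: "a \<in> Arr C" "Dom C a = Dom C m" "Cod C a = B" "b \<in> Arr C" "Dom C b = Dom C m"
          "Cod C b = B"
        using ab(2,3) gA by (auto elim!: homotopicE)
      have "f = (a \<^bold>+ b) \<cdot> e" using ab(1) A dataD(5,8) by (simp add: add_comp)
      moreover have "homotopic C m (a \<^bold>+ b) (g \<^bold>+ g')" using homotopic_add[OF ab(2,3)] A by simp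
      ultimately show "\<exists>u. f = u \<cdot> e \<and> homotopic C m u (g \<^bold>+ g')" by blast
    qed
    also have "\<dots> = coset_ext A B \<sigma> e x \<otimes>\<^bsub>YExt C n A B\<^esub> coset_ext A B \<sigma> e y"
      using g coset_ext_hcoset t.baer_sum_ext_class[OF ne B g(1,3)] by (simp add: YExt_def)
    finally show "coset_ext A B \<sigma> e (x \<otimes>\<^bsub>?H\<^esub> y)
        = coset_ext A B \<sigma> e x \<otimes>\<^bsub>YExt C n A B\<^esub> coset_ext A B \<sigma> e y" .
  qed
  show "bij_betw (coset_ext A B \<sigma> e) (carrier ?H) (carrier (YExt C n A B))"
  proof (rule bij_betw_imageI)
    show "inj_on (coset_ext A B \<sigma> e) (carrier ?H)"
    proof (rule inj_onI)
      fix x y assume "x \<in> carrier ?H" "y \<in> carrier ?H" and eq: "coset_ext A B \<sigma> e x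
          = coset_ext A B \<sigma> e y"
      then obtain g g' where g: "g \<in> Hom C (Dom C m) B" "x = hcoset \<sigma> e g" "g' \<in> Hom C (Dom C m) B"
          "y = hcoset \<sigma> e g'"
        unfolding cohomology_simps by auto
      have h: "homotopic C m g g'" using eq g coset_ext_hcoset t.ext_class_eq_iff[OF ne B g(1,3)]
        by simp
      have "homotopic C m u g \<longleftrightarrow> homotopic C m u g'" for u using h homotopic_trans homotopic_sym
        by blast
      then show "x = y" by (simp add: g hcoset_def)
    qed
    show "coset_ext A B \<sigma> e ` carrier ?H = carrier (YExt C n A B)"
    proof (intro equalityI subsetI)
      fix z assume "z \<in> coset_ext A B \<sigma> e ` carrier ?H"
      then show "z \<in> carrier (YExt C n A B)"
        unfolding cohomology_simps using coset_ext_hcoset t.ext_class_carrier[OF ne B] by auto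
    next
      fix z assume "z \<in> carrier (YExt C n A B)"
      then obtain g where "g \<in> Hom C (Dom C m) B" "z = t.ext_class A B \<sigma> g"
        by (rule t.carrier_ext_class[OF ne B])
      then show "z \<in> coset_ext A B \<sigma> e ` carrier ?H" unfolding cohomology_simps
        using coset_ext_hcoset by auto
    qed
  qed
qed

end

text \<open>Since \<open>\<tau> \<cdot> e' = e \<cdot> t n\<close>, composing a cocycle
  \<open>u \<cdot> e\<close> with \<open>t n\<close> and \<open>k\<close> amounts to replacing
  \<open>u\<close> by \<open>k \<cdot> u \<cdot> \<tau>\<close>, which is the formula of
  \<open>t.YExt_map_ext_class\<close>.\<close>

lemma coset_ext_natural:
  assumes "res_data n A d \<epsilon> \<sigma> e" "res_data n A' d' \<epsilon>' \<sigma>' e'" "B \<in> R" "B' \<in> R" "n \<ge> 1"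
      "h \<in> Hom C A' A" "k \<in> Hom C B B'"
    "\<And>i. t i \<in> Hom C (Dom C (d' i)) (Dom C (d i))" "\<And>i. t (i - 1) \<cdot> d' i = d i \<cdot> t i"
        "\<epsilon> \<cdot> t 0 = h \<cdot> \<epsilon>'"
    "x \<in> carrier (Hom_cohomology C d (int n) B)"
  shows "coset_ext A' B' \<sigma>' e' (Hom_cohomology_map C d' (int n) t k x)
      = YExt_map C n h k (coset_ext A B \<sigma> e x)"
proof -
  let ?m = "fst (hd \<sigma>)" and ?m' = "fst (hd \<sigma>')"
  note D = dataD[OF assms(1,3,5)] and D' = dataD[OF assms(2,4,5)] and kA = assms(7)[unfolded in_Hom]
  obtain \<tau> where \<tau>: "\<tau> \<in> Hom C (Dom C ?m') (Dom C ?m)" "path_mor C \<sigma>' \<sigma> \<tau> h"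
    "\<tau> \<cdot> e' = e \<cdot> t (int n)" "?m \<cdot> \<tau> = t (int n - 1) \<cdot> ?m'"
    by (rule res_data_map[OF assms(2,1,6,8,9,10,5)])
  note \<tau>A = \<tau>(1)[unfolded in_Hom]
  have tA: "t i \<in> Arr C" "Dom C (t i) = Dom C (d' i)" "Cod C (t i) = Dom C (d i)" for i
    using assms(8)[of i] by (simp_all add: in_Hom)
  obtain g where g: "g \<in> Hom C (Dom C ?m) B" "x = hcoset \<sigma> e g"
    using assms(11) unfolding cohomology_simps[OF assms(1,3,5)] by auto
  note gA = g(1)[unfolded in_Hom]
  let ?y = "Hom_cohomology_map C d' (int n) t k x"
  have y: "?y = (\<Union>c\<in>coboundaries C d' (int n) B'. \<Union>f\<in>x. {c \<^bold>+ (k \<cdot> f \<cdot> t (int n))})"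
    using kA by (simp add: Hom_cohomology_map_def set_mult_def hom_group_def)
  have "coset_ext A' B' \<sigma>' e' ?y = t.ext_class A' B' \<sigma>' (k \<cdot> g \<cdot> \<tau>)"
  proof (rule coset_ext_ext_class[OF assms(2,4,5)])
    show "k \<cdot> g \<cdot> \<tau> \<in> Hom C (Dom C ?m') B'" using kA gA \<tau>A by (simp add: in_Hom)
    have "Zero C (Cod C ?m') B' \<in> Hom C (Cod C ?m') B'" using D'(12,13) by (simp add: in_Hom)
    then have "coboundaries C d' (int n) B' \<noteq> {}" unfolding coboundaries_eq[OF assms(2,4,5)]
      by blast
    moreover have "g \<cdot> e \<in> x" using g gA homotopic_refl[OF D(12)] by (auto simp: hcoset_def)
    ultimately show "?y \<noteq> {}" unfolding y by blast
    fix f assume "f \<in> ?y"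
    then obtain c a where ca: "c \<in> coboundaries C d' (int n) B'" "a \<in> x"
        "f = c \<^bold>+ (k \<cdot> a \<cdot> t (int n))"
      unfolding y by blast
    then obtain s u where su: "s \<in> Hom C (Cod C ?m') B'" "homotopic C ?m u g"
        "f = ((s \<cdot> ?m') \<cdot> e') \<^bold>+ (k \<cdot> (u \<cdot> e) \<cdot> t (int n))"
      unfolding coboundaries_eq[OF assms(2,4,5)] g(2) hcoset_def by blast
    note sA = su(1)[unfolded in_Hom]
    have uA: "u \<in> Arr C" "Dom C u = Dom C ?m" "Cod C u = B" using su(2) gA
      by (auto elim!: homotopicE)
    have "k \<cdot> (u \<cdot> e) \<cdot> t (int n) = k \<cdot> u \<cdot> (\<tau> \<cdot> e')" unfolding \<tau>(3) using kA uA D(5,6,8) tA by simp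
    then have "f = ((s \<cdot> ?m') \<^bold>+ (k \<cdot> u \<cdot> \<tau>)) \<cdot> e'" unfolding su(3) using sA kA uA \<tau>A D'(5,8,12)
      by (simp add: add_comp)
    moreover have "homotopic C ?m' ((s \<cdot> ?m') \<^bold>+ (k \<cdot> u \<cdot> \<tau>)) (k \<cdot> g \<cdot> \<tau>)"
    proof (rule homotopic_trans)
      show "homotopic C ?m' ((s \<cdot> ?m') \<^bold>+ (k \<cdot> u \<cdot> \<tau>)) (k \<cdot> u \<cdot> \<tau>)"
        by (rule homotopicI[where s = s and B
            = B']) (use su(1) kA uA \<tau>A D'(12) in \<open>simp_all add: in_Hom\<close>)
      have "homotopic C ?m' (u \<cdot> \<tau>) (g \<cdot> \<tau>)"
        by (rule homotopic_precomp[OF su(2) _ _ _ D'(12) _ \<tau>(4)]) (use \<tau>A tA D(7) D'(7) in \<open>simp_all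
            add: in_Hom\<close>)
      then show "homotopic C ?m' (k \<cdot> u \<cdot> \<tau>) (k \<cdot> g \<cdot> \<tau>)"
        by (rule homotopic_comp) (use kA gA \<tau>A in simp_all)
    qed
    ultimately show "\<exists>g'. f = g' \<cdot> e' \<and> homotopic C ?m' g' (k \<cdot> g \<cdot> \<tau>)" by blast
  qed
  also have "\<dots> = YExt_map C n h k (t.ext_class A B \<sigma> g)"
    by (rule t.YExt_map_ext_class[OF D(1,2) assms(3) D'(1,2) assms(4,6,7) \<tau>(2) g(1), symmetric])
  also have "t.ext_class A B \<sigma> g = coset_ext A B \<sigma> e x"
    using coset_ext_hcoset[OF assms(1,3,5) g(1)] g(2) by simp
  finally show ?thesis .
qed

section \<open>Comparison of RQA with QA and of RQB with RB\<close>

lemma hd_ses: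
  assumes "t.resolution_of Z \<sigma> A" "A \<in> Q"
  shows "ses C (fst (hd \<sigma>)) (snd (hd \<sigma>))" "Dom C (fst (hd \<sigma>)) = Z" "Z \<in> Q" "Cod C (fst (hd \<sigma>)) \<in> Q"
      "Cod C (snd (hd \<sigma>)) \<in> Q"
proof -
  note r = assms(1)[unfolded t.resolution_of_def]
  have "Z \<in> Q \<and> (\<forall>e\<in>set \<sigma>. Cod C (snd e) \<in> Q)"
    using f.P_path[of Z \<sigma> A] r assms(2) by (auto simp: t.P_middle_def)
  then show "ses C (fst (hd \<sigma>)) (snd (hd \<sigma>))" "Dom C (fst (hd \<sigma>)) = Z" "Z \<in> Q"
      "Cod C (fst (hd \<sigma>)) \<in> Q" "Cod C (snd (hd \<sigma>)) \<in> Q"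
    using r by (cases \<sigma>; auto simp: t.P_middle_def)+
qed

text \<open>\<open>t.resolution_change_end\<close> resolves \<open>A\<close> and
  \<open>Cod i\<close> with the same syzygy \<open>Z\<close>, the same homotopy relation and the
  identity of \<open>Z\<close> as comparison map. On classifying arrows the map is then composition
  with \<open>r\<close>, which is bijective up to homotopy by \<open>weak_equivalence\<close>, as
  \<open>Z\<close> is cofibrant.\<close>

lemma YExt_map_iso:
  assumes "t.resolution_of Z \<sigma> A" "length \<sigma> = n" "t.special \<sigma>" "A \<in> Q" "ses C i c" "Dom C i = A"
      "Cod C c \<in> Q \<inter> W"
    and "ses C k p" "ses C j c1" "ses C \<eta> c2" "Cod C k = Dom C j" "Dom C \<eta> = Cod C p"
    and "Dom C k \<in> W \<inter> R" "Cod C c1 \<in> Q \<inter> W" "Cod C c2 \<in> Q \<inter> W" "Cod C j \<in> R" "Cod C \<eta> \<in> R"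
    and "r \<in> Hom C (Cod C j) (Cod C \<eta>)" "r \<cdot> j = \<eta> \<cdot> p"
  shows "YExt_map C n i r \<in> iso (YExt C n (Cod C i) (Cod C j)) (YExt C n A (Cod C \<eta>))"
proof -
  obtain \<sigma>' where \<sigma>': "t.resolution_of Z \<sigma>' (Cod C i)" "length \<sigma>' = length \<sigma>"
      "path_mor C \<sigma> \<sigma>' (Ident C Z) i"
    "\<And>f f'. Cod C f' \<in> R \<Longrightarrow> homotopic C (fst (hd \<sigma>)) f f' \<longleftrightarrow> homotopic C (fst (hd \<sigma>')) f f'"
    by (rule t.resolution_change_end[OF assms(1,3,5,6,7)]) blast
  have len: "length \<sigma>' = n" using \<sigma>'(2) assms(2) by simp
  note hs = hd_ses[OF assms(1,4)] and I = sesD[OF assms(5)] and rA = assms(18)[unfolded in_Hom]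
  note res = assms(1,2) and res' = \<sigma>'(1) len
  let ?G = "YExt C n (Cod C i) (Cod C j)" and ?H = "YExt C n A (Cod C \<eta>)"
  have iH: "i \<in> Hom C A (Cod C i)" using I assms(6) by (simp add: in_Hom)
  have map: "YExt_map C n i r (t.ext_class (Cod C i) (Cod C j) \<sigma>' f)
      = t.ext_class A (Cod C \<eta>) \<sigma> (r \<cdot> f)"
    if "f \<in> Hom C Z (Cod C j)" for f
    using t.YExt_map_ext_class[OF res' assms(16) res assms(17) iH assms(18) \<sigma>'(3) that] that
      by (simp add: in_Hom)
  have rf: "r \<cdot> f \<in> Hom C Z (Cod C \<eta>)" if "f \<in> Hom C Z (Cod C j)" for f using that rA
    by (simp add: in_Hom)
  note weq = weak_equivalence[OF assms(8-19) hs(1) _ hs(4,5), unfolded hs(2)]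
  show ?thesis
  proof (rule isoI)
    show "YExt_map C n i r \<in> hom ?G ?H"
    proof (rule homI)
      fix x assume "x \<in> carrier ?G"
      then obtain f where "f \<in> Hom C Z (Cod C j)" "x = t.ext_class (Cod C i) (Cod C j) \<sigma>' f"
        by (rule t.carrier_ext_class[OF res' assms(16)])
      then show "YExt_map C n i r x \<in> carrier ?H" using map rf t.ext_class_carrier[OF res assms(17)]
        by simp
    next
      fix x y assume xy: "x \<in> carrier ?G" "y \<in> carrier ?G"
      obtain f where f: "f \<in> Hom C Z (Cod C j)" "x = t.ext_class (Cod C i) (Cod C j) \<sigma>' f"
        by (rule t.carrier_ext_class[OF res' assms(16) xy(1)])
      obtain f' where f': "f' \<in> Hom C Z (Cod C j)" "y = t.ext_class (Cod C i) (Cod C j) \<sigma>' f'"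
        by (rule t.carrier_ext_class[OF res' assms(16) xy(2)])
      have s: "f \<^bold>+ f' \<in> Hom C Z (Cod C j)" using f(1) f'(1) by (simp add: in_Hom)
      have "x \<otimes>\<^bsub>?G\<^esub> y = t.ext_class (Cod C i) (Cod C j) \<sigma>' (f \<^bold>+ f')"
        using t.baer_sum_ext_class[OF res' assms(16) f(1) f'(1)] f f' by (simp add: YExt_def)
      moreover have "r \<cdot> (f \<^bold>+ f') = (r \<cdot> f) \<^bold>+ (r \<cdot> f')" using f f' rA
        by (simp add: in_Hom comp_add)
      ultimately show "YExt_map C n i r (x \<otimes>\<^bsub>?G\<^esub> y) = YExt_map C n i r x \<otimes>\<^bsub>?H\<^esub> YExt_map C n i r y"
        using map[OF s] map[OF f(1)] map[OF f'(1)] f f' t.baer_sum_ext_class[OF res assms(17) rf[OF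
            f(1)] rf[OF f'(1)]]
        by (simp add: YExt_def)
    qed
    show "bij_betw (YExt_map C n i r) (carrier ?G) (carrier ?H)"
    proof (rule bij_betw_imageI)
      show "inj_on (YExt_map C n i r) (carrier ?G)"
      proof (rule inj_onI)
        fix x y assume xy: "x \<in> carrier ?G" "y \<in> carrier ?G" and eq: "YExt_map C n i r x
            = YExt_map C n i r y"
        obtain f where f: "f \<in> Hom C Z (Cod C j)" "x = t.ext_class (Cod C i) (Cod C j) \<sigma>' f"
          by (rule t.carrier_ext_class[OF res' assms(16) xy(1)])
        obtain f' where f': "f' \<in> Hom C Z (Cod C j)" "y = t.ext_class (Cod C i) (Cod C j) \<sigma>' f'"
          by (rule t.carrier_ext_class[OF res' assms(16) xy(2)])
        have "homotopic C (fst (hd \<sigma>)) (r \<cdot> f) (r \<cdot> f')"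
          using eq map f f' t.ext_class_eq_iff[OF res assms(17) rf[OF f(1)] rf[OF f'(1)]] by simp
        then have "homotopic C (fst (hd \<sigma>)) f f'" using weq(1)[OF hs(3) f(1) f'(1)] by simp
        then have "homotopic C (fst (hd \<sigma>')) f f'" using \<sigma>'(4)[of f' f] f'(1) assms(16)
          by (simp add: in_Hom)
        then show "x = y" using f f' t.ext_class_eq_iff[OF res' assms(16) f(1) f'(1)] by simp
      qed
      show "YExt_map C n i r ` carrier ?G = carrier ?H"
      proof (intro equalityI subsetI)
        fix z assume "z \<in> YExt_map C n i r ` carrier ?G"
        then obtain x where x: "x \<in> carrier ?G" "z = YExt_map C n i r x" by blast
        obtain f where "f \<in> Hom C Z (Cod C j)" "x = t.ext_class (Cod C i) (Cod C j) \<sigma>' f"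
          by (rule t.carrier_ext_class[OF res' assms(16) x(1)])
        then show "z \<in> carrier ?H" using x(2) map rf t.ext_class_carrier[OF res assms(17)] by simp
      next
        fix z assume z: "z \<in> carrier ?H"
        obtain g where g: "g \<in> Hom C Z (Cod C \<eta>)" "z = t.ext_class A (Cod C \<eta>) \<sigma> g"
          by (rule t.carrier_ext_class[OF res assms(17) z])
        obtain f where f: "f \<in> Hom C Z (Cod C j)" "homotopic C (fst (hd \<sigma>)) (r \<cdot> f) g"
          using weq(2)[OF hs(3) g(1)] by blast
        have "z = YExt_map C n i r (t.ext_class (Cod C i) (Cod C j) \<sigma>' f)"
          using map[OF f(1)] t.ext_class_eq_iff[OF res assms(17) rf[OF f(1)] g(1)] f(2) g(2) by simp
        then show "z \<in> YExt_map C n i r ` carrier ?G"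
          using t.ext_class_carrier[OF res' assms(16) f(1)] by blast
      qed
    qed
  qed
qed

section \<open>The isomorphisms for the chosen replacements\<close>

context
  fixes T :: "('o, 'm) choices" and n :: nat
  assumes valid: "valid_choices C Q W R T" and n: "n \<ge> 1"
begin

lemma cof:
  assumes "A \<in> Obj C"
  shows "ses C (cof_ker T A) (cof_rep T A)" "Cod C (cof_rep T A) = A" "Qob C T A \<in> Q"
    "Dom C (cof_ker T A) \<in> W \<inter> R"
  using valid assms by (auto simp: valid_choices_def short_exact_iff_ses Qob_def)

lemma fib:
  assumes "A \<in> Obj C"
  shows "ses C (fib_rep T A) (fib_cok T A)" "Dom C (fib_rep T A) = A" "Rob C T A \<in> R"
    "Cod C (fib_cok T A) \<in> Q \<inter> W"
  using valid assms by (auto simp: valid_choices_def short_exact_iff_ses Rob_def)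

lemma QO: "A \<in> Obj C \<Longrightarrow> Qob C T A \<in> Obj C"
  using cof(3) f.P_Obj by blast

lemma RQ:
  assumes A: "A \<in> Obj C"
  shows "RQob C T A \<in> Q" "RQob C T A \<in> R"
proof -
  note F = fib[OF QO[OF A]]
  show "RQob C T A \<in> R" using F by (simp add: RQob_def)
  show "RQob C T A \<in> Q" using f.P_extension[OF F(1)] F cof(3)[OF A] by (simp add: RQob_def Rob_def)
qed

lemma rep_hom:
  assumes A: "A \<in> Obj C"
  shows "cof_rep T A \<in> Hom C (Qob C T A) A" "fib_rep T (Qob C T A) \<in> Hom C (Qob C T A) (RQob C T A)"
    "fib_rep T A \<in> Hom C A (Rob C T A)"
  using sesD[OF cof(1)[OF A]] cof(2)[OF A] sesD[OF fib(1)[OF A]] fib(2)[OF A]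
    sesD[OF fib(1)[OF QO[OF A]]] fib(2)[OF QO[OF A]]
  by (simp_all add: in_Hom Qob_def Rob_def RQob_def)

text \<open>Fixed once per object, so that \<open>\<phi>\<close> and its naturality refer to the
  same truncated resolution.\<close>

definition res_path :: "'o \<Rightarrow> ('m \<times> 'm) list" where
  "res_path A = (SOME \<sigma>. \<exists>e. res_data n A (res_d T A) (res_eps T A) \<sigma> e)"

definition res_epi :: "'o \<Rightarrow> 'm" where
  "res_epi A = (SOME e. res_data n A (res_d T A) (res_eps T A) (res_path A) e)"

lemma res_path_data:
  assumes "A \<in> Q"
  shows "res_data n A (res_d T A) (res_eps T A) (res_path A) (res_epi A)"
proof -
  have "\<exists>\<sigma> e. res_data n A (res_d T A) (res_eps T A) \<sigma> e"
    using valid assms M_resolution_data[OF _ n] unfolding valid_choices_def by blast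
  then have "\<exists>e. res_data n A (res_d T A) (res_eps T A) (res_path A) e"
    unfolding res_path_def by (rule someI_ex)
  then show ?thesis unfolding res_epi_def by (rule someI_ex)
qed

text \<open>A single arrow in place of the zigzag RQB <- QB -> B -> RB. It exists because RB is
  fibrant and the cokernel of QB -> RQB lies in \<open>Q \<inter> W\<close>.\<close>

definition RQ_to_R :: "'o \<Rightarrow> 'm" where
  "RQ_to_R B = (SOME r. fib_lift C T (cof_rep T B) r)"

lemma RQ_to_R:
  assumes B: "B \<in> Obj C"
  shows "RQ_to_R B \<in> Hom C (RQob C T B) (Rob C T B)"
    "RQ_to_R B \<cdot> fib_rep T (Qob C T B) = fib_rep T B \<cdot> cof_rep T B"
proof -
  note F = fib[OF QO[OF B]]
  have "fib_rep T B \<cdot> cof_rep T B \<in> Hom C (Dom C (fib_rep T (Qob C T B))) (Rob C T B)"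
    using rep_hom[OF B] F(2) by (simp add: in_Hom)
  then obtain r where "r \<in> Hom C (RQob C T B) (Rob C T B)"
    "r \<cdot> fib_rep T (Qob C T B) = fib_rep T B \<cdot> cof_rep T B"
    using t.extend[OF fib(3)[OF B] F(1,4)] by (auto simp: RQob_def Rob_def)
  then have "\<exists>r. fib_lift C T (cof_rep T B) r"
    using cof(2)[OF B] by (auto simp: fib_lift_def RQob_def Qob_def)
  then have "fib_lift C T (cof_rep T B) (RQ_to_R B)" unfolding RQ_to_R_def by (rule someI_ex)
  then show "RQ_to_R B \<in> Hom C (RQob C T B) (Rob C T B)"
    "RQ_to_R B \<cdot> fib_rep T (Qob C T B) = fib_rep T B \<cdot> cof_rep T B"
    using cof(2)[OF B] by (simp_all add: fib_lift_def RQob_def Qob_def)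
qed

lemma bifib_liftD:
  assumes "bifib_lift C T f h" "f \<in> Hom C X Y"
  shows "\<exists>q. q \<in> Hom C (Qob C T X) (Qob C T Y) \<and> cof_rep T Y \<cdot> q = f \<cdot> cof_rep T X \<and>
    h \<in> Hom C (RQob C T X) (RQob C T Y) \<and>
    h \<cdot> fib_rep T (Qob C T X) = fib_rep T (Qob C T Y) \<cdot> q"
  using assms by (auto simp: bifib_lift_def cof_lift_def fib_lift_def in_Hom RQob_def)

definition \<phi> :: "'o \<Rightarrow> 'o \<Rightarrow> 'm set \<Rightarrow> 'm list set" where
  "\<phi> A B = coset_ext (RQob C T A) (RQob C T B) (res_path (RQob C T A)) (res_epi (RQob C T A))"

definition \<psi> :: "'o \<Rightarrow> 'o \<Rightarrow> 'm list set \<Rightarrow> 'm list set" where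
  "\<psi> A B = YExt_map C n (fib_rep T (Qob C T A)) (RQ_to_R B)"

lemma phi_psi_iso:
  assumes A: "A \<in> Obj C" and B: "B \<in> Obj C"
  shows "\<phi> A B \<in> iso (Ext_Ho C T (int n) A B) (uExt_Ho C T n A B)"
    "\<psi> A B \<in> iso (uExt_Ho C T n A B) (YExt C n (Qob C T A) (Rob C T B))"
proof -
  show "\<phi> A B \<in> iso (Ext_Ho C T (int n) A B) (uExt_Ho C T n A B)"
    unfolding \<phi>_def Ext_Ho_def Ext_M_def uExt_Ho_def
    by (rule coset_ext_iso[OF res_path_data[OF RQ(1)[OF A]] RQ(2)[OF B] n])
  have d: "t.resolution_of (Dom C (fst (hd (res_path (Qob C T A))))) (res_path (Qob C T A)) (Qob C T
      A)" "length (res_path (Qob C T A)) = n" "t.special (res_path (Qob C T A))"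
    using res_path_data[OF cof(3)[OF A]] by (auto simp: res_data_def)
  note FA = fib[OF QO[OF A]] and FB = fib[OF QO[OF B]]
  have "YExt_map C n (fib_rep T (Qob C T A)) (RQ_to_R B) \<in>
    iso (YExt C n (Cod C (fib_rep T (Qob C T A))) (Cod C (fib_rep T (Qob C T B)))) (YExt C n (Qob C
        T A) (Cod C (fib_rep T B)))"
    by (rule YExt_map_iso[OF d cof(3)[OF A] FA(1,2,4) cof(1)[OF B] FB(1) fib(1)[OF B]])
      (use cof[OF B] FB fib[OF B] RQ_to_R[OF B] sesD[OF cof(1)[OF B]] in \<open>simp_all add: Qob_def
          Rob_def RQob_def\<close>)
  then show "\<psi> A B \<in> iso (uExt_Ho C T n A B) (YExt C n (Qob C T A) (Rob C T B))"
    by (simp add: \<psi>_def uExt_Ho_def RQob_def Rob_def)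
qed

lemma phi_nat:
  assumes O: "A \<in> Obj C" "A' \<in> Obj C" "B \<in> Obj C" "B' \<in> Obj C"
    and fg: "f \<in> Hom C A' A" "g \<in> Hom C B B'"
    and l: "bifib_lift C T f h" "res_lift C T h t" "bifib_lift C T g k"
    and x: "x \<in> carrier (Ext_Ho C T (int n) A B)"
  shows "\<phi> A' B' (Ext_Ho_map C T (int n) A' t k x) = YExt_map C n h k (\<phi> A B x)"
proof -
  have h: "h \<in> Hom C (RQob C T A') (RQob C T A)" and k: "k \<in> Hom C (RQob C T B) (RQob C T B')"
    using bifib_liftD[OF l(1) fg(1)] bifib_liftD[OF l(3) fg(2)] by auto
  have "Dom C h = RQob C T A'" "Cod C h = RQob C T A" using h by (simp_all add: in_Hom)
  then have t: "\<And>i. t i \<in> Hom C (Dom C (res_d T (RQob C T A') i)) (Dom C (res_d T (RQob C T A) i))"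
    "\<And>i. t (i - 1) \<cdot> res_d T (RQob C T A') i = res_d T (RQob C T A) i \<cdot> t i"
    "res_eps T (RQob C T A) \<cdot> t 0 = h \<cdot> res_eps T (RQob C T A')"
    using l(2) by (simp_all add: res_lift_def Let_def)
  show ?thesis unfolding \<phi>_def Ext_Ho_map_def
    by (rule coset_ext_natural[OF res_path_data[OF RQ(1)[OF O(1)]] res_path_data[OF RQ(1)[OF O(2)]]
        RQ(2)[OF O(3)] RQ(2)[OF O(4)] n h k t])
      (use x in \<open>simp add: Ext_Ho_def Ext_M_def\<close>)
qed

text \<open>The given lifts need not be compatible: \<open>h\<close> covers a lift \<open>q'\<close>
  of \<open>f\<close> that may differ from \<open>q\<close>, and \<open>RQ_to_R B' \<cdot> k\<close>
  may differ from \<open>r \<cdot> RQ_to_R B\<close>. Both discrepancies vanish up to homotopy: the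
  first by \<open>homotopic_agree_on_cofibrant\<close>, since \<open>q\<close> and \<open>q'\<close>
  agree over \<open>A\<close>; the second by \<open>homotopic_agree_on_cofibration\<close>, since
  the two arrows agree on QB.\<close>

lemma psi_nat:
  assumes O: "A \<in> Obj C" "A' \<in> Obj C" "B \<in> Obj C" "B' \<in> Obj C"
    and fg: "f \<in> Hom C A' A" "g \<in> Hom C B B'"
    and l: "bifib_lift C T f h" "bifib_lift C T g k" "cof_lift C T f q" "fib_lift C T g r"
    and y: "y \<in> carrier (uExt_Ho C T n A B)"
  shows "\<psi> A' B' (YExt_map C n h k y) = YExt_map C n q r (\<psi> A B y)"
proof -
  obtain q' where h: "q' \<in> Hom C (Qob C T A') (Qob C T A)" "cof_rep T A \<cdot> q' = f \<cdot> cof_rep T A'"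
    "h \<in> Hom C (RQob C T A') (RQob C T A)" "h \<cdot> fib_rep T (Qob C T A') = fib_rep T (Qob C T A) \<cdot> q'"
    using bifib_liftD[OF l(1) fg(1)] by auto
  obtain q'' where k: "q'' \<in> Hom C (Qob C T B) (Qob C T B')" "cof_rep T B' \<cdot> q'' = g \<cdot> cof_rep T B"
    "k \<in> Hom C (RQob C T B) (RQob C T B')" "k \<cdot> fib_rep T (Qob C T B)
        = fib_rep T (Qob C T B') \<cdot> q''"
    using bifib_liftD[OF l(2) fg(2)] by auto
  have q: "q \<in> Hom C (Qob C T A') (Qob C T A)" "cof_rep T A \<cdot> q = f \<cdot> cof_rep T A'"
    using l(3) fg(1) by (auto simp: cof_lift_def in_Hom)
  have r: "r \<in> Hom C (Rob C T B) (Rob C T B')" "r \<cdot> fib_rep T B = fib_rep T B' \<cdot> g"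
    using l(4) fg(2) by (auto simp: fib_lift_def in_Hom)
  define s1 where "s1 = res_path (Qob C T A)"
  define s1' where "s1' = res_path (Qob C T A')"
  define s2 where "s2 = res_path (RQob C T A)"
  define s2' where "s2' = res_path (RQob C T A')"
  have D: "t.resolution_of (Dom C (fst (hd s1))) s1 (Qob C T A)" "length s1 = n" "t.special s1"
    "t.resolution_of (Dom C (fst (hd s1'))) s1' (Qob C T A')" "length s1' = n"
    "t.resolution_of (Dom C (fst (hd s2))) s2 (RQob C T A)" "length s2 = n" "t.special s2"
    "t.resolution_of (Dom C (fst (hd s2'))) s2' (RQob C T A')" "length s2' = n" "t.special s2'"
    using res_path_data[OF cof(3)[OF O(1)]] res_path_data[OF cof(3)[OF O(2)]] res_path_data[OF
        RQ(1)[OF O(1)]] res_path_data[OF RQ(1)[OF O(2)]]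
    by (simp_all add: res_data_def s1_def s1'_def s2_def s2'_def)
  note r1 = D(1)[unfolded t.resolution_of_def] and r1' = D(4)[unfolded t.resolution_of_def]
    and r2 = D(6)[unfolded t.resolution_of_def] and r2' = D(9)[unfolded t.resolution_of_def]
  have lift: "\<exists>g\<in>Hom C Z Z'. path_mor C s s' g a"
    if "path C Z s X \<and> t.P_middle s \<and> s \<noteq> [] \<and> X \<in> Obj C"
        "path C Z' s' X' \<and> t.P_middle s' \<and> s' \<noteq> [] \<and> X' \<in> Obj C"
      "length s = n" "length s' = n" "t.special s'" "a \<in> Hom C X X'" for Z s X Z' s' X' a
    using t.path_mor_lift[of Z s X Z' s' X' a] that by auto
  \<comment> \<open>Comparison maps over the four sides of the square formed by QA', QA, RQA' and
    RQA; \<open>th \<cdot> ti'\<close> and \<open>ti \<cdot> tq\<close> run along its two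
    paths.\<close>
  obtain th where th: "th \<in> Hom C (Dom C (fst (hd s2'))) (Dom C (fst (hd s2)))"
      "path_mor C s2' s2 th h"
    using lift[OF r2' r2 D(10,7,8) h(3)] by blast
  obtain ti' where ti': "ti' \<in> Hom C (Dom C (fst (hd s1'))) (Dom C (fst (hd s2')))"
      "path_mor C s1' s2' ti' (fib_rep T (Qob C T A'))"
    using lift[OF r1' r2' D(5,10,11) rep_hom(2)[OF O(2)]] by blast
  obtain ti where ti: "ti \<in> Hom C (Dom C (fst (hd s1))) (Dom C (fst (hd s2)))"
      "path_mor C s1 s2 ti (fib_rep T (Qob C T A))"
    using lift[OF r1 r2 D(2,7,8) rep_hom(2)[OF O(1)]] by blast
  obtain tq where tq: "tq \<in> Hom C (Dom C (fst (hd s1'))) (Dom C (fst (hd s1)))"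
      "path_mor C s1' s1 tq q"
    using lift[OF r1' r1 D(5,2,3) q(1)] by blast
  obtain x where x: "x \<in> Hom C (Dom C (fst (hd s2))) (RQob C T B)"
      "y = t.ext_class (RQob C T A) (RQob C T B) s2 x"
    using y unfolding uExt_Ho_def by (rule t.carrier_ext_class[OF D(6,7) RQ(2)[OF O(3)]])
  note RB = RQ(2)[OF O(3)] and RB' = RQ(2)[OF O(4)] and FB = fib(3)[OF O(3)] and FB'
      = fib(3)[OF O(4)]
  note rB = RQ_to_R[OF O(3)] and rB' = RQ_to_R[OF O(4)]
  note A = x(1)[unfolded in_Hom] th(1)[unfolded in_Hom] ti'(1)[unfolded in_Hom] ti(1)[unfolded
      in_Hom] tq(1)[unfolded in_Hom]
    h(1,3)[unfolded in_Hom] k(1,3)[unfolded in_Hom] q(1)[unfolded in_Hom] r(1)[unfolded in_Hom]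
        rB(1)[unfolded in_Hom] rB'(1)[unfolded in_Hom]
    fg[unfolded in_Hom] rep_hom[OF O(1), unfolded in_Hom] rep_hom[OF O(3), unfolded in_Hom]
        rep_hom[OF O(4), unfolded in_Hom]
  have kx: "k \<cdot> x \<cdot> th \<in> Hom C (Dom C (fst (hd s2'))) (RQob C T B')"
    and rx: "RQ_to_R B \<cdot> x \<cdot> ti \<in> Hom C (Dom C (fst (hd s1))) (Rob C T B)" using A
      by (simp_all add: in_Hom)
  have "YExt_map C n h k y = t.ext_class (RQob C T A') (RQob C T B') s2' (k \<cdot> x \<cdot> th)"
    unfolding x(2) by (rule t.YExt_map_ext_class[OF D(6,7) RB D(9,10) RB' h(3) k(3) th(2) x(1)])
  then have L: "\<psi> A' B' (YExt_map C n h k y) = t.ext_class (Qob C T A') (Rob C T B') s1' (RQ_to_R B'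
      \<cdot> (k \<cdot> x \<cdot> th) \<cdot> ti')"
    unfolding \<psi>_def using t.YExt_map_ext_class[OF D(9,10) RB' D(4,5) FB' rep_hom(2)[OF O(2)] rB'(1)
        ti'(2) kx] by simp
  have "\<psi> A B y = t.ext_class (Qob C T A) (Rob C T B) s1 (RQ_to_R B \<cdot> x \<cdot> ti)"
    unfolding x(2) \<psi>_def by (rule t.YExt_map_ext_class[OF D(6,7) RB D(1,2) FB rep_hom(2)[OF O(1)]
        rB(1) ti(2) x(1)])
  then have M: "YExt_map C n q r (\<psi> A B y) = t.ext_class (Qob C T A') (Rob C T B') s1' (r \<cdot> (RQ_to_R
      B \<cdot> x \<cdot> ti) \<cdot> tq)"
    using t.YExt_map_ext_class[OF D(1,2) FB D(4,5) FB' q(1) r(1) tq(2) rx] by simp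
  note hs = hd_ses[OF D(4) cof(3)[OF O(2)]]
  have "path_mor C s1' s2 (th \<cdot> ti') (fib_rep T (Qob C T A) \<cdot> q')"
    using path_mor_comp[OF ti'(2) th(2)] h(4) by simp
  moreover have "path_mor C s1' s2 (ti \<cdot> tq) (fib_rep T (Qob C T A) \<cdot> q)"
    using path_mor_comp[OF tq(2) ti(2)] by simp
  moreover have "cof_rep T A \<cdot> q' = cof_rep T A \<cdot> q" using h(2) q(2) by simp
  moreover have "Cod C (cof_ker T A) = Qob C T A" using sesD(3)[OF cof(1)[OF O(1)]]
    by (simp add: Qob_def)
  ultimately have "homotopic C (fst (hd s1')) (th \<cdot> ti') (ti \<cdot> tq)"
    using homotopic_agree_on_cofibrant[OF D(4) _ D(8) cof(3)[OF O(2)] cof(1)[OF O(1)] cof(4)[OF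
        O(1)], of _ "RQob C T A" q' q
        "fib_rep T (Qob C T A)" "th \<cdot> ti'" "ti \<cdot> tq"] r2 h(1) q(1) rep_hom(2)[OF O(1)] by auto
  then have 1: "homotopic C (fst (hd s1')) ((RQ_to_R B' \<cdot> k \<cdot> x) \<cdot> (th \<cdot> ti')) ((RQ_to_R B' \<cdot> k \<cdot> x)
      \<cdot> (ti \<cdot> tq))"
    by (rule homotopic_comp) (use A in simp_all)
  note F = fib[OF QO[OF O(3)]]
  have e1: "(RQ_to_R B' \<cdot> k) \<cdot> fib_rep T (Qob C T B) = fib_rep T B' \<cdot> g \<cdot> cof_rep T B"
  proof -
    have "(RQ_to_R B' \<cdot> k) \<cdot> fib_rep T (Qob C T B) = RQ_to_R B' \<cdot> (fib_rep T (Qob C T B') \<cdot> q'')"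
      using A k(4) by simp
    also have "\<dots> = (fib_rep T B' \<cdot> cof_rep T B') \<cdot> q''"
      by (rule comp_reduce[OF rB'(2)]) (use A in simp_all)
    also have "\<dots> = fib_rep T B' \<cdot> g \<cdot> cof_rep T B" using A k(2) by simp
    finally show ?thesis .
  qed
  have e2: "(r \<cdot> RQ_to_R B) \<cdot> fib_rep T (Qob C T B) = fib_rep T B' \<cdot> g \<cdot> cof_rep T B"
  proof -
    have "(r \<cdot> RQ_to_R B) \<cdot> fib_rep T (Qob C T B) = r \<cdot> (fib_rep T B \<cdot> cof_rep T B)" using A rB(2)
      by simp
    also have "\<dots> = (fib_rep T B' \<cdot> g) \<cdot> cof_rep T B"
      by (rule comp_reduce[OF r(2)]) (use A in simp_all)
    also have "\<dots> = fib_rep T B' \<cdot> g \<cdot> cof_rep T B" using A by simp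
    finally show ?thesis .
  qed
  have 2: "homotopic C (fst (hd s1')) ((RQ_to_R B' \<cdot> k) \<cdot> (x \<cdot> ti \<cdot> tq)) ((r \<cdot> RQ_to_R B) \<cdot> (x \<cdot> ti
      \<cdot> tq))"
    by (rule homotopic_agree_on_cofibration[OF F(1,4) FB' _ _ _ hs(1,5)])
      (use A e1 e2 in \<open>simp_all add: in_Hom\<close>)
  have "homotopic C (fst (hd s1')) (RQ_to_R B' \<cdot> (k \<cdot> x \<cdot> th) \<cdot> ti') (r \<cdot> (RQ_to_R B \<cdot> x \<cdot> ti) \<cdot>
      tq)"
    using homotopic_trans[of "fst (hd s1')" _ "RQ_to_R B' \<cdot> k \<cdot> x \<cdot> ti \<cdot> tq"] 1 2 A by simp
  then show ?thesis unfolding L M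
    by (subst t.ext_class_eq_iff[OF D(4,5) FB']) (use A in \<open>simp_all add: in_Hom\<close>)
qed

end

end

theorem corollary7p4:
  fixes C :: "('o, 'm) addcat" and Q W R :: "'o set" and T :: "('o, 'm) choices" and n :: nat
  assumes "abelian_category C"
    and "hereditary_abelian_model_structure C Q W R"
    and "valid_choices C Q W R T"
    and "n \<ge> 1"
  shows "\<exists>\<phi> \<psi>.
    (\<forall>A\<in>Obj C. \<forall>B\<in>Obj C.
       \<phi> A B \<in> iso (Ext_Ho C T (int n) A B) (uExt_Ho C T n A B) \<and>
       \<psi> A B \<in> iso (uExt_Ho C T n A B) (YExt C n (Qob C T A) (Rob C T B))) \<and>
    (\<forall>A\<in>Obj C. \<forall>A'\<in>Obj C. \<forall>B\<in>Obj C. \<forall>B'\<in>Obj C. \<forall>f\<in>Hom C A' A. \<forall>g\<in>Hom C B B'.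
       (\<forall>h t k. bifib_lift C T f h \<and> res_lift C T h t \<and> bifib_lift C T g k \<longrightarrow>
          (\<forall>x\<in>carrier (Ext_Ho C T (int n) A B).
             \<phi> A' B' (Ext_Ho_map C T (int n) A' t k x) = YExt_map C n h k (\<phi> A B x))) \<and>
       (\<forall>h k q r. bifib_lift C T f h \<and> bifib_lift C T g k \<and> cof_lift C T f q \<and> fib_lift C T g r \<longrightarrow>
          (\<forall>y\<in>carrier (uExt_Ho C T n A B).
             \<psi> A' B' (YExt_map C n h k y) = YExt_map C n q r (\<psi> A B y))))"
proof -
  interpret abelian_category C by fact
  note ms = assms(2)[unfolded hereditary_abelian_model_structure_def]
  interpret model_setup C Q W R
  proof (rule model_setup.intro)
    show "cotorsion_setup C (Q \<inter> W) R" "cotorsion_setup C Q (W \<inter> R)"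
      using ms by (intro cotorsion_setupI; blast)+
    show "model_setup_axioms C W" using ms by (intro model_setup_axioms.intro) blast
  qed fact
  show ?thesis
  proof (intro exI[of _ "\<phi> T n"] exI[of _ "\<psi> T n"] conjI[of "Ball _ _"] ballI)
    show "\<phi> T n A B \<in> iso (Ext_Ho C T (int n) A B) (uExt_Ho C T n A B) \<and>
       \<psi> T n A B \<in> iso (uExt_Ho C T n A B) (YExt C n (Qob C T A) (Rob C T B))"
      if "A \<in> Obj C" "B \<in> Obj C" for A B using phi_psi_iso[OF assms(3,4) that] by blast
  next
    fix A A' B B' f g
    assume O: "A \<in> Obj C" "A' \<in> Obj C" "B \<in> Obj C" "B' \<in> Obj C" "f \<in> Hom C A' A" "g \<in> Hom C B B'"
    show "(\<forall>h t k. bifib_lift C T f h \<and> res_lift C T h t \<and> bifib_lift C T g k \<longrightarrow>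
          (\<forall>x\<in>carrier (Ext_Ho C T (int n) A B).
             \<phi> T n A' B' (Ext_Ho_map C T (int n) A' t k x) = YExt_map C n h k (\<phi> T n A B x))) \<and>
       (\<forall>h k q r. bifib_lift C T f h \<and> bifib_lift C T g k \<and> cof_lift C T f q \<and> fib_lift C T g r \<longrightarrow>
          (\<forall>y\<in>carrier (uExt_Ho C T n A B).
             \<psi> T n A' B' (YExt_map C n h k y) = YExt_map C n q r (\<psi> T n A B y)))"
      using phi_nat[OF assms(3,4) O] psi_nat[OF assms(3,4) O] by blast
  qed
qed

end
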